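(* Let $T>0$, $n\ge1$, and let $F\in W^{1,1}_{\mathrm{loc}}(\mathbb{R}^n)$ be such that $\partial_kF\in BV_{\mathrm{loc}}(\mathbb{R}^n)$ for $k=1,\dots,n$. Let $X=(X^1,\dots,X^n)\in\mathcal{C}^\alpha([0,T],\mathbb{R}^n)$ with $\alpha\in(\frac12,1)$ be a path with $X_0=\mathring{x}$ which is $(s,1)$-variable with respect to each $\partial_kF$, $k=1,\dots,n$, for some $s\in\left(\frac{1-\alpha}{\alpha},1\right)$. Then $$F(X_t)=F(\mathring{x})+\sum_{k=1}^n\int_0^t\partial_kF(X_u)\,dX^k_u\qquad( * )$$ for $\mathcal{L}^1$-a.e. $t\in[0,T]$, provided that $\mathring{x}\in\mathbb{R}^n\setminus S_F$. If in addition $F$ is continuous, then $( * )$ holds for all $t\in[0,T]$ and no matter where $\mathring{x}\in\mathbb{R}^n$ is located.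
   Context: **BV and variability.** $\varphi\in L^1_{\mathrm{loc}}(\mathbb{R}^n)$ is in $BV_{\mathrm{loc}}(\mathbb{R}^n)$ if its distributional partial derivatives are signed Radon measures; $\|D\varphi\|$ is the total variation measure of the vector measure $D\varphi$. A path is a continuous function $X:[0,T]\to\mathbb{R}^n$. For $s\in(0,1)$, $X$ is $(s,1)$-variable w.r.t. $\varphi$ if there is a relatively compact open neighborhood $\mathcal{U}$ of $X([0,T])$ such that $\int_0^T\int_{\mathcal{U}}|X_t-z|^{-n+1-s}\|D\varphi\|(dz)\,dt<\infty$. **Composition.** $\varphi\in L^1_{\mathrm{loc}}(\mathbb{R}^n)$ has approximate limit $\lambda_\varphi(x)$ at $x$ if $\lim_{r\to0}\mathcal{L}^n(B(x,r))^{-1}\int_{B(x,r)}|\varphi(y)-\lambda_\varphi(x)|dy=0$; $S_\varphi$ is the set of $x$ where no approximate limit exists. A Lebesgue representative of $\varphi$ is a Borel function $\widetilde\varphi$ with $\widetilde\varphi=\lambda_\varphi$ on $\mathbb{R}^n\setminus S_\varphi$. $\varphi(X)$ denotes the $\mathcal{L}^1$-a.e. class of $t\mapsto\widetilde\varphi(X_t)$; under $(s,1)$-variability of $X$ w.r.t. $\varphi$ it does not depend on the Lebesgue representative. In the claim, point values of $F$ are those of a Lebesgue representative (and of the continuous version if $F$ is continuous). **Function spaces.** $\mathcal{C}^\theta([0,T],\mathbb{R}^m)$: Hölder functions of order $\theta\in(0,1)$. $W^{\theta,1}_0(0,T)$: measurable $f$ with $\int_0^T\frac{|f(t)|}{t^\theta}dt+\int_0^T\int_0^T\frac{|f(t)-f(u)|}{|t-u|^{1+\theta}}du\,dt<\infty$.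 $W^{\theta,\infty}_T(0,T)$: measurable $f$ such that $f(T-)$ exists and $\sup_{t}\frac{|f(T-)-f(t)|}{(T-t)^\theta}+\sup_t\int_t^T\frac{|f(t)-f(u)|}{|t-u|^{1+\theta}}du<\infty$. **Integral.** For $f\in W_0^{\theta,1}(0,T)$, $g\in W_T^{1-\theta,\infty}(0,T)$, $\theta\in(0,1)$, $$\int_0^Tf_t\,dg_t=(-1)^\theta\int_0^TD^\theta_{0+}f(t)\,D^{1-\theta}_{T-}(g-g(T-))(t)\,dt,$$ where $D^\theta_{0+}f(t)=\frac1{\Gamma(1-\theta)}\Big(\frac{f(t)}{t^\theta}+\theta\int_0^t\frac{f(t)-f(s)}{(t-s)^{\theta+1}}ds\Big)$ and $D^\theta_{T-}g(t)=\frac{(-1)^\theta}{\Gamma(1-\theta)}\Big(\frac{g(t)}{(T-t)^\theta}+\theta\int_t^T\frac{g(t)-g(s)}{(s-t)^{\theta+1}}ds\Big)$ (the complex prefactors combine to $-1$). The value does not depend on the admissible $\theta$; $\int_0^tf\,dg:=\int_0^T\mathbf{1}_{[0,t]}f\,dg$. (The integrals in $( * )$ are well defined under the stated hypotheses.) *)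

theory Defs
  imports "HOL-Analysis.Analysis"
begin

section \<open>Weak derivatives and functions of bounded variation\<close>

definition locally_integrable :: "(real^'n \<Rightarrow> real) \<Rightarrow> bool" where
  "locally_integrable \<phi> \<longleftrightarrow> (\<forall>K. compact K \<longrightarrow> \<phi> absolutely_integrable_on K)"

definition partial :: "'n \<Rightarrow> (real^'n \<Rightarrow> real) \<Rightarrow> real^'n \<Rightarrow> real" where
  "partial k \<psi> x = frechet_derivative \<psi> (at x) (axis k 1)"

primrec C_order :: "nat \<Rightarrow> (real^'n \<Rightarrow> real) \<Rightarrow> bool" where
  "C_order 0 \<psi> \<longleftrightarrow> continuous_on UNIV \<psi>"
| "C_order (Suc m) \<psi> \<longleftrightarrow> (\<forall>x. \<psi> differentiable (at x)) \<and> (\<forall>k. C_order m (partial k \<psi>))"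

definition test_function :: "(real^'n \<Rightarrow> real) \<Rightarrow> bool" where
  "test_function \<psi> \<longleftrightarrow> (\<forall>m. C_order m \<psi>) \<and> compact (closure {x. \<psi> x \<noteq> 0})"

definition has_weak_partial :: "'n \<Rightarrow> (real^'n \<Rightarrow> real) \<Rightarrow> (real^'n \<Rightarrow> real) \<Rightarrow> bool" where
  "has_weak_partial k \<phi> g \<longleftrightarrow> locally_integrable g \<and>
     (\<forall>\<psi>. test_function \<psi> \<longrightarrow>
        (LINT x|lebesgue. \<phi> x * partial k \<psi> x) = - (LINT x|lebesgue. g x * \<psi> x))"

definition W11_loc :: "(real^'n \<Rightarrow> real) \<Rightarrow> bool" where
  "W11_loc \<phi> \<longleftrightarrow> locally_integrable \<phi> \<and> (\<forall>k. \<exists>g. has_weak_partial k \<phi> g)"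

text \<open>Locally finite Borel measures on Euclidean space are automatically regular.\<close>

definition radon_measure :: "(real^'n) measure \<Rightarrow> bool" where
  "radon_measure M \<longleftrightarrow> sets M = sets borel \<and> (\<forall>K. compact K \<longrightarrow> emeasure M K < \<infinity>)"

text \<open>
  A signed Radon measure is a difference of two Radon measures. Both may be infinite, so the
  difference is a set function on bounded Borel sets only. Here the \<open>k\<close>-th distributional
  partial derivative of \<open>\<phi>\<close> is \<open>P k - N k\<close>.
\<close>

definition has_derivative_measures ::
    "(real^'n \<Rightarrow> real) \<Rightarrow> ('n \<Rightarrow> (real^'n) measure) \<Rightarrow> ('n \<Rightarrow> (real^'n) measure) \<Rightarrow> bool" where
  "has_derivative_measures \<phi> P N \<longleftrightarrow>
     (\<forall>k. radon_measure (P k) \<and> radon_measure (N k) \<and>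
        (\<forall>\<psi>. test_function \<psi> \<longrightarrow>
           (LINT x|lebesgue. \<phi> x * partial k \<psi> x) =
             - ((LINT x|P k. \<psi> x) - (LINT x|N k. \<psi> x))))"

definition BV_loc :: "(real^'n \<Rightarrow> real) \<Rightarrow> bool" where
  "BV_loc \<phi> \<longleftrightarrow> locally_integrable \<phi> \<and> (\<exists>P N. has_derivative_measures \<phi> P N)"

text \<open>
  The vector measure \<open>D\<phi>\<close>, to be evaluated on bounded Borel sets, where its value does not
  depend on the chosen decomposition.
\<close>

definition gradient_measure :: "(real^'n \<Rightarrow> real) \<Rightarrow> (real^'n) set \<Rightarrow> real^'n" where
  "gradient_measure \<phi> B =
     (case (SOME (P, N). has_derivative_measures \<phi> P N) of
        (P, N) \<Rightarrow> \<chi> k. measure (P k) B - measure (N k) B)"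

definition variation_measure :: "(real^'n \<Rightarrow> real) \<Rightarrow> (real^'n) measure" where
  "variation_measure \<phi> = measure_of UNIV (sets borel)
     (\<lambda>A. SUP E \<in> {E :: nat \<Rightarrow> (real^'n) set. disjoint_family E \<and> (\<Union>i. E i) = A \<and>
                     (\<forall>i. E i \<in> sets borel \<and> bounded (E i))}.
            (\<Sum>i. ennreal (norm (gradient_measure \<phi> (E i)))))"


section \<open>Paths and variability\<close>

definition holder_on :: "real \<Rightarrow> real set \<Rightarrow> (real \<Rightarrow> 'b::metric_space) \<Rightarrow> bool" where
  "holder_on \<theta> I f \<longleftrightarrow> (\<exists>C. \<forall>t\<in>I. \<forall>u\<in>I. dist (f t) (f u) \<le> C * \<bar>t - u\<bar> powr \<theta>)"

text \<open>
  \<open>|x - z|\<close> to the power \<open>-n + 1 - s\<close>. It is infinite on the diagonal, whereas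
  \<^term>\<open>0 powr a = (0::real)\<close>; this matters if the variation measure has atoms.
\<close>

definition riesz_kernel :: "real \<Rightarrow> real^'n \<Rightarrow> real^'n \<Rightarrow> ennreal" where
  "riesz_kernel s x z =
     (if x = z then \<infinity> else ennreal (norm (x - z) powr (- real CARD('n) + 1 - s)))"

definition s1_variable :: "real \<Rightarrow> real \<Rightarrow> (real \<Rightarrow> real^'n) \<Rightarrow> (real^'n \<Rightarrow> real) \<Rightarrow> bool" where
  "s1_variable s T X \<phi> \<longleftrightarrow>
     (\<exists>U. open U \<and> compact (closure U) \<and> X ` {0..T} \<subseteq> U \<and>
        (\<integral>\<^sup>+ t\<in>{0..T}. (\<integral>\<^sup>+ z\<in>U. riesz_kernel s (X t) z \<partial>variation_measure \<phi>) \<partial>lborel) < \<infinity>)"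


section \<open>Approximate limits and Lebesgue representatives\<close>

definition has_approx_limit :: "(real^'n \<Rightarrow> real) \<Rightarrow> real^'n \<Rightarrow> real \<Rightarrow> bool" where
  "has_approx_limit \<phi> x l \<longleftrightarrow>
     ((\<lambda>r. (LINT y:ball x r|lebesgue. \<bar>\<phi> y - l\<bar>) / measure lebesgue (ball x r)) \<longlongrightarrow> 0)
       (at_right 0)"

definition approx_discontinuity_set :: "(real^'n \<Rightarrow> real) \<Rightarrow> (real^'n) set" where
  "approx_discontinuity_set \<phi> = {x. \<nexists>l. has_approx_limit \<phi> x l}"

text \<open>Approximate limits of locally integrable functions are unique.\<close>

definition lebesgue_representative :: "(real^'n \<Rightarrow> real) \<Rightarrow> (real^'n \<Rightarrow> real) \<Rightarrow> bool" where
  "lebesgue_representative \<phi> g \<longleftrightarrow>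
     g \<in> borel_measurable borel \<and> (\<forall>x l. has_approx_limit \<phi> x l \<longrightarrow> g x = l)"


section \<open>The fractional Stieltjes integral\<close>

definition W0_1 :: "real \<Rightarrow> real \<Rightarrow> (real \<Rightarrow> real) set" where
  "W0_1 \<theta> T = {f. f \<in> borel_measurable (lebesgue_on {0<..<T}) \<and>
     (\<integral>\<^sup>+ t\<in>{0<..<T}. ennreal (\<bar>f t\<bar> / t powr \<theta>) \<partial>lebesgue) +
     (\<integral>\<^sup>+ t\<in>{0<..<T}. (\<integral>\<^sup>+ u\<in>{0<..<T}.
        ennreal (\<bar>f t - f u\<bar> / \<bar>t - u\<bar> powr (1 + \<theta>)) \<partial>lebesgue) \<partial>lebesgue) < \<infinity>}"

definition WT_inf :: "real \<Rightarrow> real \<Rightarrow> (real \<Rightarrow> real) set" where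
  "WT_inf \<theta> T = {g. g \<in> borel_measurable (lebesgue_on {0<..<T}) \<and>
     (\<exists>l. (g \<longlongrightarrow> l) (at_left T) \<and>
       (SUP t\<in>{0<..<T}. ennreal (\<bar>l - g t\<bar> / (T - t) powr \<theta>)) +
       (SUP t\<in>{0<..<T}. (\<integral>\<^sup>+ u\<in>{t<..<T}.
          ennreal (\<bar>g t - g u\<bar> / \<bar>t - u\<bar> powr (1 + \<theta>)) \<partial>lebesgue)) < \<infinity>)}"

definition frac_deriv_left :: "real \<Rightarrow> (real \<Rightarrow> real) \<Rightarrow> real \<Rightarrow> real" where
  "frac_deriv_left \<theta> f t = 1 / Gamma (1 - \<theta>) *
     (f t / t powr \<theta> + \<theta> * (LINT u:{0<..<t}|lebesgue. (f t - f u) / (t - u) powr (\<theta> + 1)))"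

text \<open>
  The right-sided Weyl--Marchaud derivative of order \<open>\<theta>\<close> without its complex phase
  \<open>(-1)\<close> to the power \<open>\<theta>\<close>. In the integral below the phases of orders \<open>\<theta>\<close> and
  \<open>1 - \<theta>\<close> multiply to \<open>-1\<close>.
\<close>

definition frac_deriv_right :: "real \<Rightarrow> real \<Rightarrow> (real \<Rightarrow> real) \<Rightarrow> real \<Rightarrow> real" where
  "frac_deriv_right \<theta> T g t = 1 / Gamma (1 - \<theta>) *
     (g t / (T - t) powr \<theta> + \<theta> * (LINT u:{t<..<T}|lebesgue. (g t - g u) / (u - t) powr (\<theta> + 1)))"

definition admissible_order :: "real \<Rightarrow> (real \<Rightarrow> real) \<Rightarrow> (real \<Rightarrow> real) \<Rightarrow> real \<Rightarrow> bool" where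
  "admissible_order T f g \<theta> \<longleftrightarrow> 0 < \<theta> \<and> \<theta> < 1 \<and> f \<in> W0_1 \<theta> T \<and> g \<in> WT_inf (1 - \<theta>) T"

definition stieltjes_integrable :: "real \<Rightarrow> (real \<Rightarrow> real) \<Rightarrow> (real \<Rightarrow> real) \<Rightarrow> bool" where
  "stieltjes_integrable T f g \<longleftrightarrow> (\<exists>\<theta>. admissible_order T f g \<theta>)"

definition stieltjes_integral_order ::
    "real \<Rightarrow> real \<Rightarrow> (real \<Rightarrow> real) \<Rightarrow> (real \<Rightarrow> real) \<Rightarrow> real" where
  "stieltjes_integral_order \<theta> T f g =
     - (LINT t:{0<..<T}|lebesgue.
          frac_deriv_left \<theta> f t * frac_deriv_right (1 - \<theta>) T (\<lambda>u. g u - Lim (at_left T) g) t)"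

text \<open>The value does not depend on the choice of the admissible order.\<close>

definition stieltjes_integral :: "real \<Rightarrow> (real \<Rightarrow> real) \<Rightarrow> (real \<Rightarrow> real) \<Rightarrow> real" where
  "stieltjes_integral T f g = stieltjes_integral_order (SOME \<theta>. admissible_order T f g \<theta>) T f g"

text \<open>The integral of \<open>f\<close> against \<open>g\<close> over \<open>{0..t}\<close>, for \<open>t\<close> in \<open>{0..T}\<close>.\<close>

definition stieltjes_integrable_upto ::
    "real \<Rightarrow> real \<Rightarrow> (real \<Rightarrow> real) \<Rightarrow> (real \<Rightarrow> real) \<Rightarrow> bool" where
  "stieltjes_integrable_upto T t f g \<longleftrightarrow> stieltjes_integrable T (\<lambda>u. indicator {0..t} u * f u) g"

definition stieltjes_integral_upto ::
    "real \<Rightarrow> real \<Rightarrow> (real \<Rightarrow> real) \<Rightarrow> (real \<Rightarrow> real) \<Rightarrow> real" where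
  "stieltjes_integral_upto T t f g = stieltjes_integral T (\<lambda>u. indicator {0..t} u * f u) g"

end

theory Submission
  imports Defs "HOL-Computational_Algebra.Polynomial"
begin

text \<open>
  For \<open>\<theta>\<close> with \<open>1 - \<alpha> < \<theta> < \<alpha> s\<close>, mollify \<open>F\<close> and its gradient. The gradient
  measures of the \<open>\<partial>\<^sub>kF\<close> control the mollifications through Riesz potentials:
  \<open>|\<partial>\<^sub>kF\<^sub>\<epsilon>(x) - \<partial>\<^sub>kF\<^sub>\<epsilon>(y)|\<close> is at most a constant times
  \<open>|x - y|\<^sup>s (1 + p(x) + p(y))\<close>, where \<open>p\<close> is the potential whose integral along \<open>X\<close> is finite by
  \<open>(s,1)\<close>-variability. Hence \<open>\<partial>\<^sub>kF\<^sub>\<epsilon>(X)\<close> converges in the fractional Sobolev space of order \<open>\<theta>\<close> by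
  dominated convergence, and a fractional Hardy inequality carries this over to the indicator
  cut-offs. The Stieltjes integral is continuous in that space, so the chain rule for the smooth
  functions \<open>F\<^sub>\<epsilon>\<close> passes to the limit at all times where \<open>F\<close> has approximate limits, and
  finiteness of the potentials guarantees approximate limits of \<open>F\<close> along \<open>X\<close> almost everywhere.

  The Stieltjes integral of any admissible order is the limit of the integrals against the
  difference quotients of Steklov averages of the integrator. This shows at once that the order is
  irrelevant, that the integral is linear, and that the chain rule for smooth functions reduces to
  the fundamental theorem of calculus along twice averaged paths.
\<close>

text \<open>The interval for \<theta> is nonempty exactly because s > (1 - \<alpha>) / \<alpha>. Its
  lower end puts the path into \<open>WT_inf (1 - \<theta>) T\<close>; its upper end makes |t - u|
  to the power \<alpha> s - 1 - \<theta> integrable, which turns the two-point bound into a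
  dominating function for the Gagliardo integrand. Three obstacles shape the proof. The integral
  picks its order with \<open>SOME\<close>, so nothing can be computed before order independence is
  known; a limit formula that does not mention the order provides it. The cut-off at t creates a
  jump, whose cost is the integral of |f u| / (t - u) to the power \<theta>; since \<theta> < 1, the
  Hardy inequality in L1 controls it without any boundary value of f. Finally, the integrand depends
  on a representative: at times with finite potential the partial derivative has an approximate
  limit, on which all representatives agree, and the other times form a null set. For continuous F
  approximate limits exist everywhere, so no exceptional times remain.\<close>

abbreviation nn_integral_lborel :: "('a::euclidean_space \<Rightarrow> ennreal) \<Rightarrow> ennreal" (binder "NBINT " 10) where
 "nn_integral_lborel f \<equiv> integral\<^sup>N lborel f"

abbreviation ind :: "'a set \<Rightarrow> 'a \<Rightarrow> 'b::zero_neq_one" where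
 "ind \<equiv> indicator"

abbreviation eabs :: "real \<Rightarrow> ennreal" where
 "eabs x \<equiv> ennreal \<bar>x\<bar>"

abbreviation Borel (\<open>\<B>\<close>) where
 "\<B> \<equiv> borel_measurable borel"

section \<open>Total variation of vector measures\<close>

definition bounded_borel_partition :: "(real^'n) set \<Rightarrow> (nat \<Rightarrow> (real^'n) set) \<Rightarrow> bool" where
 "bounded_borel_partition A E \<longleftrightarrow>
   disjoint_family E \<and> (\<Union>i. E i) = A \<and> (\<forall>i. E i \<in> sets borel \<and> bounded (E i))"

definition total_variation :: "((real^'n) set \<Rightarrow> real^'n) \<Rightarrow> (real^'n) set \<Rightarrow> ennreal" where
 "total_variation \<gamma> A = (SUP E \<in> {E. bounded_borel_partition A E}. \<Sum>i. ennreal (norm (\<gamma> (E i))))"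

text \<open>Additivity is asked for bounded unions only: the difference of two Radon measures has no
  meaning as a number where both are infinite.\<close>

definition bounded_vector_measure :: "((real^'n) set \<Rightarrow> real^'n) \<Rightarrow> bool" where
 "bounded_vector_measure \<gamma> \<longleftrightarrow>
   (\<forall>E. bounded_borel_partition (\<Union>i. E i) E \<longrightarrow> bounded (\<Union>i. E i) \<longrightarrow>
    (\<lambda>i. \<gamma> (E i)) sums \<gamma> (\<Union>i. E i))"

lemma ennreal_norm_sums_le:
 fixes f :: "nat \<Rightarrow> 'a::real_normed_vector"
 assumes "f sums s"
 shows "ennreal (norm s) \<le> (\<Sum>i. ennreal (norm (f i)))"
proof (rule LIMSEQ_le_const2)
 show "(\<lambda>n. ennreal (norm (\<Sum>i<n. f i))) \<longlonglongrightarrow> ennreal (norm s)"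
  using assms unfolding sums_def by (intro tendsto_ennrealI tendsto_norm)
 have "ennreal (norm (\<Sum>i<n. f i)) \<le> (\<Sum>i. ennreal (norm (f i)))" for n
 proof -
  have "ennreal (norm (\<Sum>i<n. f i)) \<le> ennreal (\<Sum>i<n. norm (f i))"
   by (intro ennreal_leI norm_sum)
  also have "\<dots> = (\<Sum>i<n. ennreal (norm (f i)))" by simp
  also have "\<dots> \<le> (\<Sum>i. ennreal (norm (f i)))" by (rule sum_le_suminf) auto
  finally show ?thesis .
 qed
 then show "\<exists>N. \<forall>n\<ge>N. ennreal (norm (\<Sum>i<n. f i)) \<le> (\<Sum>i. ennreal (norm (f i)))" by blast
qed

lemma ennreal_suminf_swap:
 fixes f :: "nat \<Rightarrow> nat \<Rightarrow> ennreal"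
 shows "(\<Sum>i. \<Sum>j. f i j) = (\<Sum>j. \<Sum>i. f i j)"
proof -
 have "(\<Sum>j. \<Sum>i. f i j) = (\<Sum>j. \<integral>\<^sup>+i. f i j \<partial>count_space UNIV)"
  by (simp add: nn_integral_count_space_nat)
 also have "\<dots> = (\<integral>\<^sup>+i. (\<Sum>j. f i j) \<partial>count_space UNIV)"
  by (subst nn_integral_suminf) auto
 finally show ?thesis by (simp add: nn_integral_count_space_nat)
qed

text \<open>Cutting A along unit annuli. A nonempty family of partitions is what allows a constant
  to be moved into the supremum in \<open>total_variation_superadditive\<close>.\<close>

lemma bounded_borel_partition_exists:
 fixes A :: "(real^'n) set"
 assumes "A \<in> sets borel"
 shows "\<exists>E. bounded_borel_partition A E"
proof -
 define E where "E i = A \<inter> {x. real i \<le> norm x \<and> norm x < real i + 1}" for i :: nat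
 have "bounded (E i)" for i
  by (rule bounded_subset[of "ball 0 (real i + 1)"]) (auto simp: E_def)
 moreover have "E i \<in> sets borel" for i unfolding E_def using assms by measurable
 moreover have "disjoint_family E"
 unfolding disjoint_family_on_def proof (intro ballI impI)
  fix m n :: nat assume "m \<noteq> n"
  then show "E m \<inter> E n = {}" unfolding E_def by (cases "m < n") auto
 qed
 moreover have "(\<Union>i. E i) = A"
 proof -
  have "x \<in> (\<Union>i. E i)" if "x \<in> A" for x
  proof -
   have "real (nat \<lfloor>norm x\<rfloor>) \<le> norm x \<and> norm x < real (nat \<lfloor>norm x\<rfloor>) + 1"
    by simp
   then show ?thesis using that unfolding E_def by blast
  qed
  then show ?thesis unfolding E_def by auto
 qed
 ultimately show ?thesis unfolding bounded_borel_partition_def by blast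
qed

lemma total_variation_upper:
 assumes "bounded_borel_partition A E"
 shows "(\<Sum>i. ennreal (norm (\<gamma> (E i)))) \<le> total_variation \<gamma> A"
 unfolding total_variation_def by (rule SUP_upper) (use assms in auto)

text \<open>A partition of A and a partition of B, interleaved along even and odd indices, partition
  the union; the two suprema are then taken independently.\<close>

lemma total_variation_superadditive:
 fixes \<gamma> :: "(real^'n) set \<Rightarrow> real^'n"
 assumes "A \<in> sets borel" "B \<in> sets borel" "A \<inter> B = {}"
 shows "total_variation \<gamma> A + total_variation \<gamma> B \<le> total_variation \<gamma> (A \<union> B)"
proof -
 obtain EA EB where ne: "bounded_borel_partition A EA" "bounded_borel_partition B EB"
  using bounded_borel_partition_exists assms by metis
 define v where "v E = (\<Sum>i. ennreal (norm (\<gamma> (E i))))" for E :: "nat \<Rightarrow> (real^'n) set"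
 have *: "v E + v F \<le> total_variation \<gamma> (A \<union> B)"
  if E: "bounded_borel_partition A E" and F: "bounded_borel_partition B F" for E F
 proof -
  define G where "G i = (if even i then E (i div 2) else F (i div 2))" for i
  have UG: "(\<Union>i. G i) = A \<union> B"
  proof -
   have "E i \<subseteq> (\<Union>i. G i)" for i
   proof -
    have "G (2*i) = E i" by (simp add: G_def)
    then show ?thesis by blast
   qed
   moreover have "F i \<subseteq> (\<Union>i. G i)" for i
   proof -
    have "G (2*i+1) = F i" by (simp add: G_def)
    then show ?thesis by blast
   qed
   moreover have "(\<Union>i. G i) \<subseteq> (\<Union>i. E i) \<union> (\<Union>i. F i)" by (auto simp: G_def split: if_splits)
   ultimately have "(\<Union>i. G i) = (\<Union>i. E i) \<union> (\<Union>i. F i)"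
    using UN_least[of UNIV E "\<Union>i. G i"] UN_least[of UNIV F "\<Union>i. G i"] by (intro antisym Un_least) auto
   then show ?thesis using E F unfolding bounded_borel_partition_def by metis
  qed
  have "disjoint_family G"
  unfolding disjoint_family_on_def proof (intro ballI impI)
   fix m n :: nat assume mn: "m \<noteq> n"
   have EE: "E i \<inter> E j = {}" "F i \<inter> F j = {}" if "i \<noteq> j" for i j
    using E F that unfolding bounded_borel_partition_def disjoint_family_on_def by auto
   have EF: "E i \<inter> F j = {}" for i j
    using E F assms(3) unfolding bounded_borel_partition_def by blast
   have ev: "m div 2 \<noteq> n div 2" if "even m = even n" using mn that by presburger
   show "G m \<inter> G n = {}"
    using EE EF[of "m div 2" "n div 2"] EF[of "n div 2" "m div 2"] ev
    by (cases "even m"; cases "even n") (auto simp: G_def)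
  qed
  then have G: "bounded_borel_partition (A \<union> B) G"
   using UG E F unfolding bounded_borel_partition_def G_def by auto
  have "(\<Sum>i<n. ennreal (norm (\<gamma> (E i)))) + (\<Sum>i<n. ennreal (norm (\<gamma> (F i)))) \<le> v G" for n
  proof -
   have "(\<Sum>i<n. ennreal (norm (\<gamma> (E i)))) + (\<Sum>i<n. ennreal (norm (\<gamma> (F i))))
     = (\<Sum>i<2*n. ennreal (norm (\<gamma> (G i))))"
    by (induction n) (auto simp: G_def algebra_simps)
   also have "\<dots> \<le> v G" unfolding v_def by (rule sum_le_suminf) auto
   finally show ?thesis .
  qed
  moreover have "(\<lambda>n. (\<Sum>i<n. ennreal (norm (\<gamma> (E i)))) + (\<Sum>i<n. ennreal (norm (\<gamma> (F i)))))
    \<longlonglongrightarrow> v E + v F"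
   unfolding v_def by (intro tendsto_add summable_LIMSEQ summableI)
  ultimately have "v E + v F \<le> v G" by (intro LIMSEQ_le_const2) auto
  then show ?thesis using total_variation_upper[OF G, of \<gamma>] unfolding v_def by (rule order_trans)
 qed
 have "total_variation \<gamma> A + total_variation \<gamma> B
   = (SUP E\<in>{E. bounded_borel_partition A E}. v E + total_variation \<gamma> B)"
  unfolding total_variation_def v_def
  using ne by (subst ennreal_SUP_add_left) auto
 also have "\<dots> = (SUP E\<in>{E. bounded_borel_partition A E}. SUP F\<in>{E. bounded_borel_partition B E}. v E + v F)"
  unfolding total_variation_def v_def
  using ne by (subst ennreal_SUP_add_right) auto
 also have "\<dots> \<le> total_variation \<gamma> (A \<union> B)" using * by (intro SUP_least) auto
 finally show ?thesis .
qed

lemma total_variation_mono: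
 assumes "A \<in> sets borel" "B \<in> sets borel" "A \<subseteq> B"
 shows "total_variation \<gamma> A \<le> total_variation \<gamma> B"
proof -
 have "total_variation \<gamma> A \<le> total_variation \<gamma> A + total_variation \<gamma> (B - A)" by simp
 also have "\<dots> \<le> total_variation \<gamma> (A \<union> (B - A))"
  by (rule total_variation_superadditive) (use assms in auto)
 also have "A \<union> (B - A) = B" using assms by auto
 finally show ?thesis .
qed

text \<open>One inequality is finite superadditivity and monotonicity. For the other, a competing
  partition E of the union is refined by the sets \<open>A j\<close>: every \<open>E i\<close> is
  bounded, so \<gamma> is additive on its pieces, and the double sum may be reordered by
  \<open>A j\<close> first.\<close>

lemma total_variation_countably_additive:
 fixes \<gamma> :: "(real^'n) set \<Rightarrow> real^'n"
 assumes \<gamma>: "bounded_vector_measure \<gamma>"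
 shows "countably_additive (sets borel) (total_variation \<gamma>)"
proof (rule countably_additiveI)
 fix A :: "nat \<Rightarrow> (real^'n) set"
 assume A: "range A \<subseteq> sets borel" "disjoint_family A" "(\<Union>i. A i) \<in> sets borel"
 have fin: "(\<Sum>i<n. total_variation \<gamma> (A i)) \<le> total_variation \<gamma> (\<Union>i<n. A i)" for n
 proof (induction n)
  case (Suc n)
  have "(\<Sum>i<Suc n. total_variation \<gamma> (A i)) \<le> total_variation \<gamma> (\<Union>i<n. A i) + total_variation \<gamma> (A n)"
   using Suc by (simp add: add_mono add.commute)
  also have "\<dots> \<le> total_variation \<gamma> ((\<Union>i<n. A i) \<union> A n)"
  proof (rule total_variation_superadditive)
   show "(\<Union>i<n. A i) \<inter> A n = {}"
    using A(2) unfolding disjoint_family_on_def by (metis (no_types, lifting) UNIV_I UN_iff disjoint_iff lessThan_iff nat_neq_iff)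
  qed (use A(1) in auto)
  also have "(\<Union>i<n. A i) \<union> A n = (\<Union>i<Suc n. A i)" by (auto simp: less_Suc_eq)
  finally show ?case .
 qed simp
 show "(\<Sum>i. total_variation \<gamma> (A i)) = total_variation \<gamma> (\<Union>i. A i)"
 proof (rule antisym)
  show "(\<Sum>i. total_variation \<gamma> (A i)) \<le> total_variation \<gamma> (\<Union>i. A i)"
  proof (rule suminf_le_const[OF summableI])
   fix n
   have "total_variation \<gamma> (\<Union>i<n. A i) \<le> total_variation \<gamma> (\<Union>i. A i)"
    by (rule total_variation_mono) (use A in auto)
   then show "(\<Sum>i<n. total_variation \<gamma> (A i)) \<le> total_variation \<gamma> (\<Union>i. A i)"
    using fin[of n] by (rule order_trans[rotated])
  qed
  show "total_variation \<gamma> (\<Union>i. A i) \<le> (\<Sum>i. total_variation \<gamma> (A i))"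
   unfolding total_variation_def[of \<gamma> "\<Union>i. A i"]
  proof (rule SUP_least)
   fix E assume "E \<in> {E. bounded_borel_partition (\<Union>i. A i) E}"
   then have E: "disjoint_family E" "(\<Union>i. E i) = (\<Union>i. A i)"
     "\<And>i. E i \<in> sets borel" "\<And>i. bounded (E i)"
    unfolding bounded_borel_partition_def by auto
   have dA: "A i \<inter> A j = {}" if "i \<noteq> j" for i j using A(2) that unfolding disjoint_family_on_def by auto
   have dE: "E i \<inter> E j = {}" if "i \<noteq> j" for i j using E(1) that unfolding disjoint_family_on_def by auto
   have Am: "A i \<in> sets borel" for i using A(1) by auto
   have "(\<Sum>i. ennreal (norm (\<gamma> (E i)))) \<le> (\<Sum>i. \<Sum>j. ennreal (norm (\<gamma> (E i \<inter> A j))))"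
   proof (intro suminf_le summableI)
    fix i
    have eq: "(\<Union>j. E i \<inter> A j) = E i" using E(2) by blast
    have "bounded_borel_partition (E i) (\<lambda>j. E i \<inter> A j)"
     unfolding bounded_borel_partition_def disjoint_family_on_def
    proof (intro conjI ballI impI allI)
     show "(E i \<inter> A m) \<inter> (E i \<inter> A n) = {}" if "m \<noteq> n" for m n using dA[OF that] by auto
    qed (use eq E(3,4) Am in \<open>auto intro: bounded_Int\<close>)
    then have "(\<lambda>j. \<gamma> (E i \<inter> A j)) sums \<gamma> (E i)"
     using \<gamma>[unfolded bounded_vector_measure_def, rule_format, of "\<lambda>j. E i \<inter> A j"] eq E(4)[of i] by metis
    then show "ennreal (norm (\<gamma> (E i))) \<le> (\<Sum>j. ennreal (norm (\<gamma> (E i \<inter> A j))))"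
     by (rule ennreal_norm_sums_le)
   qed
   also have "\<dots> = (\<Sum>j. \<Sum>i. ennreal (norm (\<gamma> (E i \<inter> A j))))" by (rule ennreal_suminf_swap)
   also have "\<dots> \<le> (\<Sum>j. total_variation \<gamma> (A j))"
   proof (intro suminf_le summableI)
    fix j
    have "(\<Union>i. E i \<inter> A j) = A j" using E(2) by blast
    then have "bounded_borel_partition (A j) (\<lambda>i. E i \<inter> A j)"
     unfolding bounded_borel_partition_def disjoint_family_on_def
    proof (intro conjI ballI impI allI)
     show "(E m \<inter> A j) \<inter> (E n \<inter> A j) = {}" if "m \<noteq> n" for m n using dE[OF that] by auto
    qed (use E(3,4) Am in \<open>auto intro: bounded_Int\<close>)
    then show "(\<Sum>i. ennreal (norm (\<gamma> (E i \<inter> A j)))) \<le> total_variation \<gamma> (A j)"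
     by (rule total_variation_upper)
   qed
   finally show "(\<Sum>i. ennreal (norm (\<gamma> (E i)))) \<le> (\<Sum>i. total_variation \<gamma> (A i))" .
  qed
 qed
qed

lemma bounded_vector_measure_empty:
 assumes "bounded_vector_measure \<gamma>"
 shows "\<gamma> {} = 0"
proof -
 have "(\<lambda>i::nat. \<gamma> {}) sums \<gamma> {}"
  using assms[unfolded bounded_vector_measure_def, rule_format, of "\<lambda>i. {}"]
  by (simp add: bounded_borel_partition_def disjoint_family_on_def)
 then have "(\<lambda>i::nat. \<gamma> {}) \<longlonglongrightarrow> 0" using summable_LIMSEQ_zero sums_summable by blast
 then show ?thesis by (simp add: LIMSEQ_const_iff)
qed

lemma total_variation_empty:
 assumes "bounded_vector_measure \<gamma>"
 shows "total_variation \<gamma> {} = 0"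
proof -
 have "(\<Sum>i. ennreal (norm (\<gamma> (E i)))) = 0" if "bounded_borel_partition {} E" for E
 proof -
  have "E i = {}" for i using that unfolding bounded_borel_partition_def by auto
  then show ?thesis using bounded_vector_measure_empty[OF assms] by simp
 qed
 then have "total_variation \<gamma> {} \<le> 0" unfolding total_variation_def by (intro SUP_least) (metis mem_Collect_eq order_refl)
 then show ?thesis by simp
qed

lemma norm_le_total_variation:
 assumes "bounded_vector_measure \<gamma>" "A \<in> sets borel" "bounded A"
 shows "ennreal (norm (\<gamma> A)) \<le> total_variation \<gamma> A"
proof -
 define E where "E i = (if i = 0 then A else {})" for i :: nat
 have "bounded_borel_partition A E"
  using assms unfolding bounded_borel_partition_def E_def by (auto simp: disjoint_family_on_def)
 then have "(\<Sum>i. ennreal (norm (\<gamma> (E i)))) \<le> total_variation \<gamma> A" by (rule total_variation_upper)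
 moreover have "(\<Sum>i. ennreal (norm (\<gamma> (E i)))) = ennreal (norm (\<gamma> A))"
  using bounded_vector_measure_empty[OF assms(1)]
  by (subst suminf_finite[of "{0}"]) (auto simp: E_def)
 ultimately show ?thesis by simp
qed

lemma radon_measure_bounded_finite:
 assumes "radon_measure M" "bounded B"
 shows "emeasure M B < \<infinity>"
proof -
 have "emeasure M B \<le> emeasure M (closure B)"
  using assms by (intro emeasure_mono closure_subset) (auto simp: radon_measure_def)
 also have "\<dots> < \<infinity>" using assms unfolding radon_measure_def by (simp add: compact_closure)
 finally show ?thesis .
qed

lemma bounded_vector_measure_diff:
 fixes P N :: "'n \<Rightarrow> (real^'n) measure"
 assumes "\<And>k. radon_measure (P k)" "\<And>k. radon_measure (N k)"
 shows "bounded_vector_measure (\<lambda>B. \<chi> k. measure (P k) B - measure (N k) B)"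
 unfolding bounded_vector_measure_def
proof (intro allI impI)
 fix E :: "nat \<Rightarrow> (real^'n) set"
 assume E: "bounded_borel_partition (\<Union>i. E i) E" "bounded (\<Union>i. E i)"
 have m: "(\<lambda>i. measure M (E i)) sums measure M (\<Union>i. E i)" if M: "radon_measure M" for M
 proof (rule measure_UNION)
  show "emeasure M (\<Union> (range E)) \<noteq> \<infinity>" using radon_measure_bounded_finite[OF M E(2)] by auto
 qed (use E M in \<open>auto simp: bounded_borel_partition_def radon_measure_def\<close>)
 have c: "(\<lambda>i. measure (P k) (E i) - measure (N k) (E i)) sums
   (measure (P k) (\<Union>i. E i) - measure (N k) (\<Union>i. E i))" for k
  by (intro sums_diff m assms)
 show "(\<lambda>i. \<chi> k. measure (P k) (E i) - measure (N k) (E i)) sums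
   (\<chi> k. measure (P k) (\<Union>i. E i) - measure (N k) (\<Union>i. E i))"
  unfolding sums_def
 proof (rule vec_tendstoI)
  fix k
  show "(\<lambda>n. (\<Sum>i<n. \<chi> k. measure (P k) (E i) - measure (N k) (E i)) $ k) \<longlonglongrightarrow>
    (\<chi> k. measure (P k) (\<Union>i. E i) - measure (N k) (\<Union>i. E i)) $ k"
   using c[of k] unfolding sums_def by (simp add: sum_component)
 qed
qed

lemma sets_variation_measure [simp]:
 fixes \<phi> :: "real^'n \<Rightarrow> real"
 shows "sets (variation_measure \<phi>) = sets borel"
 unfolding variation_measure_def using sets.sets_measure_of_eq[of "borel :: (real^'n) measure"] by simp

text \<open>The bound M - N \<le> V in additive form, which stays meaningful where M and N are
  infinite. The inequality is carried through the standard induction over nonnegative measurable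
  functions.\<close>

lemma nn_integral_le_of_emeasure_le:
 fixes M N V :: "'a measure"
 assumes S: "sets N = sets M" "sets V = sets M"
  and le: "\<And>A. A \<in> sets M \<Longrightarrow> emeasure M A \<le> emeasure N A + emeasure V A"
  and f: "f \<in> borel_measurable M"
 shows "integral\<^sup>N M f \<le> integral\<^sup>N N f + integral\<^sup>N V f"
proof -
 have fM: "g \<in> borel_measurable N" "g \<in> borel_measurable V" if "g \<in> borel_measurable M" for g :: "'a \<Rightarrow> ennreal"
  using that S by (auto cong: measurable_cong_sets)
 show ?thesis using f
 proof (induction rule: borel_measurable_induct)
  case (cong f g)
  have "integral\<^sup>N M f = integral\<^sup>N M g" "integral\<^sup>N N f = integral\<^sup>N N g" "integral\<^sup>N V f = integral\<^sup>N V g"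
   using cong(3) sets_eq_imp_space_eq[OF S(1)] sets_eq_imp_space_eq[OF S(2)]
   by (auto intro!: nn_integral_cong)
  then show ?case using cong by simp
 next
  case (set A)
  then show ?case using le[of A] S by simp
 next
  case (mult u c)
  have "integral\<^sup>N M u \<le> integral\<^sup>N N u + integral\<^sup>N V u" using mult by auto
  then have "c * integral\<^sup>N M u \<le> c * (integral\<^sup>N N u + integral\<^sup>N V u)" by (intro mult_left_mono) auto
  then show ?case using mult(2) fM[OF mult(2)] by (simp only: nn_integral_cmult distrib_left)
 next
  case (add u v)
  have "integral\<^sup>N M u \<le> integral\<^sup>N N u + integral\<^sup>N V u" "integral\<^sup>N M v \<le> integral\<^sup>N N v + integral\<^sup>N V v"
   using add by auto
  note le = add_mono[OF this]
  have m: "u \<in> borel_measurable M" "v \<in> borel_measurable M" using add by auto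
  have "integral\<^sup>N K (\<lambda>x. v x + u x) = integral\<^sup>N K u + integral\<^sup>N K v"
   if "u \<in> borel_measurable K" "v \<in> borel_measurable K" for K :: "'a measure"
   using that by (subst nn_integral_add) (auto simp: add.commute)
  from this[OF m] this[OF fM(1)[OF m(1)] fM(1)[OF m(2)]] this[OF fM(2)[OF m(1)] fM(2)[OF m(2)]] le
  show ?case by (simp add: ac_simps)
 next
  case (seq U)
  have 1: "integral\<^sup>N K (SUP i. U i) = (SUP i. integral\<^sup>N K (U i))" if "\<And>i. U i \<in> borel_measurable K" for K
   unfolding SUP_apply using seq that by (intro nn_integral_monotone_convergence_SUP) auto
  have inc: "incseq (\<lambda>i. integral\<^sup>N K (U i))" for K
   using seq(3) by (auto simp: incseq_def le_fun_def intro!: nn_integral_mono)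
  have "(SUP i. integral\<^sup>N M (U i)) \<le> (SUP i. integral\<^sup>N N (U i) + integral\<^sup>N V (U i))"
   by (rule SUP_mono') (use seq in blast)
  also have "\<dots> = (SUP i. integral\<^sup>N N (U i)) + (SUP i. integral\<^sup>N V (U i))"
   using inc by (intro ennreal_SUP_add)
  finally show ?case
   by (simp only: 1[OF seq(1)] 1[OF fM(1)[OF seq(1)]] 1[OF fM(2)[OF seq(1)]])
 qed
qed

text \<open>The choice hidden in \<open>gradient_measure\<close> is opened here: P and N are the
  decomposition that it picked. Componentwise |P k - N k| is at most the norm of the vector measure,
  hence at most its variation; the two inequalities say this without subtracting.\<close>

lemma BV_loc_variation:
 fixes \<phi> :: "real^'n \<Rightarrow> real"
 assumes "BV_loc \<phi>"
 obtains P N where "has_derivative_measures \<phi> P N"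
  "\<And>k f. f \<in> \<B> \<Longrightarrow>
    integral\<^sup>N (P k) f \<le> integral\<^sup>N (N k) f + integral\<^sup>N (variation_measure \<phi>) f"
  "\<And>k f. f \<in> \<B> \<Longrightarrow>
    integral\<^sup>N (N k) f \<le> integral\<^sup>N (P k) f + integral\<^sup>N (variation_measure \<phi>) f"
proof -
 define PN where "PN = (SOME (P, N). has_derivative_measures \<phi> P N)"
 obtain P N where PN: "PN = (P, N)" by (cases PN)
 have "\<exists>p. (case p of (P, N) \<Rightarrow> has_derivative_measures \<phi> P N)"
  using assms unfolding BV_loc_def by auto
 then have "case PN of (P, N) \<Rightarrow> has_derivative_measures \<phi> P N"
  unfolding PN_def by (rule someI_ex)
 then have hd: "has_derivative_measures \<phi> P N" using PN by simp
 then have rad: "radon_measure (P k)" "radon_measure (N k)" for k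
  unfolding has_derivative_measures_def by auto
 define \<gamma> where "\<gamma> = gradient_measure \<phi>"
 have \<gamma>_eq: "\<gamma> = (\<lambda>B. \<chi> k. measure (P k) B - measure (N k) B)"
  unfolding \<gamma>_def gradient_measure_def[abs_def] PN_def[symmetric] PN by simp
 have bv: "bounded_vector_measure \<gamma>" unfolding \<gamma>_eq by (intro bounded_vector_measure_diff rad)
 let ?V = "variation_measure \<phi>"
 have V_eq: "?V = measure_of UNIV (sets borel) (total_variation \<gamma>)"
  unfolding variation_measure_def total_variation_def[abs_def] bounded_borel_partition_def \<gamma>_def ..
 have V: "emeasure ?V A = total_variation \<gamma> A" if "A \<in> sets borel" for A
 proof (rule emeasure_measure_of[OF V_eq])
  show "positive (sets ?V) (total_variation \<gamma>)"
   unfolding positive_def using total_variation_empty[OF bv] by simp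
  show "countably_additive (sets ?V) (total_variation \<gamma>)"
   using total_variation_countably_additive[OF bv] by simp
 qed (use that in auto)
 have bdd: "measure (P k) A \<le> measure (N k) A + norm (\<gamma> A)"
   "measure (N k) A \<le> measure (P k) A + norm (\<gamma> A)" for k A
  using component_le_norm_cart[of "\<gamma> A" k] unfolding \<gamma>_eq by auto
 have em: "emeasure M A = ennreal (measure M A)" if "radon_measure M" "bounded A" for M :: "(real^'n) measure" and A
  using radon_measure_bounded_finite[OF that] by (intro emeasure_eq_ennreal_measure) auto
 have bd: "emeasure (P k) A \<le> emeasure (N k) A + emeasure ?V A"
   "emeasure (N k) A \<le> emeasure (P k) A + emeasure ?V A"
  if "A \<in> sets borel" "bounded A" for k A
 proof -
  note n = norm_le_total_variation[OF bv that]
  have "emeasure (P k) A \<le> ennreal (measure (N k) A) + ennreal (norm (\<gamma> A))"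
   using bdd(1)[where k=k and A=A] by (simp add: em rad that ennreal_plus[symmetric] ennreal_leI del: ennreal_plus)
  also have "\<dots> \<le> ennreal (measure (N k) A) + emeasure ?V A" unfolding V[OF that(1)]
   by (intro add_left_mono n)
  finally show "emeasure (P k) A \<le> emeasure (N k) A + emeasure ?V A"
   by (simp add: em rad that)
  have "emeasure (N k) A \<le> ennreal (measure (P k) A) + ennreal (norm (\<gamma> A))"
   using bdd(2)[where k=k and A=A] by (simp add: em rad that ennreal_plus[symmetric] ennreal_leI del: ennreal_plus)
  also have "\<dots> \<le> ennreal (measure (P k) A) + emeasure ?V A" unfolding V[OF that(1)]
   by (intro add_left_mono n)
  finally show "emeasure (N k) A \<le> emeasure (P k) A + emeasure ?V A"
   by (simp add: em rad that)
 qed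
 \<comment> \<open>On unbounded sets the vector measure has no value, so the bound is carried over
   by exhausting A with its intersections with balls.\<close>
 have unb: "emeasure M A \<le> emeasure K A + emeasure ?V A"
  if b: "\<And>A. A \<in> sets borel \<Longrightarrow> bounded A \<Longrightarrow> emeasure M A \<le> emeasure K A + emeasure ?V A"
   and A: "A \<in> sets borel" and s: "sets M = sets borel" "sets K = sets borel" for M K A
 proof -
  define B where "B i = A \<inter> ball 0 (real i)" for i :: nat
  have UB: "(\<Union>i. B i) = A"
   unfolding B_def by (auto simp: dist_norm) (meson reals_Archimedean2)
  have inc: "incseq B" unfolding B_def incseq_def by auto
  have Bb: "B i \<in> sets borel" "bounded (B i)" for i
   unfolding B_def using A by (auto intro: bounded_subset[OF bounded_ball])
  have "emeasure M A = (SUP i. emeasure M (B i))"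
   using SUP_emeasure_incseq[of B M] inc Bb s unfolding UB[symmetric] by (simp add: image_subset_iff)
  also have "\<dots> \<le> emeasure K A + emeasure ?V A"
  proof (rule SUP_least)
   fix i
   have "emeasure M (B i) \<le> emeasure K (B i) + emeasure ?V (B i)" using b Bb by blast
   also have "\<dots> \<le> emeasure K A + emeasure ?V A"
    using A s by (intro add_mono emeasure_mono) (auto simp: B_def)
   finally show "emeasure M (B i) \<le> emeasure K A + emeasure ?V A" .
  qed
  finally show ?thesis .
 qed
 have sP: "sets (P k) = sets borel" "sets (N k) = sets borel" for k
  using rad unfolding radon_measure_def by auto
 have "integral\<^sup>N (P k) f \<le> integral\<^sup>N (N k) f + integral\<^sup>N ?V f"
    "integral\<^sup>N (N k) f \<le> integral\<^sup>N (P k) f + integral\<^sup>N ?V f"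
  if "f \<in> \<B>" for k f
  by (rule nn_integral_le_of_emeasure_le; use sP that unb bd in \<open>auto cong: measurable_cong_sets\<close>)+
 then show ?thesis using that hd by blast
qed

section \<open>Translations in \<open>L\<^sup>1\<close>\<close>

lemma nn_integral_lborel_translate:
 fixes f :: "'a::euclidean_space \<Rightarrow> ennreal"
 assumes [measurable]: "f \<in> \<B>"
 shows "(NBINT x. f (a + x)) = (NBINT x. f x)"
proof -
 have "(NBINT x. f x) = (\<integral>\<^sup>+x. f x \<partial>distr lborel borel (\<lambda>x. a + x))"
  by (simp add: lborel_distr_plus)
 also have "\<dots> = (NBINT x. f (a + x))" by (simp add: nn_integral_distr)
 finally show ?thesis ..
qed

text \<open>Points that leave S are handled by dominated convergence, since x + h n stays in S for
  large n when x is in the open set S. Points that enter S would cause trouble on the boundary of S,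
  which may have positive measure; their measure equals that of the points that leave, because S and
  its translate have the same finite measure.\<close>

lemma L1_translation_open:
 fixes S :: "'a::euclidean_space set" and h :: "nat \<Rightarrow> 'a"
 assumes S: "open S" "emeasure lborel S < \<infinity>" and h: "h \<longlonglongrightarrow> 0"
 shows "(\<lambda>n. NBINT x. eabs (ind S (x + h n) - ind S x)) \<longlonglongrightarrow> 0"
proof -
 note [measurable] = borel_open[OF S(1)]
 define u :: "nat \<Rightarrow> 'a \<Rightarrow> ennreal" where "u n x = ennreal (ind S x * (1 - ind S (x + h n)))" for n x
 define w :: "nat \<Rightarrow> 'a \<Rightarrow> ennreal" where "w n x = ennreal (ind S (x + h n) * (1 - ind S x))" for n x
 have [measurable]: "u n \<in> \<B>" "w n \<in> \<B>" for n
  unfolding u_def w_def by measurable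
 have un: "(\<lambda>n. NBINT x. u n x) \<longlonglongrightarrow> (\<integral>\<^sup>+x. 0 \<partial>(lborel :: 'a measure))"
 proof (rule nn_integral_dominated_convergence[where w="ind S"])
  show "AE x in lborel. (\<lambda>n. u n x) \<longlonglongrightarrow> 0"
  proof (intro AE_I2)
   fix x
   show "(\<lambda>n. u n x) \<longlonglongrightarrow> 0"
   proof (cases "x \<in> S")
    case True
    have "(\<lambda>n. x + h n) \<longlonglongrightarrow> x + 0" by (intro tendsto_intros h)
    then have "\<forall>\<^sub>F n in sequentially. x + h n \<in> S"
     using S(1) True by (intro topological_tendstoD) auto
    then have "\<forall>\<^sub>F n in sequentially. u n x = 0" by eventually_elim (simp add: u_def)
    then show ?thesis by (rule tendsto_eventually)
   qed (simp add: u_def)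
  qed
 qed (use S(2) in \<open>auto simp: u_def split: split_indicator\<close>)
 have fin: "(NBINT x. ind S x * ind S (x + h n)) \<noteq> \<infinity>" for n
 proof -
  have "(NBINT x. ind S x * ind S (x + h n)) \<le> (NBINT x. ind S x)"
   by (intro nn_integral_mono) (auto split: split_indicator)
  then show ?thesis using S(2) by (simp add: top.extremum_unique)
 qed
 have uw: "(NBINT x. w n x) = (NBINT x. u n x)" for n
 proof -
  let ?I = "NBINT x. ind S x * ind S (x + h n)"
  have "(NBINT x. w n x) + ?I = (NBINT x. w n x + ind S x * ind S (x + h n))"
   by (intro nn_integral_add[symmetric]) measurable
  also have "\<dots> = (NBINT x. ind S (h n + x))"
   by (intro nn_integral_cong) (auto simp: w_def add.commute split: split_indicator)
  also have "\<dots> = (NBINT x. ind S x)"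
   by (rule nn_integral_lborel_translate) measurable
  also have "\<dots> = (NBINT x. u n x + ind S x * ind S (x + h n))"
   by (intro nn_integral_cong) (auto simp: u_def split: split_indicator)
  also have "\<dots> = (NBINT x. u n x) + ?I"
   by (intro nn_integral_add) measurable
  finally show ?thesis using fin[of n] by (simp add: ennreal_add_left_cancel add.commute)
 qed
 have "(NBINT x. eabs (ind S (x + h n) - ind S x))
   = (NBINT x. u n x) + (NBINT x. u n x)" for n
 proof -
  have "(NBINT x. eabs (ind S (x + h n) - ind S x)) = (NBINT x. u n x + w n x)"
   by (intro nn_integral_cong) (auto simp: u_def w_def split: split_indicator)
  then show ?thesis by (simp add: nn_integral_add uw)
 qed
 moreover have "(\<lambda>n. (NBINT x. u n x) + (NBINT x. u n x)) \<longlonglongrightarrow> 0 + 0"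
  using un by (intro tendsto_add) auto
 ultimately show ?thesis by simp
qed

lemma L1_translation_triangle:
 fixes f g :: "'a::euclidean_space \<Rightarrow> real"
 assumes [measurable]: "f \<in> \<B>" "g \<in> \<B>"
 shows "(NBINT x. eabs (f (x + h) - f x))
   \<le> 2 * (NBINT x. eabs (f x - g x)) + (NBINT x. eabs (g (x + h) - g x))"
proof -
 have "(NBINT x. eabs (f (x + h) - f x))
   \<le> (NBINT x. eabs (f (h + x) - g (h + x)) + eabs (f x - g x) + eabs (g (x + h) - g x))"
  by (intro nn_integral_mono) (auto simp: ennreal_plus[symmetric] add.commute intro!: ennreal_leI simp del: ennreal_plus)
 also have "\<dots> = (NBINT x. eabs (f (h + x) - g (h + x))) + (NBINT x. eabs (f x - g x))
   + (NBINT x. eabs (g (x + h) - g x))"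
  by (simp add: nn_integral_add)
 also have "(NBINT x. eabs (f (h + x) - g (h + x))) = (NBINT x. eabs (f x - g x))"
  by (rule nn_integral_lborel_translate[of "\<lambda>x. eabs (f x - g x)"]) measurable
 finally show ?thesis by (simp add: mult_2)
qed

lemma L1_translation_limit:
 fixes f :: "'a::euclidean_space \<Rightarrow> real" and h :: "nat \<Rightarrow> 'a"
 assumes [measurable]: "f \<in> \<B>"
  and ap: "\<And>e::real. e > 0 \<Longrightarrow> \<exists>g. g \<in> \<B> \<and>
     (NBINT x. eabs (f x - g x)) \<le> ennreal e \<and>
     (\<lambda>n. NBINT x. eabs (g (x + h n) - g x)) \<longlonglongrightarrow> 0"
 shows "(\<lambda>n. NBINT x. eabs (f (x + h n) - f x)) \<longlonglongrightarrow> 0"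
proof (rule order_tendstoI)
 fix e :: ennreal assume "0 < e"
 then obtain e' where e': "0 < e'" "e' < e" using dense by blast
 obtain c where c: "c > 0" "ennreal c = e'" using e' by (cases e') (auto simp: ennreal_less_zero_iff less_top)
 \<comment> \<open>The approximation error is paid twice, for g and for its translate, hence c/4;
   the translation of g itself gets c/2.\<close>
 obtain g where g[measurable]: "g \<in> \<B>" and gf: "(NBINT x. eabs (f x - g x)) \<le> ennreal (c/4)"
   and lim: "(\<lambda>n. NBINT x. eabs (g (x + h n) - g x)) \<longlonglongrightarrow> 0"
  using ap[of "c/4"] c by auto
 have "\<forall>\<^sub>F n in sequentially. (NBINT x. eabs (g (x + h n) - g x)) < ennreal (c/2)"
  using c by (intro order_tendstoD(2)[OF lim]) simp
 then show "\<forall>\<^sub>F n in sequentially. (NBINT x. eabs (f (x + h n) - f x)) < e"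
 proof eventually_elim
  case (elim n)
  have "(NBINT x. eabs (f (x + h n) - f x)) \<le> 2 * ennreal (c/4) + ennreal (c/2)"
   by (rule order_trans[OF L1_translation_triangle[of f g]])
    (auto intro!: add_mono mult_left_mono gf less_imp_le[OF elim])
  also have "2 * ennreal (c/4) + ennreal (c/2) = ennreal c"
   using c by (simp add: ennreal_mult'[of 2, simplified, symmetric] ennreal_plus[symmetric] del: ennreal_plus)
  finally show ?case using e' c by simp
 qed
qed auto

text \<open>Only the indicator case carries content: an open set S that exceeds A by a small measure
  replaces A, and \<open>L1_translation_open\<close> applies to S. Sums and L1 limits preserve the
  claim.\<close>

lemma L1_translation_continuous:
 fixes f :: "'a::euclidean_space \<Rightarrow> real" and h :: "nat \<Rightarrow> 'a"
 assumes f: "integrable lborel f" and h: "h \<longlonglongrightarrow> 0"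
 shows "(\<lambda>n. NBINT x. eabs (f (x + h n) - f x)) \<longlonglongrightarrow> 0"
 using f
proof (induction rule: integrable_induct)
 case (base A c)
 have [measurable]: "A \<in> sets borel" using base by simp
 show ?case
 proof (rule L1_translation_limit)
  fix e :: real assume e: "e > 0"
  \<comment> \<open>The 1 in the denominator covers c = 0.\<close>
  define d where "d = e / (\<bar>c\<bar> + 1)"
  have d: "d > 0" "\<bar>c\<bar> * d \<le> e" using e by (auto simp: d_def field_simps)
  have "A \<in> sets lebesgue" by (simp add: \<open>A \<in> sets borel\<close>)
  from sets_lebesgue_outer_open[OF this d(1)]
  obtain S where S: "open S" "A \<subseteq> S" "emeasure lebesgue (S - A) < ennreal d" by metis
  note [measurable] = borel_open[OF S(1)]
  have SA: "emeasure lborel (S - A) < ennreal d"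
   using S(3) emeasure_completion[of "S - A" lborel] main_part[of "S - A" lborel] by simp
  have SU: "A \<union> (S - A) = S" using S(2) by auto
  have "emeasure lborel (A \<union> (S - A)) \<le> emeasure lborel A + emeasure lborel (S - A)"
   by (rule emeasure_subadditive) auto
  also have "\<dots> < \<infinity>"
   using base(2) order.strict_trans[OF SA ennreal_less_top] by (simp add: ennreal_add_less_top)
  finally have Sf: "emeasure lborel S < \<infinity>" unfolding SU .
  show "\<exists>g. g \<in> \<B> \<and>
     (NBINT x. eabs (indicat_real A x *\<^sub>R c - g x)) \<le> ennreal e \<and>
     (\<lambda>n. NBINT x. eabs (g (x + h n) - g x)) \<longlonglongrightarrow> 0"
  proof (intro exI[of _ "\<lambda>x. indicat_real S x * c"] conjI)
   have "(NBINT x. eabs (indicat_real A x *\<^sub>R c - indicat_real S x * c))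
     = (NBINT x. eabs c * ind (S - A) x)"
    using S(2) by (intro nn_integral_cong) (auto split: split_indicator)
   also have "\<dots> = eabs c * emeasure lborel (S - A)" by (subst nn_integral_cmult) auto
   also have "\<dots> \<le> eabs c * ennreal d" using SA by (intro mult_left_mono) auto
   also have "\<dots> \<le> ennreal e" using d by (simp add: ennreal_mult[symmetric] ennreal_leI)
   finally show "(NBINT x. eabs (indicat_real A x *\<^sub>R c - indicat_real S x * c)) \<le> ennreal e" .
   have "(\<lambda>n. eabs c * (NBINT x. eabs (ind S (x + h n) - ind S x))) \<longlonglongrightarrow> eabs c * 0"
    by (intro ennreal_tendsto_cmult L1_translation_open S Sf h) simp
   moreover have "(NBINT x. eabs (indicat_real S (x + h n) * c - indicat_real S x * c))
     = eabs c * (NBINT x. eabs (ind S (x + h n) - ind S x))" for n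
    by (subst nn_integral_cmult[symmetric])
     (auto simp: ennreal_mult[symmetric] abs_mult[symmetric] algebra_simps intro!: nn_integral_cong)
   ultimately show "(\<lambda>n. NBINT x. eabs (indicat_real S (x + h n) * c - indicat_real S x * c)) \<longlonglongrightarrow> 0"
    by simp
  qed simp
 qed simp
next
 case (add f g)
 have [measurable]: "f \<in> \<B>" "g \<in> \<B>"
  using add by (auto dest: borel_measurable_integrable)
 have "(\<lambda>n. (NBINT x. eabs (f (x + h n) - f x)) + (NBINT x. eabs (g (x + h n) - g x))) \<longlonglongrightarrow> 0 + 0"
  using add by (intro tendsto_add)
 then have lim: "(\<lambda>n. (NBINT x. eabs (f (x + h n) - f x)) + (NBINT x. eabs (g (x + h n) - g x))) \<longlonglongrightarrow> 0"
  by simp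
 show ?case
 proof (rule tendsto_sandwich[OF _ _ tendsto_const lim])
  show "\<forall>\<^sub>F n in sequentially. (NBINT x. eabs ((f (x + h n) + g (x + h n)) - (f x + g x)))
    \<le> (NBINT x. eabs (f (x + h n) - f x)) + (NBINT x. eabs (g (x + h n) - g x))"
   by (intro always_eventually allI, subst nn_integral_add[symmetric])
    (auto intro!: nn_integral_mono ennreal_leI simp: ennreal_plus[symmetric] simp del: ennreal_plus)
 qed auto
next
 case (lim f s)
 have [measurable]: "f \<in> \<B>" "\<And>i. s i \<in> \<B>"
  using lim by (auto dest: borel_measurable_integrable)
 have conv: "(\<lambda>i. NBINT x. norm (f x - s i x)) \<longlonglongrightarrow> 0"
 proof (rule nn_integral_dominated_convergence_norm[where w="\<lambda>x. 2 * norm (f x)"])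
  show "(NBINT x. ennreal (2 * norm (f x))) < \<infinity>"
   using lim.hyps(4) by (auto simp: integrable_iff_bounded ennreal_mult nn_integral_cmult ennreal_mult_less_top)
 qed (use lim.hyps in \<open>simp_all\<close>)
 show ?case
 proof (rule L1_translation_limit)
  fix e :: real assume "e > 0"
  then have "\<forall>\<^sub>F i in sequentially. (NBINT x. norm (f x - s i x)) < ennreal e"
   by (intro order_tendstoD(2)[OF conv]) simp
  then obtain i where "(NBINT x. norm (f x - s i x)) < ennreal e"
   using eventually_happens[of _ sequentially] by auto
  then show "\<exists>g. g \<in> \<B> \<and>
     (NBINT x. eabs (f x - g x)) \<le> ennreal e \<and>
     (\<lambda>n. NBINT x. eabs (g (x + h n) - g x)) \<longlonglongrightarrow> 0"
   using lim.IH[of i] by (intro exI[of _ "s i"] conjI) (simp_all add: less_imp_le)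
 qed simp
qed

text \<open>Averages and mollifications integrate over all small shifts at once and so need a bound
  uniform in the shift; a sequence of bad shifts tending to 0 would contradict
  \<open>L1_translation_continuous\<close>.\<close>

lemma L1_translation_uniform:
 fixes f :: "'a::euclidean_space \<Rightarrow> real"
 assumes f: "integrable lborel f" and e: "(e::ennreal) > 0"
 obtains d where "d > 0" "\<And>h. norm h < d \<Longrightarrow> (NBINT x. eabs (f (x + h) - f x)) \<le> e"
proof (rule ccontr)
 assume "\<not> thesis"
 then have "\<exists>h. norm h < d \<and> \<not> (NBINT x. eabs (f (x + h) - f x)) \<le> e" if "d > 0" for d
  using that \<open>\<And>d. \<lbrakk>0 < d; \<And>h. norm h < d \<Longrightarrow> (NBINT x. eabs (f (x + h) - f x)) \<le> e\<rbrakk> \<Longrightarrow> thesis\<close> by blast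
 then have "\<forall>n. \<exists>h. norm h < inverse (real (Suc n)) \<and> \<not> (NBINT x. eabs (f (x + h) - f x)) \<le> e"
  by (metis inverse_positive_iff_positive of_nat_0_less_iff zero_less_Suc)
 then obtain h where h: "\<And>n. norm (h n) < inverse (real (Suc n))"
  and ne: "\<And>n. \<not> (NBINT x. eabs (f (x + h n) - f x)) \<le> e" by metis
 have "h \<longlonglongrightarrow> 0"
  by (rule Lim_null_comparison[OF _ LIMSEQ_inverse_real_of_nat]) (use h in \<open>auto intro!: always_eventually less_imp_le\<close>)
 from L1_translation_continuous[OF f this] e
 have "\<forall>\<^sub>F n in sequentially. (NBINT x. eabs (f (x + h n) - f x)) < e"
  by (intro order_tendstoD(2))
 then obtain n where "(NBINT x. eabs (f (x + h n) - f x)) < e"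
  using eventually_happens[of _ sequentially] by auto
 with ne[of n] show False by simp
qed

section \<open>Fractional differences\<close>

lemma fubini_real:
 fixes f :: "'a \<Rightarrow> 'b \<Rightarrow> real"
 assumes M: "sigma_finite_measure M" "sigma_finite_measure N"
  and f: "case_prod f \<in> borel_measurable (M \<Otimes>\<^sub>M N)"
  and fin: "(\<integral>\<^sup>+x. \<integral>\<^sup>+y. eabs (f x y) \<partial>N \<partial>M) < \<infinity>"
 shows "(\<integral>x. \<integral>y. f x y \<partial>N \<partial>M) = (\<integral>y. \<integral>x. f x y \<partial>M \<partial>N)"
  and "integrable M (\<lambda>x. \<integral>y. f x y \<partial>N)" and "integrable N (\<lambda>y. \<integral>x. f x y \<partial>M)"
  and "AE x in M. integrable N (f x)"
proof -
 interpret pair_sigma_finite M N using M by (simp add: pair_sigma_finite_def)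
 have "(\<integral>\<^sup>+z. ennreal (norm (case_prod f z)) \<partial>(M \<Otimes>\<^sub>M N)) = (\<integral>\<^sup>+x. \<integral>\<^sup>+y. eabs (f x y) \<partial>N \<partial>M)"
  using f by (subst M2.nn_integral_fst[symmetric]) auto
 then have i: "integrable (M \<Otimes>\<^sub>M N) (case_prod f)"
  using f fin by (intro integrableI_bounded) auto
 show "(\<integral>x. \<integral>y. f x y \<partial>N \<partial>M) = (\<integral>y. \<integral>x. f x y \<partial>M \<partial>N)" using Fubini_integral[OF i] by simp
 show "integrable M (\<lambda>x. \<integral>y. f x y \<partial>N)" "integrable N (\<lambda>y. \<integral>x. f x y \<partial>M)"
  using integrable_fst'[OF i] integrable_snd[OF i] by auto
 show "AE x in M. integrable N (f x)" using AE_integrable_fst'[OF i] by simp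
qed

lemma powr_tail_nn:
 fixes a b :: real
 assumes "a > 0" "b > 0"
 shows "(NBINT v. ennreal (ind {a..} v * v powr (-1-b))) = ennreal (a powr (-b) / b)"
proof -
 have "(NBINT v. ennreal (v powr (-1-b)) * ind {a..} v) = ennreal (0 - (- (a powr (-b)) / b))"
 proof (rule nn_integral_FTC_atLeast)
  show "((\<lambda>x. - (x powr (-b)) / b) has_real_derivative x powr (-1-b)) (at x)" if "a \<le> x" for x
   using that assms by (auto intro!: derivative_eq_intros simp: minus_diff_commute)
  have "((\<lambda>x::real. x powr (-b)) \<longlongrightarrow> 0) at_top"
   using assms by (intro tendsto_neg_powr filterlim_ident) auto
  from tendsto_divide[OF tendsto_minus[OF this] tendsto_const[of b]]
  show "((\<lambda>x. - (x powr (-b)) / b) \<longlongrightarrow> 0) at_top" using assms by simp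
 qed auto
 also have "(NBINT v. ennreal (v powr (-1-b)) * ind {a..} v)
   = (NBINT v. ennreal (ind {a..} v * v powr (-1-b)))"
  by (intro nn_integral_cong) (auto split: split_indicator)
 finally show ?thesis by simp
qed

lemma powr_head_nn:
 fixes a c :: real
 assumes "a \<ge> 0" "c > -1"
 shows "(NBINT v. ennreal (ind {0<..<a} v * v powr c)) = ennreal (a powr (c+1) / (c+1))"
proof -
 have "((\<lambda>v. v powr c) has_integral (a powr (c+1) / (c+1))) {0..a}"
  using has_integral_powr_from_0[of c a] assms by simp
 then have "((\<lambda>v. v powr c) has_integral (a powr (c+1) / (c+1))) {0<..<a}"
  by (simp add: has_integral_Icc_iff_Ioo)
 then have "((\<lambda>v. ind {0<..<a} v * v powr c) has_integral (a powr (c+1) / (c+1))) UNIV"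
  by (subst (asm) has_integral_restrict_UNIV[symmetric])
    (auto elim!: has_integral_eq[rotated] split: split_indicator)
 then show ?thesis using assms
  by (intro nn_integral_has_integral_lborel) auto
qed

lemma powr_tail_integral:
 fixes a b :: real
 assumes "a > 0" "b > 0"
 shows "integrable lborel (\<lambda>v. ind {a..} v * v powr (-1-b))"
  and "(LBINT v. ind {a..} v * v powr (-1-b)) = a powr (-b) / b"
proof -
 have "integrable lborel (\<lambda>v. ind {a..} v * v powr (-1-b)) \<and>
  (LBINT v. ind {a..} v * v powr (-1-b)) = a powr (-b) / b"
  using powr_tail_nn[OF assms] assms by (subst (asm) nn_integral_eq_integrable) auto
 then show "integrable lborel (\<lambda>v. ind {a..} v * v powr (-1-b))"
  "(LBINT v. ind {a..} v * v powr (-1-b)) = a powr (-b) / b" by auto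
qed

lemma integral_lborel_translate:
 fixes f :: "real \<Rightarrow> real"
 shows "(LBINT x. f (t + x)) = (LBINT x. f x)"
  and "integrable lborel (\<lambda>x. f (t + x)) \<longleftrightarrow> integrable lborel f"
 using lborel_integral_real_affine[of 1 f t] lborel_integrable_real_affine_iff[of 1 f t] by auto

lemma integral_lborel_reflect:
 fixes f :: "real \<Rightarrow> real"
 shows "(LBINT x. f (t - x)) = (LBINT x. f x)"
  and "integrable lborel (\<lambda>x. f (t - x)) \<longleftrightarrow> integrable lborel f"
 using lborel_integral_real_affine[of "-1" f t] lborel_integrable_real_affine_iff[of "-1" f t] by auto

lemma nn_integral_lborel_reflect:
 fixes f :: "real \<Rightarrow> ennreal"
 assumes "f \<in> \<B>"
 shows "(NBINT x. f (t - x)) = (NBINT x. f x)"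
 using nn_integral_real_affine[OF assms, of "-1" t] by simp

text \<open>Marchaud derivatives over the whole half line. For f vanishing up to 0 the range v \<ge>
  t contributes f t / (b t powr b), so the boundary term and the integral in
  \<open>frac_deriv_left\<close> merge into this one integral, with factor b / Gamma (1 - b).
  \<open>right_diff\<close> does the same for functions vanishing after T.\<close>

definition left_diff :: "real \<Rightarrow> (real \<Rightarrow> real) \<Rightarrow> real \<Rightarrow> real" where
 "left_diff b f t = (LBINT v. ind {0<..} v * (f t - f (t - v)) * v powr (-1-b))"

definition right_diff :: "real \<Rightarrow> (real \<Rightarrow> real) \<Rightarrow> real \<Rightarrow> real" where
 "right_diff b h t = (LBINT v. ind {0<..} v * (h t - h (t + v)) * v powr (-1-b))"

definition right_diff_abs :: "real \<Rightarrow> (real \<Rightarrow> real) \<Rightarrow> real \<Rightarrow> ennreal" where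
 "right_diff_abs b h t = (NBINT v. ennreal (ind {0<..} v * \<bar>h t - h (t + v)\<bar> * v powr (-1-b)))"

text \<open>The Lipschitz bound leaves v powr (-b) near 0, the bound M leaves v powr (-1-b) beyond
  1; 0 < b < 1 makes both integrable.\<close>

lemma right_diff_kernel_finite:
 fixes b L M :: real
 assumes "0 < b" "b < 1" "L \<ge> 0" "M \<ge> 0"
 shows "(NBINT v. ennreal (ind {0<..} v * min (L * v) M * v powr (-1-b))) < \<infinity>"
proof -
 have "(NBINT v. ennreal (ind {0<..} v * min (L * v) M * v powr (-1-b)))
   \<le> (NBINT v. ennreal L * ennreal (ind {0<..<1} v * v powr (-b)) +
      ennreal M * ennreal (ind {1..} v * v powr (-1-b)))"
 proof (rule nn_integral_mono)
  fix v :: real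
  have 1: "min (L * v) M * v powr (-1-b) \<le> L * v powr (-b)" if "v > 0"
  proof -
   have "min (L * v) M * v powr (-1-b) \<le> L * v * v powr (-1-b)" by (intro mult_right_mono) auto
   also have "\<dots> = L * v powr (-b)" using that powr_add[of v 1 "-1-b"] by simp
   finally show ?thesis .
  qed
  have 2: "min (L * v) M * v powr (-1-b) \<le> M * v powr (-1-b)" by (intro mult_right_mono) auto
  show "ennreal (ind {0<..} v * min (L * v) M * v powr (-1-b)) \<le> ennreal L * ennreal (ind {0<..<1} v * v powr (-b)) +
      ennreal M * ennreal (ind {1..} v * v powr (-1-b))"
   using 1 2 assms by (auto split: split_indicator simp: ennreal_mult[symmetric] ennreal_leI)
 qed
 also have "\<dots> = ennreal L * (NBINT v. ennreal (ind {0<..<1} v * v powr (-b))) +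
      ennreal M * (NBINT v. ennreal (ind {1..} v * v powr (-1-b)))"
  by (subst nn_integral_add) (simp_all add: nn_integral_cmult)
 also have "\<dots> < \<infinity>"
  using powr_head_nn[of 1 "-b"] powr_tail_nn[of 1 b] assms
  by (simp add: ennreal_mult_less_top ennreal_add_less_top ennreal_mult_eq_top_iff less_top[symmetric])
 finally show ?thesis .
qed

lemma nn_integral_bounded_powr_finite:
 fixes c Q T :: real and u :: "real \<Rightarrow> real"
 assumes "c > -1" "Q \<ge> 0" "T \<ge> 0" and u: "\<And>v. 0 < v \<Longrightarrow> v < T \<Longrightarrow> \<bar>u v\<bar> \<le> Q" "\<And>v. v \<ge> T \<Longrightarrow> u v = 0"
 shows "(NBINT v. ennreal (ind {0<..} v * \<bar>u v\<bar> * v powr c)) \<le> ennreal (Q * (T powr (c+1) / (c+1)))"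
proof -
 have "(NBINT v. ennreal (ind {0<..} v * \<bar>u v\<bar> * v powr c))
   \<le> (NBINT v. ennreal Q * ennreal (ind {0<..<T} v * v powr c))"
 proof (rule nn_integral_mono)
  fix v :: real
  have "\<bar>u v\<bar> * v powr c \<le> Q * v powr c" if "0 < v" "v < T" using u(1)[OF that] by (intro mult_right_mono) auto
  then show "ennreal (ind {0<..} v * \<bar>u v\<bar> * v powr c) \<le> ennreal Q * ennreal (ind {0<..<T} v * v powr c)"
   using u(2)[of v] assms by (auto split: split_indicator simp: ennreal_mult[symmetric] ennreal_leI not_less)
 qed
 also have "\<dots> = ennreal Q * (NBINT v. ennreal (ind {0<..<T} v * v powr c))"
  by (rule nn_integral_cmult) simp
 also have "\<dots> = ennreal (Q * (T powr (c+1) / (c+1)))"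
  unfolding powr_head_nn[OF assms(3,1)] using assms by (subst ennreal_mult[symmetric]) auto
 finally show ?thesis .
qed

section \<open>Fractional calculus for smooth functions that vanish after T\<close>

locale C1_vanishing =
 fixes T Q :: real and p q :: "real \<Rightarrow> real"
 assumes T: "T > 0" and deriv: "\<And>x. (p has_real_derivative q x) (at x)"
  and cont: "continuous_on UNIV q" and bound: "\<And>x. \<bar>q x\<bar> \<le> Q"
  and p0: "\<And>x. x \<ge> T \<Longrightarrow> p x = 0" and q0: "\<And>x. x \<ge> T \<Longrightarrow> q x = 0"
begin

lemma Q0: "Q \<ge> 0" using bound[of 0] by linarith

lemma q_borel [measurable]: "q \<in> \<B>"
 using cont by (rule borel_measurable_continuous_onI)

lemma p_borel [measurable]: "p \<in> \<B>"
 by (rule borel_measurable_continuous_onI, rule continuous_at_imp_continuous_on) (use deriv DERIV_isCont in blast)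

lemma increment: "v \<ge> 0 \<Longrightarrow> (LBINT r. q (t + r) * ind {0..v} r) = p (t + v) - p t"
proof -
 assume "v \<ge> 0"
 then have "(LBINT r. q (t + r) * ind {0..v} r) = p (t + v) - p (t + 0)"
 proof (rule integral_FTC_Icc_real)
  fix r
  have "((\<lambda>r. p (t + r)) has_real_derivative q (t + r) * (0 + 1)) (at r)"
   by (rule DERIV_chain2[OF deriv]) (auto intro!: derivative_eq_intros)
  then show "((\<lambda>r. p (t + r)) has_real_derivative q (t + r)) (at r)" by simp
  have "continuous_on UNIV (\<lambda>r. q (t + r))" by (rule continuous_on_compose2[OF cont]) (auto intro!: continuous_intros)
  then show "isCont (\<lambda>r. q (t + r)) r" by (simp add: continuous_on_eq_continuous_at)
 qed
 then show ?thesis by simp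
qed

lemma lipschitz: "\<bar>p x - p y\<bar> \<le> Q * \<bar>x - y\<bar>"
 using field_differentiable_bound[of UNIV p q Q x y] deriv bound
 by (auto simp: has_field_derivative_at_within)

lemma p_bound: "x \<ge> 0 \<Longrightarrow> \<bar>p x\<bar> \<le> Q * T"
proof -
 assume x: "x \<ge> 0"
 show ?thesis
 proof (cases "x \<ge> T")
  case False
  have "\<bar>p x\<bar> \<le> Q * \<bar>x - T\<bar>" using lipschitz[of x T] p0[of T] by simp
  also have "\<dots> \<le> Q * T" using False x Q0 by (intro mult_left_mono) auto
  finally show ?thesis .
 qed (use p0 Q0 T in simp)
qed

text \<open>Insert p (t + v) - p t as the integral of q over r < v, exchange the integrals, and
  integrate v powr (-1-b) over v \<ge> r. A derivative of order b is thus a fractional integral of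
  order 1 - b of the ordinary derivative.\<close>

lemma right_diff_eq:
 assumes b: "0 < b" "b < 1" and t: "t \<ge> 0"
 shows "right_diff b p t = - (1 / b) * (LBINT v. ind {0<..} v * q (t + v) * v powr (-b))"
proof -
 define F where "F v r = ind {0<..} v * v powr (-1-b) * (ind {0<..} r * (q (t + r) * ind {r..} v))" for v r :: real
 have Fm: "(\<lambda>(r, v). F v r) \<in> borel_measurable (lborel \<Otimes>\<^sub>M lborel)"
 proof -
  have [measurable]: "Measurable.pred (borel \<Otimes>\<^sub>M borel) (\<lambda>x :: real \<times> real. snd x \<in> {fst x..})"
   unfolding atLeast_iff by measurable
  show ?thesis unfolding F_def by measurable
 qed
 have inner: "(LBINT v. F v r) = ind {0<..} r * q (t + r) * r powr (-b) / b" for r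
 proof (cases "r > 0")
  case True
  have "(LBINT v. F v r) = (LBINT v. q (t + r) * (ind {r..} v * v powr (-1-b)))"
   using True by (intro Bochner_Integration.integral_cong) (auto simp: F_def split: split_indicator)
  also have "\<dots> = q (t + r) * (r powr (-b) / b)" using powr_tail_integral[OF True b(1)] by simp
  finally show ?thesis using True by simp
 qed (simp add: F_def)
 have inner_nn: "(NBINT v. eabs (F v r)) = ennreal (1/b) * ennreal (ind {0<..} r * \<bar>q (t + r)\<bar> * r powr (-b))" for r
 proof (cases "r > 0")
  case True
  have "(NBINT v. eabs (F v r)) = (NBINT v. eabs (q (t + r)) * ennreal (ind {r..} v * v powr (-1-b)))"
   using True by (intro nn_integral_cong) (auto simp: F_def abs_mult ennreal_mult[symmetric] split: split_indicator)
  also have "\<dots> = eabs (q (t + r)) * ennreal (r powr (-b) / b)" using powr_tail_nn[OF True b(1)] by (simp add: nn_integral_cmult)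
  finally show ?thesis using True b by (simp add: ennreal_mult[symmetric])
 qed (simp add: F_def)
 have fin: "(NBINT r. NBINT v. eabs (F v r)) < \<infinity>"
 proof -
  have "(NBINT r. ennreal (ind {0<..} r * \<bar>q (t + r)\<bar> * r powr (-b))) \<le> ennreal (Q * (T powr (-b+1) / (-b+1)))"
   by (rule nn_integral_bounded_powr_finite) (use b t T Q0 bound q0 in auto)
  also have "\<dots> < \<infinity>" by simp
  finally have "(NBINT r. ennreal (ind {0<..} r * \<bar>q (t + r)\<bar> * r powr (-b))) < \<infinity>" .
  then show ?thesis unfolding inner_nn by (simp add: nn_integral_cmult ennreal_mult_less_top)
 qed
 have "right_diff b p t = (LBINT v. - (LBINT r. F v r))"
  unfolding right_diff_def
 proof (rule Bochner_Integration.integral_cong[OF refl])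
  fix v :: real
  show "ind {0<..} v * (p t - p (t + v)) * v powr (-1-b) = - (LBINT r. F v r)"
  proof (cases "v > 0")
   case True
   have "(LBINT r. F v r) = (LBINT r. v powr (-1-b) * (q (t + r) * ind {0..v} r))"
   proof (rule integral_cong_AE)
    show "F v \<in> borel_measurable lborel"
    proof -
     have "F v = (\<lambda>r. ind {0<..} v * v powr (-1-b) * (ind {0<..} r * (q (t + r) * ind {..v} r)))"
      by (auto simp: F_def fun_eq_iff split: split_indicator)
     then show ?thesis by simp
    qed
    show "AE r in lborel. F v r = v powr (-1-b) * (q (t + r) * ind {0..v} r)"
     using AE_lborel_singleton[of 0]
     by eventually_elim (use True in \<open>auto simp: F_def split: split_indicator\<close>)
   qed simp
   also have "\<dots> = v powr (-1-b) * (p (t + v) - p t)" using increment[of v t] True by simp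
   finally show ?thesis using True by (simp add: algebra_simps)
  qed (simp add: F_def)
 qed
 also have "\<dots> = - (LBINT v. LBINT r. F v r)" by simp
 also have "(LBINT v. LBINT r. F v r) = (LBINT r. LBINT v. F v r)"
  by (rule fubini_real(1)[symmetric, OF _ _ Fm fin]) unfold_locales
 also have "\<dots> = (LBINT v. (1 / b) * (ind {0<..} v * q (t + v) * v powr (-b)))"
  unfolding inner by (intro Bochner_Integration.integral_cong) auto
 finally show ?thesis by simp
qed

text \<open>Gamma b times the right-sided fractional integral of order b.\<close>

definition potential :: "real \<Rightarrow> real \<Rightarrow> real" where
 "potential b t = (LBINT w. ind {0<..} w * p (t + w) * w powr (b - 1))"

lemma potential_integrable:
 assumes "b > 0" "t \<ge> 0"
 shows "integrable lborel (\<lambda>w. ind {0<..} w * p (t + w) * w powr (b - 1))"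
proof (rule integrableI_bounded)
 have "(NBINT w. ennreal (ind {0<..} w * \<bar>p (t + w)\<bar> * w powr (b-1))) \<le> ennreal (Q * T * (T powr (b-1+1) / (b-1+1)))"
  by (rule nn_integral_bounded_powr_finite) (use assms T Q0 p_bound p0 in auto)
 also have "\<dots> < \<infinity>" by simp
 finally show "(NBINT w. ennreal (norm (ind {0<..} w * p (t + w) * w powr (b - 1)))) < \<infinity>"
  by (simp add: abs_mult)
qed simp

lemma potential_zero: "t \<ge> T \<Longrightarrow> potential b t = 0"
proof -
 assume "t \<ge> T"
 then have "(\<lambda>w. ind {0<..} w * p (t + w) * w powr (b - 1)) = (\<lambda>w. 0)"
  using p0 by (auto simp: fun_eq_iff split: split_indicator)
 then show ?thesis unfolding potential_def by simp
qed

lemma potential_bound: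
 assumes "b > 0" "t \<ge> 0"
 shows "\<bar>potential b t\<bar> \<le> Q * T * (T powr b / b)"
proof -
 have "eabs (potential b t) \<le> (NBINT w. ennreal (norm (ind {0<..} w * p (t + w) * w powr (b - 1))))"
  unfolding potential_def using integral_norm_bound_ennreal[OF potential_integrable[OF assms]] by simp
 also have "\<dots> = (NBINT w. ennreal (ind {0<..} w * \<bar>p (t + w)\<bar> * w powr (b-1)))"
  by (simp add: abs_mult)
 also have "\<dots> \<le> ennreal (Q * T * (T powr (b-1+1) / (b-1+1)))"
  by (rule nn_integral_bounded_powr_finite) (use assms T Q0 p_bound p0 in auto)
 finally show ?thesis using assms Q0 T by (subst (asm) ennreal_le_iff) auto
qed

text \<open>Together with \<open>potential_zero\<close> and \<open>potential_bound\<close> this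
  makes the potential an admissible partner G in \<open>left_diff_duality\<close>.\<close>

lemma potential_lipschitz:
 assumes "b > 0" "t \<ge> 0" "v \<ge> 0"
 shows "\<bar>potential b t - potential b (t + v)\<bar> \<le> (Q * (T powr b / b)) * v"
proof -
 let ?u = "\<lambda>w. p (t + w) - p (t + v + w)"
 have eq: "(\<lambda>w. ind {0<..} w * ?u w * w powr (b - 1)) = (\<lambda>w. ind {0<..} w * p (t + w) * w powr (b - 1) - ind {0<..} w * p (t + v + w) * w powr (b - 1))"
  by (auto simp: fun_eq_iff algebra_simps)
 have i: "integrable lborel (\<lambda>w. ind {0<..} w * ?u w * w powr (b - 1))"
  unfolding eq using assms by (intro Bochner_Integration.integrable_diff potential_integrable) auto
 have "potential b t - potential b (t + v) = (LBINT w. ind {0<..} w * ?u w * w powr (b - 1))"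
  unfolding eq potential_def using assms
  by (intro Bochner_Integration.integral_diff[symmetric] potential_integrable) auto
 then have "eabs (potential b t - potential b (t + v)) \<le> (NBINT w. ennreal (norm (ind {0<..} w * ?u w * w powr (b - 1))))"
  using integral_norm_bound_ennreal[OF i] by simp
 also have "\<dots> = (NBINT w. ennreal (ind {0<..} w * \<bar>?u w\<bar> * w powr (b-1)))"
  by (simp add: abs_mult)
 also have "\<dots> \<le> ennreal (Q * v * (T powr (b-1+1) / (b-1+1)))"
 proof (rule nn_integral_bounded_powr_finite)
  show "\<bar>p (t + w) - p (t + v + w)\<bar> \<le> Q * v" for w
   using lipschitz[of "t + w" "t + v + w"] assms by simp
 qed (use assms T Q0 p_bound p0 in auto)
 finally show ?thesis using assms Q0 T by (subst (asm) ennreal_le_iff) (auto simp: algebra_simps)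
qed

lemma potential_borel [measurable]: "potential b \<in> \<B>"
 unfolding potential_def by measurable

text \<open>Both operations are superpositions of translations and therefore commute. Absolute
  convergence comes from bounding the increment of p by min (Q v) (2 Q T) and from its vanishing for
  w \<ge> T.\<close>

lemma right_diff_potential:
 assumes b: "0 < b" "b < 1" and t: "t \<ge> 0"
 shows "right_diff b (potential b) t = (LBINT w. ind {0<..} w * right_diff b p (t + w) * w powr (b - 1))"
proof -
 define F where "F w v = (ind {0<..} w * w powr (b - 1)) * (ind {0<..} v * (p (t + w) - p (t + v + w)) * v powr (-1-b))" for w v :: real
 have Fm: "case_prod F \<in> borel_measurable (lborel \<Otimes>\<^sub>M lborel)" unfolding F_def by measurable
 have fin: "(NBINT w. NBINT v. eabs (F w v)) < \<infinity>"
 proof -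
  let ?K = "NBINT v. ennreal (ind {0<..} v * min (Q * v) (2 * (Q * T)) * v powr (-1-b))"
  have "(NBINT w. NBINT v. eabs (F w v))
    \<le> (NBINT w. NBINT v. ennreal (ind {0<..<T} w * w powr (b-1)) * ennreal (ind {0<..} v * min (Q * v) (2 * (Q * T)) * v powr (-1-b)))"
  proof (intro nn_integral_mono)
   fix w v :: real
   have le: "\<bar>p (t + w) - p (t + v + w)\<bar> \<le> min (Q * v) (2 * (Q * T))" if "v > 0" "w > 0"
    using lipschitz[of "t + w" "t + v + w"] p_bound[of "t + w"] p_bound[of "t + v + w"] that t by simp
   have z: "p (t + w) - p (t + v + w) = 0" if "w \<ge> T" "v > 0" using p0 that t by simp
   have "\<bar>F w v\<bar> \<le> (ind {0<..<T} w * w powr (b-1)) * (ind {0<..} v * min (Q * v) (2 * (Q * T)) * v powr (-1-b))"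
    using le z unfolding F_def
    by (cases "w < T") (auto simp: abs_mult split: split_indicator intro!: mult_left_mono mult_right_mono)
   then show "eabs (F w v) \<le> ennreal (ind {0<..<T} w * w powr (b-1)) * ennreal (ind {0<..} v * min (Q * v) (2 * (Q * T)) * v powr (-1-b))"
    using Q0 T by (subst ennreal_mult[symmetric]) (auto intro!: ennreal_leI split: split_indicator)
  qed
  also have "\<dots> = (NBINT w. ennreal (ind {0<..<T} w * w powr (b-1))) * ?K"
   by (simp add: nn_integral_cmult nn_integral_multc)
  also have "\<dots> < \<infinity>" using right_diff_kernel_finite[of b Q "2 * (Q * T)"] powr_head_nn[of T "b-1"] b Q0 T
   by (simp add: ennreal_mult_less_top)
  finally show ?thesis .
 qed
 have "right_diff b (potential b) t = (LBINT v. LBINT w. F w v)"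
  unfolding right_diff_def
 proof (rule Bochner_Integration.integral_cong[OF refl])
  fix v :: real
  show "ind {0<..} v * (potential b t - potential b (t + v)) * v powr (-1-b) = (LBINT w. F w v)"
  proof (cases "v > 0")
   case True
   have "(LBINT w. F w v) = (LBINT w. v powr (-1-b) * (ind {0<..} w * p (t + w) * w powr (b - 1) - ind {0<..} w * p (t + v + w) * w powr (b - 1)))"
    using True by (intro Bochner_Integration.integral_cong) (auto simp: F_def algebra_simps)
   also have "\<dots> = v powr (-1-b) * (potential b t - potential b (t + v))"
    unfolding potential_def using b t True
    by (subst integral_mult_right_zero, subst Bochner_Integration.integral_diff) (auto intro!: potential_integrable)
   finally show ?thesis using True by simp
  qed (simp add: F_def)
 qed
 also have "\<dots> = (LBINT w. LBINT v. F w v)"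
  by (rule fubini_real(1)[symmetric, OF _ _ Fm fin]) unfold_locales
 also have "\<dots> = (LBINT w. ind {0<..} w * right_diff b p (t + w) * w powr (b - 1))"
 proof (rule Bochner_Integration.integral_cong[OF refl])
  fix w :: real
  have "(LBINT v. F w v) = ind {0<..} w * w powr (b - 1) * right_diff b p (t + w)"
   unfolding F_def right_diff_def integral_mult_right_zero by (simp add: add_ac)
  then show "(LBINT v. F w v) = ind {0<..} w * right_diff b p (t + w) * w powr (b - 1)"
   by (simp add: mult_ac)
 qed
 finally show ?thesis .
qed

end

text \<open>Under w = y t the powers of y add up to 1 + (b - 1) - b = 0. The kernels of orders b and
  1 - b thus convolve to a constant, the kernel of a full integration.\<close>

lemma Beta_convolution_nn:
 fixes b y :: real
 assumes b: "0 < b" "b < 1" and y: "y > 0"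
 shows "(NBINT w. ennreal (ind {0<..<y} w * w powr (b - 1) * (y - w) powr (-b))) = ennreal (Beta b (1 - b))"
proof -
 have "((\<lambda>t. t powr (b - 1) * (1 - t) powr (1 - b - 1)) has_integral Beta b (1-b)) {0<..<1}"
  using has_integral_Beta_real[of b "1-b"] b by (simp add: has_integral_Icc_iff_Ioo)
 then have "((\<lambda>t. ind {0<..<1} t * t powr (b - 1) * (1 - t) powr (-b)) has_integral Beta b (1-b)) UNIV"
  by (subst (asm) has_integral_restrict_UNIV[symmetric])
    (auto elim!: has_integral_eq[rotated] split: split_indicator)
 then have B: "(NBINT t. ennreal (ind {0<..<1} t * t powr (b - 1) * (1 - t) powr (-b))) = ennreal (Beta b (1-b))"
  by (intro nn_integral_has_integral_lborel) auto
 have "(NBINT w. ennreal (ind {0<..<y} w * w powr (b - 1) * (y - w) powr (-b)))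
  = ennreal y * (NBINT t. ennreal (ind {0<..<y} (y * t) * (y * t) powr (b - 1) * (y - y * t) powr (-b)))"
  using y by (subst nn_integral_real_affine[where c=y and t=0]) auto
 also have "\<dots> = (NBINT t. ennreal (y * (ind {0<..<y} (y * t) * (y * t) powr (b - 1) * (y - y * t) powr (-b))))"
  using y by (subst nn_integral_cmult[symmetric]) (auto simp: ennreal_mult)
 also have "\<dots> = (NBINT t. ennreal (ind {0<..<1} t * t powr (b - 1) * (1 - t) powr (-b)))"
 proof (intro nn_integral_cong arg_cong[of _ _ ennreal])
  fix t :: real
  show "y * (ind {0<..<y} (y * t) * (y * t) powr (b - 1) * (y - y * t) powr (-b)) = ind {0<..<1} t * t powr (b - 1) * (1 - t) powr (-b)"
  proof (cases "0 < t \<and> t < 1")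
   case True
   have "y - y * t = y * (1 - t)" by (simp add: algebra_simps)
   then have "y * ((y * t) powr (b - 1) * (y - y * t) powr (-b)) = (y * y powr (b-1) * y powr (-b)) * (t powr (b - 1) * (1 - t) powr (-b))"
    using y True by (simp add: powr_mult)
   also have "y * y powr (b-1) * y powr (-b) = y powr (1 + (b-1) + (-b))" using y by (simp only: powr_add) simp
   also have "\<dots> = 1" using y by simp
   finally show ?thesis using True y by simp
  next
   case False
   then have "y * t \<notin> {0<..<y}" using y by (auto simp: zero_less_mult_iff)
   then show ?thesis using False by auto
  qed
 qed
 finally show ?thesis using B by simp
qed

lemma Beta_convolution:
 fixes b y :: real
 assumes b: "0 < b" "b < 1" and y: "y > 0"
 shows "(LBINT w. ind {0<..<y} w * w powr (b - 1) * (y - w) powr (-b)) = Beta b (1 - b)"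
proof -
 have "Beta b (1 - b) \<ge> 0"
  unfolding Beta_def using b by (simp add: Gamma_real_pos less_imp_le)
 then show ?thesis
  using Beta_convolution_nn[OF assms] by (subst (asm) nn_integral_eq_integrable) auto
qed

context C1_vanishing begin

lemma integral_q:
 assumes "t \<ge> 0"
 shows "(LBINT y. ind {0<..} y * q (t + y)) = - p t"
proof -
 have "(LBINT y. ind {0<..} y * q (t + y)) = (LBINT y. q (t + y) * ind {0..T} y)"
 proof (rule integral_cong_AE)
  show "AE y in lborel. ind {0<..} y * q (t + y) = q (t + y) * ind {0..T} y"
   using AE_lborel_singleton[of 0]
   by eventually_elim (use assms q0 in \<open>auto split: split_indicator\<close>)
 qed simp_all
 also have "\<dots> = - p t" using increment[of T t] p0[of "t + T"] T assms by simp
 finally show ?thesis .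
qed

text \<open>With y = w + v as the new variable, the w-integral is the Beta constant for every y > 0,
  and only the integral of q remains.\<close>

lemma double_integral:
 assumes b: "0 < b" "b < 1" and t: "t \<ge> 0"
 shows "(LBINT w. ind {0<..} w * w powr (b - 1) * (LBINT v. ind {0<..} v * q (t + w + v) * v powr (-b)))
   = - Beta b (1 - b) * p t"
proof -
 define F where "F w y = ind {0<..} w * w powr (b - 1) * (ind {0<..} (y - w) * q (t + y) * (y - w) powr (-b))" for w y :: real
 have Fm: "(\<lambda>(y, w). F w y) \<in> borel_measurable (lborel \<Otimes>\<^sub>M lborel)" unfolding F_def by measurable
 have Feq: "F w y = (if y > 0 then q (t + y) * (ind {0<..<y} w * w powr (b - 1) * (y - w) powr (-b)) else 0)" for w y
  by (auto simp: F_def split: split_indicator)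
 have inner: "(LBINT w. F w y) = Beta b (1 - b) * (ind {0<..} y * q (t + y))" for y
  using Beta_convolution[OF b, of y] unfolding Feq by (cases "y > 0") auto
 have inner_nn: "(NBINT w. eabs (F w y)) \<le> ennreal (ind {0<..<T} y * Q) * ennreal (Beta b (1 - b))" for y
 proof (cases "y > 0")
  case True
  have "(NBINT w. eabs (F w y)) = (NBINT w. eabs (q (t + y)) * ennreal (ind {0<..<y} w * w powr (b - 1) * (y - w) powr (-b)))"
   unfolding Feq using True by (intro nn_integral_cong) (auto simp: abs_mult ennreal_mult[symmetric] split: split_indicator)
  also have "\<dots> = eabs (q (t + y)) * ennreal (Beta b (1 - b))"
   using Beta_convolution_nn[OF b True] by (simp add: nn_integral_cmult)
  also have "\<dots> \<le> ennreal (ind {0<..<T} y * Q) * ennreal (Beta b (1 - b))"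
   using bound[of "t + y"] q0[of "t + y"] True t by (intro mult_right_mono ennreal_leI) (auto split: split_indicator)
  finally show ?thesis .
 qed (simp add: Feq)
 have fin: "(NBINT y. NBINT w. eabs (F w y)) < \<infinity>"
 proof -
  have "(NBINT y. NBINT w. eabs (F w y)) \<le> (NBINT y. ennreal (ind {0<..<T} y * Q) * ennreal (Beta b (1 - b)))"
   by (intro nn_integral_mono inner_nn)
  also have "\<dots> = (NBINT y. ennreal Q * ind {0<..<T} y) * ennreal (Beta b (1 - b))"
   by (subst nn_integral_multc) (auto intro!: arg_cong2[where f="(*)"] nn_integral_cong split: split_indicator)
  also have "\<dots> < \<infinity>" using T by (simp add: nn_integral_cmult ennreal_mult_less_top)
  finally show ?thesis .
 qed
 have "(LBINT w. ind {0<..} w * w powr (b - 1) * (LBINT v. ind {0<..} v * q (t + w + v) * v powr (-b)))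
   = (LBINT w. LBINT y. F w y)"
 proof (rule Bochner_Integration.integral_cong[OF refl])
  fix w :: real
  have "(LBINT v. ind {0<..} v * q (t + w + v) * v powr (-b))
    = (LBINT y. ind {0<..} (y - w) * q (t + y) * (y - w) powr (-b))"
   using integral_lborel_translate(1)[of "\<lambda>y. ind {0<..} (y - w) * q (t + y) * (y - w) powr (-b)" w]
   by (simp add: add.assoc)
  then show "ind {0<..} w * w powr (b - 1) * (LBINT v. ind {0<..} v * q (t + w + v) * v powr (-b)) = (LBINT y. F w y)"
   unfolding F_def by simp
 qed
 also have "\<dots> = (LBINT y. LBINT w. F w y)"
  by (rule fubini_real(1)[symmetric, OF _ _ Fm fin]) unfold_locales
 also have "\<dots> = - Beta b (1 - b) * p t" unfolding inner using integral_q[OF t] by simp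
 finally show ?thesis .
qed

text \<open>The fractional derivative inverts the fractional integral of the same order:
  \<open>right_diff_eq\<close> turns the derivative of p into an integral of q of order 1 - b, and
  the orders b and 1 - b add up to one.\<close>

lemma right_diff_potential_eq:
 assumes b: "0 < b" "b < 1" and t: "t \<ge> 0"
 shows "right_diff b (potential b) t = Beta b (1 - b) / b * p t"
proof -
 have "right_diff b (potential b) t = (LBINT w. - (1/b) * (ind {0<..} w * w powr (b - 1) * (LBINT v. ind {0<..} v * q (t + w + v) * v powr (-b))))"
  unfolding right_diff_potential[OF b t]
 proof (rule Bochner_Integration.integral_cong[OF refl])
  fix w :: real
  show "ind {0<..} w * right_diff b p (t + w) * w powr (b - 1) =
    - (1/b) * (ind {0<..} w * w powr (b - 1) * (LBINT v. ind {0<..} v * q (t + w + v) * v powr (-b)))"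
   using right_diff_eq[OF b, of "t + w"] t by (cases "w > 0") auto
 qed
 also have "\<dots> = - (1/b) * (- Beta b (1 - b) * p t)" unfolding integral_mult_right_zero double_integral[OF b t] ..
 finally show ?thesis by simp
qed

end

text \<open>Fractional integration by parts. For each fixed v the difference moves from f to G by a
  translation of the t-integral; the hypotheses are the absolute bounds under which the v-integral
  may be exchanged with it on either side.\<close>

lemma left_diff_duality:
 fixes f G :: "real \<Rightarrow> real"
 assumes b: "0 < b" "b < 1" and fm [measurable]: "f \<in> \<B>" and Gm [measurable]: "G \<in> \<B>"
  and f0: "\<And>t. t \<notin> {0<..<T} \<Longrightarrow> f t = 0" and fi: "integrable lborel f"
  and fin: "(NBINT t. NBINT v. ennreal (ind {0<..<T} t * (ind {0<..} v * \<bar>f t - f (t - v)\<bar> * v powr (-1-b)))) < \<infinity>"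
  and G0: "\<And>t. t \<ge> T \<Longrightarrow> G t = 0" and GM: "\<And>t. t \<ge> 0 \<Longrightarrow> \<bar>G t\<bar> \<le> M"
  and GL: "\<And>t v. t \<ge> 0 \<Longrightarrow> v \<ge> 0 \<Longrightarrow> \<bar>G t - G (t + v)\<bar> \<le> L * v"
 shows "(LBINT t. ind {0<..<T} t * left_diff b f t * G t) = (LBINT t. f t * right_diff b G t)"
proof -
 have M0: "M \<ge> 0" using GM[of 0] by linarith
 have L0: "L \<ge> 0" using GL[of 0 1] by simp
 define a where "a t v = ind {0<..<T} t * (ind {0<..} v * (f t - f (t - v)) * v powr (-1-b)) * G t" for t v :: real
 define c where "c t v = f t * (ind {0<..} v * (G t - G (t + v)) * v powr (-1-b))" for t v :: real
 have am: "case_prod a \<in> borel_measurable (lborel \<Otimes>\<^sub>M lborel)" unfolding a_def by measurable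
 have cm: "case_prod c \<in> borel_measurable (lborel \<Otimes>\<^sub>M lborel)" unfolding c_def by measurable
 have afin: "(NBINT t. NBINT v. eabs (a t v)) < \<infinity>"
 proof -
  have "(NBINT t. NBINT v. eabs (a t v)) \<le> (NBINT t. NBINT v. ennreal M * ennreal (ind {0<..<T} t * (ind {0<..} v * \<bar>f t - f (t - v)\<bar> * v powr (-1-b))))"
  proof (intro nn_integral_mono)
   fix t v :: real
   have "\<bar>a t v\<bar> = (ind {0<..<T} t * (ind {0<..} v * \<bar>f t - f (t - v)\<bar> * v powr (-1-b))) * \<bar>G t\<bar>"
    unfolding a_def by (simp add: abs_mult)
   also have "\<dots> \<le> (ind {0<..<T} t * (ind {0<..} v * \<bar>f t - f (t - v)\<bar> * v powr (-1-b))) * M"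
   proof (cases "t \<in> {0<..<T}")
    case True
    then show ?thesis using GM[of t] by (intro mult_left_mono) auto
   qed simp
   finally show "eabs (a t v) \<le> ennreal M * ennreal (ind {0<..<T} t * (ind {0<..} v * \<bar>f t - f (t - v)\<bar> * v powr (-1-b)))"
    using M0 by (simp add: ennreal_mult[symmetric] mult.commute ennreal_leI)
  qed
  also have "\<dots> = ennreal M * (NBINT t. NBINT v. ennreal (ind {0<..<T} t * (ind {0<..} v * \<bar>f t - f (t - v)\<bar> * v powr (-1-b))))"
   by (simp add: nn_integral_cmult)
  also have "\<dots> < \<infinity>" using fin by (simp add: ennreal_mult_less_top)
  finally show ?thesis .
 qed
 have cfin: "(NBINT t. NBINT v. eabs (c t v)) < \<infinity>"
 proof -
  let ?k = "\<lambda>v. ennreal (ind {0<..} v * min (L * v) (2 * M) * v powr (-1-b))"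
  have "(NBINT t. NBINT v. eabs (c t v)) \<le> (NBINT t. NBINT v. eabs (f t) * ?k v)"
  proof (intro nn_integral_mono)
   fix t v :: real
   have "\<bar>c t v\<bar> \<le> \<bar>f t\<bar> * (ind {0<..} v * min (L * v) (2 * M) * v powr (-1-b))"
   proof (cases "t \<in> {0<..<T} \<and> v > 0")
    case True
    then have "\<bar>G t - G (t + v)\<bar> \<le> min (L * v) (2 * M)"
     using GL[of t v] GM[of t] GM[of "t + v"] by auto
    then show ?thesis using True unfolding c_def by (simp add: abs_mult mult_left_mono mult_right_mono)
   qed (use f0 in \<open>auto simp: c_def\<close>)
   then show "eabs (c t v) \<le> eabs (f t) * ?k v"
    using L0 M0 by (subst ennreal_mult[symmetric]) (auto intro!: ennreal_leI split: split_indicator)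
  qed
  also have "\<dots> = (NBINT t. eabs (f t)) * (NBINT v. ?k v)"
   by (simp add: nn_integral_cmult nn_integral_multc)
  also have "\<dots> < \<infinity>" using right_diff_kernel_finite[OF b L0, of "2 * M"] M0 fi
   by (simp add: ennreal_mult_less_top integrable_iff_bounded)
  finally show ?thesis .
 qed
 have swap: "(LBINT t. a t v) = (LBINT t. c t v)" for v
 proof (cases "v > 0")
  case True
  \<comment> \<open>G is controlled at nonnegative times only, so it is truncated. Where f does not
    vanish the truncation is invisible also after the shift, because G vanishes from T on.\<close>
  define H where "H t = ind {0<..<T} t * G t" for t
  have [measurable]: "H \<in> \<B>" unfolding H_def by measurable
  have HM: "\<bar>H t\<bar> \<le> M" for t using GM[of t] M0 by (auto simp: H_def split: split_indicator)
  have i: "integrable lborel (\<lambda>t. u t * H (s + t))" if "integrable lborel u" for u s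
  proof (rule Bochner_Integration.integrable_bound[OF integrable_mult_right[OF integrable_norm[OF that], of M]])
   have [measurable]: "u \<in> \<B>" using that by (auto dest: borel_measurable_integrable)
   show "(\<lambda>t. u t * H (s + t)) \<in> borel_measurable lborel" by measurable
   show "AE t in lborel. norm (u t * H (s + t)) \<le> norm (M * norm (u t))"
   proof (intro AE_I2)
    fix t
    show "norm (u t * H (s + t)) \<le> norm (M * norm (u t))"
     using mult_left_mono[OF HM[of "s + t"] abs_ge_zero[of "u t"]] M0 by (simp add: abs_mult mult.commute)
   qed
  qed
  have fv: "integrable lborel (\<lambda>t. f (t - v))"
   using integral_lborel_translate(2)[of f "-v"] fi by (simp add: add.commute)
  have i1: "integrable lborel (\<lambda>t. f t * H t)" using i[OF fi, of 0] by simp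
  have i2: "integrable lborel (\<lambda>t. f (t - v) * H t)" using i[OF fv, of 0] by simp
  have "(LBINT t. a t v) = (LBINT t. v powr (-1-b) * (f t * H t - f (t - v) * H t))"
   using True by (intro Bochner_Integration.integral_cong) (auto simp: a_def H_def algebra_simps)
  also have "\<dots> = v powr (-1-b) * ((LBINT t. f t * H t) - (LBINT t. f (t - v) * H t))"
   using i1 i2 by simp
  also have "(LBINT t. f (t - v) * H t) = (LBINT t. f t * H (v + t))"
   using integral_lborel_translate(1)[of "\<lambda>t. f (t - v) * H t" v] by simp
  also have "(LBINT t. f t * H t) - (LBINT t. f t * H (v + t)) = (LBINT t. f t * H t - f t * H (v + t))"
   using i1 i[OF fi] by simp
  also have "v powr (-1-b) * \<dots> = (LBINT t. v powr (-1-b) * (f t * H t - f t * H (v + t)))" by simp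
  also have "\<dots> = (LBINT t. c t v)"
  proof (rule Bochner_Integration.integral_cong[OF refl])
   fix t
   show "v powr (-1-b) * (f t * H t - f t * H (v + t)) = c t v"
   proof (cases "t \<in> {0<..<T}")
    case True': True
    then have "H t = G t" "H (v + t) = G (t + v)" using True G0[of "t + v"] by (auto simp: H_def add.commute split: split_indicator)
    then show ?thesis using True by (simp add: c_def algebra_simps)
   qed (use f0 in \<open>simp add: c_def\<close>)
  qed
  finally show ?thesis .
 qed (simp add: a_def c_def)
 have "(LBINT t. ind {0<..<T} t * left_diff b f t * G t) = (LBINT t. LBINT v. a t v)"
  unfolding a_def left_diff_def by simp
 also have "\<dots> = (LBINT v. LBINT t. a t v)"
  by (rule fubini_real(1)[OF _ _ am afin]) unfold_locales
 also have "\<dots> = (LBINT v. LBINT t. c t v)" unfolding swap ..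
 also have "\<dots> = (LBINT t. LBINT v. c t v)"
  by (rule fubini_real(1)[symmetric, OF _ _ cm cfin]) unfold_locales
 also have "\<dots> = (LBINT t. f t * right_diff b G t)" unfolding c_def right_diff_def by simp
 finally show ?thesis .
qed

section \<open>Steklov averages\<close>

text \<open>The average looks forward: it preserves vanishing after T, and at t > 0 it sees only
  positive times, where the fractional derivative of the integrator is bounded.\<close>

definition steklov :: "real \<Rightarrow> (real \<Rightarrow> real) \<Rightarrow> real \<Rightarrow> real" where
 "steklov e h t = (LBINT r. ind {0<..<e} r * h (t + r)) / e"

text \<open>By \<open>steklov_rate_deriv\<close>, the derivative of the twice averaged h when h is
  continuous.\<close>

definition steklov_rate :: "real \<Rightarrow> (real \<Rightarrow> real) \<Rightarrow> real \<Rightarrow> real" where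
 "steklov_rate e h t = (steklov e h (t + e) - steklov e h t) / e"

lemma integrable_indicator_Ioo [simp]: "integrable lborel (ind {a<..<b::real} :: real \<Rightarrow> real)"
 by (rule integrable_real_indicator) (auto, cases "a \<le> b", auto)

lemma integrable_interval_bounded:
 fixes u :: "real \<Rightarrow> real"
 assumes "u \<in> \<B>" "\<And>r. r \<in> {0<..<e} \<Longrightarrow> \<bar>u r\<bar> \<le> M"
 shows "integrable lborel (\<lambda>r. ind {0<..<e} r * u r)"
proof (rule Bochner_Integration.integrable_bound)
 show "integrable lborel (\<lambda>r. M * ind {0<..<e} r)" by simp
 show "AE r in lborel. norm (ind {0<..<e} r * u r) \<le> norm (M * ind {0<..<e} r)"
  using assms(2) by (intro AE_I2) (force split: split_indicator)
qed (use assms in measurable)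

lemma steklov_borel [measurable]:
 assumes [measurable]: "h \<in> \<B>"
 shows "steklov e h \<in> \<B>"
 unfolding steklov_def by measurable

lemma steklov_rate_borel [measurable]:
 assumes [measurable]: "h \<in> \<B>"
 shows "steklov_rate e h \<in> \<B>"
 unfolding steklov_rate_def by measurable

lemma steklov_const_diff:
 assumes [measurable]: "h \<in> \<B>" and "\<And>r. r \<in> {0<..<e} \<Longrightarrow> \<bar>h (t + r)\<bar> \<le> M" and e: "e > 0"
 shows "steklov e h t - c = (LBINT r. ind {0<..<e} r * (h (t + r) - c)) / e"
proof -
 have "(LBINT r. ind {0<..<e} r * (h (t + r) - c)) = (LBINT r. ind {0<..<e} r * h (t + r) - c * ind {0<..<e} r)"
  by (intro Bochner_Integration.integral_cong) (auto simp: algebra_simps)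
 also have "\<dots> = (LBINT r. ind {0<..<e} r * h (t + r)) - (LBINT r. c * ind {0<..<e} r)"
  using assms(2) by (intro Bochner_Integration.integral_diff integrable_interval_bounded[where M=M]) auto
 also have "(LBINT r. c * ind {0<..<e} r) = c * e" using e by simp
 finally show ?thesis using e by (simp add: steklov_def field_simps)
qed

lemma integral_interval_bound:
 fixes u :: "real \<Rightarrow> real"
 assumes "e > 0" "M \<ge> 0" "\<And>r. r \<in> {0<..<e} \<Longrightarrow> \<bar>u r\<bar> \<le> M"
 shows "\<bar>LBINT r. ind {0<..<e} r * u r\<bar> \<le> M * e"
proof (cases "integrable lborel (\<lambda>r. ind {0<..<e} r * u r)")
 case True
 have "\<bar>LBINT r. ind {0<..<e} r * u r\<bar> \<le> (LBINT r. norm (ind {0<..<e} r * u r))"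
  using integral_norm_bound[of lborel "\<lambda>r. ind {0<..<e} r * u r"] by simp
 also have "\<dots> \<le> (LBINT r. M * ind {0<..<e} r)"
  using True assms(3) by (intro integral_mono integrable_norm) (auto split: split_indicator)
 also have "\<dots> = M * e" using assms by simp
 finally show ?thesis .
qed (use assms in \<open>simp add: not_integrable_integral_eq\<close>)

lemma steklov_dist_le:
 assumes [measurable]: "h \<in> \<B>"
  and e: "e > 0" and d: "\<And>r. r \<in> {0<..<e} \<Longrightarrow> \<bar>h (t + r) - c\<bar> \<le> d"
 shows "\<bar>steklov e h t - c\<bar> \<le> d"
proof -
 have d0: "d \<ge> 0" using d[of "e/2"] e by auto
 have b: "\<bar>h (t + r)\<bar> \<le> \<bar>c\<bar> + d" if "r \<in> {0<..<e}" for r using d[OF that] by linarith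
 have "\<bar>LBINT r. ind {0<..<e} r * (h (t + r) - c)\<bar> \<le> d * e"
  by (rule integral_interval_bound[OF e d0 d])
 then show ?thesis using e b
  by (subst steklov_const_diff[where M="\<bar>c\<bar> + d"]) (auto simp: field_simps)
qed

lemma steklov_bound:
 assumes "h \<in> \<B>" "e > 0" "\<And>x. x > t \<Longrightarrow> \<bar>h x\<bar> \<le> B"
 shows "\<bar>steklov e h t\<bar> \<le> B"
 using steklov_dist_le[OF assms(1,2), of t 0 B] assms(3) by simp

lemma steklov_zero:
 assumes "\<And>x. x \<ge> T \<Longrightarrow> h x = 0" "t \<ge> T"
 shows "steklov e h t = 0"
proof -
 have "(\<lambda>r. ind {0<..<e} r * h (t + r)) = (\<lambda>r. 0)"
  using assms by (auto simp: fun_eq_iff split: split_indicator)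
 then show ?thesis unfolding steklov_def by simp
qed

lemma steklov_cong: "(\<And>x. x > t \<Longrightarrow> h x = k x) \<Longrightarrow> steklov e h t = steklov e k t"
 unfolding steklov_def by (intro arg_cong2[where f="(/)"] Bochner_Integration.integral_cong) (auto split: split_indicator)

lemma steklov_minus_const:
 assumes [measurable]: "h \<in> \<B>" and "\<And>x. \<bar>h x\<bar> \<le> M" and e: "e > 0"
 shows "steklov e (\<lambda>x. h x - c) t = steklov e h t - c"
 using steklov_const_diff[of h e t M c] assms by (simp add: steklov_def)

lemma steklov_deriv:
 assumes h: "continuous_on UNIV h" and e: "e > 0"
 shows "(steklov e h has_real_derivative (h (t + e) - h t) / e) (at t)"
proof -
 have hb[measurable]: "h \<in> \<B>" using h by (rule borel_measurable_continuous_onI)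
 obtain H where H: "\<And>x. x \<in> {t-1..t+e+1} \<Longrightarrow> (H has_vector_derivative h x) (at x within {t-1..t+e+1})"
  using antiderivative_continuous[of "t-1" "t+e+1" h] continuous_on_subset[OF h] by auto
 have HD: "(H has_real_derivative h x) (at x)" if "t-1 < x" "x < t+e+1" for x
  using H[of x] that at_within_Icc_at[of "t-1" x "t+e+1"]
  by (simp add: has_real_derivative_iff_has_vector_derivative)
 have S: "steklov e h x = (H (x + e) - H x) / e" if x: "x \<in> {t-1<..<t+1}" for x
 proof -
  have "(LBINT r. ind {0<..<e} r * h (x + r)) = (LBINT r. h (x + r) * ind {0..e} r)"
  proof (rule integral_cong_AE)
   show "AE r in lborel. ind {0<..<e} r * h (x + r) = h (x + r) * ind {0..e} r"
    using AE_lborel_singleton[of 0] AE_lborel_singleton[of e]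
    by eventually_elim (auto split: split_indicator)
  qed simp_all
  also have "\<dots> = H (x + e) - H (x + 0)"
  proof (rule integral_FTC_Icc_real)
   fix r assume r: "0 \<le> r" "r \<le> e"
   have "((\<lambda>r. H (x + r)) has_real_derivative h (x + r) * (0 + 1)) (at r)"
    by (rule DERIV_chain2[OF HD]) (use r x in \<open>auto intro!: derivative_eq_intros\<close>)
   then show "((\<lambda>r. H (x + r)) has_real_derivative h (x + r)) (at r)" by simp
   have "continuous_on UNIV (\<lambda>r. h (x + r))" by (rule continuous_on_compose2[OF h]) (auto intro!: continuous_intros)
   then show "isCont (\<lambda>r. h (x + r)) r" by (simp add: continuous_on_eq_continuous_at)
  qed (use e in simp)
  finally show ?thesis by (simp add: steklov_def)
 qed
 have "((\<lambda>x. H (x + e)) has_real_derivative h (t + e) * (1 + 0)) (at t)"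
  by (rule DERIV_chain2[OF HD]) (use e in \<open>auto intro!: derivative_eq_intros\<close>)
 then have "((\<lambda>x. (H (x + e) - H x) / e) has_real_derivative (h (t + e) - h t) / e) (at t)"
  using HD[of t] e by (auto intro!: DERIV_cdivide DERIV_diff)
 then show ?thesis
  by (rule has_field_derivative_transform_within_open[where S="{t-1<..<t+1}"]) (auto simp: S)
qed

lemma steklov_continuous:
 assumes "continuous_on UNIV h" "e > 0"
 shows "continuous_on UNIV (steklov e h)"
 by (rule continuous_at_imp_continuous_on) (use steklov_deriv[OF assms] DERIV_isCont in blast)

lemma steklov_rate_deriv:
 assumes h: "continuous_on UNIV h" and e: "e > 0"
 shows "(steklov e (steklov e h) has_real_derivative steklov_rate e h t) (at t)"
 unfolding steklov_rate_def by (rule steklov_deriv[OF steklov_continuous[OF assms] e])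

text \<open>The two instances in which \<open>C1_vanishing\<close> is used. Averaging twice gives a
  second derivative: \<open>right_diff_eq\<close> is applied to the averaged integrator, and the
  inversion formula to its rate, so both must be C1.\<close>

lemma steklov_rate_C1:
 assumes h: "continuous_on UNIV h" and e: "e > 0" and T: "T > 0"
  and B: "\<And>x. \<bar>h x\<bar> \<le> B" and h0: "\<And>x. x \<ge> T \<Longrightarrow> h x = 0"
 shows "C1_vanishing T (2 * B / e) (steklov e (steklov e h)) (steklov_rate e h)"
  and "C1_vanishing T (4 * B / e^2) (steklov_rate e h) (\<lambda>t. ((h (t + e + e) - h (t + e)) / e - (h (t + e) - h t) / e) / e)"
proof -
 have hb[measurable]: "h \<in> \<B>" using h by (rule borel_measurable_continuous_onI)
 have Sb: "\<bar>steklov e h x\<bar> \<le> B" for x by (rule steklov_bound[OF hb e B])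
 have S0: "steklov e h x = 0" if "x \<ge> T" for x by (rule steklov_zero[OF h0 that])
 have Sc: "continuous_on UNIV (steklov e h)" by (rule steklov_continuous[OF h e])
 have comp: "continuous_on UNIV (\<lambda>t. k (t + c))" if "continuous_on UNIV k" for k :: "real \<Rightarrow> real" and c
  by (rule continuous_on_compose2[OF that]) (auto intro!: continuous_intros)
 show "C1_vanishing T (2 * B / e) (steklov e (steklov e h)) (steklov_rate e h)"
 proof
  show "\<bar>steklov_rate e h x\<bar> \<le> 2 * B / e" for x
   using Sb[of x] Sb[of "x + e"] e by (auto simp: steklov_rate_def abs_divide divide_right_mono)
  show "continuous_on UNIV (steklov_rate e h)"
   unfolding steklov_rate_def using Sc comp[OF Sc] e by (intro continuous_intros) auto
  show "steklov e (steklov e h) x = 0" if "x \<ge> T" for x by (rule steklov_zero[OF S0 that])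
  show "steklov_rate e h x = 0" if "x \<ge> T" for x using S0 that e by (simp add: steklov_rate_def)
  show "(steklov e (steklov e h) has_real_derivative steklov_rate e h x) (at x)" for x
   by (rule steklov_rate_deriv[OF h e])
 qed (use T in auto)
 show "C1_vanishing T (4 * B / e^2) (steklov_rate e h) (\<lambda>t. ((h (t + e + e) - h (t + e)) / e - (h (t + e) - h t) / e) / e)"
 proof
  fix x
  have "((\<lambda>t. steklov e h (t + e)) has_real_derivative (h (x + e + e) - h (x + e)) / e * (1 + 0)) (at x)"
   by (rule DERIV_chain2[OF steklov_deriv[OF h e]]) (auto intro!: derivative_eq_intros)
  then show "(steklov_rate e h has_real_derivative ((h (x + e + e) - h (x + e)) / e - (h (x + e) - h x) / e) / e) (at x)"
   unfolding steklov_rate_def[abs_def] using steklov_deriv[OF h e, of x] by (auto intro!: DERIV_cdivide DERIV_diff)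
  have "\<bar>(h (x + e + e) - h (x + e)) - (h (x + e) - h x)\<bar> \<le> 4 * B"
   using B[of x] B[of "x + e"] B[of "x + e + e"] by linarith
  then have "\<bar>(h (x + e + e) - h (x + e)) - (h (x + e) - h x)\<bar> / e^2 \<le> 4 * B / e^2"
   by (intro divide_right_mono) auto
  moreover have "\<bar>((h (x + e + e) - h (x + e)) / e - (h (x + e) - h x) / e) / e\<bar> = \<bar>(h (x + e + e) - h (x + e)) - (h (x + e) - h x)\<bar> / e^2"
   using e by (simp add: diff_divide_distrib[symmetric] abs_divide power2_eq_square)
  ultimately show "\<bar>((h (x + e + e) - h (x + e)) / e - (h (x + e) - h x) / e) / e\<bar> \<le> 4 * B / e^2" by simp
  show "((h (x + e + e) - h (x + e)) / e - (h (x + e) - h x) / e) / e = 0" if "x \<ge> T"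
   using h0 that e by simp
  show "steklov_rate e h x = 0" if "x \<ge> T" using S0 that e by (simp add: steklov_rate_def)
 next
  show "continuous_on UNIV (\<lambda>t. ((h (t + e + e) - h (t + e)) / e - (h (t + e) - h t) / e) / e)"
   using h comp[OF h] e comp[OF comp[OF h]] by (intro continuous_intros) (auto simp: add.assoc)
 qed (use T in auto)
qed

lemma right_diff_borel [measurable]:
 assumes [measurable]: "h \<in> \<B>"
 shows "right_diff b h \<in> \<B>"
 unfolding right_diff_def by measurable

lemma left_diff_borel [measurable]:
 assumes [measurable]: "h \<in> \<B>"
 shows "left_diff b h \<in> \<B>"
 unfolding left_diff_def by measurable

lemma right_diff_abs_borel [measurable]:
 assumes [measurable]: "h \<in> \<B>"
 shows "right_diff_abs b h \<in> \<B>"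
 unfolding right_diff_abs_def by measurable

lemma right_diff_le_abs:
 assumes [measurable]: "h \<in> \<B>"
 shows "eabs (right_diff b h t) \<le> right_diff_abs b h t"
proof (cases "integrable lborel (\<lambda>v. ind {0<..} v * (h t - h (t + v)) * v powr (-1-b))")
 case True
 from integral_norm_bound_ennreal[OF True] show ?thesis
  unfolding right_diff_def right_diff_abs_def by (simp add: abs_mult)
qed (simp add: right_diff_def not_integrable_integral_eq)

text \<open>Averaging is a superposition of translations, so it commutes with the fractional
  difference. The second claim returns the hypothesis for the averaged function, so that the first
  can be used twice.\<close>

lemma right_diff_steklov:
 assumes hm [measurable]: "h \<in> \<B>" and B: "\<And>x. \<bar>h x\<bar> \<le> B"
  and e: "e > 0" and t: "t > 0" and M: "\<And>x. x > 0 \<Longrightarrow> right_diff_abs b h x \<le> ennreal M"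
 shows "right_diff b (steklov e h) t = steklov e (right_diff b h) t"
  and "right_diff_abs b (steklov e h) t \<le> ennreal M"
proof -
 define F where "F r v = ind {0<..<e} r * (ind {0<..} v * (h (t + r) - h (t + r + v)) * v powr (-1-b))" for r v :: real
 have Fm: "case_prod F \<in> borel_measurable (lborel \<Otimes>\<^sub>M lborel)" unfolding F_def by measurable
 have Fabs: "(NBINT r. NBINT v. eabs (F r v)) \<le> ennreal e * ennreal M"
 proof -
  have "(NBINT r. NBINT v. eabs (F r v)) \<le> (NBINT r. ennreal M * ind {0<..<e} r)"
  proof (rule nn_integral_mono)
   fix r :: real
   have "(NBINT v. eabs (F r v)) = ind {0<..<e} r * right_diff_abs b h (t + r)"
    unfolding right_diff_abs_def F_def by (auto simp: abs_mult split: split_indicator)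
   also have "\<dots> \<le> ennreal M * ind {0<..<e} r"
    using M[of "t + r"] t by (auto split: split_indicator)
   finally show "(NBINT v. eabs (F r v)) \<le> ennreal M * ind {0<..<e} r" .
  qed
  also have "\<dots> = ennreal M * ennreal e" using e by (subst nn_integral_cmult) auto
  finally show ?thesis by (simp add: mult.commute)
 qed
 also have "\<dots> < \<infinity>" by (simp add: ennreal_mult_less_top)
 finally have fin: "(NBINT r. NBINT v. eabs (F r v)) < \<infinity>" .
 have i: "integrable lborel (\<lambda>r. ind {0<..<e} r * h (x + r))" for x
  by (rule integrable_interval_bounded[where M=B]) (use B in auto)
 have inner: "ind {0<..} v * (steklov e h t - steklov e h (t + v)) * v powr (-1-b) = (LBINT r. F r v) / e" for v
 proof -
  have "(LBINT r. F r v) = (LBINT r. (ind {0<..} v * v powr (-1-b)) * (ind {0<..<e} r * h (t + r) - ind {0<..<e} r * h (t + v + r)))"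
   by (intro Bochner_Integration.integral_cong) (auto simp: F_def algebra_simps)
  also have "\<dots> = (ind {0<..} v * v powr (-1-b)) * ((LBINT r. ind {0<..<e} r * h (t + r)) - (LBINT r. ind {0<..<e} r * h (t + v + r)))"
   unfolding integral_mult_right_zero Bochner_Integration.integral_diff[OF i i] ..
  finally show ?thesis unfolding steklov_def by (simp add: diff_divide_distrib[symmetric])
 qed
 have "right_diff b (steklov e h) t = (LBINT v. LBINT r. F r v) / e"
  unfolding right_diff_def inner by simp
 also have "(LBINT v. LBINT r. F r v) = (LBINT r. LBINT v. F r v)"
  by (rule fubini_real(1)[symmetric, OF _ _ Fm fin]) unfold_locales
 finally show "right_diff b (steklov e h) t = steklov e (right_diff b h) t"
  unfolding steklov_def F_def right_diff_def by simp
 have "right_diff_abs b (steklov e h) t \<le> (NBINT v. ennreal (1/e) * (NBINT r. eabs (F r v)))"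
  unfolding right_diff_abs_def
 proof (rule nn_integral_mono)
  fix v :: real
  have "ennreal (ind {0<..} v * \<bar>steklov e h t - steklov e h (t + v)\<bar> * v powr (-1-b)) = ennreal ((1/e) * \<bar>LBINT r. F r v\<bar>)"
   using arg_cong[OF inner[of v], of abs] e by (simp add: abs_mult abs_divide)
  also have "\<dots> = ennreal (1/e) * eabs (LBINT r. F r v)" using e by (subst ennreal_mult) auto
  also have "\<dots> \<le> ennreal (1/e) * (NBINT r. eabs (F r v))"
  proof (rule mult_left_mono)
   show "eabs (LBINT r. F r v) \<le> (NBINT r. eabs (F r v))"
    using integral_norm_bound_ennreal[of lborel "\<lambda>r. F r v"]
    by (cases "integrable lborel (\<lambda>r. F r v)") (auto simp: not_integrable_integral_eq)
  qed simp
  finally show "ennreal (ind {0<..} v * \<bar>steklov e h t - steklov e h (t + v)\<bar> * v powr (-1-b)) \<le> ennreal (1/e) * (NBINT r. eabs (F r v))" .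
 qed
 also have "\<dots> = ennreal (1/e) * (NBINT v. NBINT r. eabs (F r v))"
  unfolding F_def by (intro nn_integral_cmult) measurable
 also have "(NBINT v. NBINT r. eabs (F r v)) = (NBINT r. NBINT v. eabs (F r v))"
  unfolding F_def by (intro lborel_pair.Fubini') measurable
 also have "ennreal (1/e) * \<dots> \<le> ennreal (1/e) * (ennreal e * ennreal M)"
  by (rule mult_left_mono[OF Fabs]) simp
 also have "\<dots> = ennreal M" using e by (simp add: mult.assoc[symmetric] ennreal_mult[symmetric])
 finally show "right_diff_abs b (steklov e h) t \<le> ennreal M" .
qed

text \<open>A translation of the t-integral moves the average from u to a, so the error is the L1
  modulus of continuity of a. In the application u is a fractional derivative of the integrator,
  about which only boundedness is known.\<close>

lemma integral_steklov_approx: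
 fixes a u :: "real \<Rightarrow> real"
 assumes ai: "integrable lborel a" and a0: "\<And>t. t \<le> 0 \<Longrightarrow> a t = 0"
  and um [measurable]: "u \<in> \<B>" and M: "\<And>t. t > 0 \<Longrightarrow> \<bar>u t\<bar> \<le> M" and e: "e > 0"
  and w: "\<And>r. 0 < r \<Longrightarrow> r < e \<Longrightarrow> (NBINT t. eabs (a (t - r) - a t)) \<le> ennreal w" and w0: "w \<ge> 0"
 shows "\<bar>(LBINT t. a t * steklov e u t) - (LBINT t. a t * u t)\<bar> \<le> M * w"
proof -
 have am [measurable]: "a \<in> \<B>" using ai by (auto dest: borel_measurable_integrable)
 have M0: "M \<ge> 0" using M[of 1] by linarith
 \<comment> \<open>u is bounded at positive times only. Since a vanishes up to 0 and the shifts are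
   forward, cutting u off changes neither integral.\<close>
 define U where "U t = ind {0<..} t * u t" for t
 have [measurable]: "U \<in> \<B>" unfolding U_def by measurable
 have UM: "\<bar>U t\<bar> \<le> M" for t using M[of t] M0 by (auto simp: U_def split: split_indicator)
 have Ub: "integrable lborel (\<lambda>t. c t * U t)" if "integrable lborel c" for c
 proof (rule Bochner_Integration.integrable_bound[OF integrable_mult_right[OF integrable_norm[OF that], of M]])
  have [measurable]: "c \<in> \<B>" using that by (auto dest: borel_measurable_integrable)
  show "(\<lambda>t. c t * U t) \<in> borel_measurable lborel" by measurable
  show "AE t in lborel. norm (c t * U t) \<le> norm (M * norm (c t))"
  proof (intro AE_I2)
   fix t
   show "norm (c t * U t) \<le> norm (M * norm (c t))"
    using mult_left_mono[OF UM[of t] abs_ge_zero[of "c t"]] M0 by (simp add: abs_mult mult.commute)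
  qed
 qed
 have as: "integrable lborel (\<lambda>t. a (t - r))" for r
  using integral_lborel_translate(2)[of a "-r"] ai by (simp add: add.commute)
 define F where "F t r = a t * (ind {0<..<e} r * U (t + r))" for t r
 have Fm: "case_prod F \<in> borel_measurable (lborel \<Otimes>\<^sub>M lborel)" unfolding F_def by measurable
 have fin: "(NBINT t. NBINT r. eabs (F t r)) < \<infinity>"
 proof -
  have "(NBINT t. NBINT r. eabs (F t r)) \<le> (NBINT t. NBINT r. eabs (a t) * (ennreal M * ind {0<..<e} r))"
  proof (intro nn_integral_mono)
   fix t r
   show "eabs (F t r) \<le> eabs (a t) * (ennreal M * ind {0<..<e} r)"
    using UM[of "t + r"] M0 by (auto simp: F_def abs_mult ennreal_mult intro!: mult_left_mono ennreal_leI split: split_indicator)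
  qed
  also have "\<dots> = (NBINT t. eabs (a t)) * (ennreal M * ennreal e)"
   using e by (simp add: nn_integral_cmult nn_integral_multc)
  also have "\<dots> < \<infinity>" using ai by (simp add: ennreal_mult_less_top integrable_iff_bounded)
  finally show ?thesis .
 qed
 have FU: "a t * steklov e u t = (LBINT r. F t r) / e" for t
 proof (cases "t > 0")
  case True
  then have "steklov e u t = steklov e U t" by (intro steklov_cong) (auto simp: U_def)
  then have "a t * steklov e u t = a t * steklov e U t" by simp
  also have "\<dots> = (LBINT r. F t r) / e" unfolding F_def steklov_def by simp
  finally show ?thesis .
 qed (use a0 in \<open>simp add: F_def\<close>)
 have "(LBINT t. a t * steklov e u t) = (LBINT t. LBINT r. F t r) / e" unfolding FU by simp
 also have "(LBINT t. LBINT r. F t r) = (LBINT r. LBINT t. F t r)"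
  by (rule fubini_real(1)[OF _ _ Fm fin]) unfold_locales
 also have "\<dots> = (LBINT r. ind {0<..<e} r * (LBINT t. a (t - r) * U t))"
 proof (rule Bochner_Integration.integral_cong[OF refl])
  fix r
  have "(LBINT t. a (t - r) * U t) = (LBINT t. a t * U (t + r))"
   using integral_lborel_translate(1)[of "\<lambda>t. a (t - r) * U t" r] by (simp add: add.commute)
  moreover have "(LBINT t. F t r) = (LBINT t. ind {0<..<e} r * (a t * U (t + r)))"
   by (intro Bochner_Integration.integral_cong) (auto simp: F_def)
  ultimately show "(LBINT t. F t r) = ind {0<..<e} r * (LBINT t. a (t - r) * U t)" by simp
 qed
 finally have S: "(LBINT t. a t * steklov e u t) = (LBINT r. ind {0<..<e} r * (LBINT t. a (t - r) * U t)) / e" .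
 have aU: "(LBINT t. a t * u t) = (LBINT t. a t * U t)"
  using a0 by (intro Bochner_Integration.integral_cong) (auto simp: U_def not_less split: split_indicator)
 have d: "\<bar>(LBINT t. a (t - r) * U t) - (LBINT t. a t * u t)\<bar> \<le> M * w" if r: "r \<in> {0<..<e}" for r
 proof -
  have "(LBINT t. a (t - r) * U t) - (LBINT t. a t * u t) = (LBINT t. a (t - r) * U t - a t * U t)"
   unfolding aU by (rule Bochner_Integration.integral_diff[symmetric, OF Ub[OF as] Ub[OF ai]])
  then have "eabs ((LBINT t. a (t - r) * U t) - (LBINT t. a t * u t)) \<le> (NBINT t. ennreal (norm (a (t - r) * U t - a t * U t)))"
   using integral_norm_bound_ennreal[OF Bochner_Integration.integrable_diff[OF Ub[OF as] Ub[OF ai]], of r] by simp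
  also have "\<dots> \<le> (NBINT t. ennreal M * eabs (a (t - r) - a t))"
  proof (rule nn_integral_mono)
   fix t
   have "norm (a (t - r) * U t - a t * U t) = \<bar>U t\<bar> * \<bar>a (t - r) - a t\<bar>"
    unfolding left_diff_distrib[symmetric] by (simp add: abs_mult mult.commute)
   also have "\<dots> \<le> M * \<bar>a (t - r) - a t\<bar>" by (intro mult_right_mono UM) auto
   finally show "ennreal (norm (a (t - r) * U t - a t * U t)) \<le> ennreal M * eabs (a (t - r) - a t)"
    using M0 by (simp add: ennreal_mult[symmetric] ennreal_leI)
  qed
  also have "\<dots> = ennreal M * (NBINT t. eabs (a (t - r) - a t))" by (rule nn_integral_cmult) measurable
  also have "\<dots> \<le> ennreal M * ennreal w" using r by (intro mult_left_mono w) auto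
  also have "\<dots> = ennreal (M * w)" using M0 w0 by (simp add: ennreal_mult)
  finally show ?thesis using M0 w0 by (subst (asm) ennreal_le_iff) auto
 qed
 \<comment> \<open>The integral over the shift r is itself a Steklov average, of k at 0, so
   \<open>steklov_dist_le\<close> finishes the estimate.\<close>
 define k where "k r = (LBINT t. a (t - r) * U t)" for r
 have [measurable]: "k \<in> \<B>" unfolding k_def by measurable
 have "\<bar>steklov e k 0 - (LBINT t. a t * u t)\<bar> \<le> M * w"
  by (rule steklov_dist_le[OF _ e]) (use d in \<open>auto simp: k_def\<close>)
 moreover have "steklov e k 0 = (LBINT t. a t * steklov e u t)"
  by (subst S) (simp add: steklov_def k_def)
 ultimately show ?thesis by simp
qed

section \<open>The fractional Stieltjes integral\<close>

text \<open>The range v \<ge> t, where f (t - v) = 0, produces the weight 1 / (b t powr b): the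
  half-line difference carries a Gagliardo term and the Hardy term of \<open>W0_1\<close> at
  once.\<close>

lemma left_diff_abs_split:
 fixes f :: "real \<Rightarrow> real"
 assumes fm [measurable]: "f \<in> \<B>" and f0: "\<And>x. x \<le> 0 \<Longrightarrow> f x = 0" and t: "t > 0" and b: "b > 0"
 shows "(NBINT v. ennreal (ind {0<..} v * \<bar>f t - f (t - v)\<bar> * v powr (-1-b)))
  = (NBINT u. ennreal (ind {0<..<t} u * (\<bar>f t - f u\<bar> / \<bar>t - u\<bar> powr (1 + b)))) + ennreal (\<bar>f t\<bar> / t powr b / b)"
proof -
 have "(NBINT v. ennreal (ind {0<..} v * \<bar>f t - f (t - v)\<bar> * v powr (-1-b)))
   = (NBINT v. ennreal (ind {0<..<t} v * \<bar>f t - f (t - v)\<bar> * v powr (-1-b)) + eabs (f t) * ennreal (ind {t..} v * v powr (-1-b)))"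
  using t f0 by (intro nn_integral_cong) (auto simp: ennreal_mult[symmetric] split: split_indicator)
 also have "\<dots> = (NBINT v. ennreal (ind {0<..<t} v * \<bar>f t - f (t - v)\<bar> * v powr (-1-b))) + eabs (f t) * (NBINT v. ennreal (ind {t..} v * v powr (-1-b)))"
  by (subst nn_integral_add) (auto simp: nn_integral_cmult)
 also have "eabs (f t) * (NBINT v. ennreal (ind {t..} v * v powr (-1-b))) = ennreal (\<bar>f t\<bar> / t powr b / b)"
  using t b unfolding powr_tail_nn[OF t b] by (simp add: ennreal_mult[symmetric] powr_minus_divide)
 also have "(NBINT v. ennreal (ind {0<..<t} v * \<bar>f t - f (t - v)\<bar> * v powr (-1-b)))
   = (NBINT v. ennreal (ind {0<..<t} (t - v) * (\<bar>f t - f (t - v)\<bar> / \<bar>t - (t - v)\<bar> powr (1 + b))))"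
 proof (intro nn_integral_cong arg_cong[of _ _ ennreal])
  fix v :: real
  have "v powr (-1-b) = 1 / v powr (1 + b)" using powr_minus_divide[of v "1 + b"] by (simp add: minus_diff_commute)
  then show "ind {0<..<t} v * \<bar>f t - f (t - v)\<bar> * v powr (-1-b) = ind {0<..<t} (t - v) * (\<bar>f t - f (t - v)\<bar> / \<bar>t - (t - v)\<bar> powr (1 + b))"
   by (auto split: split_indicator)
 qed
 also have "\<dots> = (NBINT u. ennreal (ind {0<..<t} u * (\<bar>f t - f u\<bar> / \<bar>t - u\<bar> powr (1 + b))))"
  by (rule nn_integral_lborel_reflect) measurable
 finally show ?thesis .
qed

lemma right_diff_abs_split:
 fixes h :: "real \<Rightarrow> real"
 assumes hm [measurable]: "h \<in> \<B>" and h0: "\<And>x. x \<ge> T \<Longrightarrow> h x = 0" and t: "t < T" and b: "b > 0"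
 shows "right_diff_abs b h t
  = (NBINT u. ennreal (ind {t<..<T} u * (\<bar>h t - h u\<bar> / \<bar>t - u\<bar> powr (1 + b)))) + ennreal (\<bar>h t\<bar> / (T - t) powr b / b)"
proof -
 define s where "s = T - t"
 have s: "s > 0" using t by (simp add: s_def)
 have "right_diff_abs b h t
   = (NBINT v. ennreal (ind {0<..<s} v * \<bar>h t - h (t + v)\<bar> * v powr (-1-b)) + eabs (h t) * ennreal (ind {s..} v * v powr (-1-b)))"
  unfolding right_diff_abs_def
  using s h0 by (intro nn_integral_cong) (auto simp: ennreal_mult[symmetric] s_def split: split_indicator)
 also have "\<dots> = (NBINT v. ennreal (ind {0<..<s} v * \<bar>h t - h (t + v)\<bar> * v powr (-1-b))) + eabs (h t) * (NBINT v. ennreal (ind {s..} v * v powr (-1-b)))"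
  by (subst nn_integral_add) (auto simp: nn_integral_cmult)
 also have "eabs (h t) * (NBINT v. ennreal (ind {s..} v * v powr (-1-b))) = ennreal (\<bar>h t\<bar> / s powr b / b)"
  using s b unfolding powr_tail_nn[OF s b] by (simp add: ennreal_mult[symmetric] powr_minus_divide)
 also have "(NBINT v. ennreal (ind {0<..<s} v * \<bar>h t - h (t + v)\<bar> * v powr (-1-b)))
   = (NBINT v. ennreal (ind {t<..<T} (t + v) * (\<bar>h t - h (t + v)\<bar> / \<bar>t - (t + v)\<bar> powr (1 + b))))"
 proof (intro nn_integral_cong arg_cong[of _ _ ennreal])
  fix v :: real
  have "v powr (-1-b) = 1 / v powr (1 + b)" using powr_minus_divide[of v "1 + b"] by (simp add: minus_diff_commute)
  then show "ind {0<..<s} v * \<bar>h t - h (t + v)\<bar> * v powr (-1-b) = ind {t<..<T} (t + v) * (\<bar>h t - h (t + v)\<bar> / \<bar>t - (t + v)\<bar> powr (1 + b))"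
   by (auto simp: s_def split: split_indicator)
 qed
 also have "\<dots> = (NBINT u. ennreal (ind {t<..<T} u * (\<bar>h t - h u\<bar> / \<bar>t - u\<bar> powr (1 + b))))"
  by (rule nn_integral_lborel_translate) measurable
 finally show ?thesis unfolding s_def .
qed

lemma frac_deriv_left_lborel:
 assumes [measurable]: "f \<in> \<B>"
 shows "frac_deriv_left b f t = 1 / Gamma (1 - b) * (f t / t powr b + b * (LBINT u. ind {0<..<t} u * ((f t - f u) / (t - u) powr (b + 1))))"
 unfolding frac_deriv_left_def set_lebesgue_integral_def by (subst integral_completion) auto

lemma frac_deriv_right_lborel:
 assumes [measurable]: "g \<in> \<B>"
 shows "frac_deriv_right b T g t = 1 / Gamma (1 - b) * (g t / (T - t) powr b + b * (LBINT u. ind {t<..<T} u * ((g t - g u) / (u - t) powr (b + 1))))"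
 unfolding frac_deriv_right_def set_lebesgue_integral_def by (subst integral_completion) auto

lemma frac_deriv_borel [measurable]:
 assumes [measurable]: "f \<in> \<B>"
 shows "frac_deriv_left b f \<in> \<B>" "frac_deriv_right b T f \<in> \<B>"
proof -
 have [measurable]: "Measurable.pred (borel \<Otimes>\<^sub>M borel) (\<lambda>x :: real \<times> real. snd x \<in> {0<..<fst x})"
   "Measurable.pred (borel \<Otimes>\<^sub>M borel) (\<lambda>x :: real \<times> real. snd x \<in> {fst x<..<T})"
  unfolding greaterThanLessThan_iff by measurable
 show "frac_deriv_left b f \<in> \<B>"
  unfolding frac_deriv_left_lborel[OF assms, abs_def] by measurable
 show "frac_deriv_right b T f \<in> \<B>"
  unfolding frac_deriv_right_lborel[OF assms, abs_def] by measurable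
qed

lemma frac_deriv_left_eq:
 fixes f :: "real \<Rightarrow> real"
 assumes fm [measurable]: "f \<in> \<B>" and f0: "\<And>x. x \<le> 0 \<Longrightarrow> f x = 0" and t: "t > 0" and b: "b > 0"
  and i: "integrable lborel (\<lambda>v. ind {0<..} v * (f t - f (t - v)) * v powr (-1-b))"
 shows "frac_deriv_left b f t = b / Gamma (1 - b) * left_diff b f t"
proof -
 let ?u = "\<lambda>v. ind {0<..} v * (f t - f (t - v)) * v powr (-1-b)"
 have eq: "?u v = ind {0<..<t} v * ((f t - f (t - v)) * v powr (-1-b)) + f t * (ind {t..} v * v powr (-1-b))" for v
  using f0 t by (auto split: split_indicator)
 have i1: "integrable lborel (\<lambda>v. ind {0<..<t} v * ((f t - f (t - v)) * v powr (-1-b)))"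
  by (rule Bochner_Integration.integrable_bound[OF i]) (use t in \<open>auto split: split_indicator\<close>)
 have "left_diff b f t = (LBINT v. ind {0<..<t} v * ((f t - f (t - v)) * v powr (-1-b))) + f t * (LBINT v. ind {t..} v * v powr (-1-b))"
  unfolding left_diff_def eq using i1 powr_tail_integral[OF t b] by (subst Bochner_Integration.integral_add) auto
 also have "f t * (LBINT v. ind {t..} v * v powr (-1-b)) = f t / t powr b / b"
  using powr_tail_integral[OF t b] by (simp add: powr_minus_divide)
 also have "(LBINT v. ind {0<..<t} v * ((f t - f (t - v)) * v powr (-1-b)))
   = (LBINT v. ind {0<..<t} (t - v) * ((f t - f (t - v)) / (t - (t - v)) powr (b + 1)))"
 proof (intro Bochner_Integration.integral_cong refl)
  fix v :: real
  have "v powr (-1-b) = 1 / v powr (b + 1)" using powr_minus_divide[of v "b + 1"] by (simp add: minus_diff_commute)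
  then show "ind {0<..<t} v * ((f t - f (t - v)) * v powr (-1-b)) = ind {0<..<t} (t - v) * ((f t - f (t - v)) / (t - (t - v)) powr (b + 1))"
   by (auto split: split_indicator)
 qed
 also have "\<dots> = (LBINT u. ind {0<..<t} u * ((f t - f u) / (t - u) powr (b + 1)))"
  by (rule integral_lborel_reflect(1)[of "\<lambda>u. ind {0<..<t} u * ((f t - f u) / (t - u) powr (b + 1))"])
 finally show ?thesis unfolding frac_deriv_left_lborel[OF fm] using b by (simp add: field_simps)
qed

lemma frac_deriv_right_eq:
 fixes h :: "real \<Rightarrow> real"
 assumes hm [measurable]: "h \<in> \<B>" and h0: "\<And>x. x \<ge> T \<Longrightarrow> h x = 0" and t: "t < T" and b: "b > 0"
  and fin: "right_diff_abs b h t < \<infinity>"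
 shows "frac_deriv_right b T h t = b / Gamma (1 - b) * right_diff b h t"
proof -
 define s where "s = T - t"
 have s: "s > 0" using t by (simp add: s_def)
 let ?u = "\<lambda>v. ind {0<..} v * (h t - h (t + v)) * v powr (-1-b)"
 have i: "integrable lborel ?u"
  using fin unfolding right_diff_abs_def by (intro integrableI_bounded) (auto simp: abs_mult)
 have eq: "?u v = ind {0<..<s} v * ((h t - h (t + v)) * v powr (-1-b)) + h t * (ind {s..} v * v powr (-1-b))" for v
  using h0 s by (auto simp: s_def split: split_indicator)
 have i1: "integrable lborel (\<lambda>v. ind {0<..<s} v * ((h t - h (t + v)) * v powr (-1-b)))"
  by (rule Bochner_Integration.integrable_bound[OF i]) (use s in \<open>auto split: split_indicator\<close>)
 have "right_diff b h t = (LBINT v. ind {0<..<s} v * ((h t - h (t + v)) * v powr (-1-b))) + h t * (LBINT v. ind {s..} v * v powr (-1-b))"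
  unfolding right_diff_def eq using i1 powr_tail_integral[OF s b] by (subst Bochner_Integration.integral_add) auto
 also have "h t * (LBINT v. ind {s..} v * v powr (-1-b)) = h t / s powr b / b"
  using powr_tail_integral[OF s b] by (simp add: powr_minus_divide)
 also have "(LBINT v. ind {0<..<s} v * ((h t - h (t + v)) * v powr (-1-b)))
   = (LBINT v. ind {t<..<T} (t + v) * ((h t - h (t + v)) / ((t + v) - t) powr (b + 1)))"
 proof (intro Bochner_Integration.integral_cong refl)
  fix v :: real
  have "v powr (-1-b) = 1 / v powr (b + 1)" using powr_minus_divide[of v "b + 1"] by (simp add: minus_diff_commute)
  then show "ind {0<..<s} v * ((h t - h (t + v)) * v powr (-1-b)) = ind {t<..<T} (t + v) * ((h t - h (t + v)) / ((t + v) - t) powr (b + 1))"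
   by (auto simp: s_def split: split_indicator)
 qed
 also have "\<dots> = (LBINT u. ind {t<..<T} u * ((h t - h u) / (u - t) powr (b + 1)))"
  by (rule integral_lborel_translate(1)[of "\<lambda>u. ind {t<..<T} u * ((h t - h u) / (u - t) powr (b + 1))"])
 finally show ?thesis unfolding frac_deriv_right_lborel[OF hm] s_def[symmetric] using b by (simp add: field_simps)
qed

definition gagliardo :: "real \<Rightarrow> real \<Rightarrow> (real \<Rightarrow> real) \<Rightarrow> ennreal" where
 "gagliardo b T f = (NBINT t. NBINT u. ennreal (ind {0<..<T} t * ind {0<..<T} u * (\<bar>f t - f u\<bar> / \<bar>t - u\<bar> powr (1 + b))))"

definition hardy_norm :: "real \<Rightarrow> real \<Rightarrow> (real \<Rightarrow> real) \<Rightarrow> ennreal" where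
 "hardy_norm b T f = (NBINT t. ennreal (ind {0<..<T} t * (\<bar>f t\<bar> / t powr b)))"

lemma W0_1_iff:
 assumes [measurable]: "f \<in> \<B>"
 shows "f \<in> W0_1 b T \<longleftrightarrow> hardy_norm b T f + gagliardo b T f < \<infinity>"
proof -
 have fm: "f \<in> borel_measurable (lebesgue_on {0<..<T})"
  by (intro measurable_restrict_space1 measurable_completion) simp
 have 1: "(\<integral>\<^sup>+ t\<in>{0<..<T}. ennreal (\<bar>f t\<bar> / t powr b) \<partial>lebesgue) = hardy_norm b T f"
  unfolding hardy_norm_def nn_integral_completion by (intro nn_integral_cong) (auto split: split_indicator)
 have 2: "(\<integral>\<^sup>+ t\<in>{0<..<T}. (\<integral>\<^sup>+ u\<in>{0<..<T}. ennreal (\<bar>f t - f u\<bar> / \<bar>t - u\<bar> powr (1 + b)) \<partial>lebesgue) \<partial>lebesgue) = gagliardo b T f"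
  unfolding gagliardo_def nn_integral_completion
 proof (rule nn_integral_cong)
  fix t
  show "(\<integral>\<^sup>+ u\<in>{0<..<T}. ennreal (\<bar>f t - f u\<bar> / \<bar>t - u\<bar> powr (1 + b)) \<partial>lborel) * ind {0<..<T} t
   = (NBINT u. ennreal (ind {0<..<T} t * ind {0<..<T} u * (\<bar>f t - f u\<bar> / \<bar>t - u\<bar> powr (1 + b))))"
   by (cases "t \<in> {0<..<T}") (auto intro!: nn_integral_cong split: split_indicator)
 qed
 show ?thesis unfolding W0_1_def using fm 1 2 by simp
qed

lemma W0_1_left_diff:
 fixes f :: "real \<Rightarrow> real"
 assumes fm [measurable]: "f \<in> \<B>" and f0: "\<And>x. x \<notin> {0<..<T} \<Longrightarrow> f x = 0" and b: "b > 0" and T: "T > 0"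
 shows "(NBINT t. NBINT v. ennreal (ind {0<..<T} t * (ind {0<..} v * \<bar>f t - f (t - v)\<bar> * v powr (-1-b))))
   \<le> gagliardo b T f + ennreal (1/b) * hardy_norm b T f"
  and "(NBINT t. eabs (f t)) \<le> ennreal (T powr b) * hardy_norm b T f"
proof -
 have "(NBINT t. NBINT v. ennreal (ind {0<..<T} t * (ind {0<..} v * \<bar>f t - f (t - v)\<bar> * v powr (-1-b))))
   \<le> (NBINT t. (NBINT u. ennreal (ind {0<..<T} t * ind {0<..<T} u * (\<bar>f t - f u\<bar> / \<bar>t - u\<bar> powr (1 + b)))) + ennreal (1/b) * ennreal (ind {0<..<T} t * (\<bar>f t\<bar> / t powr b)))"
 proof (rule nn_integral_mono)
  fix t
  show "(NBINT v. ennreal (ind {0<..<T} t * (ind {0<..} v * \<bar>f t - f (t - v)\<bar> * v powr (-1-b))))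
   \<le> (NBINT u. ennreal (ind {0<..<T} t * ind {0<..<T} u * (\<bar>f t - f u\<bar> / \<bar>t - u\<bar> powr (1 + b)))) + ennreal (1/b) * ennreal (ind {0<..<T} t * (\<bar>f t\<bar> / t powr b))"
  proof (cases "t \<in> {0<..<T}")
   case True
   have f0': "\<And>x. x \<le> 0 \<Longrightarrow> f x = 0" using f0 by auto
   have "(NBINT v. ennreal (ind {0<..<T} t * (ind {0<..} v * \<bar>f t - f (t - v)\<bar> * v powr (-1-b))))
     = (NBINT u. ennreal (ind {0<..<t} u * (\<bar>f t - f u\<bar> / \<bar>t - u\<bar> powr (1 + b)))) + ennreal (\<bar>f t\<bar> / t powr b / b)"
    using True left_diff_abs_split[OF fm f0' _ b, of t] by simp
   also have "\<dots> \<le> (NBINT u. ennreal (ind {0<..<T} t * ind {0<..<T} u * (\<bar>f t - f u\<bar> / \<bar>t - u\<bar> powr (1 + b)))) + ennreal (1/b) * ennreal (ind {0<..<T} t * (\<bar>f t\<bar> / t powr b))"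
   proof (rule add_mono)
    show "(NBINT u. ennreal (ind {0<..<t} u * (\<bar>f t - f u\<bar> / \<bar>t - u\<bar> powr (1 + b)))) \<le> (NBINT u. ennreal (ind {0<..<T} t * ind {0<..<T} u * (\<bar>f t - f u\<bar> / \<bar>t - u\<bar> powr (1 + b))))"
     using True by (intro nn_integral_mono ennreal_leI) (auto split: split_indicator)
    show "ennreal (\<bar>f t\<bar> / t powr b / b) \<le> ennreal (1/b) * ennreal (ind {0<..<T} t * (\<bar>f t\<bar> / t powr b))"
     using True b by (simp add: ennreal_mult[symmetric] mult.commute)
   qed
   finally show ?thesis .
  qed simp
 qed
 also have "\<dots> = gagliardo b T f + ennreal (1/b) * hardy_norm b T f"
  unfolding gagliardo_def hardy_norm_def by (subst nn_integral_add) (auto simp: nn_integral_cmult)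
 finally show "(NBINT t. NBINT v. ennreal (ind {0<..<T} t * (ind {0<..} v * \<bar>f t - f (t - v)\<bar> * v powr (-1-b))))
   \<le> gagliardo b T f + ennreal (1/b) * hardy_norm b T f" .
 have "(NBINT t. eabs (f t)) \<le> (NBINT t. ennreal (T powr b) * ennreal (ind {0<..<T} t * (\<bar>f t\<bar> / t powr b)))"
 proof (rule nn_integral_mono)
  fix t
  show "eabs (f t) \<le> ennreal (T powr b) * ennreal (ind {0<..<T} t * (\<bar>f t\<bar> / t powr b))"
  proof (cases "t \<in> {0<..<T}")
   case True
   then have "t powr b \<le> T powr b" using b by (intro powr_mono2) auto
   then have "\<bar>f t\<bar> * t powr b \<le> \<bar>f t\<bar> * T powr b" by (intro mult_left_mono) auto
   then have "\<bar>f t\<bar> \<le> T powr b * (\<bar>f t\<bar> / t powr b)" using True by (simp add: field_simps)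
   then show ?thesis using True by (simp add: ennreal_mult[symmetric] ennreal_leI)
  qed (simp add: f0)
 qed
 then show "(NBINT t. eabs (f t)) \<le> ennreal (T powr b) * hardy_norm b T f"
  unfolding hardy_norm_def by (subst (asm) nn_integral_cmult) auto
qed

text \<open>Through \<open>right_diff_abs_split\<close> the two suprema of \<open>WT_inf\<close>
  become one uniform bound; the limit l at T is g T by continuity. From T on the function g - g T
  vanishes, so the bound holds for all x > 0.\<close>

lemma WT_inf_right_diff_abs:
 assumes g: "continuous_on UNIV g" and gT: "\<And>x. x \<ge> T \<Longrightarrow> g x = g T" and b: "b > 0" and T: "T > 0" and W: "g \<in> WT_inf b T"
 shows "\<exists>M\<ge>0. \<forall>x>0. right_diff_abs b (\<lambda>u. g u - g T) x \<le> ennreal M"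
proof -
 have gm [measurable]: "g \<in> \<B>" using g by (rule borel_measurable_continuous_onI)
 obtain l where l: "(g \<longlongrightarrow> l) (at_left T)" and
  fin: "(SUP t\<in>{0<..<T}. ennreal (\<bar>l - g t\<bar> / (T - t) powr b)) +
    (SUP t\<in>{0<..<T}. (\<integral>\<^sup>+ u\<in>{t<..<T}. ennreal (\<bar>g t - g u\<bar> / \<bar>t - u\<bar> powr (1 + b)) \<partial>lebesgue)) < \<infinity>"
  using W unfolding WT_inf_def by blast
 have "(g \<longlongrightarrow> g T) (at_left T)"
  using continuous_on_subset[OF g, of "{..T}"] by (auto simp: continuous_on_def intro: tendsto_within_subset)
 from tendsto_unique[OF trivial_limit_at_left_real l this] have lT: "l = g T" .
 define S1 where "S1 = (SUP t\<in>{0<..<T}. ennreal (\<bar>l - g t\<bar> / (T - t) powr b))"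
 define S2 where "S2 = (SUP t\<in>{0<..<T}. (\<integral>\<^sup>+ u\<in>{t<..<T}. ennreal (\<bar>g t - g u\<bar> / \<bar>t - u\<bar> powr (1 + b)) \<partial>lebesgue))"
 have S: "S1 < \<infinity>" "S2 < \<infinity>" using fin unfolding S1_def[symmetric] S2_def[symmetric] by auto
 let ?h = "\<lambda>u. g u - g T"
 have h0: "g x - g T = 0" if "x \<ge> T" for x using gT[OF that] by linarith
 have le: "right_diff_abs b ?h x \<le> S2 + ennreal (1/b) * S1" if x: "x > 0" for x
 proof (cases "x < T")
  case True
  have "right_diff_abs b ?h x = (NBINT u. ennreal (ind {x<..<T} u * (\<bar>g x - g u\<bar> / \<bar>x - u\<bar> powr (1 + b)))) + ennreal (1/b) * ennreal (\<bar>l - g x\<bar> / (T - x) powr b)"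
   using b by (subst right_diff_abs_split[OF _ h0 True b]) (auto simp: lT ennreal_mult[symmetric] abs_minus_commute)
  also have "\<dots> \<le> S2 + ennreal (1/b) * S1"
  proof (intro add_mono mult_left_mono)
   have "(NBINT u. ennreal (ind {x<..<T} u * (\<bar>g x - g u\<bar> / \<bar>x - u\<bar> powr (1 + b)))) = (\<integral>\<^sup>+ u\<in>{x<..<T}. ennreal (\<bar>g x - g u\<bar> / \<bar>x - u\<bar> powr (1 + b)) \<partial>lebesgue)"
    unfolding nn_integral_completion by (intro nn_integral_cong) (auto split: split_indicator)
   also have "\<dots> \<le> S2" unfolding S2_def using x True by (intro SUP_upper) auto
   finally show "(NBINT u. ennreal (ind {x<..<T} u * (\<bar>g x - g u\<bar> / \<bar>x - u\<bar> powr (1 + b)))) \<le> S2" .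
   show "ennreal (\<bar>l - g x\<bar> / (T - x) powr b) \<le> S1" unfolding S1_def using x True by (intro SUP_upper) auto
  qed auto
  finally show ?thesis .
 next
  case False
  then have "g (x + v) - g T = 0" if "v \<ge> 0" for v using h0[of "x + v"] that by simp
  from this[of 0] this have "(\<lambda>v. ennreal (ind {0<..} v * \<bar>?h x - ?h (x + v)\<bar> * v powr (-1-b))) = (\<lambda>v. 0)"
   by (auto simp: fun_eq_iff split: split_indicator)
  then show ?thesis unfolding right_diff_abs_def by simp
 qed
 have "S2 + ennreal (1/b) * S1 < \<infinity>" using S by (simp add: ennreal_mult_less_top)
 then have "S2 + ennreal (1/b) * S1 = ennreal (enn2real (S2 + ennreal (1/b) * S1))" by (simp add: less_top)
 then show ?thesis using le by (intro exI[of _ "enn2real (S2 + ennreal (1/b) * S1)"]) (auto simp: enn2real_nonneg)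
qed

lemma stieltjes_order_eq:
 fixes f g :: "real \<Rightarrow> real"
 assumes T: "T > 0" and b: "0 < b" "b < 1"
  and fm [measurable]: "f \<in> \<B>" and f0: "\<And>x. x \<notin> {0<..<T} \<Longrightarrow> f x = 0"
  and W: "f \<in> W0_1 b T"
  and g: "continuous_on UNIV g" and gT: "\<And>x. x \<ge> T \<Longrightarrow> g x = g T"
  and gW: "g \<in> WT_inf (1 - b) T"
 shows "integrable lborel f"
  and "(NBINT t. NBINT v. ennreal (ind {0<..<T} t * (ind {0<..} v * \<bar>f t - f (t - v)\<bar> * v powr (-1-b)))) < \<infinity>"
  and "integrable lborel (\<lambda>t. ind {0<..<T} t * left_diff b f t)"
  and "stieltjes_integral_order b T f g = - ((b / Gamma (1 - b)) * ((1 - b) / Gamma b)) *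
   (LBINT t. ind {0<..<T} t * left_diff b f t * right_diff (1 - b) (\<lambda>u. g u - g T) t)"
  and "(NBINT t. eabs (ind {0<..<T} t * left_diff b f t)) \<le> gagliardo b T f + ennreal (1/b) * hardy_norm b T f"
proof -
 have gm [measurable]: "g \<in> \<B>" using g by (rule borel_measurable_continuous_onI)
 define h where "h u = g u - g T" for u
 have hc: "continuous_on UNIV h" unfolding h_def by (intro continuous_intros g)
 have hm [measurable]: "h \<in> \<B>" unfolding h_def by measurable
 have h0: "h x = 0" if "x \<ge> T" for x using gT[OF that] unfolding h_def by linarith
 obtain M where M0: "M \<ge> 0" and M: "\<And>x. x > 0 \<Longrightarrow> right_diff_abs (1 - b) h x \<le> ennreal M"
  using WT_inf_right_diff_abs[OF g gT _ T gW] b unfolding h_def by auto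
 have fin0: "hardy_norm b T f < \<infinity>" "gagliardo b T f < \<infinity>" using W unfolding W0_1_iff[OF fm] by auto
 have "(NBINT t. NBINT v. ennreal (ind {0<..<T} t * (ind {0<..} v * \<bar>f t - f (t - v)\<bar> * v powr (-1-b))))
   \<le> gagliardo b T f + ennreal (1/b) * hardy_norm b T f"
  by (rule W0_1_left_diff(1)[OF fm f0 b(1) T])
 also have "\<dots> < \<infinity>" using fin0 by (simp add: ennreal_mult_less_top)
 finally have fin: "(NBINT t. NBINT v. ennreal (ind {0<..<T} t * (ind {0<..} v * \<bar>f t - f (t - v)\<bar> * v powr (-1-b)))) < \<infinity>" .
 have "(NBINT t. eabs (f t)) \<le> ennreal (T powr b) * hardy_norm b T f"
  by (rule W0_1_left_diff(2)[OF fm f0 b(1) T])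
 also have "\<dots> < \<infinity>" using fin0 by (simp add: ennreal_mult_less_top)
 finally have fi: "integrable lborel f" by (intro integrableI_bounded) auto
 define F where "F t v = ind {0<..<T} t * (ind {0<..} v * (f t - f (t - v)) * v powr (-1-b))" for t v :: real
 have Fm: "case_prod F \<in> borel_measurable (lborel \<Otimes>\<^sub>M lborel)" unfolding F_def by measurable
 have Ffin: "(NBINT t. NBINT v. eabs (F t v)) < \<infinity>"
  using fin unfolding F_def by (simp add: abs_mult)
 define a where "a t = ind {0<..<T} t * left_diff b f t" for t
 have am [measurable]: "a \<in> \<B>" unfolding a_def by measurable
 have aF: "a t = (LBINT v. F t v)" for t unfolding a_def F_def left_diff_def by simp
 have ai: "integrable lborel a" unfolding aF[abs_def]
  by (rule fubini_real(2)[OF _ _ Fm Ffin]) unfold_locales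
 \<comment> \<open>Fubini gives absolute convergence of the left difference at almost every t, which
   is enough to identify the integrands.\<close>
 have AEi: "AE t in lborel. integrable lborel (F t)"
  by (rule fubini_real(4)[OF _ _ Fm Ffin]) unfold_locales
 show "integrable lborel f" by (rule fi)
 show "(NBINT t. NBINT v. ennreal (ind {0<..<T} t * (ind {0<..} v * \<bar>f t - f (t - v)\<bar> * v powr (-1-b)))) < \<infinity>"
  by (rule fin)
 show "integrable lborel (\<lambda>t. ind {0<..<T} t * left_diff b f t)" using ai unfolding a_def[abs_def] .
 have "(NBINT t. eabs (ind {0<..<T} t * left_diff b f t)) \<le> (NBINT t. NBINT v. eabs (F t v))"
 proof (rule nn_integral_mono)
  fix t
  show "eabs (ind {0<..<T} t * left_diff b f t) \<le> (NBINT v. eabs (F t v))"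
   using integral_norm_bound_ennreal[of lborel "F t"] unfolding a_def[symmetric] aF
   by (cases "integrable lborel (F t)") (auto simp: not_integrable_integral_eq)
 qed
 also have "\<dots> \<le> gagliardo b T f + ennreal (1/b) * hardy_norm b T f"
  using W0_1_left_diff(1)[OF fm f0 b(1) T] unfolding F_def by (simp add: abs_mult)
 finally show "(NBINT t. eabs (ind {0<..<T} t * left_diff b f t)) \<le> gagliardo b T f + ennreal (1/b) * hardy_norm b T f" .
 define u where "u = right_diff (1 - b) h"
 have um [measurable]: "u \<in> \<B>" unfolding u_def by measurable
 define \<kappa> where "\<kappa> = (b / Gamma (1 - b)) * ((1 - b) / Gamma b)"
 have lim_g: "Lim (at_left T) g = g T"
 proof (rule tendsto_Lim)
  show "(g \<longlongrightarrow> g T) (at_left T)"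
   using continuous_on_subset[OF g, of "{..T}"] by (auto simp: continuous_on_def intro: tendsto_within_subset)
 qed simp
 have order_eq: "stieltjes_integral_order b T f g = - \<kappa> * (LBINT t. a t * u t)"
 proof -
  have "stieltjes_integral_order b T f g = - (LBINT t. ind {0<..<T} t * (frac_deriv_left b f t * frac_deriv_right (1 - b) T h t))"
   unfolding stieltjes_integral_order_def lim_g h_def[symmetric] set_lebesgue_integral_def
   by (subst integral_completion) auto
  also have "(LBINT t. ind {0<..<T} t * (frac_deriv_left b f t * frac_deriv_right (1 - b) T h t)) = (LBINT t. \<kappa> * (a t * u t))"
  proof (rule integral_cong_AE)
   show "AE t in lborel. ind {0<..<T} t * (frac_deriv_left b f t * frac_deriv_right (1 - b) T h t) = \<kappa> * (a t * u t)"
    using AEi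
   proof eventually_elim
    case (elim t)
    show ?case
    proof (cases "t \<in> {0<..<T}")
     case True
     have f0': "\<And>x. x \<le> 0 \<Longrightarrow> f x = 0" using f0 by auto
     have "frac_deriv_left b f t = b / Gamma (1 - b) * left_diff b f t"
      using elim True by (intro frac_deriv_left_eq[OF fm f0' _ b(1)]) (auto simp: F_def[abs_def])
     moreover have "frac_deriv_right (1 - b) T h t = (1 - b) / Gamma (1 - (1 - b)) * right_diff (1 - b) h t"
      using True b M[of t] by (intro frac_deriv_right_eq[OF hm h0]) (auto intro: order_le_less_trans)
     ultimately show ?thesis using True unfolding a_def u_def \<kappa>_def by simp
    qed (simp add: a_def)
   qed
  qed measurable
  finally show ?thesis by simp
 qed
 show "stieltjes_integral_order b T f g = - ((b / Gamma (1 - b)) * ((1 - b) / Gamma b)) *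
   (LBINT t. ind {0<..<T} t * left_diff b f t * right_diff (1 - b) (\<lambda>u. g u - g T) t)"
  using order_eq unfolding \<kappa>_def a_def u_def h_def[abs_def] .
qed

text \<open>The approximating integrals do not mention b; this is the source of order independence
  and additivity. For the twice averaged integrator, with rate p, the right difference of order 1 -
  b is a multiple of the potential of p of order b. Duality turns the left difference of f into a
  right difference of this potential, which the inversion formula evaluates to a multiple of p. What
  remains is the integral of f p.\<close>

lemma stieltjes_order_limit:
 fixes f g :: "real \<Rightarrow> real"
 assumes T: "T > 0" and b: "0 < b" "b < 1"
  and fm [measurable]: "f \<in> \<B>" and f0: "\<And>x. x \<notin> {0<..<T} \<Longrightarrow> f x = 0"
  and W: "f \<in> W0_1 b T"
  and g: "continuous_on UNIV g" and gT: "\<And>x. x \<ge> T \<Longrightarrow> g x = g T" and gB: "\<And>x. \<bar>g x\<bar> \<le> B"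
  and gW: "g \<in> WT_inf (1 - b) T"
 shows "((\<lambda>e. LBINT t. f t * steklov_rate e g t) \<longlongrightarrow> stieltjes_integral_order b T f g) (at_right 0)"
proof -
 have gm [measurable]: "g \<in> \<B>" using g by (rule borel_measurable_continuous_onI)
 define h where "h u = g u - g T" for u
 have hc: "continuous_on UNIV h" unfolding h_def by (intro continuous_intros g)
 have hm [measurable]: "h \<in> \<B>" unfolding h_def by measurable
 have h0: "h x = 0" if "x \<ge> T" for x using gT[OF that] unfolding h_def by linarith
 have hB: "\<bar>h x\<bar> \<le> 2 * B" for x using gB[of x] gB[of T] unfolding h_def by linarith
 obtain M where M0: "M \<ge> 0" and M: "\<And>x. x > 0 \<Longrightarrow> right_diff_abs (1 - b) h x \<le> ennreal M"
  using WT_inf_right_diff_abs[OF g gT _ T gW] b unfolding h_def by auto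
 note eq = stieltjes_order_eq[OF T b fm f0 W g gT gW]
 note fi = eq(1) and fin = eq(2)
 define a where "a t = ind {0<..<T} t * left_diff b f t" for t
 have am [measurable]: "a \<in> \<B>" unfolding a_def by measurable
 have ai: "integrable lborel a" using eq(3) unfolding a_def[abs_def] .
 define u where "u = right_diff (1 - b) h"
 have um [measurable]: "u \<in> \<B>" unfolding u_def by measurable
 have uM: "\<bar>u t\<bar> \<le> M" if "t > 0" for t
 proof -
  have "eabs (u t) \<le> ennreal M" unfolding u_def by (rule order_trans[OF right_diff_le_abs[OF hm] M[OF that]])
  then show ?thesis using M0 by (subst (asm) ennreal_le_iff) auto
 qed
 define \<kappa> where "\<kappa> = (b / Gamma (1 - b)) * ((1 - b) / Gamma b)"
 have order_eq: "stieltjes_integral_order b T f g = - \<kappa> * (LBINT t. a t * u t)"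
  using eq(4) unfolding \<kappa>_def a_def u_def h_def[abs_def] .
 have G: "Gamma b > 0" "Gamma (1 - b) > 0" using b by (auto intro: Gamma_real_pos)
 \<comment> \<open>For fixed e the averaged integrator is smooth enough for an exact identity; only
   the right side then needs a limit.\<close>
 have rate: "(LBINT t. f t * steklov_rate e g t) = - \<kappa> * (LBINT t. a t * steklov e (steklov e u) t)" if e: "e > 0" for e
 proof -
  let ?p = "steklov_rate e h"
  interpret I1: C1_vanishing T "2 * (2 * B) / e" "steklov e (steklov e h)" ?p
   by (rule steklov_rate_C1(1)[OF hc e T hB h0])
  interpret I2: C1_vanishing T "4 * (2 * B) / e^2" ?p "\<lambda>t. ((h (t + e + e) - h (t + e)) / e - (h (t + e) - h t) / e) / e"
   by (rule steklov_rate_C1(2)[OF hc e T hB h0])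
  have rd: "right_diff (1 - b) (steklov e (steklov e h)) t = steklov e (steklov e u) t" if t: "t > 0" for t
  proof -
   have M': "right_diff_abs (1 - b) (steklov e h) x \<le> ennreal M" if "x > 0" for x
    by (rule right_diff_steklov(2)[OF hm hB e that M])
   have "right_diff (1 - b) (steklov e (steklov e h)) t = steklov e (right_diff (1 - b) (steklov e h)) t"
    by (rule right_diff_steklov(1)[OF _ steklov_bound[OF hm e hB] e t M']) measurable
   also have "\<dots> = steklov e (steklov e u) t"
    unfolding u_def using t by (intro steklov_cong right_diff_steklov(1)[OF hm hB e _ M]) auto
   finally show ?thesis .
  qed
  have pot: "right_diff (1 - b) (steklov e (steklov e h)) t = - (1 / (1 - b)) * I2.potential b t" if "t \<ge> 0" for t
   using I1.right_diff_eq[of "1 - b" t] b that unfolding I2.potential_def by simp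
  have "(LBINT t. a t * steklov e (steklov e u) t) = (LBINT t. - (1 / (1 - b)) * (ind {0<..<T} t * left_diff b f t * I2.potential b t))"
  proof (rule Bochner_Integration.integral_cong[OF refl])
   fix t
   show "a t * steklov e (steklov e u) t = - (1 / (1 - b)) * (ind {0<..<T} t * left_diff b f t * I2.potential b t)"
   proof (cases "t \<in> {0<..<T}")
    case True
    then have "steklov e (steklov e u) t = - (1 / (1 - b)) * I2.potential b t" using rd[of t] pot[of t] by simp
    then show ?thesis by (simp add: a_def)
   qed (simp add: a_def)
  qed
  also have "\<dots> = - (1 / (1 - b)) * (LBINT t. ind {0<..<T} t * left_diff b f t * I2.potential b t)"
   by simp
  also have "(LBINT t. ind {0<..<T} t * left_diff b f t * I2.potential b t) = (LBINT t. f t * right_diff b (I2.potential b) t)"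
   by (rule left_diff_duality[OF b fm I2.potential_borel f0 fi fin I2.potential_zero I2.potential_bound[OF b(1)] I2.potential_lipschitz[OF b(1)]])
  also have "\<dots> = (LBINT t. Beta b (1 - b) / b * (f t * ?p t))"
  proof (rule Bochner_Integration.integral_cong[OF refl])
   fix t
   show "f t * right_diff b (I2.potential b) t = Beta b (1 - b) / b * (f t * ?p t)"
    using I2.right_diff_potential_eq[OF b, of t] f0[of t] by (cases "t \<ge> 0") auto
  qed
  finally have X: "(LBINT t. a t * steklov e (steklov e u) t) = - (1 / (1 - b)) * (Beta b (1 - b) / b * (LBINT t. f t * ?p t))"
   by simp
  \<comment> \<open>Beta b (1 - b) is Gamma b * Gamma (1 - b), as Gamma 1 = 1, so all constants
    cancel.\<close>
  have \<kappa>: "\<kappa> * ((1 / (1 - b)) * (Beta b (1 - b) / b)) = 1"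
   unfolding \<kappa>_def Beta_def using b G[THEN less_imp_neq] by (simp add: field_simps)
  have "- \<kappa> * (LBINT t. a t * steklov e (steklov e u) t) = \<kappa> * ((1 / (1 - b)) * (Beta b (1 - b) / b)) * (LBINT t. f t * ?p t)"
   unfolding X by (simp only: minus_mult_minus mult_minus_left mult.assoc)
  then have "- \<kappa> * (LBINT t. a t * steklov e (steklov e u) t) = (LBINT t. f t * ?p t)"
   unfolding \<kappa> by simp
  moreover have "?p = steklov_rate e g"
  proof
   fix t
   have "steklov e h x = steklov e g x - g T" for x
    unfolding h_def by (rule steklov_minus_const[OF gm gB e])
   then show "?p t = steklov_rate e g t" unfolding steklov_rate_def by simp
  qed
  ultimately show ?thesis by simp
 qed
 have conv: "((\<lambda>e. LBINT t. a t * steklov e (steklov e u) t) \<longlongrightarrow> (LBINT t. a t * u t)) (at_right 0)"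
 proof (rule tendstoI)
  fix \<epsilon> :: real assume \<epsilon>: "\<epsilon> > 0"
  \<comment> \<open>Each of the two averages costs at most M w, hence at most \<epsilon>/4; the
    summand 1 covers M = 0.\<close>
  define w where "w = \<epsilon> / (4 * (M + 1))"
  have w: "w > 0" using \<epsilon> M0 by (simp add: w_def)
  obtain d where d: "d > 0" "\<And>r. norm r < d \<Longrightarrow> (NBINT x. eabs (a (x + r) - a x)) \<le> ennreal w"
   using L1_translation_uniform[OF ai, of "ennreal w"] w by auto
  have "\<forall>\<^sub>F e in at_right 0. e \<in> {0<..<d}" using eventually_at_rightI[of 0 d "\<lambda>e. e \<in> {0<..<d}"] d(1) by blast
  then show "\<forall>\<^sub>F e in at_right 0. dist (LBINT t. a t * steklov e (steklov e u) t) (LBINT t. a t * u t) < \<epsilon>"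
  proof eventually_elim
   case (elim e)
   then have e: "e > 0" "e < d" by auto
   have a0: "a t = 0" if "t \<le> 0" for t using that by (simp add: a_def)
   have ww: "(NBINT t. eabs (a (t - r) - a t)) \<le> ennreal w" if "0 < r" "r < e" for r
    using d(2)[of "-r"] that e by simp
   have "\<bar>(LBINT t. a t * steklov e u t) - (LBINT t. a t * u t)\<bar> \<le> M * w"
    by (rule integral_steklov_approx[OF ai a0 um uM e(1) ww]) (use w in auto)
   moreover have "\<bar>(LBINT t. a t * steklov e (steklov e u) t) - (LBINT t. a t * steklov e u t)\<bar> \<le> M * w"
   proof (rule integral_steklov_approx[OF ai a0 _ _ e(1) ww])
    show "\<bar>steklov e u t\<bar> \<le> M" if "t > 0" for t
     using that by (intro steklov_bound[OF um e(1)] uM) auto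
   qed (use w in auto)
   ultimately have "dist (LBINT t. a t * steklov e (steklov e u) t) (LBINT t. a t * u t) \<le> 2 * (M * w)"
    by (simp add: dist_real_def)
   also have "M * w \<le> \<epsilon> / 4" using M0 \<epsilon> by (simp add: w_def field_simps)
   finally show ?case using \<epsilon> by linarith
  qed
 qed
 have "((\<lambda>e. - \<kappa> * (LBINT t. a t * steklov e (steklov e u) t)) \<longlongrightarrow> stieltjes_integral_order b T f g) (at_right 0)"
  unfolding order_eq by (intro tendsto_intros conv)
 then show ?thesis
  by (rule Lim_transform_eventually) (use rate in \<open>auto intro!: eventually_at_rightI[of 0 1]\<close>)
qed

text \<open>The right difference of g is bounded, so the integral is controlled by the L1 norm of
  the left difference of f.\<close>

lemma stieltjes_order_bound:
 fixes g :: "real \<Rightarrow> real"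
 assumes T: "T > 0" and b: "0 < b" "b < 1"
  and g: "continuous_on UNIV g" and gT: "\<And>x. x \<ge> T \<Longrightarrow> g x = g T" and gW: "g \<in> WT_inf (1 - b) T"
 obtains K where "K \<ge> 0" "\<And>f. f \<in> \<B> \<Longrightarrow> (\<And>x. x \<notin> {0<..<T} \<Longrightarrow> f x = 0) \<Longrightarrow> f \<in> W0_1 b T \<Longrightarrow>
   eabs (stieltjes_integral_order b T f g) \<le> ennreal K * (gagliardo b T f + ennreal (1/b) * hardy_norm b T f)"
proof -
 have gm [measurable]: "g \<in> \<B>" using g by (rule borel_measurable_continuous_onI)
 define h where "h u = g u - g T" for u
 have hm [measurable]: "h \<in> \<B>" unfolding h_def by measurable
 obtain M where M0: "M \<ge> 0" and M: "\<And>x. x > 0 \<Longrightarrow> right_diff_abs (1 - b) h x \<le> ennreal M"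
  using WT_inf_right_diff_abs[OF g gT _ T gW] b unfolding h_def by auto
 define u where "u = right_diff (1 - b) h"
 have um [measurable]: "u \<in> \<B>" unfolding u_def by measurable
 have uM: "\<bar>u t\<bar> \<le> M" if "t > 0" for t
 proof -
  have "eabs (u t) \<le> ennreal M" unfolding u_def by (rule order_trans[OF right_diff_le_abs[OF hm] M[OF that]])
  then show ?thesis using M0 by (subst (asm) ennreal_le_iff) auto
 qed
 define \<kappa> where "\<kappa> = (b / Gamma (1 - b)) * ((1 - b) / Gamma b)"
 have "eabs (stieltjes_integral_order b T f g) \<le> ennreal (\<bar>\<kappa>\<bar> * M) * (gagliardo b T f + ennreal (1/b) * hardy_norm b T f)"
  if fm [measurable]: "f \<in> \<B>" and f0: "\<And>x. x \<notin> {0<..<T} \<Longrightarrow> f x = 0" and W: "f \<in> W0_1 b T" for f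
 proof -
  note eq = stieltjes_order_eq[OF T b fm f0 W g gT gW]
  define a where "a t = ind {0<..<T} t * left_diff b f t" for t
  have am [measurable]: "a \<in> \<B>" unfolding a_def by measurable
  have o: "stieltjes_integral_order b T f g = - \<kappa> * (LBINT t. a t * u t)"
   using eq(4) unfolding \<kappa>_def a_def u_def h_def[abs_def] .
  have "eabs (stieltjes_integral_order b T f g) = eabs \<kappa> * eabs (LBINT t. a t * u t)"
   unfolding o by (simp add: abs_mult ennreal_mult)
  also have "\<dots> \<le> eabs \<kappa> * (NBINT t. ennreal (norm (a t * u t)))"
   using integral_norm_bound_ennreal[of lborel "\<lambda>t. a t * u t"]
   by (cases "integrable lborel (\<lambda>t. a t * u t)") (auto simp: not_integrable_integral_eq intro!: mult_left_mono)
  also have "\<dots> \<le> eabs \<kappa> * (NBINT t. ennreal M * eabs (a t))"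
  proof (intro mult_left_mono nn_integral_mono)
   fix t
   have "\<bar>a t\<bar> * \<bar>u t\<bar> \<le> \<bar>a t\<bar> * M"
    using uM[of t] by (cases "t > 0") (auto simp: a_def intro!: mult_left_mono)
   then show "ennreal (norm (a t * u t)) \<le> ennreal M * eabs (a t)"
    using M0 by (simp add: abs_mult mult.commute ennreal_leI flip: ennreal_mult)
  qed simp
  also have "\<dots> = eabs \<kappa> * (ennreal M * (NBINT t. eabs (a t)))" by (subst nn_integral_cmult) auto
  also have "\<dots> \<le> eabs \<kappa> * (ennreal M * (gagliardo b T f + ennreal (1/b) * hardy_norm b T f))"
   using eq(5) unfolding a_def by (intro mult_left_mono) auto
  also have "\<dots> = ennreal (\<bar>\<kappa>\<bar> * M) * (gagliardo b T f + ennreal (1/b) * hardy_norm b T f)"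
   using M0 by (simp add: ennreal_mult mult.assoc)
  finally show ?thesis .
 qed
 then show ?thesis using that[of "\<bar>\<kappa>\<bar> * M"] M0 by auto
qed

section \<open>A fractional Hardy inequality and indicator cut-offs\<close>

lemma powr_average_exponent:
 fixes b :: real
 assumes "0 < b" "b < 1"
 obtains M where "M \<ge> 4" "M powr b = M / 4"
proof
 \<comment> \<open>Averaging over ((M - 1) r, M r) multiplies the Hardy integral by M powr b / (M -
   1). As b < 1 this can be made small: with M powr b = M / 4 it is (M / 4) / (M - 1), at most 1/3
   for M \<ge> 4.\<close>
 define M :: real where "M = 4 powr (1 / (1 - b))"
 have "1 \<le> 1 / (1 - b)" using assms by (simp add: field_simps)
 then have "4 powr 1 \<le> M" unfolding M_def by (intro powr_mono) auto
 then show "M \<ge> 4" by simp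
 have "M powr (1 - b) = 4" unfolding M_def using assms by (simp add: powr_powr)
 moreover have "M powr b * M powr (1 - b) = M" using \<open>M \<ge> 4\<close> by (simp flip: powr_add)
 ultimately show "M powr b = M / 4" by simp
qed

text \<open>The value \<open>f(r)\<close> is compared with its average over \<open>((M - 1) r, M r)\<close>,
 where \<open>M\<close> is so large that the averaged term can be absorbed.\<close>

lemma fractional_hardy:
 fixes a b :: real
 assumes b: "0 < b" "b < 1" and a: "a > 0"
 obtains C where "C \<ge> 0" "\<And>f. f \<in> \<B> \<Longrightarrow>
   hardy_norm b a f \<le> ennreal C * ((NBINT t. ennreal (ind {0<..<a} t * \<bar>f t\<bar>)) + gagliardo b a f)"
proof -
 obtain M where M: "M \<ge> 4" "M powr b = M / 4" using powr_average_exponent[OF b] by blast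
 \<comment> \<open>For 0 < r < c the averaging interval ((M - 1) r, M r) stays inside (0,
   a).\<close>
 define c where "c = a / M"
 have c: "0 < c" "c * M = a" "c < a" using a M by (auto simp: c_def field_simps)
 \<comment> \<open>The first entry bounds the weight on [c, a); the second converts r powr (-1-b)
   into the Gagliardo kernel, since |r - u| \<le> (M - 1) r.\<close>
 define K where "K = max (c powr (-b)) ((M - 1) powr (1 + b))"
 have K0: "K > 0" using c by (simp add: K_def less_max_iff_disj)
 have KK: "c powr (-b) \<le> K" "(M - 1) powr (1 + b) \<le> K" by (auto simp: K_def)
 have main: "hardy_norm b a f \<le> ennreal (3 * K) * ((NBINT t. ennreal (ind {0<..<a} t * \<bar>f t\<bar>)) + gagliardo b a f)"
  if fm [measurable]: "f \<in> \<B>" for f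
 proof (cases "(NBINT t. ennreal (ind {0<..<a} t * \<bar>f t\<bar>)) = \<infinity>")
  case True
  then show ?thesis using K0 by (simp add: ennreal_mult_eq_top_iff ennreal_mult_top)
 next
  case False
  define I where "I = (NBINT t. ennreal (ind {0<..<a} t * \<bar>f t\<bar>))"
  have If: "I \<noteq> top" using False by (simp add: I_def)
  \<comment> \<open>The cut-off at d makes \<open>J d\<close> finite, so that a third of it can be
    absorbed on the left; d tends to 0 by monotone convergence.\<close>
  define J where "J d = (NBINT r. ennreal (ind {d<..<c} r * (\<bar>f r\<bar> * r powr (-b))))" for d
  have J: "J d \<le> ennreal (2 * K) * (I + gagliardo b a f)" if d: "d > 0" for d
  proof -
   \<comment> \<open>The interval has length r, so r powr (-1-b) integrates over u to the weight r
     powr (-b). The indicators are written through differences to be visibly measurable in the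
     pair.\<close>
   define A where "A r u = ind {d<..<c} r * (ind {0<..} (u - (M - 1) * r) * ind {0<..} (M * r - u)) * r powr (-1-b)" for r u :: real
   have [measurable]: "(\<lambda>(r, u). A r u) \<in> borel_measurable (borel \<Otimes>\<^sub>M borel)" unfolding A_def by measurable
   have A0: "A r u \<ge> 0" for r u unfolding A_def by simp
   have Aset: "ind {0<..} (u - (M - 1) * r) * ind {0<..} (M * r - u) = (ind {(M-1)*r<..<M*r} u :: real)" for r u :: real
    by (auto split: split_indicator)
   have "J d \<le> (NBINT r. NBINT u. ennreal (A r u * \<bar>f u\<bar>) + ennreal (A r u * \<bar>f r - f u\<bar>))"
    unfolding J_def
   proof (rule nn_integral_mono)
    fix r :: real
    show "ennreal (ind {d<..<c} r * (\<bar>f r\<bar> * r powr (-b))) \<le> (NBINT u. ennreal (A r u * \<bar>f u\<bar>) + ennreal (A r u * \<bar>f r - f u\<bar>))"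
    proof (cases "r \<in> {d<..<c}")
     case True
     then have r: "r > 0" using d by simp
     have "ennreal (ind {d<..<c} r * (\<bar>f r\<bar> * r powr (-b))) = ennreal (\<bar>f r\<bar> * r powr (-1-b)) * ennreal r"
      using True r powr_add[of r "-1-b" 1] by (simp add: ennreal_mult[symmetric] mult.assoc)
     also have "\<dots> = (NBINT u. ennreal (\<bar>f r\<bar> * r powr (-1-b)) * ind {(M-1)*r<..<M*r} u)"
      using r by (subst nn_integral_cmult) (auto simp: algebra_simps)
     also have "\<dots> \<le> (NBINT u. ennreal (A r u * \<bar>f u\<bar>) + ennreal (A r u * \<bar>f r - f u\<bar>))"
     proof (rule nn_integral_mono)
      fix u
      have "r powr (-1-b) * \<bar>f r\<bar> \<le> r powr (-1-b) * (\<bar>f u\<bar> + \<bar>f r - f u\<bar>)" by (intro mult_left_mono) auto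
      then show "ennreal (\<bar>f r\<bar> * r powr (-1-b)) * ind {(M-1)*r<..<M*r} u \<le> ennreal (A r u * \<bar>f u\<bar>) + ennreal (A r u * \<bar>f r - f u\<bar>)"
       using True unfolding A_def Aset
       by (auto simp: ennreal_plus[symmetric] distrib_left mult.commute simp del: ennreal_plus intro!: ennreal_leI split: split_indicator)
     qed
     finally show ?thesis .
    qed simp
   qed
   also have "\<dots> = (NBINT r. NBINT u. ennreal (A r u * \<bar>f u\<bar>)) + (NBINT r. NBINT u. ennreal (A r u * \<bar>f r - f u\<bar>))"
    by (simp add: nn_integral_add)
   also have "(NBINT r. NBINT u. ennreal (A r u * \<bar>f u\<bar>)) = (NBINT u. NBINT r. ennreal (A r u * \<bar>f u\<bar>))"
    by (intro lborel_pair.Fubini') measurable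
   also have "\<dots> \<le> (NBINT u. ennreal (1/3) * (ennreal (ind {d<..<c} u * (\<bar>f u\<bar> * u powr (-b))) + ennreal K * ennreal (ind {0<..<a} u * \<bar>f u\<bar>)))"
   proof (rule nn_integral_mono)
    fix u :: real
    show "(NBINT r. ennreal (A r u * \<bar>f u\<bar>)) \<le> ennreal (1/3) * (ennreal (ind {d<..<c} u * (\<bar>f u\<bar> * u powr (-b))) + ennreal K * ennreal (ind {0<..<a} u * \<bar>f u\<bar>))"
    proof (cases "d < u \<and> u < a")
     case True
     then have u: "u > 0" using d by simp
     have "(NBINT r. ennreal (A r u * \<bar>f u\<bar>)) \<le> (NBINT r. ennreal (\<bar>f u\<bar> * (u / M) powr (-1-b)) * ind {u / M<..<u / (M-1)} r)"
     proof (rule nn_integral_mono)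
      fix r :: real
      have "A r u * \<bar>f u\<bar> \<le> \<bar>f u\<bar> * (u / M) powr (-1-b)" if "A r u \<noteq> 0"
      proof -
       have r: "u / M < r" "u < M * r" using that M d unfolding A_def Aset by (auto simp: field_simps split: split_indicator_asm)
       then have "r powr (-1-b) \<le> (u / M) powr (-1-b)" using u M b by (intro powr_mono2') auto
       then have "A r u \<le> (u / M) powr (-1-b)" unfolding A_def by (auto split: split_indicator)
       then show ?thesis by (subst mult.commute) (intro mult_left_mono, auto)
      qed
      moreover have "r \<in> {u / M<..<u / (M-1)}" if "A r u \<noteq> 0"
       using that M d unfolding A_def Aset by (auto simp: field_simps split: split_indicator_asm)
      ultimately show "ennreal (A r u * \<bar>f u\<bar>) \<le> ennreal (\<bar>f u\<bar> * (u / M) powr (-1-b)) * ind {u / M<..<u / (M-1)} r"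
       by (cases "A r u = 0") (auto intro!: ennreal_leI)
     qed
     also have "\<dots> = ennreal (\<bar>f u\<bar> * (u / M) powr (-1-b)) * ennreal (u / (M-1) - u / M)"
      using u M by (subst nn_integral_cmult) (auto simp: divide_left_mono)
     also have "\<dots> = ennreal (\<bar>f u\<bar> * (u / M) powr (-1-b) * (u / (M-1) - u / M))"
      using u M by (subst ennreal_mult) (auto simp: divide_left_mono)
     also have "\<dots> \<le> ennreal ((1/3) * (\<bar>f u\<bar> * u powr (-b)))"
     proof (rule ennreal_leI)
      have "(u / M) powr (-1-b) = u powr (-1-b) * M powr (1 + b)"
       using u M powr_add[of M "1 + b" "-1-b"] by (simp add: powr_divide field_simps)
      also have "M powr (1 + b) = M * (M / 4)" using M by (simp add: powr_add)
      finally have eq: "(u / M) powr (-1-b) = u powr (-1-b) * (M * (M / 4))" .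
      have D: "u / (M-1) - u / M = u * (1 / (M-1) - 1 / M)" by (simp add: right_diff_distrib)
      have "(u / M) powr (-1-b) * (u / (M-1) - u / M) = (u powr (-1-b) * u) * (M * (M/4) * (1 / (M-1) - 1 / M))"
       unfolding eq D by (simp only: mult_ac)
      also have "u powr (-1-b) * u = u powr (-b)" using u powr_add[of u "-1-b" 1] by simp
      also have "M * (M/4) * (1 / (M-1) - 1 / M) = (M / 4) / (M - 1)" using M by (simp add: field_simps)
      also have "u powr (-b) * ((M / 4) / (M - 1)) \<le> u powr (-b) * (1/3)" using M by (intro mult_left_mono) (auto simp: field_simps)
      finally have "\<bar>f u\<bar> * ((u / M) powr (-1-b) * (u / (M-1) - u / M)) \<le> \<bar>f u\<bar> * (u powr (-b) * (1/3))"
       by (intro mult_left_mono) auto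
      then show "\<bar>f u\<bar> * (u / M) powr (-1-b) * (u / (M-1) - u / M) \<le> (1/3) * (\<bar>f u\<bar> * u powr (-b))" by (simp add: mult.assoc)
     qed
     also have "\<dots> \<le> ennreal ((1/3) * (ind {d<..<c} u * (\<bar>f u\<bar> * u powr (-b)) + K * (ind {0<..<a} u * \<bar>f u\<bar>)))"
     proof (intro ennreal_leI mult_left_mono)
      show "\<bar>f u\<bar> * u powr (-b) \<le> ind {d<..<c} u * (\<bar>f u\<bar> * u powr (-b)) + K * (ind {0<..<a} u * \<bar>f u\<bar>)"
      proof (cases "u < c")
       case False
       then have "u powr (-b) \<le> c powr (-b)" using c b by (intro powr_mono2') auto
       also have "\<dots> \<le> K" by (rule KK)
       finally have "\<bar>f u\<bar> * u powr (-b) \<le> \<bar>f u\<bar> * K" by (intro mult_left_mono) auto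
       then show ?thesis using False True u by (simp add: mult.commute)
      qed (use True K0 in \<open>auto split: split_indicator\<close>)
     qed simp
     also have "\<dots> = ennreal (1/3) * (ennreal (ind {d<..<c} u * (\<bar>f u\<bar> * u powr (-b))) + ennreal K * ennreal (ind {0<..<a} u * \<bar>f u\<bar>))"
     proof -
      have "ennreal ((1/3) * (x + K * y)) = ennreal (1/3) * (ennreal x + ennreal K * ennreal y)" if "x \<ge> 0" "y \<ge> 0" for x y
       using that K0 by (simp only: ennreal_mult[symmetric] ennreal_plus[symmetric] less_imp_le mult_nonneg_nonneg add_nonneg_nonneg divide_nonneg_nonneg zero_le_one zero_le_numeral)
      then show ?thesis by simp
     qed
     finally show ?thesis .
    next
     case False
     have "A r u = 0" for r
     proof (rule ccontr)
      assume "A r u \<noteq> 0"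
      then have r: "d < r" "r < c" "(M - 1) * r < u" "u < M * r" unfolding A_def Aset by (auto split: split_indicator_asm)
      have "r * 1 \<le> r * (M - 1)" using r d M by (intro mult_left_mono) auto
      moreover have "M * r \<le> M * c" using r M by (intro mult_left_mono) auto
      ultimately show False using False r c by (simp add: mult.commute)
     qed
     then show ?thesis by simp
    qed
   qed
   also have "\<dots> = ennreal (1/3) * (J d + ennreal K * I)"
    unfolding J_def I_def by (simp add: nn_integral_cmult nn_integral_add)
   also have "(NBINT r. NBINT u. ennreal (A r u * \<bar>f r - f u\<bar>)) \<le> (NBINT r. NBINT u. ennreal K * ennreal (ind {0<..<a} r * ind {0<..<a} u * (\<bar>f r - f u\<bar> / \<bar>r - u\<bar> powr (1 + b))))"
   proof (intro nn_integral_mono)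
    fix r u :: real
    show "ennreal (A r u * \<bar>f r - f u\<bar>) \<le> ennreal K * ennreal (ind {0<..<a} r * ind {0<..<a} u * (\<bar>f r - f u\<bar> / \<bar>r - u\<bar> powr (1 + b)))"
    proof (cases "A r u = 0")
     case False
     then have r: "d < r" "r < c" "(M - 1) * r < u" "u < M * r" unfolding A_def Aset by (auto split: split_indicator_asm)
     have r3: "r * 3 \<le> r * (M - 1)" using r d M by (intro mult_left_mono) auto
     have rc: "M * r \<le> M * c" using r M by (intro mult_left_mono) auto
     have ru: "0 < r" "r < u" "u < a" "u - r \<le> (M - 1) * r"
      using r3 rc r c d mult.commute[of r "M - 1"] mult.commute[of M c] left_diff_distrib[of M 1 r] by linarith+
     have Ar: "A r u = r powr (-1-b)" using r unfolding A_def Aset by simp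
     have "(u - r) powr (1 + b) \<le> ((M - 1) * r) powr (1 + b)" using ru b by (intro powr_mono2) auto
     also have "\<dots> = (M - 1) powr (1 + b) * r powr (1 + b)" using ru M by (simp add: powr_mult)
     also have "\<dots> \<le> K * r powr (1 + b)" by (intro mult_right_mono KK) auto
     finally have "1 / r powr (1 + b) \<le> K / (u - r) powr (1 + b)" using ru by (simp add: field_simps)
     moreover have "r powr (-1-b) = 1 / r powr (1 + b)" using powr_minus_divide[of r "1 + b"] by (simp add: minus_diff_commute)
     ultimately have "r powr (-1-b) * \<bar>f r - f u\<bar> \<le> K / (u - r) powr (1 + b) * \<bar>f r - f u\<bar>" by (intro mult_right_mono) auto
     then show ?thesis unfolding Ar using ru K0 by (simp add: ennreal_mult[symmetric] ennreal_leI)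
    qed simp
   qed
   also have "\<dots> = ennreal K * gagliardo b a f" unfolding gagliardo_def by (simp add: nn_integral_cmult)
   finally have le: "J d \<le> ennreal (1/3) * (J d + ennreal K * I) + ennreal K * gagliardo b a f"
    by (simp add: add_left_mono add_right_mono)
   have Jf: "J d \<noteq> top"
   proof -
    have "J d \<le> (NBINT r. ennreal (d powr (-b)) * ennreal (ind {0<..<a} r * \<bar>f r\<bar>))"
     unfolding J_def
    proof (rule nn_integral_mono)
     fix r :: real
     have "\<bar>f r\<bar> * r powr (-b) \<le> \<bar>f r\<bar> * d powr (-b)" if "d < r" using that d b by (intro mult_left_mono powr_mono2') auto
     then show "ennreal (ind {d<..<c} r * (\<bar>f r\<bar> * r powr (-b))) \<le> ennreal (d powr (-b)) * ennreal (ind {0<..<a} r * \<bar>f r\<bar>)"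
      using d c by (auto simp: ennreal_mult[symmetric] mult.commute intro!: ennreal_leI split: split_indicator)
    qed
    also have "\<dots> = ennreal (d powr (-b)) * I" unfolding I_def by (simp add: nn_integral_cmult)
    also have "\<dots> < top" using If by (simp add: ennreal_mult_less_top less_top)
    finally show ?thesis by simp
   qed
   show ?thesis
   proof (cases "gagliardo b a f = top")
    case True
    then show ?thesis using K0 by (simp add: ennreal_mult_top)
   next
    case False
    define j where "j = enn2real (J d)"
    define i where "i = enn2real I"
    define g where "g = enn2real (gagliardo b a f)"
    have e: "J d = ennreal j" "I = ennreal i" "gagliardo b a f = ennreal g" "j \<ge> 0" "i \<ge> 0" "g \<ge> 0"
     using Jf If False by (auto simp: j_def i_def g_def less_top)
    have "j \<le> (1/3) * (j + K * i) + K * g"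
     using le e K0 by (simp add: ennreal_mult[symmetric] ennreal_plus[symmetric] del: ennreal_plus)
    moreover have "K * i \<ge> 0" "K * g \<ge> 0" using K0 e by auto
    moreover have "j \<le> 2 * x + 2 * y" if "j \<le> (1/3) * (j + x) + y" "0 \<le> x" "0 \<le> y" for x y
     using that by (simp add: field_simps)
    ultimately have "j \<le> 2 * (K * i) + 2 * (K * g)" by blast
    then have "j \<le> 2 * K * (i + g)" by (simp add: distrib_left mult.assoc)
    then show ?thesis using e K0 by (simp add: ennreal_mult[symmetric] ennreal_plus[symmetric] del: ennreal_plus)
   qed
  qed
  have J0: "J 0 \<le> ennreal (2 * K) * (I + gagliardo b a f)"
  proof -
   define v where "v n r = ennreal (ind {inverse (real (Suc n))<..<c} r * (\<bar>f r\<bar> * r powr (-b)))" for n r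
   have "incseq v"
   proof (rule incseq_SucI, rule le_funI)
    fix n r
    have le: "inverse (real (Suc (Suc n))) \<le> inverse (real (Suc n))" by simp
    show "v n r \<le> v (Suc n) r"
    proof (cases "inverse (real (Suc n)) < r")
     case True
     with le have "inverse (real (Suc (Suc n))) < r" by (rule order_le_less_trans)
     with True have "v n r = v (Suc n) r" unfolding v_def by (simp add: indicator_def del: of_nat_Suc)
     then show ?thesis by simp
    qed (simp add: v_def del: of_nat_Suc)
   qed
   have vS: "(SUP n. v n r) = ennreal (ind {0<..<c} r * (\<bar>f r\<bar> * r powr (-b)))" for r
   proof (rule antisym)
    show "(SUP n. v n r) \<le> ennreal (ind {0<..<c} r * (\<bar>f r\<bar> * r powr (-b)))"
    proof (rule SUP_least)
     fix n
     have p: "0 < inverse (real (Suc n))" by simp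
     show "v n r \<le> ennreal (ind {0<..<c} r * (\<bar>f r\<bar> * r powr (-b)))"
     proof (cases "inverse (real (Suc n)) < r")
      case True
      with p have "0 < r" by (rule less_trans)
      with True show ?thesis by (simp add: v_def indicator_def del: of_nat_Suc)
     qed (simp add: v_def del: of_nat_Suc)
    qed
    show "ennreal (ind {0<..<c} r * (\<bar>f r\<bar> * r powr (-b))) \<le> (SUP n. v n r)"
    proof (cases "r \<in> {0<..<c}")
     case True
     then obtain n where "inverse (real (Suc n)) < r" using reals_Archimedean by auto
     then have "v n r = ennreal (ind {0<..<c} r * (\<bar>f r\<bar> * r powr (-b)))" using True by (simp add: v_def)
     then show ?thesis by (metis SUP_upper UNIV_I)
    qed simp
   qed
   have "J 0 = (NBINT r. (SUP n. v n r))" unfolding vS J_def ..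
   also have "\<dots> = (SUP n. NBINT r. v n r)"
    by (intro nn_integral_monotone_convergence_SUP \<open>incseq v\<close>) (simp add: v_def)
   also have "\<dots> \<le> ennreal (2 * K) * (I + gagliardo b a f)"
    using J unfolding J_def v_def by (intro SUP_least) simp
   finally show ?thesis .
  qed
  have "hardy_norm b a f \<le> (NBINT r. ennreal (ind {0<..<c} r * (\<bar>f r\<bar> * r powr (-b))) + ennreal K * ennreal (ind {0<..<a} r * \<bar>f r\<bar>))"
   unfolding hardy_norm_def
  proof (rule nn_integral_mono)
   fix r :: real
   show "ennreal (ind {0<..<a} r * (\<bar>f r\<bar> / r powr b)) \<le> ennreal (ind {0<..<c} r * (\<bar>f r\<bar> * r powr (-b))) + ennreal K * ennreal (ind {0<..<a} r * \<bar>f r\<bar>)"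
   proof (cases "r \<in> {0<..<a} \<and> r \<ge> c")
    case True
    then have "r powr (-b) \<le> c powr (-b)" using c b by (intro powr_mono2') auto
    also have "\<dots> \<le> K" by (rule KK)
    finally have "\<bar>f r\<bar> * r powr (-b) \<le> \<bar>f r\<bar> * K" by (intro mult_left_mono) auto
    then show ?thesis using True K0 by (simp add: ennreal_mult[symmetric] powr_minus_divide mult.commute ennreal_leI)
   next
    case False
    then have "ennreal (ind {0<..<a} r * (\<bar>f r\<bar> / r powr b)) \<le> ennreal (ind {0<..<c} r * (\<bar>f r\<bar> * r powr (-b)))"
     by (intro ennreal_leI) (auto simp: powr_minus_divide split: split_indicator)
    then show ?thesis by (rule order_trans) simp
   qed
  qed
  also have "\<dots> = J 0 + ennreal K * I" unfolding J_def I_def by (simp add: nn_integral_add nn_integral_cmult)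
  also have "\<dots> \<le> ennreal (2 * K) * (I + gagliardo b a f) + ennreal K * (I + gagliardo b a f)"
   by (intro add_mono J0 mult_left_mono) auto
  also have "\<dots> = ennreal (3 * K) * (I + gagliardo b a f)"
   using K0 by (simp add: distrib_right[symmetric] ennreal_plus[symmetric] del: ennreal_plus)
  finally show ?thesis unfolding I_def .
 qed
 show ?thesis by (rule that[of "3 * K"]) (use main K0 in auto)
qed

lemma gagliardo_reflect:
 assumes [measurable]: "f \<in> \<B>"
 shows "gagliardo b a (\<lambda>r. f (a - r)) = gagliardo b a f"
proof -
 define k where "k t u = ennreal (ind {0<..<a} t * ind {0<..<a} u * (\<bar>f t - f u\<bar> / \<bar>t - u\<bar> powr (1 + b)))" for t u
 have [measurable]: "(\<lambda>(t, u). k t u) \<in> borel_measurable (borel \<Otimes>\<^sub>M borel)" unfolding k_def by measurable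
 have "gagliardo b a (\<lambda>r. f (a - r)) = (NBINT t. NBINT u. k (a - t) (a - u))"
  unfolding gagliardo_def k_def
  by (intro nn_integral_cong arg_cong[of _ _ ennreal]) (auto simp: abs_minus_commute split: split_indicator)
 also have "\<dots> = (NBINT t. NBINT u. k (a - t) u)"
  by (intro nn_integral_cong nn_integral_lborel_reflect) measurable
 also have "\<dots> = (NBINT t. NBINT u. k t u)"
  by (rule nn_integral_lborel_reflect[of "\<lambda>t. \<integral>\<^sup>+u. k t u \<partial>lborel"]) measurable
 finally show ?thesis unfolding gagliardo_def k_def .
qed

lemma nn_integral_tail_kernel:
 fixes r t b :: real
 assumes "r < t" "b > 0"
 shows "(NBINT u. ennreal (ind {t..} u * (u - r) powr (-1-b))) = ennreal ((t - r) powr (-b) / b)"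
proof -
 have "(NBINT u. ennreal (ind {t..} (r + u) * (r + u - r) powr (-1-b))) = (NBINT v. ennreal (ind {t - r..} v * v powr (-1-b)))"
  by (intro nn_integral_cong) (auto split: split_indicator)
 then show ?thesis
  using nn_integral_lborel_translate[of "\<lambda>u. ennreal (ind {t..} u * (u - r) powr (-1-b))" r] powr_tail_nn[of "t - r" b] assms
  by simp
qed

text \<open>Cutting f at t adds to the Gagliardo integral the pairs separated by t. Integrating out
  the partner beyond t leaves |f r| / (b (t - r) powr b), which under the reflection of r to t - r
  is a Hardy term on (0, t).\<close>

lemma W0_1_indicator_bound:
 fixes T b t :: real
 assumes T: "T > 0" and b: "0 < b" "b < 1" and t: "0 < t" "t \<le> T"
 obtains C where "C \<ge> 0" "\<And>f. f \<in> \<B> \<Longrightarrow>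
   hardy_norm b T (\<lambda>u. ind {0<..t} u * f u) + gagliardo b T (\<lambda>u. ind {0<..t} u * f u)
   \<le> ennreal C * ((NBINT t. ennreal (ind {0<..<T} t * \<bar>f t\<bar>)) + gagliardo b T f)"
proof -
 obtain C1 where C1: "C1 \<ge> 0" "\<And>f. f \<in> \<B> \<Longrightarrow>
   hardy_norm b T f \<le> ennreal C1 * ((NBINT t. ennreal (ind {0<..<T} t * \<bar>f t\<bar>)) + gagliardo b T f)"
  by (rule fractional_hardy[OF b T]) blast
 obtain C2 where C2: "C2 \<ge> 0" "\<And>f. f \<in> \<B> \<Longrightarrow>
   hardy_norm b t f \<le> ennreal C2 * ((NBINT r. ennreal (ind {0<..<t} r * \<bar>f r\<bar>)) + gagliardo b t f)"
  by (rule fractional_hardy[OF b t(1)]) blast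
 \<comment> \<open>C1 pays for the weight at 0, 1 for the Gagliardo integral of f, and C2 / b for
   each of the two cross regions.\<close>
 define C where "C = C1 + 1 + 2 * C2 / b"
 have "hardy_norm b T (\<lambda>u. ind {0<..t} u * f u) + gagliardo b T (\<lambda>u. ind {0<..t} u * f u)
   \<le> ennreal C * ((NBINT t. ennreal (ind {0<..<T} t * \<bar>f t\<bar>)) + gagliardo b T f)"
  if fm [measurable]: "f \<in> \<B>" for f
 proof -
  define I where "I = (NBINT t. ennreal (ind {0<..<T} t * \<bar>f t\<bar>))"
  define F where "F u = ind {0<..t} u * f u" for u
  have "hardy_norm b T F \<le> hardy_norm b T f"
   unfolding hardy_norm_def F_def by (intro nn_integral_mono ennreal_leI) (auto split: split_indicator)
  also have "\<dots> \<le> ennreal C1 * (I + gagliardo b T f)" unfolding I_def by (rule C1(2)[OF fm])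
  finally have h: "hardy_norm b T F \<le> ennreal C1 * (I + gagliardo b T f)" .
  define k where "k r u = ennreal (ind {0<..t} r * ind {t<..<T} u * (\<bar>f r\<bar> / \<bar>r - u\<bar> powr (1 + b)))" for r u
  have [measurable]: "(\<lambda>(r, u). k r u) \<in> borel_measurable (borel \<Otimes>\<^sub>M borel)" unfolding k_def by measurable
  have "(NBINT r. NBINT u. k r u) \<le> (NBINT r. ennreal (1/b) * ennreal (ind {0<..<t} r * (\<bar>f r\<bar> / (t - r) powr b)))"
  proof (rule nn_integral_mono_AE)
   show "AE r in lborel. (NBINT u. k r u) \<le> ennreal (1/b) * ennreal (ind {0<..<t} r * (\<bar>f r\<bar> / (t - r) powr b))"
    using AE_lborel_singleton[of t]
   proof eventually_elim
    case (elim r)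
    show ?case
    proof (cases "r \<in> {0<..<t}")
     case True
     have "(NBINT u. k r u) \<le> (NBINT u. eabs (f r) * ennreal (ind {t..} u * (u - r) powr (-1-b)))"
     proof (rule nn_integral_mono)
      fix u
      have "(u - r) powr (-1-b) = 1 / (u - r) powr (1 + b)" using powr_minus_divide[of "u - r" "1 + b"] by (simp add: minus_diff_commute)
      then show "k r u \<le> eabs (f r) * ennreal (ind {t..} u * (u - r) powr (-1-b))"
       using True unfolding k_def by (auto simp: ennreal_mult[symmetric] split: split_indicator)
     qed
     also have "\<dots> = eabs (f r) * ennreal ((t - r) powr (-b) / b)"
      using True b by (simp add: nn_integral_cmult nn_integral_tail_kernel)
     also have "\<dots> = ennreal (1/b) * ennreal (ind {0<..<t} r * (\<bar>f r\<bar> / (t - r) powr b))"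
      using True b by (simp add: ennreal_mult[symmetric] powr_minus_divide mult.commute)
     finally show ?thesis .
    qed (use elim in \<open>auto simp: k_def\<close>)
   qed
  qed
  also have "\<dots> = ennreal (1/b) * (NBINT r. ennreal (ind {0<..<t} r * (\<bar>f r\<bar> / (t - r) powr b)))"
   by (rule nn_integral_cmult) measurable
  also have "(NBINT r. ennreal (ind {0<..<t} r * (\<bar>f r\<bar> / (t - r) powr b)))
    = (NBINT r. ennreal (ind {0<..<t} (t - r) * (\<bar>f (t - r)\<bar> / (t - (t - r)) powr b)))"
   by (rule nn_integral_lborel_reflect[symmetric]) measurable
  also have "\<dots> = hardy_norm b t (\<lambda>r. f (t - r))"
   unfolding hardy_norm_def by (intro nn_integral_cong) (auto split: split_indicator)
  also have "\<dots> \<le> ennreal C2 * ((NBINT r. ennreal (ind {0<..<t} r * \<bar>f (t - r)\<bar>)) + gagliardo b t (\<lambda>r. f (t - r)))"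
   by (rule C2(2)) measurable
  also have "gagliardo b t (\<lambda>r. f (t - r)) = gagliardo b t f" by (rule gagliardo_reflect[OF fm])
  also have "\<dots> \<le> gagliardo b T f"
   unfolding gagliardo_def using t by (intro nn_integral_mono ennreal_leI) (auto split: split_indicator)
  also have "(NBINT r. ennreal (ind {0<..<t} r * \<bar>f (t - r)\<bar>)) = (NBINT r. ennreal (ind {0<..<t} (t - r) * \<bar>f (t - r)\<bar>))"
   by (intro nn_integral_cong) (auto split: split_indicator)
  also have "\<dots> = (NBINT r. ennreal (ind {0<..<t} r * \<bar>f r\<bar>))"
   by (rule nn_integral_lborel_reflect) measurable
  also have "\<dots> \<le> I"
   unfolding I_def using t by (intro nn_integral_mono ennreal_leI) (auto split: split_indicator)
  finally have kk: "(NBINT r. NBINT u. k r u) \<le> ennreal (1/b) * (ennreal C2 * (I + gagliardo b T f))"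
   by (simp add: add_left_mono add_right_mono mult_left_mono)
  have "gagliardo b T F \<le> (NBINT r. NBINT u. (ennreal (ind {0<..<T} r * ind {0<..<T} u * (\<bar>f r - f u\<bar> / \<bar>r - u\<bar> powr (1 + b))) + k r u) + k u r)"
   unfolding gagliardo_def
  proof (intro nn_integral_mono)
   fix r u
   have "ind {0<..<T} r * ind {0<..<T} u * (\<bar>F r - F u\<bar> / \<bar>r - u\<bar> powr (1 + b))
    \<le> ind {0<..<T} r * ind {0<..<T} u * (\<bar>f r - f u\<bar> / \<bar>r - u\<bar> powr (1 + b))
     + ind {0<..t} r * ind {t<..<T} u * (\<bar>f r\<bar> / \<bar>r - u\<bar> powr (1 + b)) + ind {0<..t} u * ind {t<..<T} r * (\<bar>f u\<bar> / \<bar>u - r\<bar> powr (1 + b))"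
    unfolding F_def by (auto simp: abs_minus_commute[of u r] split: split_indicator)
   moreover have add3: "ennreal (x + y + z) \<le> ennreal x + ennreal y + ennreal z" if "x \<ge> 0" "y \<ge> 0" "z \<ge> 0" for x y z
    using that by simp
   ultimately show "ennreal (ind {0<..<T} r * ind {0<..<T} u * (\<bar>F r - F u\<bar> / \<bar>r - u\<bar> powr (1 + b)))
    \<le> (ennreal (ind {0<..<T} r * ind {0<..<T} u * (\<bar>f r - f u\<bar> / \<bar>r - u\<bar> powr (1 + b))) + k r u) + k u r"
    unfolding k_def by (intro order_trans[OF ennreal_leI add3]) simp_all
  qed
  also have "\<dots> = (gagliardo b T f + (NBINT r. NBINT u. k r u)) + (NBINT r. NBINT u. k u r)"
   unfolding gagliardo_def by (simp add: nn_integral_add)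
  also have "(NBINT r. NBINT u. k u r) = (NBINT r. NBINT u. k r u)"
   by (intro lborel_pair.Fubini') measurable
  also have "(gagliardo b T f + (NBINT r. NBINT u. k r u)) + (NBINT r. NBINT u. k r u)
    \<le> ((I + gagliardo b T f) + ennreal (1/b) * (ennreal C2 * (I + gagliardo b T f))) + ennreal (1/b) * (ennreal C2 * (I + gagliardo b T f))"
   by (intro add_mono kk) auto
  finally have "hardy_norm b T F + gagliardo b T F \<le> ennreal C1 * (I + gagliardo b T f) + (((I + gagliardo b T f) + ennreal (1/b) * (ennreal C2 * (I + gagliardo b T f))) + ennreal (1/b) * (ennreal C2 * (I + gagliardo b T f)))"
   by (intro add_mono h)
  also have "\<dots> = (ennreal C1 + (1 + ennreal (1/b) * ennreal C2 + ennreal (1/b) * ennreal C2)) * (I + gagliardo b T f)"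
   by (simp add: distrib_right mult.assoc add.assoc)
  also have "ennreal C1 + (1 + ennreal (1/b) * ennreal C2 + ennreal (1/b) * ennreal C2) = ennreal C"
   unfolding C_def using C1(1) C2(1) b
   by (simp add: ennreal_mult[symmetric] ennreal_plus[symmetric] ennreal_1[symmetric] del: ennreal_plus ennreal_1)
  finally show ?thesis unfolding F_def I_def .
 qed
 then show ?thesis using that[of C] C1 C2 b by (auto simp: C_def)
qed

section \<open>Mollifiers\<close>

text \<open>exp (-1/t) with a polynomial in 1/t as prefactor: this family contains the standard
  smooth cut-off and is closed under differentiation.\<close>

definition gexp :: "real poly \<Rightarrow> real \<Rightarrow> real" where
 "gexp p t = (if t > 0 then poly p (1 / t) * exp (- (1 / t)) else 0)"

text \<open>The factor \<open>[:0, 0, 1:]\<close> is the square, from the inner derivative of 1/t;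
  its sign is accounted for in \<open>p - pderiv p\<close>.\<close>

definition dpoly :: "real poly \<Rightarrow> real poly" where
 "dpoly p = [:0, 0, 1:] * (p - pderiv p)"

lemma poly_exp_tendsto_0: "((\<lambda>x::real. poly p x * exp (- x)) \<longlongrightarrow> 0) at_top"
proof -
 have "((\<lambda>x::real. \<Sum>i\<le>degree p. coeff p i * (x ^ i / exp x)) \<longlongrightarrow> (\<Sum>i\<le>degree p. coeff p i * 0)) at_top"
  by (intro tendsto_intros tendsto_power_div_exp_0)
 moreover have "(\<Sum>i\<le>degree p. coeff p i * (x ^ i / exp x)) = poly p x * exp (- x)" for x :: real
  by (simp add: poly_altdef exp_minus sum_distrib_right divide_inverse mult.assoc)
 ultimately show ?thesis by simp
qed

lemma gexp_deriv: "(gexp p has_real_derivative gexp (dpoly p) t) (at t)"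
proof -
 consider "t > 0" | "t < 0" | "t = 0" by linarith
 then show ?thesis
 proof cases
  case 1
  have "((\<lambda>t. poly p (1 / t) * exp (- (1 / t))) has_real_derivative gexp (dpoly p) t) (at t)"
   using 1 by (auto intro!: derivative_eq_intros DERIV_chain2[OF poly_DERIV] simp: gexp_def dpoly_def field_simps power2_eq_square)
  then show ?thesis
   by (rule has_field_derivative_transform_within_open[where S="{0<..}"]) (use 1 in \<open>auto simp: gexp_def\<close>)
 next
  case 2
  have "((\<lambda>t. 0) has_real_derivative gexp (dpoly p) t) (at t)" using 2 by (simp add: gexp_def)
  then show ?thesis
   by (rule has_field_derivative_transform_within_open[where S="{..<0}"]) (use 2 in \<open>auto simp: gexp_def\<close>)
 next
  case 3
  \<comment> \<open>The difference quotient at 0 from the right is x p(x) exp (-x) at x = 1/h, which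
    tends to 0 like any polynomial times exp (-x).\<close>
  have "((\<lambda>h. poly ([:0, 1:] * p) (inverse h) * exp (- inverse h)) \<longlongrightarrow> 0) (at_right 0)"
   by (rule filterlim_compose[OF poly_exp_tendsto_0 filterlim_inverse_at_top_right])
  then have "((\<lambda>h. (gexp p (0 + h) - gexp p 0) / h) \<longlongrightarrow> 0) (at_right 0)"
  proof (rule Lim_transform_eventually)
   show "\<forall>\<^sub>F h in at_right 0. poly ([:0, 1:] * p) (inverse h) * exp (- inverse h) = (gexp p (0 + h) - gexp p 0) / h"
    by (rule eventually_at_rightI[of 0 1]) (auto simp: gexp_def divide_inverse mult_ac)
  qed
  moreover have "((\<lambda>h. (gexp p (0 + h) - gexp p 0) / h) \<longlongrightarrow> 0) (at_left 0)"
  proof (rule Lim_transform_eventually[OF tendsto_const])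
   show "\<forall>\<^sub>F h in at_left 0. 0 = (gexp p (0 + h) - gexp p 0) / h"
    by (rule eventually_at_leftI[of "-1"]) (auto simp: gexp_def)
  qed
  ultimately have "((\<lambda>h. (gexp p (0 + h) - gexp p 0) / h) \<longlongrightarrow> 0) (at 0)"
   by (simp add: filterlim_split_at)
  then show ?thesis using 3 by (simp add: DERIV_def gexp_def)
 qed
qed

lemma gexp_continuous: "continuous_on A (gexp p)"
 by (rule continuous_at_imp_continuous_on) (use gexp_deriv DERIV_isCont in blast)

definition bump :: "real poly \<Rightarrow> real \<Rightarrow> real^'n \<Rightarrow> real" where
 "bump p e z = gexp p (1 - (norm z)\<^sup>2 / e\<^sup>2)"

definition bump_deriv :: "real poly \<Rightarrow> real \<Rightarrow> real^'n \<Rightarrow> real^'n \<Rightarrow> real" where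
 "bump_deriv p e z v = bump (dpoly p) e z * (- (2 * (z \<bullet> v) / e\<^sup>2))"

lemma bump_has_derivative:
 fixes z :: "real^'n"
 shows "(bump p e has_derivative bump_deriv p e z) (at z)"
proof -
 have "((\<lambda>z::real^'n. 1 - inverse (e\<^sup>2) * (z \<bullet> z)) has_derivative (\<lambda>v. - (inverse (e\<^sup>2) * (z \<bullet> v + v \<bullet> z)))) (at z)"
  by (auto intro!: derivative_eq_intros)
 then have "((\<lambda>z::real^'n. 1 - z \<bullet> z / e\<^sup>2) has_derivative (\<lambda>v. - ((z \<bullet> v + v \<bullet> z) / e\<^sup>2))) (at z)"
  by (simp add: divide_inverse mult.commute)
 then have "((\<lambda>z. gexp p (1 - z \<bullet> z / e\<^sup>2)) has_derivative (\<lambda>v. gexp (dpoly p) (1 - z \<bullet> z / e\<^sup>2) * (- ((z \<bullet> v + v \<bullet> z) / e\<^sup>2)))) (at z)"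
  by (rule has_derivative_compose[OF _ gexp_deriv[unfolded has_field_derivative_def]])
 moreover have "(\<lambda>v. gexp (dpoly p) (1 - z \<bullet> z / e\<^sup>2) * (- ((z \<bullet> v + v \<bullet> z) / e\<^sup>2))) = bump_deriv p e z"
  by (auto simp: bump_deriv_def bump_def power2_norm_eq_inner inner_commute)
 ultimately show ?thesis by (simp add: bump_def[abs_def] power2_norm_eq_inner)
qed

lemma bump_continuous: "continuous_on A (bump p e)"
 by (rule continuous_at_imp_continuous_on) (use bump_has_derivative has_derivative_continuous in blast)

lemma bump_borel [measurable]: "bump p e \<in> \<B>"
 by (rule borel_measurable_continuous_onI) (rule bump_continuous)

lemma bump_outside: "e > 0 \<Longrightarrow> norm z \<ge> e \<Longrightarrow> bump p e z = 0"
proof -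
 assume e: "e > 0" and z: "norm z \<ge> e"
 have "e\<^sup>2 \<le> (norm z)\<^sup>2" using e z by (intro power_mono) auto
 then have "1 \<le> (norm z)\<^sup>2 / e\<^sup>2" using e by simp
 then show ?thesis unfolding bump_def gexp_def by simp
qed

lemma gexp_bounded: "\<exists>B\<ge>0. \<forall>t\<le>1. \<bar>gexp p t\<bar> \<le> B"
proof -
 have "bounded (gexp p ` {0..1})" by (intro compact_imp_bounded compact_continuous_image gexp_continuous) simp
 then obtain B where "\<forall>t\<in>{0..1}. \<bar>gexp p t\<bar> \<le> B" by (auto simp: bounded_real)
 then have B: "\<And>t. t \<in> {0..1} \<Longrightarrow> \<bar>gexp p t\<bar> \<le> B" by blast
 have "\<bar>gexp p t\<bar> \<le> B" if "t \<le> 1" for t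
  using B[of t] B[of 0] that by (cases "t \<ge> 0") (auto simp: gexp_def)
 moreover have "B \<ge> 0" using B[of 0] by auto
 ultimately show ?thesis by blast
qed

lemma bump_bounded: "\<exists>B\<ge>0. \<forall>(z::real^'n) e. \<bar>bump p e z\<bar> \<le> B"
proof -
 obtain B where "B \<ge> 0" "\<And>t. t \<le> 1 \<Longrightarrow> \<bar>gexp p t\<bar> \<le> B" using gexp_bounded by blast
 moreover have "1 - (norm z)\<^sup>2 / e\<^sup>2 \<le> 1" for z :: "real^'n" and e by simp
 ultimately show ?thesis unfolding bump_def by blast
qed

lemma bump_lipschitz:
 assumes e: "e > 0"
 shows "\<exists>L\<ge>0. \<forall>z z' :: real^'n. \<bar>bump p e z - bump p e z'\<bar> \<le> L * norm (z - z')"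
proof -
 obtain B where B: "B \<ge> 0" "\<And>(z::real^'n) e. \<bar>bump (dpoly p) e z\<bar> \<le> B" using bump_bounded by blast
 have "\<bar>bump_deriv p e z v\<bar> \<le> (2 * B / e) * norm v" for z v :: "real^'n"
 proof (cases "norm z < e")
  case True
  have "\<bar>bump_deriv p e z v\<bar> = \<bar>bump (dpoly p) e z\<bar> * (2 * \<bar>z \<bullet> v\<bar> / e\<^sup>2)"
   unfolding bump_deriv_def by (simp add: abs_mult)
  also have "\<dots> \<le> B * (2 * (e * norm v) / e\<^sup>2)"
  proof (intro mult_mono B divide_right_mono mult_left_mono)
   have "\<bar>z \<bullet> v\<bar> \<le> norm z * norm v" by (rule Cauchy_Schwarz_ineq2)
   also have "\<dots> \<le> e * norm v" using True by (intro mult_right_mono) auto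
   finally show "\<bar>z \<bullet> v\<bar> \<le> e * norm v" .
  qed (use B in auto)
  also have "\<dots> = (2 * B / e) * norm v" using e by (simp add: power2_eq_square)
  finally show ?thesis .
 qed (use B e bump_outside[of e z "dpoly p"] in \<open>simp add: bump_deriv_def\<close>)
 then have on: "onorm (bump_deriv p e z) \<le> 2 * B / e" for z :: "real^'n"
  by (intro onorm_bound) (use B e in auto)
 have "norm (bump p e z - bump p e z') \<le> (2 * B / e) * norm (z - z')" for z z' :: "real^'n"
  by (rule differentiable_bound[of UNIV _ "bump_deriv p e"]) (auto intro: bump_has_derivative on)
 then show ?thesis using B e by (intro exI[of _ "2 * B / e"]) auto
qed

text \<open>The factor z \<bullet> v is bounded only on the ball, so the product estimate assumes
  that one of the points lies there; if both lie outside, both values vanish.\<close>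

lemma bump_deriv_lipschitz:
 assumes e: "e > 0"
 shows "\<exists>L\<ge>0. \<forall>z z' v :: real^'n. \<bar>bump_deriv p e z v - bump_deriv p e z' v\<bar> \<le> L * norm (z - z') * norm v"
proof -
 obtain B where B: "B \<ge> 0" "\<And>(z::real^'n) e. \<bar>bump (dpoly p) e z\<bar> \<le> B" using bump_bounded by blast
 obtain L where L: "L \<ge> 0" "\<And>z z' :: real^'n. \<bar>bump (dpoly p) e z - bump (dpoly p) e z'\<bar> \<le> L * norm (z - z')"
  using bump_lipschitz[OF e] by blast
 let ?g = "bump (dpoly p) e :: real^'n \<Rightarrow> real"
 have *: "\<bar>?g z * (z \<bullet> v) - ?g z' * (z' \<bullet> v)\<bar> \<le> (L * e + B) * norm (z - z') * norm v" if z: "norm z \<le> e" for z z' v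
 proof -
  have "?g z * (z \<bullet> v) - ?g z' * (z' \<bullet> v) = (?g z - ?g z') * (z \<bullet> v) + ?g z' * ((z - z') \<bullet> v)"
   by (simp add: algebra_simps)
  also have "\<bar>\<dots>\<bar> \<le> \<bar>?g z - ?g z'\<bar> * \<bar>z \<bullet> v\<bar> + \<bar>?g z'\<bar> * \<bar>(z - z') \<bullet> v\<bar>"
   by (rule order_trans[OF abs_triangle_ineq]) (simp add: abs_mult)
  also have "\<dots> \<le> (L * norm (z - z')) * (e * norm v) + B * (norm (z - z') * norm v)"
  proof (intro add_mono mult_mono L B Cauchy_Schwarz_ineq2)
   have "\<bar>z \<bullet> v\<bar> \<le> norm z * norm v" by (rule Cauchy_Schwarz_ineq2)
   also have "\<dots> \<le> e * norm v" using z by (intro mult_right_mono) auto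
   finally show "\<bar>z \<bullet> v\<bar> \<le> e * norm v" .
  qed (use L B in auto)
  finally show ?thesis by (simp add: algebra_simps)
 qed
 have **: "\<bar>?g z * (z \<bullet> v) - ?g z' * (z' \<bullet> v)\<bar> \<le> (L * e + B) * norm (z - z') * norm v" for z z' v
 proof (cases "norm z \<le> e")
  case False
  show ?thesis
  proof (cases "norm z' \<le> e")
   case True
   then show ?thesis using *[of z' v z] by (simp add: norm_minus_commute abs_minus_commute)
  next
   case F2: False
   then show ?thesis using False bump_outside[OF e, of z] bump_outside[OF e, of z'] L B e by simp
  qed
 qed (rule *)
 have eq: "bump_deriv p e z v - bump_deriv p e z' v = - (2 / e\<^sup>2) * (?g z * (z \<bullet> v) - ?g z' * (z' \<bullet> v))" for z z' v :: "real^'n"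
  unfolding bump_deriv_def by (simp add: algebra_simps)
 have "\<bar>bump_deriv p e z v - bump_deriv p e z' v\<bar> \<le> (2 / e\<^sup>2) * ((L * e + B) * norm (z - z') * norm v)" for z z' v :: "real^'n"
  unfolding eq abs_mult using ** by (intro mult_mono) auto
 then have "\<bar>bump_deriv p e z v - bump_deriv p e z' v\<bar> \<le> ((2 / e\<^sup>2) * (L * e + B)) * norm (z - z') * norm v" for z z' v :: "real^'n"
  by (simp only: mult.assoc)
 moreover have "(2 / e\<^sup>2) * (L * e + B) \<ge> 0" using L B e by simp
 ultimately show ?thesis by blast
qed

text \<open>Closed under partial derivatives, which makes the members smooth in the sense of \<^const>\<open>C_order\<close>.\<close>

inductive bump_algebra :: "real \<Rightarrow> real^'n \<Rightarrow> (real^'n \<Rightarrow> real) \<Rightarrow> bool" for e :: real and x :: "real^'n" where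
 const: "bump_algebra e x (\<lambda>y. c)"
| coord: "bump_algebra e x (\<lambda>y. y $ k)"
| bump: "bump_algebra e x (\<lambda>y. bump p e (x - y))"
| add: "bump_algebra e x f \<Longrightarrow> bump_algebra e x g \<Longrightarrow> bump_algebra e x (\<lambda>y. f y + g y)"
| mult: "bump_algebra e x f \<Longrightarrow> bump_algebra e x g \<Longrightarrow> bump_algebra e x (\<lambda>y. f y * g y)"

lemma bump_shift_has_derivative:
 "((\<lambda>y. bump p e (x - y)) has_derivative (\<lambda>v. - bump_deriv p e (x - y) v)) (at y)"
proof -
 have "((\<lambda>y. x - y) has_derivative (\<lambda>v. - v)) (at y)" by (auto intro!: derivative_eq_intros)
 from has_derivative_compose[OF this bump_has_derivative, of p e]
 show ?thesis by (simp add: bump_deriv_def)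
qed

lemma bump_algebra_deriv:
 fixes x :: "real^'n"
 assumes "bump_algebra e x f"
 shows "\<exists>D. (\<forall>y. (f has_derivative D y) (at y)) \<and> (\<forall>k. bump_algebra e x (\<lambda>y. D y (axis k 1)))"
 using assms
proof (induction rule: bump_algebra.induct)
 case (const c)
 show ?case by (rule exI[of _ "\<lambda>y v. 0"]) (auto intro: bump_algebra.const)
next
 case (coord k)
 show ?case
 proof (rule exI[of _ "\<lambda>y v. v $ k"], intro conjI allI)
  show "((\<lambda>y. y $ k) has_derivative (\<lambda>v. v $ k)) (at y)" for y :: "real^'n"
   by (rule bounded_linear.has_derivative[OF bounded_linear_vec_nth]) (rule has_derivative_ident)
 qed (auto intro: bump_algebra.const)
next
 case (bump p)
 show ?case
 proof (rule exI[of _ "\<lambda>y v. - bump_deriv p e (x - y) v"], intro conjI allI bump_shift_has_derivative)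
  fix k
  have "(\<lambda>y. - bump_deriv p e (x - y) (axis k 1)) = (\<lambda>y. bump (dpoly p) e (x - y) * (2 / e\<^sup>2 * (x $ k + (-1) * y $ k)))"
   by (auto simp: bump_deriv_def inner_axis)
  moreover have "bump_algebra e x (\<lambda>y. bump (dpoly p) e (x - y) * (2 / e\<^sup>2 * (x $ k + (-1) * y $ k)))"
   by (intro bump_algebra.intros)
  ultimately show "bump_algebra e x (\<lambda>y. - bump_deriv p e (x - y) (axis k 1))" by simp
 qed
next
 case (add f g)
 then obtain D E where D: "\<And>y. (f has_derivative D y) (at y)" "\<And>k. bump_algebra e x (\<lambda>y. D y (axis k 1))"
  and E: "\<And>y. (g has_derivative E y) (at y)" "\<And>k. bump_algebra e x (\<lambda>y. E y (axis k 1))" by blast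
 show ?case
  by (rule exI[of _ "\<lambda>y v. D y v + E y v"]) (auto intro: bump_algebra.intros D E has_derivative_add)
next
 case (mult f g)
 then obtain D E where D: "\<And>y. (f has_derivative D y) (at y)" "\<And>k. bump_algebra e x (\<lambda>y. D y (axis k 1))"
  and E: "\<And>y. (g has_derivative E y) (at y)" "\<And>k. bump_algebra e x (\<lambda>y. E y (axis k 1))" by blast
 show ?case
 proof (rule exI[of _ "\<lambda>y v. f y * E y v + D y v * g y"], intro conjI allI)
  show "bump_algebra e x (\<lambda>y. f y * E y (axis k 1) + D y (axis k 1) * g y)" for k
   using mult.hyps D E by (intro bump_algebra.intros)
 qed (rule has_derivative_mult[OF D(1) E(1)])
qed

lemma bump_algebra_C_order: "bump_algebra e x f \<Longrightarrow> C_order m f"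
proof (induction m arbitrary: f)
 case 0
 from bump_algebra_deriv[OF this] obtain D where "\<And>y. (f has_derivative D y) (at y)" by blast
 then show ?case by (auto intro!: continuous_at_imp_continuous_on has_derivative_continuous)
next
 case (Suc m)
 from bump_algebra_deriv[OF Suc.prems] obtain D where D: "\<And>y. (f has_derivative D y) (at y)"
  and k: "\<And>k. bump_algebra e x (\<lambda>y. D y (axis k 1))" by blast
 have "partial k f = (\<lambda>y. D y (axis k 1))" for k
  unfolding partial_def[abs_def] using frechet_derivative_at[OF D] by simp
 then show ?case using Suc.IH[OF k] D by (auto simp: differentiable_def)
qed

section \<open>Normalised mollifiers as test functions\<close>

definition mollifier :: "real \<Rightarrow> real^'n \<Rightarrow> real" where
 "mollifier e z = bump 1 e z / (LBINT w. bump 1 e (w :: real^'n))"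

definition mollifier_deriv :: "real \<Rightarrow> real^'n \<Rightarrow> real^'n \<Rightarrow> real" where
 "mollifier_deriv e z v = bump_deriv 1 e z v / (LBINT w. bump 1 e (w :: real^'n))"

lemma mollifier_borel [measurable]: "mollifier e \<in> \<B>"
 unfolding mollifier_def by measurable

lemma mollifier_deriv_borel [measurable]: "(\<lambda>z. mollifier_deriv e z v) \<in> \<B>"
 unfolding mollifier_deriv_def bump_deriv_def by measurable

lemma mollifier_outside: "e > 0 \<Longrightarrow> norm z \<ge> e \<Longrightarrow> mollifier e z = 0"
 "e > 0 \<Longrightarrow> norm z \<ge> e \<Longrightarrow> mollifier_deriv e z v = 0"
 by (simp_all add: mollifier_def mollifier_deriv_def bump_deriv_def bump_outside)

lemma mollifier_test_function:
 assumes e: "e > 0"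
 shows "test_function (\<lambda>y. mollifier e (x - y))"
proof -
 have "bump_algebra e x (\<lambda>y. bump 1 e (x - y) * (1 / (LBINT w. bump 1 e (w :: real^'n))))"
  by (intro bump_algebra.intros)
 then have "\<forall>m. C_order m (\<lambda>y. mollifier e (x - y))"
  unfolding mollifier_def by (auto intro: bump_algebra_C_order)
 moreover have "compact (closure {y. mollifier e (x - y) \<noteq> 0})"
 proof -
  have "{y. mollifier e (x - y) \<noteq> 0} \<subseteq> cball x e"
   using mollifier_outside(1)[OF e] by (force simp: dist_norm not_le)
  then show ?thesis by (meson bounded_cball bounded_subset compact_closure)
 qed
 ultimately show ?thesis unfolding test_function_def by blast
qed

lemma mollifier_shift_partial:
 "partial k (\<lambda>y. mollifier e (x - y)) y = - mollifier_deriv e (x - y) (axis k 1)"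
proof -
 have "((\<lambda>y. mollifier e (x - y)) has_derivative (\<lambda>v. - mollifier_deriv e (x - y) v)) (at y)"
  unfolding mollifier_def mollifier_deriv_def minus_divide_left
  by (rule bounded_linear.has_derivative[OF bounded_linear_divide bump_shift_has_derivative])
 from frechet_derivative_at[OF this] show ?thesis unfolding partial_def by metis
qed

lemma mollifier_has_derivative: "(mollifier e has_derivative mollifier_deriv e z) (at z)"
 unfolding mollifier_def[abs_def] mollifier_deriv_def[abs_def]
 by (rule bounded_linear.has_derivative[OF bounded_linear_divide bump_has_derivative])

lemma mollifier_lipschitz:
 assumes "e > 0"
 shows "\<exists>L\<ge>0. \<forall>z z' :: real^'n. \<bar>mollifier e z - mollifier e z'\<bar> \<le> L * norm (z - z')"
proof -
 let ?m = "LBINT w. bump 1 e (w :: real^'n)"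
 obtain L where L: "L \<ge> 0" "\<And>z z' :: real^'n. \<bar>bump 1 e z - bump 1 e z'\<bar> \<le> L * norm (z - z')"
  using bump_lipschitz[OF assms] by blast
 have "\<bar>mollifier e z - mollifier e z'\<bar> \<le> (L / \<bar>?m\<bar>) * norm (z - z')" for z z' :: "real^'n"
  unfolding mollifier_def diff_divide_distrib[symmetric] abs_divide using divide_right_mono[OF L(2)[of z z'], of "\<bar>?m\<bar>"] by simp
 then show ?thesis using L by (intro exI[of _ "L / \<bar>?m\<bar>"]) auto
qed

lemma mollifier_deriv_lipschitz:
 assumes "e > 0"
 shows "\<exists>L\<ge>0. \<forall>z z' v :: real^'n. \<bar>mollifier_deriv e z v - mollifier_deriv e z' v\<bar> \<le> L * norm (z - z') * norm v"
proof -
 let ?m = "LBINT w. bump 1 e (w :: real^'n)"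
 obtain L where L: "L \<ge> 0" "\<And>z z' v :: real^'n. \<bar>bump_deriv 1 e z v - bump_deriv 1 e z' v\<bar> \<le> L * norm (z - z') * norm v"
  using bump_deriv_lipschitz[OF assms] by blast
 have "\<bar>mollifier_deriv e z v - mollifier_deriv e z' v\<bar> \<le> (L / \<bar>?m\<bar>) * norm (z - z') * norm v" for z z' v :: "real^'n"
  unfolding mollifier_deriv_def diff_divide_distrib[symmetric] abs_divide using divide_right_mono[OF L(2)[of z v z'], of "\<bar>?m\<bar>"] by simp
 then show ?thesis using L by (intro exI[of _ "L / \<bar>?m\<bar>"]) auto
qed

lemma gexp_1: "gexp 1 t = (if t > 0 then exp (- (1 / t)) else 0)" by (simp add: gexp_def)

lemma bump_1_nonneg: "bump 1 e z \<ge> 0" by (simp add: bump_def gexp_1)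

lemma bump_1_le: "bump 1 e z \<le> 1" by (simp add: bump_def gexp_1)

text \<open>On the ball of radius e/2 the bump is at least exp (-4/3), because its argument is at
  least 3/4. The resulting mass of order e ^ n bounds the mollifier by a constant over e ^ n, with
  the constant free of e.\<close>

lemma bump_1_mass:
 assumes e: "e > 0"
 shows "integrable lborel (bump 1 e :: real^'n \<Rightarrow> real)"
  and "exp (- (4/3)) * unit_ball_vol (real CARD('n)) * (e / 2) ^ CARD('n) \<le> (LBINT w. bump 1 e (w :: real^'n))"
proof -
 let ?b = "bump 1 e :: real^'n \<Rightarrow> real"
 have ib: "integrable lborel (ind (ball 0 r) :: real^'n \<Rightarrow> real)" for r
  using emeasure_lborel_ball_finite[of "0::real^'n" r] by (intro integrable_real_indicator) auto
 show i: "integrable lborel ?b"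
 proof (rule Bochner_Integration.integrable_bound[OF ib[of e]])
  show "AE z in lborel. norm (?b z) \<le> norm (ind (ball 0 e) z :: real)"
  proof (intro AE_I2)
   fix z :: "real^'n"
   show "norm (?b z) \<le> norm (ind (ball 0 e) z :: real)"
    using bump_1_le[of e z] bump_1_nonneg[of e z] bump_outside[OF e, of z 1]
    by (cases "norm z < e") auto
  qed
 qed simp
 have "exp (- (4/3)) * (unit_ball_vol (real CARD('n)) * (e / 2) ^ CARD('n)) = (LBINT w. exp (- (4/3)) * ind (ball (0::real^'n) (e/2)) w)"
  using content_ball[of "e/2" "0 :: real^'n"] e by simp
 also have "\<dots> \<le> (LBINT w. ?b w)"
 proof (rule integral_mono[OF integrable_mult_right[OF ib] i])
  fix w :: "real^'n"
  show "exp (- (4/3)) * ind (ball 0 (e/2)) w \<le> ?b w"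
  proof (cases "norm w < e / 2")
   case True
   have "(norm w)\<^sup>2 \<le> (e/2)\<^sup>2" using True by (intro power_mono) auto
   then have "(norm w)\<^sup>2 / e\<^sup>2 \<le> 1/4" using e by (simp add: power2_eq_square field_simps)
   then have t: "1 - (norm w)\<^sup>2 / e\<^sup>2 \<ge> 3/4" by simp
   then have p: "1 - (norm w)\<^sup>2 / e\<^sup>2 > 0" by linarith
   have "1 / (1 - (norm w)\<^sup>2 / e\<^sup>2) \<le> 1 / (3/4)" using t p by (intro divide_left_mono) auto
   moreover have "?b w = exp (- (1 / (1 - (norm w)\<^sup>2 / e\<^sup>2)))"
    unfolding bump_def gexp_1 using p by (simp only: if_True)
   ultimately show ?thesis using True by simp
  qed (simp add: bump_1_nonneg)
 qed
 finally show "exp (- (4/3)) * unit_ball_vol (real CARD('n)) * (e / 2) ^ CARD('n) \<le> (LBINT w. ?b w)"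
  by (simp add: mult.assoc)
qed

lemma mollifier_properties:
 fixes z :: "real^'n"
 assumes e: "e > 0"
 shows "mollifier e z \<ge> 0"
  and "mollifier e z \<le> (2 ^ CARD('n) * exp (4/3) / unit_ball_vol (real CARD('n))) / e ^ CARD('n)"
  and "(NBINT z. ennreal (mollifier e (z :: real^'n))) = 1"
  and "(LBINT z. mollifier e (z :: real^'n)) = 1"
  and "integrable lborel (mollifier e :: real^'n \<Rightarrow> real)"
proof -
 let ?m = "LBINT w. bump 1 e (w :: real^'n)"
 let ?l = "exp (- (4/3)) * unit_ball_vol (real CARD('n)) * (e / 2) ^ CARD('n)"
 have l: "?l > 0" using e by (simp add: unit_ball_vol_pos)
 then have m: "?m > 0" "?l \<le> ?m" using bump_1_mass(2)[OF e, where 'n='n] by auto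
 show n: "mollifier e z \<ge> 0" for z :: "real^'n" using m bump_1_nonneg[of e z] by (simp add: mollifier_def)
 have "mollifier e z \<le> 1 / ?m" unfolding mollifier_def using m bump_1_le[of e z] by (intro divide_right_mono) auto
 also have "\<dots> \<le> 1 / ?l" using m l by (intro divide_left_mono) auto
 also have "\<dots> = (2 ^ CARD('n) * exp (4/3) / unit_ball_vol (real CARD('n))) / e ^ CARD('n)"
  using e by (simp add: exp_minus power_divide field_simps)
 finally show "mollifier e z \<le> (2 ^ CARD('n) * exp (4/3) / unit_ball_vol (real CARD('n))) / e ^ CARD('n)" .
 show i: "integrable lborel (mollifier e :: real^'n \<Rightarrow> real)"
  unfolding mollifier_def by (intro integrable_divide_zero bump_1_mass(1)[OF e])
 show I: "(LBINT z. mollifier e (z :: real^'n)) = 1" using m by (simp add: mollifier_def)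
 show "(NBINT z. ennreal (mollifier e (z :: real^'n))) = 1"
  using nn_integral_eq_integral[OF i] n I by simp
qed

section \<open>Mollification of locally integrable Borel functions\<close>

definition loc_int :: "(real^'n \<Rightarrow> real) \<Rightarrow> bool" where
 "loc_int \<phi> \<longleftrightarrow> \<phi> \<in> \<B> \<and>
   (\<forall>R. integrable lborel (\<lambda>y. ind (ball 0 R) y * \<phi> y))"

definition moll :: "real \<Rightarrow> (real^'n \<Rightarrow> real) \<Rightarrow> real^'n \<Rightarrow> real" where
 "moll e \<phi> x = (LBINT y. \<phi> y * mollifier e (x - y))"

definition moll_deriv :: "real \<Rightarrow> (real^'n \<Rightarrow> real) \<Rightarrow> real^'n \<Rightarrow> real^'n \<Rightarrow> real" where
 "moll_deriv e \<phi> x v = (LBINT y. \<phi> y * mollifier_deriv e (x - y) v)"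

definition ball_L1 :: "real \<Rightarrow> (real^'n \<Rightarrow> real) \<Rightarrow> real" where
 "ball_L1 R \<phi> = (LBINT y. ind (ball 0 R) y * \<bar>\<phi> y\<bar>)"

lemma loc_int_borel [measurable_dest]: "loc_int \<phi> \<Longrightarrow> \<phi> \<in> \<B>"
 by (simp add: loc_int_def)

lemma loc_int_mult:
 fixes \<phi> w :: "real^'n \<Rightarrow> real"
 assumes \<phi>: "loc_int \<phi>" and w [measurable]: "w \<in> \<B>"
  and B: "\<And>y. \<bar>w y\<bar> \<le> B" and w0: "\<And>y. norm y \<ge> R \<Longrightarrow> w y = 0"
 shows "integrable lborel (\<lambda>y. \<phi> y * w y)" and "\<bar>LBINT y. \<phi> y * w y\<bar> \<le> B * ball_L1 R \<phi>"
proof -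
 have \<phi>m [measurable]: "\<phi> \<in> \<B>" using \<phi> by (rule loc_int_borel)
 have "integrable lborel (\<lambda>y. norm (ind (ball 0 R) y * \<phi> y))"
  using \<phi> unfolding loc_int_def by (intro integrable_norm) blast
 then have i: "integrable lborel (\<lambda>y. ind (ball 0 R) y * \<bar>\<phi> y\<bar>)" by (simp add: abs_mult)
 have le: "norm (\<phi> y * w y) \<le> B * (ind (ball 0 R) y * \<bar>\<phi> y\<bar>)" for y
  using mult_left_mono[OF B[of y] abs_ge_zero[of "\<phi> y"]] w0[of y]
  by (cases "norm y < R") (auto simp: abs_mult mult.commute)
 have B0: "B \<ge> 0" using B[of 0] by linarith
 show 1: "integrable lborel (\<lambda>y. \<phi> y * w y)"
 proof (rule Bochner_Integration.integrable_bound[OF integrable_mult_right[OF i, of B]])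
  show "AE y in lborel. norm (\<phi> y * w y) \<le> norm (B * (ind (ball 0 R) y * \<bar>\<phi> y\<bar>))"
   using order_trans[OF le abs_ge_self] by (intro AE_I2) simp
 qed measurable
 have "\<bar>LBINT y. \<phi> y * w y\<bar> \<le> (LBINT y. norm (\<phi> y * w y))"
  using integral_norm_bound[of lborel "\<lambda>y. \<phi> y * w y"] by simp
 also have "\<dots> \<le> (LBINT y. B * (ind (ball 0 R) y * \<bar>\<phi> y\<bar>))"
  by (rule integral_mono[OF integrable_norm[OF 1] integrable_mult_right[OF i] le])
 finally show "\<bar>LBINT y. \<phi> y * w y\<bar> \<le> B * ball_L1 R \<phi>" by (simp add: ball_L1_def)
qed

lemma ball_L1_nonneg: "ball_L1 R \<phi> \<ge> 0"
 unfolding ball_L1_def by (intro integral_nonneg_AE) auto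

text \<open>A general Lipschitz kernel of bounded support is allowed, so as to serve both the
  mollifier and its directional derivatives.\<close>

lemma convolution_continuous:
 fixes \<phi> k :: "real^'n \<Rightarrow> real"
 assumes \<phi>: "loc_int \<phi>" and k [measurable]: "k \<in> \<B>"
  and L: "L \<ge> 0" "\<And>z z'. \<bar>k z - k z'\<bar> \<le> L * norm (z - z')" and k0: "\<And>z. norm z \<ge> e \<Longrightarrow> k z = 0"
 shows "integrable lborel (\<lambda>y. \<phi> y * k (x - y))"
  and "norm (x - x') \<le> 1 \<Longrightarrow> \<bar>(LBINT y. \<phi> y * k (x - y)) - (LBINT y. \<phi> y * k (x' - y))\<bar> \<le> L * norm (x - x') * ball_L1 (norm x + e + 1) \<phi>"
  and "continuous_on UNIV (\<lambda>x. LBINT y. \<phi> y * k (x - y))"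
proof -
 define E where "E = max e 0"
 have kE: "k z = 0" if "norm z \<ge> E" for z using k0 that unfolding E_def by simp
 have kb: "\<bar>k z\<bar> \<le> L * (2 * E + 1)" for z
 proof (cases "norm z \<ge> E")
  case False
  \<comment> \<open>A point of norm E, where k vanishes; the Lipschitz bound measured from it bounds
    k on the ball. E replaces e because e may be negative.\<close>
  define z' :: "real^'n" where "z' = E *\<^sub>R axis undefined 1"
  have "norm z' = E" unfolding z'_def E_def by simp
  then have "\<bar>k z\<bar> \<le> L * norm (z - z')" using L(2)[of z z'] kE[of z'] by simp
  also have "norm (z - z') \<le> 2 * E + 1" using norm_triangle_ineq4[of z z'] \<open>norm z' = E\<close> False by simp
  finally show ?thesis using L(1) by (simp add: mult_left_mono)
 qed (use kE L E_def in simp)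
 have far: "norm y \<ge> norm x + E \<Longrightarrow> norm (x - y) \<ge> E" for x y :: "real^'n"
  using norm_triangle_ineq2[of y x] by (simp add: norm_minus_commute)
 have i: "integrable lborel (\<lambda>y. \<phi> y * k (x - y))" for x
  by (rule loc_int_mult(1)[OF \<phi> _ kb, of _ "norm x + E"]) (use kE far in auto)
 have bd: "\<bar>(LBINT y. \<phi> y * k (x - y)) - (LBINT y. \<phi> y * k (x' - y))\<bar> \<le> L * norm (x - x') * ball_L1 (norm x + e + 1) \<phi>"
  if "norm (x - x') \<le> 1" for x x' :: "real^'n"
 proof -
  have "(LBINT y. \<phi> y * k (x - y)) - (LBINT y. \<phi> y * k (x' - y)) = (LBINT y. \<phi> y * (k (x - y) - k (x' - y)))"
   using Bochner_Integration.integral_diff[OF i[of x] i[of x']] by (simp add: right_diff_distrib)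
  also have "\<bar>\<dots>\<bar> \<le> L * norm (x - x') * ball_L1 (norm x + e + 1) \<phi>"
  proof (rule loc_int_mult(2)[OF \<phi>])
   show "\<bar>k (x - y) - k (x' - y)\<bar> \<le> L * norm (x - x')" for y using L(2)[of "x - y" "x' - y"] by simp
   fix y :: "real^'n" assume y: "norm y \<ge> norm x + e + 1"
   have "norm (x - y) \<ge> e" using y norm_triangle_ineq2[of y x] by (simp add: norm_minus_commute)
   moreover have "norm (x' - y) \<ge> e"
    using y that norm_triangle_ineq2[of y x'] norm_triangle_ineq2[of x' x] by (simp add: norm_minus_commute)
   ultimately show "k (x - y) - k (x' - y) = 0" using k0 by simp
  qed measurable
  finally show ?thesis .
 qed
 show "integrable lborel (\<lambda>y. \<phi> y * k (x - y))" by (rule i)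
 show "norm (x - x') \<le> 1 \<Longrightarrow> \<bar>(LBINT y. \<phi> y * k (x - y)) - (LBINT y. \<phi> y * k (x' - y))\<bar> \<le> L * norm (x - x') * ball_L1 (norm x + e + 1) \<phi>"
  by (rule bd)
 show "continuous_on UNIV (\<lambda>x. LBINT y. \<phi> y * k (x - y))"
 proof (rule continuous_at_imp_continuous_on, intro ballI)
  fix x :: "real^'n"
  let ?I = "\<lambda>x. \<integral>y. \<phi> y * k (x - y) \<partial>lborel"
  have "((\<lambda>x'. ?I x' - ?I x) \<longlongrightarrow> 0) (at x)"
  proof (rule Lim_null_comparison)
   have "((\<lambda>x'. L * norm (x - x') * ball_L1 (norm x + e + 1) \<phi>) \<longlongrightarrow> L * norm (x - x) * ball_L1 (norm x + e + 1) \<phi>) (at x)"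
    by (intro tendsto_intros)
   then show "((\<lambda>x'. L * norm (x - x') * ball_L1 (norm x + e + 1) \<phi>) \<longlongrightarrow> 0) (at x)" by simp
   have "\<forall>\<^sub>F x' in at x. dist x' x < 1" unfolding eventually_at by (intro exI[of _ 1]) auto
   then show "\<forall>\<^sub>F x' in at x. norm (?I x' - ?I x) \<le> L * norm (x - x') * ball_L1 (norm x + e + 1) \<phi>"
    by eventually_elim (use bd[of x] in \<open>auto simp: dist_norm norm_minus_commute abs_minus_commute\<close>)
  qed
  then show "isCont ?I x" by (simp add: isCont_def LIM_zero_iff)
 qed
qed

lemma moll_continuous:
 fixes \<phi> :: "real^'n \<Rightarrow> real"
 assumes "loc_int \<phi>" "e > 0"
 shows "continuous_on UNIV (moll e \<phi>)"
proof -
 obtain L where "L \<ge> 0" "\<And>z z' :: real^'n. \<bar>mollifier e z - mollifier e z'\<bar> \<le> L * norm (z - z')"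
  using mollifier_lipschitz[OF assms(2)] by blast
 from convolution_continuous(3)[OF assms(1) mollifier_borel this mollifier_outside(1)[OF assms(2)]]
 show ?thesis unfolding moll_def[abs_def] .
qed

lemma moll_borel [measurable]:
 fixes \<phi> :: "real^'n \<Rightarrow> real"
 assumes "loc_int \<phi>" "e > 0"
 shows "moll e \<phi> \<in> \<B>"
 by (rule borel_measurable_continuous_onI[OF moll_continuous[OF assms]])

lemma moll_integrable:
 fixes \<phi> :: "real^'n \<Rightarrow> real"
 assumes "loc_int \<phi>" "e > 0"
 shows "integrable lborel (\<lambda>y. \<phi> y * mollifier e (x - y))"
proof -
 obtain L where "L \<ge> 0" "\<And>z z' :: real^'n. \<bar>mollifier e z - mollifier e z'\<bar> \<le> L * norm (z - z')"
  using mollifier_lipschitz[OF assms(2)] by blast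
 from convolution_continuous(1)[OF assms(1) mollifier_borel this mollifier_outside(1)[OF assms(2)]]
 show ?thesis .
qed

lemma moll_lipschitz:
 fixes \<phi> :: "real^'n \<Rightarrow> real"
 assumes "loc_int \<phi>" "e > 0"
 shows "\<exists>L\<ge>0. \<forall>x\<in>ball 0 R. \<forall>x'. norm (x - x') \<le> 1 \<longrightarrow> \<bar>moll e \<phi> x - moll e \<phi> x'\<bar> \<le> L * norm (x - x')"
proof -
 obtain L where L: "L \<ge> 0" "\<And>z z' :: real^'n. \<bar>mollifier e z - mollifier e z'\<bar> \<le> L * norm (z - z')"
  using mollifier_lipschitz[OF assms(2)] by blast
 have mono: "ball_L1 (norm x + e + 1) \<phi> \<le> ball_L1 (R + e + 1) \<phi>" if "x \<in> ball 0 R" for x :: "real^'n"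
  unfolding ball_L1_def
 proof (rule integral_mono)
  have "integrable lborel (\<lambda>y. norm (ind (ball 0 r) y * \<phi> y))" for r
   using assms(1) unfolding loc_int_def by (intro integrable_norm) blast
  then show "integrable lborel (\<lambda>y. ind (ball 0 r) y * \<bar>\<phi> y\<bar>)" for r by (simp add: abs_mult)
  then show "integrable lborel (\<lambda>y. ind (ball 0 (R + e + 1)) y * \<bar>\<phi> y\<bar>)" .
 qed (use that in \<open>auto split: split_indicator\<close>)
 have "\<bar>moll e \<phi> x - moll e \<phi> x'\<bar> \<le> (L * ball_L1 (R + e + 1) \<phi>) * norm (x - x')"
  if "x \<in> ball 0 R" "norm (x - x') \<le> 1" for x x'
 proof -
  have "\<bar>moll e \<phi> x - moll e \<phi> x'\<bar> \<le> L * norm (x - x') * ball_L1 (norm x + e + 1) \<phi>"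
   unfolding moll_def
   by (rule convolution_continuous(2)[OF assms(1) mollifier_borel L mollifier_outside(1)[OF assms(2)] that(2)])
  also have "\<dots> \<le> L * norm (x - x') * ball_L1 (R + e + 1) \<phi>"
   using L(1) mono[OF that(1)] by (intro mult_left_mono) auto
  finally show ?thesis by (simp add: mult_ac)
 qed
 then show ?thesis using L(1) ball_L1_nonneg[of "R + e + 1" \<phi>] by (intro exI[of _ "L * ball_L1 (R + e + 1) \<phi>"]) auto
qed

lemma mollifier_deriv_linear:
 fixes z u v :: "real^'n"
 shows
 "mollifier_deriv e z (u + v) = mollifier_deriv e z u + mollifier_deriv e z v"
 "mollifier_deriv e z (c *\<^sub>R v) = c * mollifier_deriv e z v"
proof -
 have "mollifier_deriv e z v = (bump (dpoly 1) e z * (-2) / e\<^sup>2 / (LBINT w. bump 1 e (w :: real^'n))) * (z \<bullet> v)" for v :: "real^'n"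
  by (simp add: mollifier_deriv_def bump_deriv_def)
 then show "mollifier_deriv e z (u + v) = mollifier_deriv e z u + mollifier_deriv e z v"
  "mollifier_deriv e z (c *\<^sub>R v) = c * mollifier_deriv e z v"
  by (simp_all only: inner_add_right inner_scaleR_right distrib_left mult.left_commute)
qed

text \<open>Differentiation under the integral by a direct remainder estimate: the derivative of the
  mollifier is Lipschitz, so its linearisation error is quadratic in the increment, uniformly in y
  and supported in a fixed ball.\<close>

lemma moll_has_derivative:
 fixes \<phi> :: "real^'n \<Rightarrow> real"
 assumes \<phi>: "loc_int \<phi>" and e: "e > 0"
 shows "(moll e \<phi> has_derivative moll_deriv e \<phi> x) (at x)"
  and "continuous_on UNIV (\<lambda>x. moll_deriv e \<phi> x v)"
proof -
 obtain L where L: "L \<ge> 0" "\<And>(z::real^'n) z' v. \<bar>mollifier_deriv e z v - mollifier_deriv e z' v\<bar> \<le> L * norm (z - z') * norm v"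
  using mollifier_deriv_lipschitz[OF e] by blast
 have L': "\<bar>mollifier_deriv e z v - mollifier_deriv e z' v\<bar> \<le> (L * norm v) * norm (z - z')" for z z' v :: "real^'n"
  using L(2)[of z v z'] by (simp add: mult_ac)
 have Lv: "L * norm v \<ge> 0" for v :: "real^'n" using L by simp
 note cc = convolution_continuous[OF \<phi> mollifier_deriv_borel Lv L' mollifier_outside(2)[OF e]]
 show "continuous_on UNIV (\<lambda>x. moll_deriv e \<phi> x v)"
  unfolding moll_deriv_def by (rule cc(3))
 have di: "integrable lborel (\<lambda>y. \<phi> y * mollifier_deriv e (x - y) v)" for v by (rule cc(1))
 define C where "C = L * ball_L1 (norm x + e + 1) \<phi>"
 have C0: "C \<ge> 0" unfolding C_def using L ball_L1_nonneg[of "norm x + e + 1" \<phi>] by simp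
 have far: "norm (x - y) \<ge> e" "norm (x' - y) \<ge> e" if y: "norm y \<ge> norm x + e + 1" and x': "norm (x' - x) \<le> 1" for y x' :: "real^'n"
  using y x' norm_triangle_ineq2[of y x] norm_triangle_ineq2[of y x'] norm_triangle_ineq2[of x' x] by (simp_all add: norm_minus_commute)
 have rem: "\<bar>moll e \<phi> x' - moll e \<phi> x - moll_deriv e \<phi> x (x' - x)\<bar> \<le> C * norm (x' - x) ^ 2" if x': "norm (x' - x) \<le> 1" for x'
 proof -
  let ?r = "\<lambda>y. mollifier e (x' - y) - mollifier e (x - y) - mollifier_deriv e (x - y) (x' - x)"
  have "moll e \<phi> x' - moll e \<phi> x - moll_deriv e \<phi> x (x' - x) = (LBINT y. \<phi> y * ?r y)"
   unfolding moll_def moll_deriv_def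
   using Bochner_Integration.integral_diff[OF Bochner_Integration.integrable_diff[OF moll_integrable[OF \<phi> e, of x'] moll_integrable[OF \<phi> e, of x]] di[of "x' - x"]]
    Bochner_Integration.integral_diff[OF moll_integrable[OF \<phi> e, of x'] moll_integrable[OF \<phi> e, of x]]
   by (simp add: right_diff_distrib)
  also have "\<bar>\<dots>\<bar> \<le> (L * norm (x' - x) ^ 2) * ball_L1 (norm x + e + 1) \<phi>"
  proof (rule loc_int_mult(2)[OF \<phi>])
   fix y
   show "\<bar>?r y\<bar> \<le> L * norm (x' - x) ^ 2"
   proof -
    have "norm (mollifier e (x' - y) - mollifier e (x - y) - mollifier_deriv e (x - y) ((x' - y) - (x - y))) \<le> norm ((x' - y) - (x - y)) * (L * norm (x' - x))"
    proof (rule differentiable_bound_linearization[where S="closed_segment (x - y) (x' - y)"])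
     show "(mollifier e has_derivative mollifier_deriv e z) (at z within closed_segment (x - y) (x' - y))" for z :: "real^'n"
      by (rule has_derivative_at_withinI[OF mollifier_has_derivative])
     show "x - y + t *\<^sub>R (x' - y - (x - y)) \<in> closed_segment (x - y) (x' - y)" if "t \<in> {0..1}" for t
      using that unfolding closed_segment_def by (auto simp: algebra_simps intro!: exI[of _ t])
     fix z assume "z \<in> closed_segment (x - y) (x' - y)"
     then have z: "norm (z - (x - y)) \<le> norm (x' - x)" using segment_bound(1)[of z "x - y" "x' - y"] by simp
     show "onorm (mollifier_deriv e z - mollifier_deriv e (x - y)) \<le> L * norm (x' - x)"
     proof (rule onorm_bound)
      fix v
      have "\<bar>mollifier_deriv e z v - mollifier_deriv e (x - y) v\<bar> \<le> L * norm (z - (x - y)) * norm v"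
       by (rule L(2))
      also have "\<dots> \<le> L * norm (x' - x) * norm v"
       using z L(1) by (intro mult_right_mono mult_left_mono) auto
      finally show "norm ((mollifier_deriv e z - mollifier_deriv e (x - y)) v) \<le> L * norm (x' - x) * norm v" by simp
     qed (use L in simp)
    qed simp
    then show ?thesis by (simp add: power2_eq_square mult_ac)
   qed
  next
   fix y :: "real^'n" assume "norm y \<ge> norm x + e + 1"
   from far[OF this x'] show "?r y = 0" by (simp add: mollifier_outside[OF e])
  qed measurable
  finally show ?thesis by (simp add: C_def mult_ac)
 qed
 show "(moll e \<phi> has_derivative moll_deriv e \<phi> x) (at x)"
 proof (rule has_derivativeI_sandwich[where e=1])
  show "bounded_linear (moll_deriv e \<phi> x)"
  proof (rule bounded_linear_intro[of _ "L * (2 * e + 2) * ball_L1 (norm x + e) \<phi>"])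
   show "moll_deriv e \<phi> x (u + v) = moll_deriv e \<phi> x u + moll_deriv e \<phi> x v" for u v
    unfolding moll_deriv_def mollifier_deriv_linear distrib_left using di by simp
   show "moll_deriv e \<phi> x (c *\<^sub>R v) = c *\<^sub>R moll_deriv e \<phi> x v" for c v
    unfolding moll_deriv_def mollifier_deriv_linear by (simp add: mult.left_commute)
   fix v :: "real^'n"
   have "\<bar>moll_deriv e \<phi> x v\<bar> \<le> (L * (2 * e + 2) * norm v) * ball_L1 (norm x + e) \<phi>"
    unfolding moll_deriv_def
   proof (rule loc_int_mult(2)[OF \<phi>])
    fix y
    show "\<bar>mollifier_deriv e (x - y) v\<bar> \<le> L * (2 * e + 2) * norm v"
    proof (cases "norm (x - y) \<ge> e")
     case False
     define z' :: "real^'n" where "z' = e *\<^sub>R axis undefined 1"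
     have "norm z' = e" unfolding z'_def using e by simp
     then have "\<bar>mollifier_deriv e (x - y) v\<bar> \<le> L * norm (x - y - z') * norm v" using L(2)[of "x - y" v z'] mollifier_outside(2)[OF e, of z'] by simp
     also have "\<dots> \<le> L * (2 * e + 2) * norm v"
      using norm_triangle_ineq4[of "x - y" z'] \<open>norm z' = e\<close> False L(1) by (intro mult_right_mono mult_left_mono) auto
     finally show ?thesis .
    qed (use L e in \<open>simp add: mollifier_outside(2)[OF e]\<close>)
   next
    fix y :: "real^'n" assume "norm y \<ge> norm x + e"
    then have "norm (x - y) \<ge> e" using norm_triangle_ineq2[of y x] by (simp add: norm_minus_commute)
    then show "mollifier_deriv e (x - y) v = 0" by (rule mollifier_outside(2)[OF e])
   qed measurable
   then show "norm (moll_deriv e \<phi> x v) \<le> norm v * (L * (2 * e + 2) * ball_L1 (norm x + e) \<phi>)" by (simp add: mult_ac)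
  qed
  show "((\<lambda>y. C * norm (y - x)) \<longlongrightarrow> 0) (at x)"
  proof -
   have "((\<lambda>y. C * norm (y - x)) \<longlongrightarrow> C * norm (x - x)) (at x)" by (intro tendsto_intros)
   then show ?thesis by simp
  qed
  show "norm (moll e \<phi> y - moll e \<phi> x - moll_deriv e \<phi> x (y - x)) / norm (y - x) \<le> C * norm (y - x)"
   if "y \<noteq> x" "dist y x < 1" for y
   using rem[of y] that by (simp add: dist_norm divide_le_eq power2_eq_square mult.assoc)
 qed simp
qed

section \<open>Riesz potentials\<close>

lemma ball_measurable [measurable]: "ball x r \<in> sets borel"
 by simp

lemma emeasure_ball_cart:
 fixes x :: "real^'n"
 assumes "r \<ge> 0"
 shows "emeasure lborel (ball x r) = ennreal (unit_ball_vol (real CARD('n)) * r ^ CARD('n))"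
  and "emeasure lborel (cball x r) = ennreal (unit_ball_vol (real CARD('n)) * r ^ CARD('n))"
 using emeasure_ball[OF assms, of x] emeasure_cball[OF assms, of x] by simp_all

lemma vol_pos: "unit_ball_vol (real CARD('n::finite)) > 0"
 by (rule unit_ball_vol_pos) simp

text \<open>Layer cake: norm (x - w) powr (-\<beta>) is the integral of \<beta> t powr (-1-\<beta>)
  over t \<ge> norm (x - w). After the exchange of integrals only volumes of balls remain, of radius
  t for t < R and of radius R beyond.\<close>

lemma riesz_ball_integral:
 fixes x :: "real^'n"
 assumes \<beta>: "0 < \<beta>" "\<beta> < real CARD('n)" and R: "R > 0"
 shows "(NBINT w. ennreal (ind (ball x R) w * norm (x - w) powr (-\<beta>)))
  \<le> ennreal (unit_ball_vol (real CARD('n)) * (1 + \<beta> / (real CARD('n) - \<beta>)) * R powr (real CARD('n) - \<beta>))"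
proof -
 let ?n = "real CARD('n)"
 let ?v = "unit_ball_vol ?n"
 have v: "?v > 0" by (rule vol_pos)
 define k where "k w t = ennreal (ind (ball x R) w) * (ennreal \<beta> * ennreal (ind {0..} (t - norm (x - w)) * t powr (-1-\<beta>)))" for w t
 have km [measurable]: "(\<lambda>(w, t). k w t) \<in> borel_measurable (borel \<Otimes>\<^sub>M borel)" unfolding k_def by measurable
 have "(NBINT w. ennreal (ind (ball x R) w * norm (x - w) powr (-\<beta>))) \<le> (NBINT w. NBINT t. k w t)"
 proof (rule nn_integral_mono)
  fix w
  show "ennreal (ind (ball x R) w * norm (x - w) powr (-\<beta>)) \<le> (NBINT t. k w t)"
  proof (cases "w = x")
   case False
   then have p: "norm (x - w) > 0" by simp
   have "(NBINT t. k w t) = ennreal (ind (ball x R) w) * (ennreal \<beta> * (NBINT t. ennreal (ind {norm (x - w)..} t * t powr (-1-\<beta>))))"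
    unfolding k_def by (simp add: nn_integral_cmult indicator_def)
   also have "\<dots> = ennreal (ind (ball x R) w * norm (x - w) powr (-\<beta>))"
    unfolding powr_tail_nn[OF p \<beta>(1)] using \<beta> by (simp add: ennreal_mult[symmetric])
   finally show ?thesis by simp
  qed simp
 qed
 also have "\<dots> = (NBINT t. NBINT w. k w t)"
  by (intro lborel_pair.Fubini'[symmetric]) measurable
 also have "\<dots> \<le> (NBINT t. ennreal (?v * \<beta>) * ennreal (ind {0<..<R} t * t powr (?n - 1 - \<beta>)) + ennreal (?v * R ^ CARD('n) * \<beta>) * ennreal (ind {R..} t * t powr (-1-\<beta>)))"
 proof (rule nn_integral_mono_AE)
  show "AE t in lborel. (NBINT w. k w t) \<le> ennreal (?v * \<beta>) * ennreal (ind {0<..<R} t * t powr (?n - 1 - \<beta>)) + ennreal (?v * R ^ CARD('n) * \<beta>) * ennreal (ind {R..} t * t powr (-1-\<beta>))"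
   using AE_lborel_singleton[of 0]
  proof eventually_elim
   case (elim t)
   show ?case
   proof (cases "t > 0")
    case True
    have "(NBINT w. k w t) \<le> (NBINT w. ennreal (\<beta> * t powr (-1-\<beta>)) * ind (if t < R then cball x t else ball x R) w)"
     unfolding k_def using \<beta>
     by (intro nn_integral_mono) (auto simp: ennreal_mult dist_norm split: split_indicator)
    also have "\<dots> = ennreal (\<beta> * t powr (-1-\<beta>)) * emeasure lborel (if t < R then cball x t else ball x R)"
     by (rule nn_integral_cmult_indicator) auto
    also have "\<dots> = ennreal (\<beta> * t powr (-1-\<beta>)) * ennreal (?v * (if t < R then t ^ CARD('n) else R ^ CARD('n)))"
     using True R by (simp add: emeasure_ball_cart)
    also have "\<dots> = ennreal (\<beta> * t powr (-1-\<beta>) * (?v * (if t < R then t ^ CARD('n) else R ^ CARD('n))))"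
     using \<beta> v R True by (subst ennreal_mult) auto
    also have "\<dots> = ennreal (?v * \<beta>) * ennreal (ind {0<..<R} t * t powr (?n - 1 - \<beta>)) + ennreal (?v * R ^ CARD('n) * \<beta>) * ennreal (ind {R..} t * t powr (-1-\<beta>))"
    proof (cases "t < R")
     case tR: True
     have "t powr (-1-\<beta>) * t ^ CARD('n) = t powr (?n - 1 - \<beta>)"
      using True by (simp add: powr_realpow[symmetric] powr_add[symmetric] algebra_simps)
     then have "\<beta> * t powr (-1-\<beta>) * (?v * t ^ CARD('n)) = ?v * \<beta> * t powr (?n - 1 - \<beta>)" by simp
     then show ?thesis using True tR \<beta> v by (simp add: ennreal_mult[symmetric])
    next
     case False
     then show ?thesis using True \<beta> v R by (simp add: ennreal_mult[symmetric] mult_ac)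
    qed
    finally show ?thesis .
   next
    case False
    then have "k w t = 0" for w
    proof -
     have "t - norm (x - w) < 0" using elim False norm_ge_zero[of "x - w"] by linarith
     then show ?thesis by (simp add: k_def indicator_def)
    qed
    then show ?thesis by simp
   qed
  qed
 qed
 also have "\<dots> = ennreal (?v * \<beta>) * (NBINT t. ennreal (ind {0<..<R} t * t powr (?n - 1 - \<beta>))) + ennreal (?v * R ^ CARD('n) * \<beta>) * (NBINT t. ennreal (ind {R..} t * t powr (-1-\<beta>)))"
  by (simp add: nn_integral_add nn_integral_cmult)
 also have "\<dots> = ennreal (?v * \<beta>) * ennreal (R powr (?n - \<beta>) / (?n - \<beta>)) + ennreal (?v * R ^ CARD('n) * \<beta>) * ennreal (R powr (-\<beta>) / \<beta>)"
  using powr_head_nn[of R "?n - 1 - \<beta>"] powr_tail_nn[OF R \<beta>(1)] R \<beta> by simp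
 also have "\<dots> = ennreal ((?v * \<beta>) * (R powr (?n - \<beta>) / (?n - \<beta>)) + (?v * R ^ CARD('n) * \<beta>) * (R powr (-\<beta>) / \<beta>))"
 proof -
  have "ennreal a * ennreal c + ennreal d * ennreal f = ennreal (a * c + d * f)"
   if "a \<ge> 0" "c \<ge> 0" "d \<ge> 0" "f \<ge> 0" for a c d f
   using that by (simp add: ennreal_mult)
  from this[of "?v * \<beta>" "R powr (?n - \<beta>) / (?n - \<beta>)" "?v * R ^ CARD('n) * \<beta>" "R powr (-\<beta>) / \<beta>"]
  show ?thesis using \<beta> v R by auto
 qed
 also have "(?v * \<beta>) * (R powr (?n - \<beta>) / (?n - \<beta>)) + (?v * R ^ CARD('n) * \<beta>) * (R powr (-\<beta>) / \<beta>) = ?v * (1 + \<beta> / (?n - \<beta>)) * R powr (?n - \<beta>)"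
 proof -
  have "R ^ CARD('n) * R powr (-\<beta>) = R powr (?n - \<beta>)"
   using R by (simp add: powr_realpow[symmetric] powr_add[symmetric])
  then have "(?v * R ^ CARD('n) * \<beta>) * (R powr (-\<beta>) / \<beta>) = ?v * R powr (?n - \<beta>)" using \<beta> by simp
  then show ?thesis by (simp add: algebra_simps)
 qed
 finally show ?thesis .
qed

text \<open>Allows the Riesz potential of a mollified measure to be bounded by that of the measure,
  uniformly in e. If x is far from the ball, the kernel is comparable on it to its value at the
  centre; otherwise the ball lies in the ball of radius 3 e around x, and e is at least half of norm
  (x - z).\<close>

lemma riesz_kernel_mean:
 assumes \<beta>: "0 < \<beta>" "\<beta> < real CARD('n)"
 obtains K where "K > 0" "\<And>(x :: real^'n) z e. x \<noteq> z \<Longrightarrow> e > 0 \<Longrightarrow>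
  (NBINT w. ennreal (ind (ball z e) w * norm (x - w) powr (-\<beta>))) \<le> ennreal (K * e ^ CARD('n) * norm (x - z) powr (-\<beta>))"
proof -
 let ?n = "real CARD('n)"
 let ?v = "unit_ball_vol ?n"
 have v: "?v > 0" by (rule vol_pos)
 define K0 where "K0 = ?v * (1 + \<beta> / (?n - \<beta>))"
 have K0: "K0 > 0" unfolding K0_def using v \<beta> by (intro mult_pos_pos add_pos_pos) auto
 define K where "K = ?v * 2 powr \<beta> + K0 * 3 powr (?n - \<beta>) * 2 powr \<beta>"
 have K: "K > 0" unfolding K_def using v K0 by (intro add_pos_pos) auto
 have "(NBINT w. ennreal (ind (ball z e) w * norm (x - w) powr (-\<beta>))) \<le> ennreal (K * e ^ CARD('n) * norm (x - z) powr (-\<beta>))"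
  if xz: "x \<noteq> z" and e: "e > 0" for x z :: "real^'n" and e
 proof (cases "norm (x - z) \<ge> 2 * e")
  case True
  have "(NBINT w. ennreal (ind (ball z e) w * norm (x - w) powr (-\<beta>))) \<le> (NBINT w. ennreal ((norm (x - z) / 2) powr (-\<beta>)) * ind (ball z e) w)"
  proof (rule nn_integral_mono)
   fix w
   have "norm (x - w) powr (-\<beta>) \<le> (norm (x - z) / 2) powr (-\<beta>)" if "w \<in> ball z e"
   proof (rule powr_mono2')
    have "norm (x - z) \<le> norm (x - w) + norm (z - w)" using norm_triangle_ineq4[of "x - w" "z - w"] by simp
    then show "norm (x - z) / 2 \<le> norm (x - w)" using that True by (simp add: dist_norm)
   qed (use xz \<beta> in auto)
   then show "ennreal (ind (ball z e) w * norm (x - w) powr (-\<beta>)) \<le> ennreal ((norm (x - z) / 2) powr (-\<beta>)) * ind (ball z e) w"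
    by (auto intro!: ennreal_leI split: split_indicator)
  qed
  also have "\<dots> = ennreal ((norm (x - z) / 2) powr (-\<beta>)) * ennreal (?v * e ^ CARD('n))"
   using e by (subst nn_integral_cmult_indicator) (auto simp: emeasure_ball_cart)
  also have "\<dots> = ennreal ((norm (x - z) / 2) powr (-\<beta>) * (?v * e ^ CARD('n)))" using v e by (simp add: ennreal_mult)
  also have "\<dots> \<le> ennreal (K * e ^ CARD('n) * norm (x - z) powr (-\<beta>))"
  proof (rule ennreal_leI)
   have "(norm (x - z) / 2) powr (-\<beta>) = 2 powr \<beta> * norm (x - z) powr (-\<beta>)" by (simp add: powr_divide powr_minus field_simps)
   moreover have "(?v * 2 powr \<beta>) * (e ^ CARD('n) * norm (x - z) powr (-\<beta>)) \<le> K * (e ^ CARD('n) * norm (x - z) powr (-\<beta>))"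
    unfolding K_def using K0 e by (intro mult_right_mono) auto
   ultimately show "(norm (x - z) / 2) powr (-\<beta>) * (?v * e ^ CARD('n)) \<le> K * e ^ CARD('n) * norm (x - z) powr (-\<beta>)" by (simp add: mult_ac)
  qed
  finally show ?thesis .
 next
  case False
  have "(NBINT w. ennreal (ind (ball z e) w * norm (x - w) powr (-\<beta>))) \<le> (NBINT w. ennreal (ind (ball x (3 * e)) w * norm (x - w) powr (-\<beta>)))"
  proof (intro nn_integral_mono ennreal_leI mult_right_mono)
   fix w
   have "w \<in> ball x (3 * e)" if "w \<in> ball z e"
    using that False norm_triangle_ineq[of "x - z" "z - w"] by (simp add: dist_norm)
   then show "ind (ball z e) w \<le> (ind (ball x (3 * e)) w :: real)" by (auto split: split_indicator)
  qed simp
  also have "\<dots> \<le> ennreal (K0 * (3 * e) powr (?n - \<beta>))" unfolding K0_def using e by (intro riesz_ball_integral \<beta>) auto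
  also have "\<dots> \<le> ennreal (K * e ^ CARD('n) * norm (x - z) powr (-\<beta>))"
  proof (rule ennreal_leI)
   have "e powr (-\<beta>) \<le> (norm (x - z) / 2) powr (-\<beta>)" using False xz \<beta> by (intro powr_mono2') auto
   also have "\<dots> = 2 powr \<beta> * norm (x - z) powr (-\<beta>)" by (simp add: powr_divide powr_minus field_simps)
   finally have e1: "e powr (-\<beta>) \<le> 2 powr \<beta> * norm (x - z) powr (-\<beta>)" .
   have "(3 * e) powr (?n - \<beta>) = 3 powr (?n - \<beta>) * (e ^ CARD('n) * e powr (-\<beta>))"
    using e by (simp add: powr_mult powr_realpow[symmetric] powr_add[symmetric])
   then have "K0 * (3 * e) powr (?n - \<beta>) = (K0 * 3 powr (?n - \<beta>) * e ^ CARD('n)) * e powr (-\<beta>)" by simp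
   also have "\<dots> \<le> (K0 * 3 powr (?n - \<beta>) * e ^ CARD('n)) * (2 powr \<beta> * norm (x - z) powr (-\<beta>))"
    using K0 e by (intro mult_left_mono e1) auto
   also have "\<dots> = (K0 * 3 powr (?n - \<beta>) * 2 powr \<beta>) * (e ^ CARD('n) * norm (x - z) powr (-\<beta>))" by simp
   also have "\<dots> \<le> K * (e ^ CARD('n) * norm (x - z) powr (-\<beta>))"
    unfolding K_def using v e by (intro mult_right_mono) auto
   finally show "K0 * (3 * e) powr (?n - \<beta>) \<le> K * e ^ CARD('n) * norm (x - z) powr (-\<beta>)" by (simp add: mult.assoc)
  qed
  finally show ?thesis .
 qed
 then show ?thesis using that K by blast
qed

section \<open>Pointwise Poincare inequalities by integration along rays\<close>

lemma nn_integral_homothety: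
 fixes h :: "real^'n \<Rightarrow> ennreal"
 assumes [measurable]: "h \<in> \<B>" and \<tau>: "\<tau> > 0"
 shows "(NBINT w. h w) = ennreal (\<tau> ^ CARD('n)) * (NBINT z. h (x + \<tau> *\<^sub>R (z - x)))"
proof -
 have "(NBINT w. h w) = ennreal (\<tau> ^ CARD('n)) * (NBINT z. h ((x - \<tau> *\<^sub>R x) + \<tau> *\<^sub>R z))"
  using \<tau> by (subst lborel_affine[of \<tau> "x - \<tau> *\<^sub>R x"])
   (simp_all add: nn_integral_density nn_integral_distr nn_integral_cmult)
 also have "(\<lambda>z. (x - \<tau> *\<^sub>R x) + \<tau> *\<^sub>R z) = (\<lambda>z. x + \<tau> *\<^sub>R (z - x))" by (auto simp: algebra_simps)
 finally show ?thesis by (simp add: algebra_simps)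
qed

text \<open>Integrate the gradient over the segment from x to z, exchange, and substitute w = x +
  \<tau> (z - x). The homothety contributes \<tau> to the power -n, and norm (x - z) = norm (x - w)
  / \<tau> one more negative power.\<close>

lemma segment_estimate:
 fixes f :: "real^'n \<Rightarrow> real" and G :: "real^'n \<Rightarrow> ennreal"
 assumes f: "\<And>y. (f has_derivative f' y) (at y)" and f'c: "\<And>v. continuous_on UNIV (\<lambda>y. f' y v)"
  and Gm [measurable]: "G \<in> \<B>"
  and G: "\<And>y v. y \<in> ball x r \<Longrightarrow> eabs (f' y v) \<le> G y * ennreal (norm v)"
  and r: "r > 0"
 shows "(NBINT z. ind (ball x r) z * eabs (f z - f x))
  \<le> (NBINT \<tau>. ennreal (ind {0<..<1} \<tau> * \<tau> powr (- real CARD('n) - 1)) * (NBINT w. ennreal (ind {0<..} (\<tau> * r - norm (x - w)) * norm (x - w)) * G w))"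
proof -
 have fc: "continuous_on UNIV f"
  by (rule continuous_at_imp_continuous_on) (use f has_derivative_continuous in blast)
 have [measurable]: "f \<in> \<B>" by (rule borel_measurable_continuous_onI[OF fc])
 have line: "eabs (f z - f x) \<le> (NBINT \<tau>. ind {0<..<1} \<tau> * (ennreal (norm (x - z)) * G (x + \<tau> *\<^sub>R (z - x))))" if z: "z \<in> ball x r" for z
 proof -
  let ?d = "\<lambda>\<tau>. f' (x + \<tau> *\<^sub>R (z - x)) (z - x)"
  have dc: "continuous_on UNIV ?d"
   by (rule continuous_on_compose2[OF f'c]) (auto intro!: continuous_intros)
  have [measurable]: "?d \<in> \<B>" by (rule borel_measurable_continuous_onI[OF dc])
  have "(LBINT \<tau>. ?d \<tau> * ind {0..1} \<tau>) = f (x + 1 *\<^sub>R (z - x)) - f (x + 0 *\<^sub>R (z - x))"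
  proof (rule integral_FTC_Icc_real)
   fix \<tau> :: real
   have "((\<lambda>\<tau>. x + \<tau> *\<^sub>R (z - x)) has_derivative (\<lambda>h. h *\<^sub>R (z - x))) (at \<tau>)"
    by (auto intro!: derivative_eq_intros)
   from has_derivative_compose[OF this f]
   have "((\<lambda>\<tau>. f (x + \<tau> *\<^sub>R (z - x))) has_derivative (\<lambda>h. f' (x + \<tau> *\<^sub>R (z - x)) (h *\<^sub>R (z - x)))) (at \<tau>)" .
   moreover have "f' (x + \<tau> *\<^sub>R (z - x)) (h *\<^sub>R (z - x)) = ?d \<tau> * h" for h
    using linear_cmul[OF has_derivative_linear[OF f[of "x + \<tau> *\<^sub>R (z - x)"]], of h "z - x"] by simp
   ultimately show "((\<lambda>\<tau>. f (x + \<tau> *\<^sub>R (z - x))) has_real_derivative ?d \<tau>) (at \<tau>)"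
    by (simp add: has_field_derivative_def)
   show "isCont ?d \<tau>" using dc by (simp add: continuous_on_eq_continuous_at)
  qed simp
  then have "f z - f x = (LBINT \<tau>. ?d \<tau> * ind {0..1} \<tau>)" by simp
  then have "eabs (f z - f x) \<le> (NBINT \<tau>. ennreal (norm (?d \<tau> * ind {0..1} \<tau>)))"
   using integral_norm_bound_ennreal[of lborel "\<lambda>\<tau>. ?d \<tau> * ind {0..1} \<tau>"]
   by (cases "integrable lborel (\<lambda>\<tau>. ?d \<tau> * ind {0..1} \<tau>)") (auto simp: not_integrable_integral_eq)
  also have "\<dots> \<le> (NBINT \<tau>. ind {0<..<1} \<tau> * (ennreal (norm (x - z)) * G (x + \<tau> *\<^sub>R (z - x))))"
  proof (rule nn_integral_mono_AE)
   show "AE \<tau> in lborel. ennreal (norm (?d \<tau> * ind {0..1} \<tau>)) \<le> ind {0<..<1} \<tau> * (ennreal (norm (x - z)) * G (x + \<tau> *\<^sub>R (z - x)))"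
    using AE_lborel_singleton[of 0] AE_lborel_singleton[of 1]
   proof eventually_elim
    case (elim \<tau>)
    show ?case
    proof (cases "\<tau> \<in> {0<..<1}")
     case True
     have "norm (\<tau> *\<^sub>R (z - x)) \<le> 1 * norm (z - x)"
      using True unfolding norm_scaleR by (intro mult_right_mono) auto
     then have "x + \<tau> *\<^sub>R (z - x) \<in> ball x r" using z by (simp add: dist_norm norm_minus_commute)
     from G[OF this, of "z - x"] show ?thesis using True by (simp add: norm_minus_commute mult.commute)
    qed (use elim in auto)
   qed
  qed
  finally show ?thesis .
 qed
 have "(NBINT z. ind (ball x r) z * eabs (f z - f x))
   \<le> (NBINT z. NBINT \<tau>. ind (ball x r) z * (ind {0<..<1} \<tau> * (ennreal (norm (x - z)) * G (x + \<tau> *\<^sub>R (z - x)))))"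
  using line by (intro nn_integral_mono) (auto split: split_indicator)
 also have "\<dots> = (NBINT \<tau>. NBINT z. ind (ball x r) z * (ind {0<..<1} \<tau> * (ennreal (norm (x - z)) * G (x + \<tau> *\<^sub>R (z - x)))))"
  by (intro lborel_pair.Fubini'[symmetric]) measurable
 also have "\<dots> \<le> (NBINT \<tau>. ennreal (ind {0<..<1} \<tau> * \<tau> powr (- real CARD('n) - 1)) * (NBINT w. ennreal (ind {0<..} (\<tau> * r - norm (x - w)) * norm (x - w)) * G w))"
 proof (rule nn_integral_mono)
  fix \<tau> :: real
  show "(NBINT z. ind (ball x r) z * (ind {0<..<1} \<tau> * (ennreal (norm (x - z)) * G (x + \<tau> *\<^sub>R (z - x)))))
   \<le> ennreal (ind {0<..<1} \<tau> * \<tau> powr (- real CARD('n) - 1)) * (NBINT w. ennreal (ind {0<..} (\<tau> * r - norm (x - w)) * norm (x - w)) * G w)"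
  proof (cases "\<tau> \<in> {0<..<1}")
   case True
   then have \<tau>: "\<tau> > 0" by simp
   define h where "h w = ennreal (ind {0<..} (\<tau> * r - norm (x - w)) * norm (x - w)) * G w" for w
   have [measurable]: "h \<in> \<B>" unfolding h_def by measurable
   have "ind (ball x r) z * (ind {0<..<1} \<tau> * (ennreal (norm (x - z)) * G (x + \<tau> *\<^sub>R (z - x)))) = ennreal (1 / \<tau>) * h (x + \<tau> *\<^sub>R (z - x))" for z
   proof (cases "z \<in> ball x r")
    case zr: True
    then have "\<tau> * norm (x - z) < \<tau> * r" using \<tau> by (simp add: dist_norm)
    moreover have "norm (x - (x + \<tau> *\<^sub>R (z - x))) = \<tau> * norm (x - z)" using \<tau> by (simp add: norm_minus_commute)
    ultimately show ?thesis using zr True \<tau> unfolding h_def by (simp add: ennreal_mult[symmetric] mult.assoc[symmetric])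
   next
    case False
    moreover have "norm (x - (x + \<tau> *\<^sub>R (z - x))) = \<tau> * norm (x - z)" using \<tau> by (simp add: norm_minus_commute)
    ultimately show ?thesis using \<tau> unfolding h_def by (auto simp: dist_norm not_less)
   qed
   then have "(NBINT z. ind (ball x r) z * (ind {0<..<1} \<tau> * (ennreal (norm (x - z)) * G (x + \<tau> *\<^sub>R (z - x)))))
    = ennreal (1 / \<tau>) * (NBINT z. h (x + \<tau> *\<^sub>R (z - x)))"
    by (simp add: nn_integral_cmult)
   also have "\<dots> = ennreal (\<tau> powr (- real CARD('n) - 1)) * (ennreal (\<tau> ^ CARD('n)) * (NBINT z. h (x + \<tau> *\<^sub>R (z - x))))"
   proof -
    have "\<tau> powr (- real CARD('n) - 1) * \<tau> ^ CARD('n) = \<tau> powr (-1)"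
     using \<tau> by (simp add: powr_realpow[symmetric] powr_add[symmetric])
    then have "\<tau> powr (- real CARD('n) - 1) * \<tau> ^ CARD('n) = 1 / \<tau>" using \<tau> by (simp add: powr_minus_divide)
    then show ?thesis using \<tau> by (simp add: mult.assoc[symmetric] ennreal_mult[symmetric])
   qed
   also have "ennreal (\<tau> ^ CARD('n)) * (NBINT z. h (x + \<tau> *\<^sub>R (z - x))) = (NBINT w. h w)"
    by (rule nn_integral_homothety[symmetric]) (use \<tau> in auto)
   finally show ?thesis using True unfolding h_def by simp
  qed simp
 qed
 finally show ?thesis .
qed

text \<open>Where norm (x - w) < \<tau> r, the factor norm (x - w) is at most (\<tau> r) powr (n +
  s) times norm (x - w) powr (1 - n - s). The powers of \<tau> then combine to s - 1, which is
  integrable because s > 0; this is the origin of the factor 1 / s.\<close>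

lemma poincare_potential:
 fixes f :: "real^'n \<Rightarrow> real" and G :: "real^'n \<Rightarrow> ennreal"
 assumes f: "\<And>y. (f has_derivative f' y) (at y)" and f'c: "\<And>v. continuous_on UNIV (\<lambda>y. f' y v)"
  and Gm [measurable]: "G \<in> \<B>"
  and G: "\<And>y v. y \<in> ball x r \<Longrightarrow> eabs (f' y v) \<le> G y * ennreal (norm v)"
  and r: "r > 0" and s: "s > 0"
 shows "(NBINT z. ind (ball x r) z * eabs (f z - f x))
  \<le> ennreal (r powr (real CARD('n) + s) / s) * (NBINT w. ind (ball x r) w * (ennreal (norm (x - w) powr (1 - real CARD('n) - s)) * G w))"
proof -
 let ?n = "real CARD('n)"
 let ?I = "NBINT w. ind (ball x r) w * (ennreal (norm (x - w) powr (1 - ?n - s)) * G w)"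
 note segment_estimate[OF f f'c Gm G r]
 also have "(NBINT \<tau>. ennreal (ind {0<..<1} \<tau> * \<tau> powr (- ?n - 1)) * (NBINT w. ennreal (ind {0<..} (\<tau> * r - norm (x - w)) * norm (x - w)) * G w))
   \<le> (NBINT \<tau>. ennreal (ind {0<..<1} \<tau> * \<tau> powr (s - 1)) * (ennreal (r powr (?n + s)) * ?I))"
 proof (rule nn_integral_mono)
  fix \<tau> :: real
  show "ennreal (ind {0<..<1} \<tau> * \<tau> powr (- ?n - 1)) * (NBINT w. ennreal (ind {0<..} (\<tau> * r - norm (x - w)) * norm (x - w)) * G w)
   \<le> ennreal (ind {0<..<1} \<tau> * \<tau> powr (s - 1)) * (ennreal (r powr (?n + s)) * ?I)"
  proof (cases "\<tau> \<in> {0<..<1}")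
   case True
   then have \<tau>: "0 < \<tau>" "\<tau> < 1" by auto
   have pt: "\<tau> powr (- ?n - 1) * (ind {0<..} (\<tau> * r - norm (x - w)) * norm (x - w)) \<le> \<tau> powr (s - 1) * r powr (?n + s) * (ind (ball x r) w * norm (x - w) powr (1 - ?n - s))" for w
   proof (cases "norm (x - w) < \<tau> * r \<and> w \<noteq> x")
    case w: True
    define \<rho> where "\<rho> = norm (x - w)"
    have \<rho>: "\<rho> > 0" "\<rho> < \<tau> * r" using w unfolding \<rho>_def by auto
    have "\<tau> * r < 1 * r" using \<tau> r by (intro mult_strict_right_mono) auto
    then have wr: "w \<in> ball x r" using \<rho> unfolding \<rho>_def by (simp add: dist_norm)
    have "\<rho> = \<rho> powr (1 - ?n - s) * \<rho> powr (?n + s)" using \<rho> by (simp add: powr_add[symmetric])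
    also have "\<dots> \<le> \<rho> powr (1 - ?n - s) * (\<tau> * r) powr (?n + s)"
     using \<rho> s by (intro mult_left_mono powr_mono2) auto
    also have "(\<tau> * r) powr (?n + s) = \<tau> powr (?n + s) * r powr (?n + s)" using \<tau> r by (simp add: powr_mult)
    finally have "\<tau> powr (- ?n - 1) * \<rho> \<le> \<tau> powr (- ?n - 1) * (\<rho> powr (1 - ?n - s) * (\<tau> powr (?n + s) * r powr (?n + s)))"
     by (intro mult_left_mono) auto
    also have "\<dots> = (\<tau> powr (- ?n - 1) * \<tau> powr (?n + s)) * r powr (?n + s) * \<rho> powr (1 - ?n - s)" by simp
    also have "\<tau> powr (- ?n - 1) * \<tau> powr (?n + s) = \<tau> powr (s - 1)" using \<tau> by (simp add: powr_add[symmetric])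
    finally show ?thesis using \<rho> wr unfolding \<rho>_def[symmetric] by simp
   qed auto
   have "ennreal (\<tau> powr (- ?n - 1)) * (NBINT w. ennreal (ind {0<..} (\<tau> * r - norm (x - w)) * norm (x - w)) * G w)
    = (NBINT w. ennreal (\<tau> powr (- ?n - 1) * (ind {0<..} (\<tau> * r - norm (x - w)) * norm (x - w))) * G w)"
    by (subst nn_integral_cmult[symmetric]) (auto simp: ennreal_mult mult.assoc)
   also have "\<dots> \<le> (NBINT w. ennreal (\<tau> powr (s - 1) * r powr (?n + s) * (ind (ball x r) w * norm (x - w) powr (1 - ?n - s))) * G w)"
    by (intro nn_integral_mono mult_right_mono ennreal_leI pt) auto
   also have "\<dots> = (NBINT w. ennreal (\<tau> powr (s - 1) * r powr (?n + s)) * (ind (ball x r) w * (ennreal (norm (x - w) powr (1 - ?n - s)) * G w)))"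
    by (intro nn_integral_cong) (auto simp: ennreal_mult mult.assoc split: split_indicator)
   also have "\<dots> = ennreal (\<tau> powr (s - 1)) * (ennreal (r powr (?n + s)) * ?I)"
    by (subst nn_integral_cmult) (auto simp: ennreal_mult mult.assoc)
   finally show ?thesis using True by simp
  qed simp
 qed
 also have "\<dots> = ennreal (1 / s) * (ennreal (r powr (?n + s)) * ?I)"
  using powr_head_nn[of 1 "s - 1"] s by (simp add: nn_integral_multc)
 also have "\<dots> = ennreal (r powr (?n + s) / s) * ?I"
  using s by (simp add: mult.assoc[symmetric] ennreal_mult[symmetric])
 finally show ?thesis .
qed

text \<open>Counterpart without a singular kernel: if the means of G over small balls are bounded,
  the mass in the ball of radius \<tau> r and the bound norm (x - w) \<le> \<tau> r together cancel
  the singular power of \<tau> exactly. Meant for F itself, whose mollified gradient has bounded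
  means.\<close>

lemma poincare_linear:
 fixes f :: "real^'n \<Rightarrow> real" and G :: "real^'n \<Rightarrow> ennreal"
 assumes f: "\<And>y. (f has_derivative f' y) (at y)" and f'c: "\<And>v. continuous_on UNIV (\<lambda>y. f' y v)"
  and Gm [measurable]: "G \<in> \<B>"
  and G: "\<And>y v. y \<in> ball x r \<Longrightarrow> eabs (f' y v) \<le> G y * ennreal (norm v)"
  and r: "r > 0"
  and A: "\<And>\<rho>. 0 < \<rho> \<Longrightarrow> \<rho> \<le> r \<Longrightarrow> (NBINT w. ind (ball x \<rho>) w * G w) \<le> A * ennreal (\<rho> ^ CARD('n))"
 shows "(NBINT z. ind (ball x r) z * eabs (f z - f x)) \<le> A * ennreal (r * r ^ CARD('n))"
proof -
 let ?n = "real CARD('n)"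
 note segment_estimate[OF f f'c Gm G r]
 also have "(NBINT \<tau>. ennreal (ind {0<..<1} \<tau> * \<tau> powr (- ?n - 1)) * (NBINT w. ennreal (ind {0<..} (\<tau> * r - norm (x - w)) * norm (x - w)) * G w))
   \<le> (NBINT \<tau>. (A * ennreal (r * r ^ CARD('n))) * ind {0<..<1::real} \<tau>)"
 proof (rule nn_integral_mono)
  fix \<tau> :: real
  show "ennreal (ind {0<..<1} \<tau> * \<tau> powr (- ?n - 1)) * (NBINT w. ennreal (ind {0<..} (\<tau> * r - norm (x - w)) * norm (x - w)) * G w)
   \<le> (A * ennreal (r * r ^ CARD('n))) * ind {0<..<1} \<tau>"
  proof (cases "\<tau> \<in> {0<..<1}")
   case True
   then have \<tau>: "0 < \<tau>" "\<tau> < 1" by auto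
   have \<tau>r: "0 < \<tau> * r" "\<tau> * r \<le> r" using \<tau> r by (auto simp: mult_le_cancel_right1)
   have "(NBINT w. ennreal (ind {0<..} (\<tau> * r - norm (x - w)) * norm (x - w)) * G w) \<le> (NBINT w. ennreal (\<tau> * r) * (ind (ball x (\<tau> * r)) w * G w))"
    using \<tau>r by (intro nn_integral_mono) (auto simp: dist_norm intro!: mult_right_mono ennreal_leI split: split_indicator)
   also have "\<dots> = ennreal (\<tau> * r) * (NBINT w. ind (ball x (\<tau> * r)) w * G w)" by (rule nn_integral_cmult) measurable
   also have "\<dots> \<le> ennreal (\<tau> * r) * (A * ennreal ((\<tau> * r) ^ CARD('n)))" by (intro mult_left_mono A \<tau>r) auto
   finally have "ennreal (\<tau> powr (- ?n - 1)) * (NBINT w. ennreal (ind {0<..} (\<tau> * r - norm (x - w)) * norm (x - w)) * G w)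
     \<le> ennreal (\<tau> powr (- ?n - 1)) * (ennreal (\<tau> * r) * (A * ennreal ((\<tau> * r) ^ CARD('n))))" by (rule mult_left_mono) simp
   also have "\<dots> = A * (ennreal (\<tau> powr (- ?n - 1)) * (ennreal (\<tau> * r) * ennreal ((\<tau> * r) ^ CARD('n))))" by (simp only: mult_ac)
   also have "ennreal (\<tau> powr (- ?n - 1)) * (ennreal (\<tau> * r) * ennreal ((\<tau> * r) ^ CARD('n))) = ennreal (\<tau> powr (- ?n - 1) * (\<tau> * r * (\<tau> * r) ^ CARD('n)))"
    using \<tau>r by (simp add: ennreal_mult)
   also have "\<tau> powr (- ?n - 1) * (\<tau> * r * (\<tau> * r) ^ CARD('n)) = (\<tau> powr (- ?n - 1) * \<tau> powr (?n + 1)) * (r * r ^ CARD('n))"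
    using \<tau> by (simp add: powr_add powr_realpow power_mult_distrib)
   also have "\<tau> powr (- ?n - 1) * \<tau> powr (?n + 1) = 1" using \<tau> by (simp add: powr_add[symmetric])
   finally show ?thesis using True by simp
  qed simp
 qed
 also have "\<dots> = A * ennreal (r * r ^ CARD('n))" by (subst nn_integral_cmult_indicator) auto
 finally show ?thesis .
qed

section \<open>Approximate limits\<close>

lemma nn_integral_ball_const:
 fixes x :: "real^'n"
 assumes "r > 0" "c \<ge> 0"
 shows "(NBINT y. ind (ball x r) y * ennreal c) = ennreal (c * (unit_ball_vol (real CARD('n)) * r ^ CARD('n)))"
proof -
 have "(NBINT y. ind (ball x r) y * ennreal c) = (NBINT y. ennreal c * ind (ball x r) y)"
  by (simp only: mult.commute)
 also have "\<dots> = ennreal c * emeasure lborel (ball x r)" by (rule nn_integral_cmult_indicator) simp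
 also have "\<dots> = ennreal (c * (unit_ball_vol (real CARD('n)) * r ^ CARD('n)))"
  unfolding emeasure_ball_cart(1)[OF less_imp_le[OF assms(1)]]
  using assms vol_pos[where 'n='n] by (intro ennreal_mult[symmetric]) auto
 finally show ?thesis .
qed

lemma moll_local:
 fixes \<phi> :: "real^'n \<Rightarrow> real"
 assumes e: "0 < e" "e \<le> 1" and x: "norm x < R"
 shows "moll e \<phi> x = moll e (\<lambda>y. ind (ball 0 (R + 1)) y * \<phi> y) x"
 unfolding moll_def
proof (rule Bochner_Integration.integral_cong[OF refl])
 fix y :: "real^'n"
 have "mollifier e (x - y) = 0" if "norm y \<ge> R + 1"
  using that x e norm_triangle_ineq2[of y x] by (intro mollifier_outside(1)) (simp_all add: norm_minus_commute)
 then show "\<phi> y * mollifier e (x - y) = ind (ball 0 (R + 1)) y * \<phi> y * mollifier e (x - y)"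
  by (auto split: split_indicator)
qed

lemma mollifier_shift_nn:
 fixes x :: "real^'n"
 assumes "e > 0" and [measurable]: "u \<in> \<B>"
 shows "(NBINT y. u y * ennreal (mollifier e (x - y))) = (NBINT z. u (x - z) * ennreal (mollifier e z))"
proof -
 have *: "(NBINT y. v (x - y)) = (NBINT y. v y)" if [measurable]: "v \<in> \<B>" for v :: "real^'n \<Rightarrow> ennreal"
 proof -
  have "(NBINT y. v y) = ennreal (\<bar>-1\<bar> ^ CARD('n)) * (NBINT y. v (x + (-1) *\<^sub>R y))"
   by (subst lborel_affine[of "-1" x]) (simp_all add: nn_integral_density nn_integral_distr nn_integral_cmult)
  then show ?thesis by simp
 qed
 show ?thesis using *[of "\<lambda>z. u (x - z) * ennreal (mollifier e z)"] by simp
qed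

lemma moll_diff_le:
 fixes \<phi> :: "real^'n \<Rightarrow> real"
 assumes \<phi>: "loc_int \<phi>" and e: "e > 0"
 shows "eabs (moll e \<phi> x - c) \<le> (NBINT y. eabs (\<phi> y - c) * ennreal (mollifier e (x - y)))"
proof -
 have [measurable]: "\<phi> \<in> \<B>" using \<phi> by (rule loc_int_borel)
 have one: "loc_int (\<lambda>y :: real^'n. 1)"
  unfolding loc_int_def using emeasure_lborel_ball_finite[of "0 :: real^'n"]
  by (auto intro!: integrable_real_indicator)
 have nn: "(NBINT y. ennreal (mollifier e (x - y))) = 1"
  using mollifier_shift_nn[OF e, of "\<lambda>_. 1" x] mollifier_properties(3)[OF e, where 'n='n] by simp
 have i1: "integrable lborel (\<lambda>y. mollifier e (x - y))" using moll_integrable[OF one e, of x] by simp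
 have I1: "(LBINT y. mollifier e (x - y)) = 1"
  using nn_integral_eq_integral[OF i1] nn mollifier_properties(1)[OF e, where 'n='n]
  by (metis AE_I2 ennreal_eq_1 )
 have i2: "integrable lborel (\<lambda>y. c * mollifier e (x - y))" using i1 by simp
 have "moll e \<phi> x - c = (LBINT y. (\<phi> y - c) * mollifier e (x - y))"
  unfolding moll_def left_diff_distrib Bochner_Integration.integral_diff[OF moll_integrable[OF \<phi> e] i2] using I1 by simp
 moreover have "integrable lborel (\<lambda>y. (\<phi> y - c) * mollifier e (x - y))"
  unfolding left_diff_distrib by (rule Bochner_Integration.integrable_diff[OF moll_integrable[OF \<phi> e] i2])
 ultimately have "eabs (moll e \<phi> x - c) \<le> (NBINT y. ennreal (norm ((\<phi> y - c) * mollifier e (x - y))))"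
  using integral_norm_bound_ennreal[of lborel "\<lambda>y. (\<phi> y - c) * mollifier e (x - y)"] by simp
 also have "\<dots> = (NBINT y. eabs (\<phi> y - c) * ennreal (mollifier e (x - y)))"
  using mollifier_properties(1)[OF e, where 'n='n] by (simp add: abs_mult ennreal_mult)
 finally show ?thesis .
qed

text \<open>The ball is enlarged by 1, which exceeds e, so that truncation makes the function
  integrable without changing its mollification on the smaller ball. The claim is then the L1
  continuity of translations, averaged with the mollifier.\<close>

lemma moll_L1_convergence:
 fixes \<phi> :: "real^'n \<Rightarrow> real"
 assumes \<phi>: "loc_int \<phi>" and \<eta>: "(\<eta>::ennreal) > 0"
 obtains d where "0 < d" "d \<le> 1" "\<And>e. 0 < e \<Longrightarrow> e < d \<Longrightarrow>
   (NBINT x. ind (ball 0 R) x * eabs (moll e \<phi> x - \<phi> x)) \<le> \<eta>"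
proof -
 define \<psi> where "\<psi> y = ind (ball 0 (R + 1)) y * \<phi> y" for y
 have \<phi>m [measurable]: "\<phi> \<in> \<B>" using \<phi> by (rule loc_int_borel)
 have \<psi>i: "integrable lborel \<psi>" using \<phi> unfolding loc_int_def \<psi>_def by blast
 have \<psi>m [measurable]: "\<psi> \<in> \<B>" unfolding \<psi>_def by measurable
 have \<psi>: "loc_int \<psi>" unfolding loc_int_def
 proof (intro conjI allI)
  fix r
  show "integrable lborel (\<lambda>y. ind (ball 0 r) y * \<psi> y)"
   by (rule Bochner_Integration.integrable_bound[OF \<psi>i]) (auto split: split_indicator)
 qed measurable
 obtain d where d: "d > 0" "\<And>h. norm h < d \<Longrightarrow> (NBINT x. eabs (\<psi> (x + h) - \<psi> x)) \<le> \<eta>"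
  using L1_translation_uniform[OF \<psi>i \<eta>] by blast
 show ?thesis
 proof (rule that[of "min d 1"])
  fix e assume e: "0 < e" "e < min d 1"
  have "(NBINT x. ind (ball 0 R) x * eabs (moll e \<phi> x - \<phi> x))
    \<le> (NBINT x. NBINT z. eabs (\<psi> (x - z) - \<psi> x) * ennreal (mollifier e z))"
  proof (rule nn_integral_mono)
   fix x :: "real^'n"
   show "ind (ball 0 R) x * eabs (moll e \<phi> x - \<phi> x) \<le> (NBINT z. eabs (\<psi> (x - z) - \<psi> x) * ennreal (mollifier e z))"
   proof (cases "norm x < R")
    case True
    have "moll e \<phi> x = moll e \<psi> x" unfolding \<psi>_def using e True by (intro moll_local) auto
    moreover have "\<phi> x = \<psi> x" using True by (simp add: \<psi>_def)
    moreover have "(NBINT y. eabs (\<psi> y - \<psi> x) * ennreal (mollifier e (x - y))) = (NBINT z. eabs (\<psi> (x - z) - \<psi> x) * ennreal (mollifier e z))"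
     by (rule mollifier_shift_nn[OF e(1)]) measurable
    ultimately show ?thesis using moll_diff_le[OF \<psi> e(1), of x "\<psi> x"] True by simp
   qed simp
  qed
  also have "\<dots> = (NBINT z. NBINT x. eabs (\<psi> (x - z) - \<psi> x) * ennreal (mollifier e z))"
   by (intro lborel_pair.Fubini'[symmetric]) measurable
  also have "\<dots> \<le> (NBINT z. \<eta> * ennreal (mollifier e (z :: real^'n)))"
  proof (rule nn_integral_mono)
   fix z :: "real^'n"
   show "(NBINT x. eabs (\<psi> (x - z) - \<psi> x) * ennreal (mollifier e z)) \<le> \<eta> * ennreal (mollifier e z)"
   proof (cases "norm z < e")
    case True
    have "(NBINT x. eabs (\<psi> (x - z) - \<psi> x) * ennreal (mollifier e z)) = (NBINT x. eabs (\<psi> (x + - z) - \<psi> x)) * ennreal (mollifier e z)"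
     by (simp add: nn_integral_multc)
    also have "\<dots> \<le> \<eta> * ennreal (mollifier e z)" using True e by (intro mult_right_mono d) auto
    finally show ?thesis .
   next
    case False
    then have "mollifier e z = 0" by (intro mollifier_outside(1) e) auto
    then show ?thesis by simp
   qed
  qed
  also have "\<dots> = \<eta>" using mollifier_properties(3)[OF e(1), where 'n='n] by (simp add: nn_integral_cmult)
  finally show "(NBINT x. ind (ball 0 R) x * eabs (moll e \<phi> x - \<phi> x)) \<le> \<eta>" .
 qed (use d in auto)
qed

lemma has_approx_limit_nn:
 fixes \<phi> :: "real^'n \<Rightarrow> real"
 assumes \<phi>: "loc_int \<phi>"
 shows "has_approx_limit \<phi> x l \<longleftrightarrow> ((\<lambda>r. enn2real (NBINT y. ind (ball x r) y * eabs (\<phi> y - l)) / (unit_ball_vol (real CARD('n)) * r ^ CARD('n))) \<longlongrightarrow> 0) (at_right 0)"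
 unfolding has_approx_limit_def
proof (rule filterlim_cong[OF refl refl])
 have [measurable]: "\<phi> \<in> \<B>" using \<phi> by (rule loc_int_borel)
 have "(LINT y:ball x r|lebesgue. \<bar>\<phi> y - l\<bar>) / measure lebesgue (ball x r)
   = enn2real (NBINT y. ind (ball x r) y * eabs (\<phi> y - l)) / (unit_ball_vol (real CARD('n)) * r ^ CARD('n))" if r: "r > 0" for r
 proof -
  have "(LINT y:ball x r|lebesgue. \<bar>\<phi> y - l\<bar>) = (LBINT y. ind (ball x r) y * \<bar>\<phi> y - l\<bar>)"
   unfolding set_lebesgue_integral_def by (subst integral_completion) auto
  also have "\<dots> = enn2real (NBINT y. ennreal (ind (ball x r) y * \<bar>\<phi> y - l\<bar>))"
   by (intro integral_eq_nn_integral) auto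
  also have "(NBINT y. ennreal (ind (ball x r) y * \<bar>\<phi> y - l\<bar>)) = (NBINT y. ind (ball x r) y * eabs (\<phi> y - l))"
   by (intro nn_integral_cong) (auto split: split_indicator)
  moreover have "measure lebesgue (ball x r) = unit_ball_vol (real CARD('n)) * r ^ CARD('n)"
   using content_ball[of r x] r by simp
  ultimately show ?thesis by simp
 qed
 then show "\<forall>\<^sub>F r in at_right 0. (LINT y:ball x r|lebesgue. \<bar>\<phi> y - l\<bar>) / measure lebesgue (ball x r)
   = enn2real (NBINT y. ind (ball x r) y * eabs (\<phi> y - l)) / (unit_ball_vol (real CARD('n)) * r ^ CARD('n))"
  by (intro eventually_at_rightI[of 0 1]) auto
qed

lemma loc_int_ball_finite:
 fixes \<phi> :: "real^'n \<Rightarrow> real"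
 assumes \<phi>: "loc_int \<phi>"
 shows "(NBINT y. ind (ball x r) y * eabs (\<phi> y - l)) < \<infinity>"
proof -
 have [measurable]: "\<phi> \<in> \<B>" using \<phi> by (rule loc_int_borel)
 define R where "R = norm x + r"
 have i: "integrable lborel (\<lambda>y. ind (ball 0 R) y * \<phi> y)" using \<phi> unfolding loc_int_def by blast
 have "(NBINT y. ind (ball x r) y * eabs (\<phi> y - l)) \<le> (NBINT y. ennreal (norm (ind (ball 0 R) y * \<phi> y)) + eabs l * ind (ball 0 R) y)"
 proof (rule nn_integral_mono)
  fix y
  have "eabs (\<phi> y - l) \<le> eabs (\<phi> y) + eabs l"
   by (simp add: ennreal_plus[symmetric] ennreal_leI del: ennreal_plus)
  moreover have "norm y < R" if "y \<in> ball x r"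
   using that norm_triangle_ineq2[of y x] unfolding R_def by (simp add: dist_norm norm_minus_commute)
  ultimately show "ind (ball x r) y * eabs (\<phi> y - l) \<le> ennreal (norm (ind (ball 0 R) y * \<phi> y)) + eabs l * ind (ball 0 R) y"
   by (auto split: split_indicator)
 qed
 also have "\<dots> = (NBINT y. ennreal (norm (ind (ball 0 R) y * \<phi> y))) + eabs l * emeasure lborel (ball (0 :: real^'n) R)"
  by (subst nn_integral_add) (auto simp: nn_integral_cmult_indicator)
 also have "\<dots> < \<infinity>"
  using i emeasure_lborel_ball_finite[of "0 :: real^'n" R] by (simp add: integrable_iff_bounded ennreal_mult_less_top)
 finally show ?thesis .
qed

text \<open>A mollifier bounded by C / e ^ n and supported in the ball of radius e sees at most a
  multiple of the mean of |\<phi> - l| over that ball.\<close>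

lemma moll_tendsto_approx_limit:
 fixes \<phi> :: "real^'n \<Rightarrow> real"
 assumes \<phi>: "loc_int \<phi>" and l: "has_approx_limit \<phi> x l"
 shows "((\<lambda>e. moll e \<phi> x) \<longlongrightarrow> l) (at_right 0)"
proof -
 have [measurable]: "\<phi> \<in> \<B>" using \<phi> by (rule loc_int_borel)
 let ?n = "CARD('n)" and ?v = "unit_ball_vol (real CARD('n))"
 define C where "C = 2 ^ ?n * exp (4/3) / ?v"
 have v: "?v > 0" by (rule vol_pos)
 have C: "C > 0" unfolding C_def using v by simp
 define a where "a r = enn2real (NBINT y. ind (ball x r) y * eabs (\<phi> y - l))" for r
 have lim: "((\<lambda>r. a r / (?v * r ^ ?n)) \<longlongrightarrow> 0) (at_right 0)" using l unfolding has_approx_limit_nn[OF \<phi>] a_def .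
 have "\<bar>moll e \<phi> x - l\<bar> \<le> (C * ?v) * (a e / (?v * e ^ ?n))" if e: "e > 0" for e
 proof -
  have "eabs (moll e \<phi> x - l) \<le> (NBINT y. eabs (\<phi> y - l) * ennreal (mollifier e (x - y)))"
   by (rule moll_diff_le[OF \<phi> e])
  also have "\<dots> \<le> (NBINT y. ennreal (C / e ^ ?n) * (ind (ball x e) y * eabs (\<phi> y - l)))"
  proof (rule nn_integral_mono)
   fix y
   show "eabs (\<phi> y - l) * ennreal (mollifier e (x - y)) \<le> ennreal (C / e ^ ?n) * (ind (ball x e) y * eabs (\<phi> y - l))"
   proof (cases "y \<in> ball x e")
    case True
    have "mollifier e (x - y) \<le> C / e ^ ?n" unfolding C_def by (rule mollifier_properties(2)[OF e])
    then have "eabs (\<phi> y - l) * ennreal (mollifier e (x - y)) \<le> eabs (\<phi> y - l) * ennreal (C / e ^ ?n)"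
     by (intro mult_left_mono ennreal_leI) auto
    then show ?thesis using True by (simp add: mult.commute)
   next
    case False
    then have "mollifier e (x - y) = 0" by (intro mollifier_outside(1) e) (simp add: dist_norm)
    then show ?thesis by simp
   qed
  qed
  also have "\<dots> = ennreal (C / e ^ ?n) * (NBINT y. ind (ball x e) y * eabs (\<phi> y - l))"
   by (rule nn_integral_cmult) measurable
  also have "(NBINT y. ind (ball x e) y * eabs (\<phi> y - l)) = ennreal (a e)"
   unfolding a_def using loc_int_ball_finite[OF \<phi>, of x e l] by (simp add: less_top)
  also have "ennreal (C / e ^ ?n) * ennreal (a e) = ennreal (C / e ^ ?n * a e)"
   by (rule ennreal_mult[symmetric]) (use C e in \<open>auto simp: a_def\<close>)
  finally have "\<bar>moll e \<phi> x - l\<bar> \<le> C / e ^ ?n * a e"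
   using C e by (subst (asm) ennreal_le_iff) (auto simp: a_def)
  moreover have "?v \<noteq> 0" using v by linarith
  ultimately show ?thesis using e by simp
 qed
 then have ev: "\<forall>\<^sub>F e in at_right 0. norm (moll e \<phi> x - l) \<le> (C * ?v) * (a e / (?v * e ^ ?n))"
  by (intro eventually_at_rightI[of 0 1]) auto
 have "((\<lambda>e. moll e \<phi> x - l) \<longlongrightarrow> 0) (at_right 0)"
  by (rule Lim_null_comparison[OF ev]) (use tendsto_mult[OF tendsto_const[of "C * ?v"] lim] in simp)
 then show ?thesis by (simp add: LIM_zero_iff)
qed

text \<open>The mollified values at x are a Cauchy sequence: two of them are compared by averaging
  over one fixed small ball, on which the mollifications oscillate little by hypothesis and converge
  in L1. The limit is l, and the oscillation bound passes from the mollifications to \<phi>.\<close>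

lemma approx_limit_of_moll:
 fixes \<phi> :: "real^'n \<Rightarrow> real"
 assumes \<phi>: "loc_int \<phi>" and d: "d > 0"
  and \<omega>: "\<And>r e. 0 < r \<Longrightarrow> r < d \<Longrightarrow> 0 < e \<Longrightarrow> e < d \<Longrightarrow>
    (NBINT z. ind (ball x r) z * eabs (moll e \<phi> z - moll e \<phi> x)) \<le> ennreal (\<omega> r * r ^ CARD('n))"
  and \<omega>0: "\<And>r. \<omega> r \<ge> 0" and lim: "(\<omega> \<longlongrightarrow> 0) (at_right 0)"
 shows "\<exists>l. has_approx_limit \<phi> x l"
proof -
 have [measurable]: "\<phi> \<in> \<B>" using \<phi> by (rule loc_int_borel)
 let ?n = "CARD('n)" and ?v = "unit_ball_vol (real CARD('n))"
 have v: "?v > 0" by (rule vol_pos)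
 \<comment> \<open>The double successor makes the first term d/2, strictly below d.\<close>
 define e where "e m = d * inverse (real (Suc (Suc m)))" for m
 have e: "0 < e m" "e m < d" for m
 proof -
  show "0 < e m" using d by (simp add: e_def)
  have "inverse (real (Suc (Suc m))) < 1" by (simp add: field_simps)
  then have "d * inverse (real (Suc (Suc m))) < d * 1" using d by (intro mult_strict_left_mono)
  then show "e m < d" by (simp add: e_def)
 qed
 have e0: "e \<longlonglongrightarrow> 0"
  unfolding e_def using tendsto_mult[OF tendsto_const[of d] LIMSEQ_Suc[OF LIMSEQ_inverse_real_of_nat]] by simp
 define R where "R = norm x + d"
 have ball: "y \<in> ball 0 R" if "y \<in> ball x r" "r < d" for y r
  using that norm_triangle_ineq2[of y x] unfolding R_def by (simp add: dist_norm norm_minus_commute)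
 have [measurable]: "moll (e m) \<phi> \<in> \<B>" for m by (rule moll_borel[OF \<phi> e(1)])
 have L1: "\<exists>N. \<forall>m\<ge>N. (NBINT y. ind (ball x r) y * eabs (moll (e m) \<phi> y - \<phi> y)) \<le> ennreal \<eta>"
  if "\<eta> > 0" "r < d" for \<eta> r
 proof -
  have "ennreal \<eta> > 0" using \<open>\<eta> > 0\<close> by simp
  then obtain c where c: "0 < c" "c \<le> 1" "\<And>e. 0 < e \<Longrightarrow> e < c \<Longrightarrow> (NBINT x. ind (ball 0 R) x * eabs (moll e \<phi> x - \<phi> x)) \<le> ennreal \<eta>"
   by (rule moll_L1_convergence[OF \<phi>, where R=R]) blast
  obtain N where N: "\<And>m. m \<ge> N \<Longrightarrow> e m < c"
   using order_tendstoD(2)[OF e0 c(1)] unfolding eventually_sequentially by blast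
  have "(NBINT y. ind (ball x r) y * eabs (moll (e m) \<phi> y - \<phi> y)) \<le> ennreal \<eta>" if "m \<ge> N" for m
  proof -
   have "(NBINT y. ind (ball x r) y * eabs (moll (e m) \<phi> y - \<phi> y)) \<le> (NBINT y. ind (ball 0 R) y * eabs (moll (e m) \<phi> y - \<phi> y))"
    using ball \<open>r < d\<close> by (intro nn_integral_mono mult_right_mono) (auto split: split_indicator simp del: mem_ball)
   also have "\<dots> \<le> ennreal \<eta>" by (rule c(3)[OF e(1) N[OF that]])
   finally show ?thesis .
  qed
  then show ?thesis by blast
 qed
 note const = nn_integral_ball_const
 have "Cauchy (\<lambda>m. moll (e m) \<phi> x)"
 proof (rule metric_CauchyI)
  fix \<epsilon> :: real assume \<epsilon>: "\<epsilon> > 0"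
  have "\<forall>\<^sub>F r in at_right 0. \<omega> r < \<epsilon> * ?v / 4" using \<epsilon> v by (intro order_tendstoD(2)[OF lim]) simp
  moreover have "\<forall>\<^sub>F r in at_right 0. 0 < r \<and> r < d" using d by (intro eventually_at_rightI[of 0 d]) auto
  ultimately have "\<forall>\<^sub>F r in at_right 0. \<omega> r < \<epsilon> * ?v / 4 \<and> 0 < r \<and> r < d" by eventually_elim simp
  then obtain r where r: "\<omega> r < \<epsilon> * ?v / 4" "0 < r" "r < d"
   using eventually_happens[of _ "at_right (0::real)"] by auto
  \<comment> \<open>With v the volume of the unit ball, two oscillations below \<epsilon> v r ^ n /
    4 and two L1 errors of \<epsilon> v r ^ n / 8 add up to less than \<epsilon> v r ^ n.\<close>
  define \<eta> where "\<eta> = \<epsilon> * ?v * r ^ ?n / 8"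
  have \<eta>: "\<eta> > 0" unfolding \<eta>_def using \<epsilon> v r by simp
  obtain N where N: "\<And>m. m \<ge> N \<Longrightarrow> (NBINT y. ind (ball x r) y * eabs (moll (e m) \<phi> y - \<phi> y)) \<le> ennreal \<eta>"
   using L1[OF \<eta> r(3)] by blast
  have "dist (moll (e m) \<phi> x) (moll (e k) \<phi> x) < \<epsilon>" if "m \<ge> N" "k \<ge> N" for m k
  proof -
   let ?a = "\<lambda>m z. ind (ball x r) z * eabs (moll (e m) \<phi> z - moll (e m) \<phi> x)"
   let ?b = "\<lambda>m z. ind (ball x r) z * eabs (moll (e m) \<phi> z - \<phi> z)"
   have "ennreal (\<bar>moll (e m) \<phi> x - moll (e k) \<phi> x\<bar> * (?v * r ^ ?n)) = (NBINT z. ind (ball x r) z * eabs (moll (e m) \<phi> x - moll (e k) \<phi> x))"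
    by (rule const[symmetric, OF r(2)]) simp
   also have "\<dots> \<le> (NBINT z. (?a m z + ?b m z) + (?a k z + ?b k z))"
    by (intro nn_integral_mono) (auto simp: ennreal_plus[symmetric] simp del: ennreal_plus intro!: ennreal_leI split: split_indicator)
   also have "\<dots> = ((NBINT z. ?a m z) + (NBINT z. ?b m z)) + ((NBINT z. ?a k z) + (NBINT z. ?b k z))"
    by (simp add: nn_integral_add)
   also have "\<dots> \<le> (ennreal (\<omega> r * r ^ ?n) + ennreal \<eta>) + (ennreal (\<omega> r * r ^ ?n) + ennreal \<eta>)"
    by (intro add_mono \<omega> N r e that)
   also have "\<dots> = ennreal (2 * (\<omega> r * r ^ ?n + \<eta>))" using \<omega>0[of r] r \<eta> by (simp add: ennreal_plus[symmetric] del: ennreal_plus)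
   finally have "\<bar>moll (e m) \<phi> x - moll (e k) \<phi> x\<bar> * (?v * r ^ ?n) \<le> 2 * (\<omega> r * r ^ ?n + \<eta>)"
    using \<omega>0[of r] r \<eta> by (subst (asm) ennreal_le_iff) auto
   also have "\<dots> < 2 * ((\<epsilon> * ?v / 4) * r ^ ?n + \<eta>)" using r by (intro mult_strict_left_mono add_strict_right_mono mult_strict_right_mono) auto
   also have "\<dots> < \<epsilon> * (?v * r ^ ?n)"
   proof -
    have "0 < \<epsilon> * (?v * r ^ ?n)" using \<epsilon> v r by simp
    then show ?thesis unfolding \<eta>_def by (simp add: field_simps)
   qed
   finally show ?thesis using v r by (simp add: dist_real_def)
  qed
  then show "\<exists>M. \<forall>m\<ge>M. \<forall>k\<ge>M. dist (moll (e m) \<phi> x) (moll (e k) \<phi> x) < \<epsilon>" by blast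
 qed
 then obtain l where l: "(\<lambda>m. moll (e m) \<phi> x) \<longlonglongrightarrow> l" using Cauchy_convergent convergent_def by blast
 have bound: "enn2real (NBINT y. ind (ball x r) y * eabs (\<phi> y - l)) / (?v * r ^ ?n) \<le> \<omega> r / ?v" if r: "0 < r" "r < d" for r
 proof -
  have "(NBINT y. ind (ball x r) y * eabs (\<phi> y - l)) \<le> ennreal (\<omega> r * r ^ ?n)"
  proof (rule ennreal_le_epsilon)
   fix \<epsilon> :: real assume \<epsilon>: "\<epsilon> > 0"
   obtain N where N: "\<And>m. m \<ge> N \<Longrightarrow> (NBINT y. ind (ball x r) y * eabs (moll (e m) \<phi> y - \<phi> y)) \<le> ennreal (\<epsilon>/2)"
    using L1[of "\<epsilon>/2" r] \<epsilon> r by auto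
   \<comment> \<open>Chosen so that the constant c has integral \<epsilon>/2 over the ball.\<close>
   define c where "c = \<epsilon> / (2 * (?v * r ^ ?n))"
   have vr: "?v * r ^ ?n > 0" using v r by simp
   have c: "c > 0" "c * (?v * r ^ ?n) = \<epsilon> / 2"
   proof -
    have "\<epsilon> / (2 * w) > 0" "\<epsilon> / (2 * w) * w = \<epsilon> / 2" if "w > 0" for w using that \<epsilon> by auto
    from this[OF vr] show "c > 0" "c * (?v * r ^ ?n) = \<epsilon> / 2" unfolding c_def .
   qed
   obtain N' where N': "\<And>m. m \<ge> N' \<Longrightarrow> \<bar>moll (e m) \<phi> x - l\<bar> < c"
    using LIMSEQ_D[OF l c(1)] by auto
   define m where "m = max N N'"
   have "(NBINT y. ind (ball x r) y * eabs (\<phi> y - l))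
    \<le> (NBINT y. ind (ball x r) y * eabs (moll (e m) \<phi> y - moll (e m) \<phi> x) + (ind (ball x r) y * eabs (moll (e m) \<phi> y - \<phi> y) + ind (ball x r) y * ennreal c))"
   proof (rule nn_integral_mono)
    fix y
    have "\<bar>\<phi> y - l\<bar> \<le> \<bar>moll (e m) \<phi> y - moll (e m) \<phi> x\<bar> + (\<bar>moll (e m) \<phi> y - \<phi> y\<bar> + c)"
     using N'[of m] unfolding m_def by linarith
    then show "ind (ball x r) y * eabs (\<phi> y - l) \<le> ind (ball x r) y * eabs (moll (e m) \<phi> y - moll (e m) \<phi> x) + (ind (ball x r) y * eabs (moll (e m) \<phi> y - \<phi> y) + ind (ball x r) y * ennreal c)"
     using c by (auto simp: ennreal_plus[symmetric] simp del: ennreal_plus intro!: ennreal_leI split: split_indicator)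
   qed
   also have "\<dots> = (NBINT y. ind (ball x r) y * eabs (moll (e m) \<phi> y - moll (e m) \<phi> x)) + ((NBINT y. ind (ball x r) y * eabs (moll (e m) \<phi> y - \<phi> y)) + (NBINT y. ind (ball x r) y * ennreal c))"
    by (simp add: nn_integral_add)
   also have "\<dots> \<le> ennreal (\<omega> r * r ^ ?n) + (ennreal (\<epsilon>/2) + ennreal (\<epsilon>/2))"
   proof (intro add_mono)
    show "(NBINT y. ind (ball x r) y * eabs (moll (e m) \<phi> y - moll (e m) \<phi> x)) \<le> ennreal (\<omega> r * r ^ ?n)" by (rule \<omega>[OF r e])
    show "(NBINT y. ind (ball x r) y * eabs (moll (e m) \<phi> y - \<phi> y)) \<le> ennreal (\<epsilon>/2)" by (rule N) (simp add: m_def)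
    show "(NBINT y. ind (ball x r) y * ennreal c) \<le> ennreal (\<epsilon>/2)" unfolding const[OF r(1) less_imp_le[OF c(1)]] c(2) by simp
   qed
   also have "\<dots> = ennreal (\<omega> r * r ^ ?n) + ennreal \<epsilon>" using \<epsilon> by (simp add: ennreal_plus[symmetric] del: ennreal_plus)
   finally show "(NBINT y. ind (ball x r) y * eabs (\<phi> y - l)) \<le> ennreal (\<omega> r * r ^ ?n) + ennreal \<epsilon>" .
  qed
  then have "enn2real (NBINT y. ind (ball x r) y * eabs (\<phi> y - l)) \<le> \<omega> r * r ^ ?n"
   using enn2real_mono[of _ "ennreal (\<omega> r * r ^ ?n)"] \<omega>0[of r] r by fastforce
  then have "enn2real (NBINT y. ind (ball x r) y * eabs (\<phi> y - l)) / (?v * r ^ ?n) \<le> (\<omega> r * r ^ ?n) / (?v * r ^ ?n)"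
   using v r by (intro divide_right_mono) auto
  then show ?thesis using r v by simp
 qed
 have "has_approx_limit \<phi> x l" unfolding has_approx_limit_nn[OF \<phi>]
 proof (rule Lim_null_comparison)
  show "\<forall>\<^sub>F r in at_right 0. norm (enn2real (NBINT y. ind (ball x r) y * eabs (\<phi> y - l)) / (?v * r ^ ?n)) \<le> \<omega> r / ?v"
   by (rule eventually_at_rightI[of 0 d]) (use bound d v in auto)
  show "((\<lambda>r. \<omega> r / ?v) \<longlongrightarrow> 0) (at_right 0)" using tendsto_divide[OF lim tendsto_const[of ?v]] v by simp
 qed
 then show ?thesis by blast
qed

lemma continuous_has_approx_limit:
 fixes \<phi> :: "real^'n \<Rightarrow> real"
 assumes c: "continuous_on UNIV \<phi>" and \<phi>: "loc_int \<phi>"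
 shows "has_approx_limit \<phi> x (\<phi> x)"
 unfolding has_approx_limit_nn[OF \<phi>]
proof (rule tendstoI)
 let ?n = "CARD('n)" and ?v = "unit_ball_vol (real CARD('n))"
 have v: "?v > 0" by (rule vol_pos)
 fix \<epsilon> :: real assume \<epsilon>: "\<epsilon> > 0"
 have "isCont \<phi> x" using c by (simp add: continuous_on_eq_continuous_at)
 then obtain d where d: "d > 0" "\<And>y. dist y x < d \<Longrightarrow> dist (\<phi> y) (\<phi> x) < \<epsilon> / 2"
  using \<epsilon> unfolding continuous_at_eps_delta by (metis half_gt_zero)
 have "enn2real (NBINT y. ind (ball x r) y * eabs (\<phi> y - \<phi> x)) / (?v * r ^ ?n) \<le> \<epsilon> / 2" if r: "0 < r" "r < d" for r
 proof -
  have "(NBINT y. ind (ball x r) y * eabs (\<phi> y - \<phi> x)) \<le> (NBINT y. ennreal (\<epsilon>/2) * ind (ball x r) y)"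
  proof (rule nn_integral_mono)
   fix y
   have "\<bar>\<phi> y - \<phi> x\<bar> \<le> \<epsilon> / 2" if "y \<in> ball x r"
    using d(2)[of y] that r by (simp add: dist_commute dist_real_def abs_minus_commute)
   then show "ind (ball x r) y * eabs (\<phi> y - \<phi> x) \<le> ennreal (\<epsilon>/2) * ind (ball x r) y"
    by (auto intro!: ennreal_leI split: split_indicator simp del: mem_ball)
  qed
  also have "\<dots> = ennreal ((\<epsilon>/2) * (?v * r ^ ?n))"
   using r v \<epsilon> by (simp add: nn_integral_cmult_indicator emeasure_ball_cart ennreal_mult[symmetric])
  finally have "enn2real (NBINT y. ind (ball x r) y * eabs (\<phi> y - \<phi> x)) \<le> (\<epsilon>/2) * (?v * r ^ ?n)"
   using enn2real_mono[of _ "ennreal ((\<epsilon>/2) * (?v * r ^ ?n))"] \<epsilon> v r by fastforce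
  then show ?thesis using v r by (simp add: divide_le_eq)
 qed
 then have "\<forall>\<^sub>F r in at_right 0. enn2real (NBINT y. ind (ball x r) y * eabs (\<phi> y - \<phi> x)) / (?v * r ^ ?n) \<le> \<epsilon> / 2 \<and> r > 0"
  by (intro eventually_at_rightI[of 0 d]) (use d in auto)
 then show "\<forall>\<^sub>F r in at_right 0. dist (enn2real (NBINT y. ind (ball x r) y * eabs (\<phi> y - \<phi> x)) / (?v * r ^ ?n)) 0 < \<epsilon>"
 proof eventually_elim
  case (elim r)
  have "0 \<le> enn2real (NBINT y. ind (ball x r) y * eabs (\<phi> y - \<phi> x)) / (?v * r ^ ?n)"
   using elim v by (intro divide_nonneg_nonneg mult_nonneg_nonneg) auto
  then show ?case using elim \<epsilon> by (simp only: dist_real_def diff_0_right abs_of_nonneg) linarith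
 qed
qed

section \<open>Potential estimates for functions of bounded variation\<close>

lemma ennreal_divide_cancel:
 fixes a w :: real
 assumes "w > 0" "a \<ge> 0"
 shows "ennreal a = ennreal (1 / w) * ennreal (a * w)"
 using assms by (simp flip: ennreal_mult)

lemma ennreal_mult_assoc:
 fixes a b :: real
 assumes "a \<ge> 0" "b \<ge> 0"
 shows "ennreal a * (ennreal b * c) = ennreal (a * b) * c"
 using assms by (simp add: ennreal_mult mult.assoc)

text \<open>M is to be the variation measure restricted to U. The gradient bound is therefore asked
  only when the mollification at w reads \<phi> inside U, and every estimate below keeps its balls
  inside U.\<close>

locale potential_bounds =
 fixes \<phi> :: "real^'n \<Rightarrow> real" and M :: "(real^'n) measure" and U :: "(real^'n) set" and s :: real
 assumes \<phi>: "loc_int \<phi>" and M: "finite_measure M" and sets_M [simp, measurable_cong]: "sets M = sets borel"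
  and deriv: "\<And>e w j. 0 < e \<Longrightarrow> ball w e \<subseteq> U \<Longrightarrow>
   eabs (moll_deriv e \<phi> w (axis j 1)) \<le> (\<integral>\<^sup>+z. ennreal (mollifier e (w - z)) \<partial>M)"
  and s: "0 < s" "s < 1" and U: "bounded U"
begin

text \<open>The kernel is infinite at z = x, so a finite value also says that M has no atom at
  x.\<close>

definition pot :: "real^'n \<Rightarrow> ennreal" where
 "pot x = (\<integral>\<^sup>+z. riesz_kernel s x z \<partial>M)"

lemma \<phi>_borel [measurable]: "\<phi> \<in> \<B>" using \<phi> by (rule loc_int_borel)

sublocale finite_measure M by (rule M)

sublocale pair: pair_sigma_finite lborel M
 by unfold_locales

lemma riesz_kernel_measurable [measurable]: "(\<lambda>(x, z). riesz_kernel s x z) \<in> borel_measurable (borel \<Otimes>\<^sub>M (borel :: (real^'n) measure))"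
 unfolding riesz_kernel_def by measurable

lemma pot_borel [measurable]: "pot \<in> \<B>"
 unfolding pot_def by measurable

lemma deriv_all:
 assumes e: "0 < e" and w: "ball w e \<subseteq> U"
 shows "eabs (moll_deriv e \<phi> w v) \<le> (of_nat CARD('n) * (\<integral>\<^sup>+z. ennreal (mollifier e (w - z)) \<partial>M)) * ennreal (norm v)"
proof -
 let ?I = "\<integral>\<^sup>+z. ennreal (mollifier e (w - z)) \<partial>M"
 have lin: "linear (moll_deriv e \<phi> w)" using moll_has_derivative(1)[OF \<phi> e] by (rule has_derivative_linear)
 have "moll_deriv e \<phi> w v = moll_deriv e \<phi> w (\<Sum>j\<in>UNIV. (v $ j) *\<^sub>R axis j 1)"
  using basis_expansion[of v] by (simp add: scalar_mult_eq_scaleR)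
 also have "\<dots> = (\<Sum>j\<in>UNIV. v $ j * moll_deriv e \<phi> w (axis j 1))"
  by (simp add: linear_sum[OF lin] linear_cmul[OF lin])
 finally have "\<bar>moll_deriv e \<phi> w v\<bar> \<le> (\<Sum>j\<in>UNIV. \<bar>v $ j * moll_deriv e \<phi> w (axis j 1)\<bar>)"
  by (simp add: sum_abs)
 also have "\<dots> \<le> (\<Sum>j\<in>UNIV. norm v * \<bar>moll_deriv e \<phi> w (axis j 1)\<bar>)"
  unfolding abs_mult using component_le_norm_cart[of v] by (intro sum_mono mult_right_mono) auto
 finally have "eabs (moll_deriv e \<phi> w v) \<le> ennreal (\<Sum>j\<in>UNIV. norm v * \<bar>moll_deriv e \<phi> w (axis j 1)\<bar>)"
  by (rule ennreal_leI)
 also have "\<dots> = (\<Sum>j\<in>UNIV. ennreal (norm v) * eabs (moll_deriv e \<phi> w (axis j 1)))"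
  by (simp add: sum_ennreal[symmetric] ennreal_mult del: sum_ennreal)
 also have "\<dots> \<le> (\<Sum>j\<in>(UNIV :: 'n set). ennreal (norm v) * ?I)"
  by (intro sum_mono mult_left_mono deriv[OF e w]) auto
 also have "\<dots> = (of_nat CARD('n) * ?I) * ennreal (norm v)" by (simp add: mult_ac)
 finally show ?thesis .
qed

text \<open>\<open>poincare_potential\<close> with the mollified measure as bound for the gradient;
  Fubini moves the mollifier onto the kernel, where \<open>riesz_kernel_mean\<close> removes it at
  the price of a constant. The kernel exponent \<beta> = n - 1 + s lies strictly between 0 and n for
  every n \<ge> 1.\<close>

lemma oscillation:
 obtains C where "C > 0" "\<And>x r e. 0 < r \<Longrightarrow> 0 < e \<Longrightarrow> ball x (r + e) \<subseteq> U \<Longrightarrow>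
  (NBINT z. ind (ball x r) z * eabs (moll e \<phi> z - moll e \<phi> x)) \<le> ennreal (C * r powr (real CARD('n) + s)) * pot x"
proof -
 let ?n = "real CARD('n)"
 define \<beta> where "\<beta> = ?n - 1 + s"
 have n1: "1 \<le> ?n" using zero_less_card_finite[where 'a='n] by linarith
 have \<beta>: "0 < \<beta>" "\<beta> < ?n" using s n1 unfolding \<beta>_def by linarith+
 obtain K where K: "K > 0" "\<And>(x :: real^'n) z e. x \<noteq> z \<Longrightarrow> e > 0 \<Longrightarrow>
  (NBINT w. ennreal (ind (ball z e) w * norm (x - w) powr (-\<beta>))) \<le> ennreal (K * e ^ CARD('n) * norm (x - z) powr (-\<beta>))"
  using riesz_kernel_mean[OF \<beta>] by blast
 define Cm where "Cm = 2 ^ CARD('n) * exp (4/3) / unit_ball_vol ?n"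
 have Cm: "Cm > 0" unfolding Cm_def using vol_pos[where 'n='n] by simp
 define C where "C = ?n * (Cm * K) / s"
 have C: "C > 0" unfolding C_def using n1 Cm K s by simp
 have "(NBINT z. ind (ball x r) z * eabs (moll e \<phi> z - moll e \<phi> x)) \<le> ennreal (C * r powr (?n + s)) * pot x"
  if r: "0 < r" and e: "0 < e" and sub: "ball x (r + e) \<subseteq> U" for x r e
 proof -
  define G where "G w = of_nat CARD('n) * (\<integral>\<^sup>+z. ennreal (mollifier e (w - z)) \<partial>M)" for w
  have [measurable]: "G \<in> \<B>" unfolding G_def by measurable
  have "(NBINT z. ind (ball x r) z * eabs (moll e \<phi> z - moll e \<phi> x))
    \<le> ennreal (r powr (?n + s) / s) * (NBINT w. ind (ball x r) w * (ennreal (norm (x - w) powr (1 - ?n - s)) * G w))"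
  proof (rule poincare_potential[OF moll_has_derivative(1)[OF \<phi> e] moll_has_derivative(2)[OF \<phi> e] _ _ r s(1)])
   fix y v assume y: "y \<in> ball x r"
   have "ball y e \<subseteq> ball x (r + e)"
   proof
    fix z assume "z \<in> ball y e"
    then show "z \<in> ball x (r + e)" using y dist_triangle[of x z y] by simp
   qed
   then have "ball y e \<subseteq> U" using sub by blast
   from deriv_all[OF e this] show "eabs (moll_deriv e \<phi> y v) \<le> G y * ennreal (norm v)" unfolding G_def .
  qed measurable
  also have "(NBINT w. ind (ball x r) w * (ennreal (norm (x - w) powr (1 - ?n - s)) * G w)) \<le> ennreal (?n * (Cm * K)) * pot x"
  proof -
   have "(NBINT w. ind (ball x r) w * (ennreal (norm (x - w) powr (1 - ?n - s)) * G w))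
     \<le> (NBINT w. ennreal ?n * (\<integral>\<^sup>+z. ennreal (norm (x - w) powr (-\<beta>)) * ennreal (mollifier e (w - z)) \<partial>M))"
   proof (rule nn_integral_mono)
    fix w
    have "ennreal (norm (x - w) powr (1 - ?n - s)) * G w = ennreal ?n * (\<integral>\<^sup>+z. ennreal (norm (x - w) powr (-\<beta>)) * ennreal (mollifier e (w - z)) \<partial>M)"
     unfolding G_def \<beta>_def by (subst nn_integral_cmult) (auto simp: ennreal_of_nat_eq_real_of_nat mult_ac minus_diff_eq diff_diff_eq2)
    then show "ind (ball x r) w * (ennreal (norm (x - w) powr (1 - ?n - s)) * G w) \<le> ennreal ?n * (\<integral>\<^sup>+z. ennreal (norm (x - w) powr (-\<beta>)) * ennreal (mollifier e (w - z)) \<partial>M)"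
     by (auto split: split_indicator)
   qed
   also have "\<dots> = ennreal ?n * (NBINT w. \<integral>\<^sup>+z. ennreal (norm (x - w) powr (-\<beta>)) * ennreal (mollifier e (w - z)) \<partial>M)"
    by (rule nn_integral_cmult) measurable
   also have "(NBINT w. \<integral>\<^sup>+z. ennreal (norm (x - w) powr (-\<beta>)) * ennreal (mollifier e (w - z)) \<partial>M)
     = (\<integral>\<^sup>+z. (NBINT w. ennreal (norm (x - w) powr (-\<beta>)) * ennreal (mollifier e (w - z))) \<partial>M)"
    by (intro pair.Fubini'[symmetric]) measurable
   also have "\<dots> \<le> (\<integral>\<^sup>+z. ennreal (Cm * K) * riesz_kernel s x z \<partial>M)"
   proof (rule nn_integral_mono)
    fix z :: "real^'n"
    show "(NBINT w. ennreal (norm (x - w) powr (-\<beta>)) * ennreal (mollifier e (w - z))) \<le> ennreal (Cm * K) * riesz_kernel s x z"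
    \<comment> \<open>On the diagonal the right side is infinite by the definition of the kernel, so
      the mean value bound is applied only off the diagonal.\<close>
    proof (cases "x = z")
     case True
     have "ennreal (Cm * K) * top = top" using Cm K by (simp add: ennreal_mult_top)
     then show ?thesis using True by (simp add: riesz_kernel_def)
    next
     case False
     have "(NBINT w. ennreal (norm (x - w) powr (-\<beta>)) * ennreal (mollifier e (w - z)))
      \<le> (NBINT w. ennreal (Cm / e ^ CARD('n)) * ennreal (ind (ball z e) w * norm (x - w) powr (-\<beta>)))"
     proof (rule nn_integral_mono)
      fix w :: "real^'n"
      show "ennreal (norm (x - w) powr (-\<beta>)) * ennreal (mollifier e (w - z)) \<le> ennreal (Cm / e ^ CARD('n)) * ennreal (ind (ball z e) w * norm (x - w) powr (-\<beta>))"
      proof (cases "w \<in> ball z e")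
       case True
       have "mollifier e (w - z) \<le> Cm / e ^ CARD('n)" unfolding Cm_def by (rule mollifier_properties(2)[OF e])
       then have "ennreal (norm (x - w) powr (-\<beta>)) * ennreal (mollifier e (w - z)) \<le> ennreal (norm (x - w) powr (-\<beta>)) * ennreal (Cm / e ^ CARD('n))"
        by (intro mult_left_mono ennreal_leI) auto
       then show ?thesis using True by (simp add: mult.commute)
      next
       case False
       then have "mollifier e (w - z) = 0" by (intro mollifier_outside(1) e) (simp add: dist_norm norm_minus_commute)
       then show ?thesis by simp
      qed
     qed
     also have "\<dots> = ennreal (Cm / e ^ CARD('n)) * (NBINT w. ennreal (ind (ball z e) w * norm (x - w) powr (-\<beta>)))"
      by (rule nn_integral_cmult) measurable
     also have "\<dots> \<le> ennreal (Cm / e ^ CARD('n)) * ennreal (K * e ^ CARD('n) * norm (x - z) powr (-\<beta>))"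
      by (intro mult_left_mono K(2) False e) auto
     also have "\<dots> = ennreal ((Cm / e ^ CARD('n)) * (K * e ^ CARD('n) * norm (x - z) powr (-\<beta>)))"
      using Cm K e by (intro ennreal_mult[symmetric]) auto
     also have "(Cm / e ^ CARD('n)) * (K * e ^ CARD('n) * norm (x - z) powr (-\<beta>)) = (Cm * K) * norm (x - z) powr (-\<beta>)"
      using e by simp
     also have "ennreal \<dots> = ennreal (Cm * K) * riesz_kernel s x z"
     proof -
      have "- ?n + 1 - s = -\<beta>" by (simp add: \<beta>_def)
      then show ?thesis using False Cm K by (simp add: riesz_kernel_def ennreal_mult)
     qed
     finally show ?thesis .
    qed
   qed
   also have "\<dots> = ennreal (Cm * K) * pot x" unfolding pot_def by (rule nn_integral_cmult) measurable
   finally have "(NBINT w. ind (ball x r) w * (ennreal (norm (x - w) powr (1 - ?n - s)) * G w)) \<le> ennreal ?n * (ennreal (Cm * K) * pot x)"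
    by (simp add: mult_left_mono)
   also have "\<dots> = ennreal (?n * (Cm * K)) * pot x" using Cm K by (subst (2) ennreal_mult) (auto simp: mult.assoc)
   finally show ?thesis .
  qed
  also have "ennreal (r powr (?n + s) / s) * (ennreal (?n * (Cm * K)) * pot x) = ennreal (C * r powr (?n + s)) * pot x"
  proof -
   have "ennreal (r powr (?n + s) / s) * ennreal (?n * (Cm * K)) = ennreal (C * r powr (?n + s))"
    using s Cm K by (subst ennreal_mult[symmetric]) (auto simp: C_def mult_ac)
   then show ?thesis by (simp add: mult.assoc[symmetric])
  qed
  finally show ?thesis by (simp add: mult_left_mono)
 qed
 then show ?thesis using that C by blast
qed

text \<open>With r = dist x y, the ball of radius r about x lies in the balls of radius 2 r about x
  and about y, so both values are compared with the function there; dividing r powr (n + s) by the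
  volume leaves r powr s.\<close>

lemma two_point:
 obtains C where "C > 0" "\<And>x y e. x \<noteq> y \<Longrightarrow> 0 < e \<Longrightarrow> ball x (2 * dist x y + e) \<subseteq> U \<Longrightarrow> ball y (2 * dist x y + e) \<subseteq> U \<Longrightarrow>
  eabs (moll e \<phi> x - moll e \<phi> y) \<le> ennreal (C * dist x y powr s) * (pot x + pot y)"
proof -
 let ?n = "real CARD('n)" and ?v = "unit_ball_vol (real CARD('n))"
 have v: "?v > 0" by (rule vol_pos)
 obtain C where C: "C > 0" "\<And>x r e. 0 < r \<Longrightarrow> 0 < e \<Longrightarrow> ball x (r + e) \<subseteq> U \<Longrightarrow>
  (NBINT z. ind (ball x r) z * eabs (moll e \<phi> z - moll e \<phi> x)) \<le> ennreal (C * r powr (?n + s)) * pot x"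
  using oscillation by blast
 define C' where "C' = C * 2 powr (?n + s) / ?v"
 have C': "C' > 0" unfolding C'_def using C v by simp
 have "eabs (moll e \<phi> x - moll e \<phi> y) \<le> ennreal (C' * dist x y powr s) * (pot x + pot y)"
  if xy: "x \<noteq> y" and e: "0 < e" and sx: "ball x (2 * dist x y + e) \<subseteq> U" and sy: "ball y (2 * dist x y + e) \<subseteq> U" for x y e
 proof -
  define r where "r = dist x y"
  have r: "r > 0" using xy by (simp add: r_def)
  have [measurable]: "moll e \<phi> \<in> \<B>" by (rule moll_borel[OF \<phi> e])
  have sub: "z \<in> ball y (2 * r)" "z \<in> ball x (2 * r)" if "z \<in> ball x r" for z
   using that dist_triangle[of y z x] r by (simp_all add: dist_commute[of y x] flip: r_def)
  have "ennreal (\<bar>moll e \<phi> x - moll e \<phi> y\<bar> * (?v * r ^ CARD('n))) = (NBINT z. ind (ball x r) z * eabs (moll e \<phi> x - moll e \<phi> y))"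
   by (rule nn_integral_ball_const[symmetric, OF r]) simp
  also have "\<dots> \<le> (NBINT z. ind (ball x (2 * r)) z * eabs (moll e \<phi> z - moll e \<phi> x) + ind (ball y (2 * r)) z * eabs (moll e \<phi> z - moll e \<phi> y))"
  proof (rule nn_integral_mono)
   fix z
   show "ind (ball x r) z * eabs (moll e \<phi> x - moll e \<phi> y) \<le> ind (ball x (2 * r)) z * eabs (moll e \<phi> z - moll e \<phi> x) + ind (ball y (2 * r)) z * eabs (moll e \<phi> z - moll e \<phi> y)"
    using sub[of z] by (cases "z \<in> ball x r") (auto simp: ennreal_plus[symmetric] simp del: ennreal_plus mem_ball intro!: ennreal_leI)
  qed
  also have "\<dots> = (NBINT z. ind (ball x (2 * r)) z * eabs (moll e \<phi> z - moll e \<phi> x)) + (NBINT z. ind (ball y (2 * r)) z * eabs (moll e \<phi> z - moll e \<phi> y))"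
   by (rule nn_integral_add) measurable
  also have "\<dots> \<le> ennreal (C * (2 * r) powr (?n + s)) * pot x + ennreal (C * (2 * r) powr (?n + s)) * pot y"
   using r e sx sy unfolding r_def by (intro add_mono C(2)) auto
  also have "\<dots> = ennreal (C * (2 * r) powr (?n + s)) * (pot x + pot y)" by (simp add: distrib_left)
  finally have le: "ennreal (\<bar>moll e \<phi> x - moll e \<phi> y\<bar> * (?v * r ^ CARD('n))) \<le> ennreal (C * (2 * r) powr (?n + s)) * (pot x + pot y)" .
  have vr: "?v * r ^ CARD('n) > 0" using v r by simp
  have "eabs (moll e \<phi> x - moll e \<phi> y) = ennreal (1 / (?v * r ^ CARD('n))) * ennreal (\<bar>moll e \<phi> x - moll e \<phi> y\<bar> * (?v * r ^ CARD('n)))"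
   by (rule ennreal_divide_cancel[OF vr]) simp
  also have "\<dots> \<le> ennreal (1 / (?v * r ^ CARD('n))) * (ennreal (C * (2 * r) powr (?n + s)) * (pot x + pot y))"
   by (rule mult_left_mono[OF le]) simp
  also have "\<dots> = ennreal (1 / (?v * r ^ CARD('n)) * (C * (2 * r) powr (?n + s))) * (pot x + pot y)"
  proof (rule ennreal_mult_assoc)
   show "0 \<le> 1 / (?v * r ^ CARD('n))" using vr by (intro divide_nonneg_nonneg less_imp_le) auto
  qed (use C(1) in simp)
  also have "1 / (?v * r ^ CARD('n)) * (C * (2 * r) powr (?n + s)) = C' * r powr s"
  proof -
   have "(2 * r) powr (?n + s) = 2 powr (?n + s) * (r ^ CARD('n) * r powr s)"
    using r by (simp add: powr_mult powr_add powr_realpow)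
   then show ?thesis using r by (simp add: C'_def)
  qed
  finally show ?thesis by (simp add: r_def)
 qed
 then show ?thesis using that C' by blast
qed

text \<open>The value at x is at most the mean of the absolute value over a ball plus the mean
  oscillation there. The former is controlled by the integral of |\<phi>| over a bounded set, the
  latter by the potential.\<close>

lemma moll_bound:
 assumes d: "d > 0"
 obtains A where "A > 0" "\<And>x e. 0 < e \<Longrightarrow> e \<le> 1 \<Longrightarrow> ball x (d + e) \<subseteq> U \<Longrightarrow> eabs (moll e \<phi> x) \<le> ennreal A * (1 + pot x)"
proof -
 let ?n = "real CARD('n)" and ?v = "unit_ball_vol (real CARD('n))"
 have v: "?v > 0" by (rule vol_pos)
 obtain C where C: "C > 0" "\<And>x r e. 0 < r \<Longrightarrow> 0 < e \<Longrightarrow> ball x (r + e) \<subseteq> U \<Longrightarrow>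
  (NBINT z. ind (ball x r) z * eabs (moll e \<phi> z - moll e \<phi> x)) \<le> ennreal (C * r powr (?n + s)) * pot x"
  using oscillation by blast
 obtain R where R: "\<And>x. x \<in> U \<Longrightarrow> norm x \<le> R" using U unfolding bounded_iff by blast
 \<comment> \<open>Points of U have norm at most R and e \<le> 1, so mollifications at points of U
   read \<phi> only on this ball.\<close>
 define I where "I = enn2real (NBINT y. ind (ball (0 :: real^'n) (R + 2)) y * eabs (\<phi> y - 0))"
 have I: "(NBINT y. ind (ball (0 :: real^'n) (R + 2)) y * eabs (\<phi> y - 0)) = ennreal I" "I \<ge> 0"
  unfolding I_def using loc_int_ball_finite[OF \<phi>, of 0 "R + 2" 0] by (auto simp: less_top)
 have vd: "?v * d ^ CARD('n) > 0" using v d by simp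
 define A where "A = (I + C * d powr (?n + s)) / (?v * d ^ CARD('n))"
 have A: "A > 0" unfolding A_def using I C d vd by (intro divide_pos_pos add_nonneg_pos) auto
 have "eabs (moll e \<phi> x) \<le> ennreal A * (1 + pot x)" if e: "0 < e" "e \<le> 1" and sub: "ball x (d + e) \<subseteq> U" for x e
 proof -
  have [measurable]: "moll e \<phi> \<in> \<B>" by (rule moll_borel[OF \<phi> e(1)])
  have mass: "(NBINT z. ind (ball x d) z * eabs (moll e \<phi> z)) \<le> ennreal I"
  proof -
   have "(NBINT z. ind (ball x d) z * eabs (moll e \<phi> z)) \<le> (NBINT z. NBINT y. ind (ball x d) z * (eabs (\<phi> y - 0) * ennreal (mollifier e (z - y))))"
   proof (rule nn_integral_mono)
    fix z
    have "ind (ball x d) z * eabs (moll e \<phi> z) \<le> ind (ball x d) z * (NBINT y. eabs (\<phi> y - 0) * ennreal (mollifier e (z - y)))"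
     using moll_diff_le[OF \<phi> e(1), of z 0] by (intro mult_left_mono) auto
    also have "\<dots> = (NBINT y. ind (ball x d) z * (eabs (\<phi> y - 0) * ennreal (mollifier e (z - y))))"
     by (rule nn_integral_cmult[symmetric]) measurable
    finally show "ind (ball x d) z * eabs (moll e \<phi> z) \<le> (NBINT y. ind (ball x d) z * (eabs (\<phi> y - 0) * ennreal (mollifier e (z - y))))" .
   qed
   also have "\<dots> = (NBINT y. NBINT z. ind (ball x d) z * (eabs (\<phi> y - 0) * ennreal (mollifier e (z - y))))"
    by (intro lborel_pair.Fubini'[symmetric]) measurable
   also have "\<dots> \<le> (NBINT y. NBINT z. (ind (ball 0 (R + 2)) y * eabs (\<phi> y - 0)) * ennreal (mollifier e (-y + z)))"
   proof (intro nn_integral_mono)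
    fix y z :: "real^'n"
    show "ind (ball x d) z * (eabs (\<phi> y - 0) * ennreal (mollifier e (z - y))) \<le> (ind (ball 0 (R + 2)) y * eabs (\<phi> y - 0)) * ennreal (mollifier e (-y + z))"
    proof (cases "z \<in> ball x d \<and> norm (z - y) < e")
     case True
     then have "z \<in> U" using sub e by auto
     then have "norm y < R + 2" using R[of z] True e norm_triangle_ineq2[of y z] by (simp add: norm_minus_commute)
     then show ?thesis using True by simp
    next
     case False
     then have "z \<notin> ball x d \<or> mollifier e (z - y) = 0" using mollifier_outside(1)[OF e(1), of "z - y"] by (auto simp: not_less)
     then show ?thesis by (auto simp del: mem_ball)
    qed
   qed
   also have "\<dots> = (NBINT y. (ind (ball 0 (R + 2)) y * eabs (\<phi> y - 0)) * (NBINT z. ennreal (mollifier e (-y + z))))"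
    by (intro nn_integral_cong nn_integral_cmult) measurable
   also have "\<dots> = (NBINT y. (ind (ball (0 :: real^'n) (R + 2)) y * eabs (\<phi> y - 0)))"
   proof (intro nn_integral_cong)
    fix y :: "real^'n"
    have "(NBINT z. ennreal (mollifier e (-y + z))) = 1"
     using nn_integral_lborel_translate[of "\<lambda>z. ennreal (mollifier e z)" "-y"] mollifier_properties(3)[OF e(1), where 'n='n] by simp
    then show "(ind (ball 0 (R + 2)) y * eabs (\<phi> y - 0)) * (NBINT z. ennreal (mollifier e (-y + z))) = ind (ball 0 (R + 2)) y * eabs (\<phi> y - 0)" by simp
   qed
   also have "\<dots> = ennreal I" by (rule I(1))
   finally show ?thesis .
  qed
  have "ennreal (\<bar>moll e \<phi> x\<bar> * (?v * d ^ CARD('n))) = (NBINT z. ind (ball x d) z * eabs (moll e \<phi> x))"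
   by (rule nn_integral_ball_const[symmetric, OF d]) simp
  also have "\<dots> \<le> (NBINT z. ind (ball x d) z * eabs (moll e \<phi> z) + ind (ball x d) z * eabs (moll e \<phi> z - moll e \<phi> x))"
   by (intro nn_integral_mono) (auto simp: ennreal_plus[symmetric] simp del: ennreal_plus intro!: ennreal_leI split: split_indicator)
  also have "\<dots> = (NBINT z. ind (ball x d) z * eabs (moll e \<phi> z)) + (NBINT z. ind (ball x d) z * eabs (moll e \<phi> z - moll e \<phi> x))"
   by (rule nn_integral_add) measurable
  also have "\<dots> \<le> ennreal I + ennreal (C * d powr (?n + s)) * pot x"
   by (intro add_mono mass C(2) d e sub)
  also have "\<dots> \<le> ennreal (I + C * d powr (?n + s)) * (1 + pot x)"
  proof -
   have "ennreal I \<le> ennreal (I + C * d powr (?n + s)) * 1" using I C by (simp add: ennreal_leI)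
   moreover have "ennreal (C * d powr (?n + s)) * pot x \<le> ennreal (I + C * d powr (?n + s)) * pot x"
    using I by (intro mult_right_mono ennreal_leI) auto
   ultimately show ?thesis unfolding distrib_left by (rule add_mono)
  qed
  finally have le: "ennreal (\<bar>moll e \<phi> x\<bar> * (?v * d ^ CARD('n))) \<le> ennreal (I + C * d powr (?n + s)) * (1 + pot x)" .
  have "eabs (moll e \<phi> x) = ennreal (1 / (?v * d ^ CARD('n))) * ennreal (\<bar>moll e \<phi> x\<bar> * (?v * d ^ CARD('n)))"
   by (rule ennreal_divide_cancel[OF vd]) simp
  also have "\<dots> \<le> ennreal (1 / (?v * d ^ CARD('n))) * (ennreal (I + C * d powr (?n + s)) * (1 + pot x))"
   by (rule mult_left_mono[OF le]) simp
  also have "\<dots> = (ennreal (1 / (?v * d ^ CARD('n))) * ennreal (I + C * d powr (?n + s))) * (1 + pot x)"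
   by (simp only: mult.assoc)
  also have "ennreal (1 / (?v * d ^ CARD('n))) * ennreal (I + C * d powr (?n + s)) = ennreal A"
   unfolding A_def using vd I C by (subst ennreal_mult[symmetric]) auto
  finally show ?thesis .
 qed
 then show ?thesis using that A by blast
qed

lemma approx_limit_exists:
 assumes U: "open U" and x: "x \<in> U" and p: "pot x < \<infinity>"
 shows "\<exists>l. has_approx_limit \<phi> x l"
proof -
 let ?n = "real CARD('n)"
 obtain C where C: "C > 0" "\<And>x r e. 0 < r \<Longrightarrow> 0 < e \<Longrightarrow> ball x (r + e) \<subseteq> U \<Longrightarrow>
  (NBINT z. ind (ball x r) z * eabs (moll e \<phi> z - moll e \<phi> x)) \<le> ennreal (C * r powr (?n + s)) * pot x"
  using oscillation by blast
 obtain d where d: "d > 0" "ball x d \<subseteq> U" using U x openE by blast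
 define q where "q = enn2real (pot x)"
 have q: "pot x = ennreal q" "q \<ge> 0" using p by (auto simp: q_def less_top)
 define \<omega> where "\<omega> r = C * q * r powr s" for r
 show ?thesis
 proof (rule approx_limit_of_moll[OF \<phi>, of "d / 2" x \<omega>])
  fix r e assume r: "0 < r" "r < d / 2" and e: "0 < e" "e < d / 2"
  have "ball x (r + e) \<subseteq> U" using d(2) r e by (auto intro: subsetD[OF d(2)])
  from C(2)[OF r(1) e(1) this]
  have "(NBINT z. ind (ball x r) z * eabs (moll e \<phi> z - moll e \<phi> x)) \<le> ennreal (C * r powr (?n + s)) * pot x" .
  also have "\<dots> = ennreal (C * r powr (?n + s) * q)" unfolding q(1) using C q by (intro ennreal_mult[symmetric]) auto
  also have "C * r powr (?n + s) * q = \<omega> r * r ^ CARD('n)"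
   using r by (simp add: \<omega>_def powr_add powr_realpow)
  finally show "(NBINT z. ind (ball x r) z * eabs (moll e \<phi> z - moll e \<phi> x)) \<le> ennreal (\<omega> r * r ^ CARD('n))" .
 next
  show "(\<omega> \<longlongrightarrow> 0) (at_right 0)"
  proof -
   have "((\<lambda>r. r powr s) \<longlongrightarrow> 0 powr s) (at_right 0)"
    using s(1) by (intro tendsto_powr') (auto intro!: tendsto_intros eventually_at_rightI[of 0 1])
   from tendsto_mult[OF tendsto_const[of "C * q"] this] show ?thesis using s by (simp add: \<omega>_def[abs_def])
  qed
 qed (use d C q in \<open>auto simp: \<omega>_def\<close>)
qed

end

section \<open>Borel representatives, and gradients of mollifications\<close>

lemma loc_int_representative:
 fixes F :: "real^'n \<Rightarrow> real"
 assumes F: "locally_integrable F"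
 shows "F \<in> borel_measurable lebesgue" and "\<exists>F'. loc_int F' \<and> (AE x in lebesgue. F x = F' x)"
proof -
 have i: "integrable lebesgue (\<lambda>x. ind (cball 0 R) x * F x)" for R
  using F unfolding locally_integrable_def set_integrable_def by (auto dest: spec[of _ "cball 0 R"])
 have "(\<lambda>n. ind (cball 0 (real n)) x * F x) \<longlonglongrightarrow> F x" for x
 proof (rule tendsto_eventually)
  obtain n0 :: nat where "norm x \<le> real n0" using real_arch_simple by blast
  then show "\<forall>\<^sub>F n in sequentially. ind (cball 0 (real n)) x * F x = F x"
   unfolding eventually_sequentially by (intro exI[of _ n0]) (auto split: split_indicator)
 qed
 then show Fm: "F \<in> borel_measurable lebesgue"
  by (rule borel_measurable_LIMSEQ_real[where u="\<lambda>n x. ind (cball 0 (real n)) x * F x"]) (rule borel_measurable_integrable[OF i])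
 from completion_ex_borel_measurable_real[OF this]
 obtain F' where F'm: "F' \<in> borel_measurable lborel" and ae: "AE x in lborel. F x = F' x" by blast
 have [measurable]: "F' \<in> \<B>" using F'm by simp
 have ae': "AE x in lebesgue. F x = F' x" by (rule AE_completion[OF ae])
 have "integrable lborel (\<lambda>y. ind (ball 0 R) y * F' y)" for R
 proof -
  have [measurable]: "cball (0 :: real^'n) R \<in> sets borel" by simp
  have "integrable lebesgue (\<lambda>y. ind (cball 0 R) y * F' y)"
  proof (rule integrable_cong_AE_imp[OF i[of R]])
   show "AE x in lebesgue. ind (cball 0 R) x * F x = ind (cball 0 R) x * F' x"
    using ae' by eventually_elim simp
   show "(\<lambda>y. ind (cball 0 R) y * F' y) \<in> borel_measurable lebesgue"
    by (rule measurable_completion) measurable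
  qed
  then have "integrable lborel (\<lambda>y. ind (cball 0 R) y * F' y)"
   by (subst (asm) integrable_completion) auto
  then show ?thesis by (rule Bochner_Integration.integrable_bound) (auto split: split_indicator)
 qed
 then show "\<exists>F'. loc_int F' \<and> (AE x in lebesgue. F x = F' x)"
  using ae' unfolding loc_int_def by (intro exI[of _ F']) auto
qed

lemma integral_representative:
 fixes F F' \<psi> :: "real^'n \<Rightarrow> real"
 assumes Fm: "F \<in> borel_measurable lebesgue" and F': "F' \<in> \<B>" and ae: "AE x in lebesgue. F x = F' x"
  and \<psi>: "\<psi> \<in> \<B>"
 shows "(LINT x|lebesgue. F x * \<psi> x) = (LBINT x. F' x * \<psi> x)"
proof -
 have m: "\<psi> \<in> borel_measurable lebesgue" "F' \<in> borel_measurable lebesgue"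
  using \<psi> F' by (auto intro: measurable_completion)
 have "(LINT x|lebesgue. F x * \<psi> x) = (LINT x|lebesgue. F' x * \<psi> x)"
  by (rule integral_cong_AE) (use ae Fm m in \<open>auto elim: eventually_mono\<close>)
 also have "\<dots> = (LBINT x. F' x * \<psi> x)"
  by (rule integral_completion) (use \<psi> F' in measurable)
 finally show ?thesis .
qed

lemma has_approx_limit_representative:
 fixes F F' :: "real^'n \<Rightarrow> real"
 assumes Fm: "F \<in> borel_measurable lebesgue" and F': "F' \<in> \<B>" and ae: "AE x in lebesgue. F x = F' x"
 shows "has_approx_limit F x l \<longleftrightarrow> has_approx_limit F' x l"
proof -
 have m: "F' \<in> borel_measurable lebesgue" using F' by (auto intro: measurable_completion)
 note [measurable] = Fm m
 have [measurable]: "ball x r \<in> sets lebesgue" for r by simp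
 have "(LINT y:ball x r|lebesgue. \<bar>F y - l\<bar>) = (LINT y:ball x r|lebesgue. \<bar>F' y - l\<bar>)" for r
  unfolding set_lebesgue_integral_def
  by (rule integral_cong_AE) (use ae Fm m in \<open>auto elim: eventually_mono\<close>)
 then show ?thesis unfolding has_approx_limit_def by simp
qed

text \<open>The mollifier shifted to x is a test function of y. The sign from the reflection of y to
  x - y cancels the sign in the definition of the weak derivative.\<close>

lemma moll_deriv_weak_partial:
 fixes F F' G G' :: "real^'n \<Rightarrow> real"
 assumes Fm: "F \<in> borel_measurable lebesgue" "F' \<in> \<B>" "AE x in lebesgue. F x = F' x"
  and Gm: "G \<in> borel_measurable lebesgue" "G' \<in> \<B>" "AE x in lebesgue. G x = G' x"
  and w: "has_weak_partial k F G" and e: "e > 0"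
 shows "moll_deriv e F' x (axis k 1) = moll e G' x"
proof -
 let ?\<psi> = "\<lambda>y. mollifier e (x - y)"
 have p: "partial k ?\<psi> = (\<lambda>y. - mollifier_deriv e (x - y) (axis k 1))" by (rule ext) (rule mollifier_shift_partial)
 have "(LINT y|lebesgue. F y * partial k ?\<psi> y) = - (LINT y|lebesgue. G y * ?\<psi> y)"
  using w mollifier_test_function[OF e] unfolding has_weak_partial_def by blast
 moreover have "(LINT y|lebesgue. F y * partial k ?\<psi> y) = (LBINT y. F' y * - mollifier_deriv e (x - y) (axis k 1))"
  unfolding p by (rule integral_representative[OF Fm]) measurable
 moreover have "(LINT y|lebesgue. G y * ?\<psi> y) = (LBINT y. G' y * ?\<psi> y)"
  by (rule integral_representative[OF Gm]) measurable
 ultimately show ?thesis unfolding moll_deriv_def moll_def by simp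
qed

text \<open>The same test function, now against P j and N j. It is nonnegative and its integrals are
  finite, so the two additive inequalities of \<open>BV_loc_variation\<close> can be turned into a
  bound on the difference.\<close>

lemma moll_deriv_BV_bound:
 fixes G G' :: "real^'n \<Rightarrow> real"
 assumes BV: "BV_loc G"
  and Gm: "G \<in> borel_measurable lebesgue" "G' \<in> \<B>" "AE x in lebesgue. G x = G' x"
  and e: "e > 0"
 shows "eabs (moll_deriv e G' w (axis j 1)) \<le> (\<integral>\<^sup>+z. ennreal (mollifier e (w - z)) \<partial>variation_measure G)"
proof -
 obtain P N where hd: "has_derivative_measures G P N"
  and PN: "\<And>k f. f \<in> \<B> \<Longrightarrow>
    integral\<^sup>N (P k) f \<le> integral\<^sup>N (N k) f + integral\<^sup>N (variation_measure G) f"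
  and NP: "\<And>k f. f \<in> \<B> \<Longrightarrow>
    integral\<^sup>N (N k) f \<le> integral\<^sup>N (P k) f + integral\<^sup>N (variation_measure G) f"
  by (rule BV_loc_variation[OF BV]) blast
 let ?\<psi> = "\<lambda>y. mollifier e (w - y)"
 have \<psi>m [measurable]: "?\<psi> \<in> \<B>" by measurable
 have p: "partial j ?\<psi> = (\<lambda>y. - mollifier_deriv e (w - y) (axis j 1))" by (rule ext) (rule mollifier_shift_partial)
 have "(LINT y|lebesgue. G y * partial j ?\<psi> y) = - ((LINT y|P j. ?\<psi> y) - (LINT y|N j. ?\<psi> y))"
  using hd mollifier_test_function[OF e] unfolding has_derivative_measures_def by blast
 moreover have "(LINT y|lebesgue. G y * partial j ?\<psi> y) = (LBINT y. G' y * - mollifier_deriv e (w - y) (axis j 1))"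
  unfolding p by (rule integral_representative[OF Gm]) measurable
 ultimately have eq: "moll_deriv e G' w (axis j 1) = (LINT y|P j. ?\<psi> y) - (LINT y|N j. ?\<psi> y)"
  unfolding moll_deriv_def by simp
 have rad: "radon_measure (P j)" "radon_measure (N j)" using hd unfolding has_derivative_measures_def by auto
 define C where "C = (2 ^ CARD('n) * exp (4/3) / unit_ball_vol (real CARD('n))) / e ^ CARD('n)"
 have fin: "(\<integral>\<^sup>+y. ennreal (?\<psi> y) \<partial>M) < \<infinity>" "(LINT y|M. ?\<psi> y) = enn2real (\<integral>\<^sup>+y. ennreal (?\<psi> y) \<partial>M)" if M: "radon_measure M" for M
 proof -
  have sM [measurable_cong]: "sets M = sets borel" using M unfolding radon_measure_def by simp
  have "(\<integral>\<^sup>+y. ennreal (?\<psi> y) \<partial>M) \<le> (\<integral>\<^sup>+y. ennreal C * ind (cball w e) y \<partial>M)"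
  proof (rule nn_integral_mono)
   fix y
   have "mollifier e (w - y) = 0" if "y \<notin> cball w e"
    using that by (intro mollifier_outside(1) e) (simp add: dist_norm)
   moreover have "mollifier e (w - y) \<le> C" unfolding C_def by (rule mollifier_properties(2)[OF e])
   ultimately show "ennreal (?\<psi> y) \<le> ennreal C * ind (cball w e) y"
    by (cases "y \<in> cball w e") (auto intro: ennreal_leI)
  qed
  also have "\<dots> = ennreal C * emeasure M (cball w e)" by (rule nn_integral_cmult_indicator) (simp add: sM)
  also have "\<dots> < \<infinity>"
   using radon_measure_bounded_finite[OF M bounded_cball[of w e]] by (simp add: ennreal_mult_less_top)
  finally show "(\<integral>\<^sup>+y. ennreal (?\<psi> y) \<partial>M) < \<infinity>" .
  show "(LINT y|M. ?\<psi> y) = enn2real (\<integral>\<^sup>+y. ennreal (?\<psi> y) \<partial>M)"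
   by (rule integral_eq_nn_integral) (auto intro: mollifier_properties(1)[OF e])
 qed
 define a where "a = enn2real (\<integral>\<^sup>+y. ennreal (?\<psi> y) \<partial>P j)"
 define c where "c = enn2real (\<integral>\<^sup>+y. ennreal (?\<psi> y) \<partial>N j)"
 have ac: "(\<integral>\<^sup>+y. ennreal (?\<psi> y) \<partial>P j) = ennreal a" "(\<integral>\<^sup>+y. ennreal (?\<psi> y) \<partial>N j) = ennreal c" "a \<ge> 0" "c \<ge> 0"
  unfolding a_def c_def using fin(1)[OF rad(1)] fin(1)[OF rad(2)] by (auto simp: less_top)
 let ?v = "\<integral>\<^sup>+y. ennreal (?\<psi> y) \<partial>variation_measure G"
 have le: "ennreal a \<le> ennreal c + ?v" "ennreal c \<le> ennreal a + ?v"
  using PN[of "\<lambda>y. ennreal (?\<psi> y)" j] NP[of "\<lambda>y. ennreal (?\<psi> y)" j] unfolding ac by auto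
 have "eabs (a - c) \<le> ?v"
 proof (cases "?v")
  case (real r)
  then have "a \<le> c + r" "c \<le> a + r" using le ac(3,4) by (auto simp flip: ennreal_plus)
  then show ?thesis using real by (auto intro: ennreal_leI)
 qed simp
 then show ?thesis unfolding eq fin(2)[OF rad(1)] fin(2)[OF rad(2)] a_def c_def .
qed

text \<open>Restriction to U makes the measure finite; for a ball inside U it loses nothing, because
  the mollifier vanishes off the ball.\<close>

lemma BV_potential_bounds:
 fixes G G' :: "real^'n \<Rightarrow> real"
 assumes BV: "BV_loc G" and Gm: "G \<in> borel_measurable lebesgue" "loc_int G'" "AE x in lebesgue. G x = G' x"
  and U: "open U" "bounded U" and fin: "emeasure (variation_measure G) U < \<infinity>" and s: "0 < s" "s < 1"
 shows "potential_bounds G' (density (variation_measure G) (ind U)) U s"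
  and "potential_bounds.pot (density (variation_measure G) (ind U)) s x = (\<integral>\<^sup>+z\<in>U. riesz_kernel s x z \<partial>variation_measure G)"
proof -
 let ?V = "variation_measure G"
 let ?M = "density ?V (ind U)"
 have Um [measurable]: "U \<in> sets ?V" using U by simp
 note [measurable_cong] = sets_variation_measure[of G]
 show pb: "potential_bounds G' ?M U s"
 proof (rule potential_bounds.intro)
  show "finite_measure ?M"
  proof (rule finite_measureI)
   have "emeasure ?M (space ?M) = (\<integral>\<^sup>+z. ind U z * ind (space ?V) z \<partial>?V)"
    unfolding space_density by (rule emeasure_density[OF borel_measurable_indicator[OF Um] sets.top])
   also have "\<dots> = (\<integral>\<^sup>+z. ind U z \<partial>?V)" by (intro nn_integral_cong) (auto split: split_indicator)
   also have "\<dots> = emeasure ?V U" by (rule nn_integral_indicator[OF Um])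
   finally show "emeasure ?M (space ?M) \<noteq> \<infinity>" using fin by simp
  qed
  fix e w j assume e: "0 < (e::real)" and sub: "ball w e \<subseteq> U"
  have "eabs (moll_deriv e G' w (axis j 1)) \<le> (\<integral>\<^sup>+z. ennreal (mollifier e (w - z)) \<partial>?V)"
   by (rule moll_deriv_BV_bound[OF BV Gm(1) loc_int_borel[OF Gm(2)] Gm(3) e])
  also have "\<dots> = (\<integral>\<^sup>+z. ind U z * ennreal (mollifier e (w - z)) \<partial>?V)"
  proof (rule nn_integral_cong)
   fix z
   have "mollifier e (w - z) = 0" if "z \<notin> U"
    using that sub by (intro mollifier_outside(1) e) (auto simp: dist_norm not_less[symmetric])
   then show "ennreal (mollifier e (w - z)) = ind U z * ennreal (mollifier e (w - z))" by (auto split: split_indicator)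
  qed
  also have "\<dots> = (\<integral>\<^sup>+z. ennreal (mollifier e (w - z)) \<partial>?M)"
   by (subst nn_integral_density) auto
  finally show "eabs (moll_deriv e G' w (axis j 1)) \<le> (\<integral>\<^sup>+z. ennreal (mollifier e (w - z)) \<partial>?M)" .
 qed (use Gm U s in auto)
 interpret potential_bounds G' ?M U s by (rule pb)
 have [measurable]: "(\<lambda>z. riesz_kernel s x z) \<in> \<B>" by measurable
 show "potential_bounds.pot ?M s x = (\<integral>\<^sup>+z\<in>U. riesz_kernel s x z \<partial>?V)"
  unfolding pot_def by (subst nn_integral_density) (auto intro!: nn_integral_cong simp: mult.commute)
qed

text \<open>Finite potentials at x bound the mollified gradients at x and their oscillation, hence
  their means over all small balls around x, uniformly in e. \<open>poincare_linear\<close> then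
  gives the mollified F an oscillation of order r, and \<open>approx_limit_of_moll\<close> yields
  the limit.\<close>

lemma approx_limit_of_gradient:
 fixes F :: "real^'n \<Rightarrow> real" and G :: "'n \<Rightarrow> real^'n \<Rightarrow> real"
 assumes F: "loc_int F" and pb: "\<And>k. potential_bounds (G k) (M k) (U k) s"
  and d: "\<And>e w k. e > 0 \<Longrightarrow> moll_deriv e F w (axis k 1) = moll e (G k) w"
  and U: "\<And>k. open (U k)" "\<And>k. x \<in> U k" and p: "\<And>k. potential_bounds.pot (M k) s x < \<infinity>"
 shows "\<exists>l. has_approx_limit F x l"
proof -
 let ?n = "real CARD('n)" and ?v = "unit_ball_vol (real CARD('n))"
 have v: "?v > 0" by (rule vol_pos)
 define q where "q k = enn2real (potential_bounds.pot (M k) s x)" for k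
 have q: "potential_bounds.pot (M k) s x = ennreal (q k)" "q k \<ge> 0" for k using p[of k] by (auto simp: q_def less_top)
 have "\<forall>k. \<exists>d>0. ball x d \<subseteq> U k" using U openE by metis
 then obtain \<delta>' where \<delta>': "\<And>k. \<delta>' k > 0" "\<And>k. ball x (\<delta>' k) \<subseteq> U k" by metis
 \<comment> \<open>The finitely many sets U k share a ball around x; the bound 1 later gives \<rho>
   powr s \<le> 1.\<close>
 define \<delta> where "\<delta> = min 1 (Min (range \<delta>'))"
 have \<delta>0: "\<delta> > 0" "\<delta> \<le> 1" unfolding \<delta>_def using \<delta>'(1) by auto
 have \<delta>: "ball x \<delta> \<subseteq> U k" for k
 proof -
  have "\<delta> \<le> \<delta>' k" unfolding \<delta>_def by (intro min.coboundedI2 Min_le) auto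
  then show ?thesis using \<delta>'(2)[of k] by (meson subset_ball subset_trans)
 qed
 have "\<forall>k. \<exists>C>0. \<forall>r e. 0 < r \<longrightarrow> 0 < e \<longrightarrow> ball x (r + e) \<subseteq> U k \<longrightarrow>
  (NBINT z. ind (ball x r) z * eabs (moll e (G k) z - moll e (G k) x)) \<le> ennreal (C * r powr (?n + s)) * ennreal (q k)"
 proof
  fix k
  obtain C0 where C0: "C0 > 0" "\<And>y r e. 0 < r \<Longrightarrow> 0 < e \<Longrightarrow> ball y (r + e) \<subseteq> U k \<Longrightarrow>
   (NBINT z. ind (ball y r) z * eabs (moll e (G k) z - moll e (G k) y)) \<le> ennreal (C0 * r powr (?n + s)) * potential_bounds.pot (M k) s y"
   by (rule potential_bounds.oscillation[OF pb[of k]]) blast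
  show "\<exists>C>0. \<forall>r e. 0 < r \<longrightarrow> 0 < e \<longrightarrow> ball x (r + e) \<subseteq> U k \<longrightarrow>
  (NBINT z. ind (ball x r) z * eabs (moll e (G k) z - moll e (G k) x)) \<le> ennreal (C * r powr (?n + s)) * ennreal (q k)" unfolding q(1)[symmetric] by (rule exI[of _ C0], intro conjI allI impI C0)
 qed
 from choice[OF this] obtain C where C': "\<forall>k. C k > 0 \<and> (\<forall>r e. 0 < r \<longrightarrow> 0 < e \<longrightarrow> ball x (r + e) \<subseteq> U k \<longrightarrow>
  (NBINT z. ind (ball x r) z * eabs (moll e (G k) z - moll e (G k) x)) \<le> ennreal (C k * r powr (?n + s)) * ennreal (q k))" by (elim exE) (rule that)
 note C = C'[THEN spec, THEN conjunct1] C'[THEN spec, THEN conjunct2, rule_format]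
 have "\<forall>k. \<exists>A>0. \<forall>e. 0 < e \<longrightarrow> e \<le> 1 \<longrightarrow> ball x (\<delta>/2 + e) \<subseteq> U k \<longrightarrow> eabs (moll e (G k) x) \<le> ennreal A * (1 + ennreal (q k))"
 proof
  fix k
  have "\<delta> / 2 > 0" using \<delta>0 by simp
  then obtain A0 where A0: "A0 > 0" "\<And>y e. 0 < e \<Longrightarrow> e \<le> 1 \<Longrightarrow> ball y (\<delta>/2 + e) \<subseteq> U k \<Longrightarrow> eabs (moll e (G k) y) \<le> ennreal A0 * (1 + potential_bounds.pot (M k) s y)"
   by (rule potential_bounds.moll_bound[OF pb[of k]]) blast
  show "\<exists>A>0. \<forall>e. 0 < e \<longrightarrow> e \<le> 1 \<longrightarrow> ball x (\<delta>/2 + e) \<subseteq> U k \<longrightarrow> eabs (moll e (G k) x) \<le> ennreal A * (1 + ennreal (q k))" unfolding q(1)[symmetric] by (rule exI[of _ A0], intro conjI allI impI A0)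
 qed
 from choice[OF this] obtain A where A': "\<forall>k. A k > 0 \<and> (\<forall>e. 0 < e \<longrightarrow> e \<le> 1 \<longrightarrow> ball x (\<delta>/2 + e) \<subseteq> U k \<longrightarrow> eabs (moll e (G k) x) \<le> ennreal (A k) * (1 + ennreal (q k)))"
  by (elim exE) (rule that)
 note A = A'[THEN spec, THEN conjunct1] A'[THEN spec, THEN conjunct2, rule_format]
 \<comment> \<open>The first summand is the size at x from \<open>moll_bound\<close>, the second the
   oscillation; both scale with \<rho> ^ n.\<close>
 define B where "B k = A k * (1 + q k) * ?v + C k * q k" for k
 have B0: "B k \<ge> 0" for k unfolding B_def using A(1)[of k] C(1)[of k] q(2)[of k] v by simp
 define \<omega> where "\<omega> r = (\<Sum>k\<in>UNIV. B k) * r" for r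
 have s: "0 < s" "s < 1" using potential_bounds.s[OF pb] by auto
 show ?thesis
 \<comment> \<open>The absolute value keeps the modulus nonnegative for negative r as well, as
   \<open>approx_limit_of_moll\<close> asks.\<close>
 proof (rule approx_limit_of_moll[OF F, of "\<delta>/2" x "\<lambda>r. \<bar>\<omega> r\<bar>"])
  fix r e :: real assume r: "0 < r" "r < \<delta>/2" and e: "0 < e" "e < \<delta>/2"
  have sub: "ball x (\<rho> + e) \<subseteq> U k" if "\<rho> \<le> \<delta>/2" for \<rho> k
   by (rule subset_trans[OF subset_ball \<delta>]) (use that e in linarith)
  have [measurable]: "moll e (G k) \<in> \<B>" for k by (rule moll_borel[OF potential_bounds.\<phi>[OF pb] e(1)])
  define H where "H w = (\<Sum>k\<in>UNIV. eabs (moll e (G k) w))" for w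
  have [measurable]: "H \<in> \<B>" unfolding H_def by measurable
  have "(NBINT z. ind (ball x r) z * eabs (moll e F z - moll e F x)) \<le> ennreal (\<Sum>k\<in>UNIV. B k) * ennreal (r * r ^ CARD('n))"
  proof (rule poincare_linear[OF moll_has_derivative(1)[OF F e(1)] moll_has_derivative(2)[OF F e(1)] _ _ r(1)])
   fix w u :: "real^'n"
   have lin: "linear (moll_deriv e F w)" using moll_has_derivative(1)[OF F e(1)] by (rule has_derivative_linear)
   have "moll_deriv e F w u = moll_deriv e F w (\<Sum>j\<in>UNIV. (u $ j) *\<^sub>R axis j 1)"
    using basis_expansion[of u] by (simp add: scalar_mult_eq_scaleR)
   also have "\<dots> = (\<Sum>j\<in>UNIV. u $ j * moll e (G j) w)"
    by (simp add: linear_sum[OF lin] linear_cmul[OF lin] d[OF e(1)])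
   finally have "\<bar>moll_deriv e F w u\<bar> \<le> (\<Sum>j\<in>UNIV. \<bar>u $ j * moll e (G j) w\<bar>)" by (simp add: sum_abs)
   also have "\<dots> \<le> (\<Sum>j\<in>UNIV. \<bar>moll e (G j) w\<bar> * norm u)"
    unfolding abs_mult mult.commute[of "\<bar>u $ _\<bar>"] using component_le_norm_cart[of u] by (intro sum_mono mult_left_mono) auto
   finally have "eabs (moll_deriv e F w u) \<le> ennreal ((\<Sum>j\<in>UNIV. \<bar>moll e (G j) w\<bar>) * norm u)"
    by (intro ennreal_leI) (simp add: sum_distrib_right)
   also have "\<dots> = H w * ennreal (norm u)" unfolding H_def by (simp add: ennreal_mult sum_nonneg)
   finally show "eabs (moll_deriv e F w u) \<le> H w * ennreal (norm u)" .
  next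
   fix \<rho> :: real assume \<rho>: "0 < \<rho>" "\<rho> \<le> r"
   have one: "(NBINT w. ind (ball x \<rho>) w * eabs (moll e (G k) w)) \<le> ennreal (B k * \<rho> ^ CARD('n))" for k
   proof -
    have "(NBINT w. ind (ball x \<rho>) w * eabs (moll e (G k) w))
     \<le> (NBINT w. ind (ball x \<rho>) w * eabs (moll e (G k) x) + ind (ball x \<rho>) w * eabs (moll e (G k) w - moll e (G k) x))"
     by (intro nn_integral_mono) (auto simp: ennreal_plus[symmetric] simp del: ennreal_plus intro!: ennreal_leI split: split_indicator)
    also have "\<dots> = (NBINT w. ind (ball x \<rho>) w * eabs (moll e (G k) x)) + (NBINT w. ind (ball x \<rho>) w * eabs (moll e (G k) w - moll e (G k) x))"
     by (rule nn_integral_add) measurable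
    also have "\<dots> \<le> ennreal (A k * (1 + q k) * (?v * \<rho> ^ CARD('n))) + ennreal (C k * \<rho> powr (?n + s)) * ennreal (q k)"
    proof (rule add_mono)
     have "eabs (moll e (G k) x) \<le> ennreal (A k) * (1 + ennreal (q k))"
      using e \<delta>0 sub[of "\<delta>/2" k] by (intro A(2)) auto
     also have "\<dots> = ennreal (A k * (1 + q k))" using q(2)[of k] A(1)[of k] by (simp add: ennreal_mult)
     finally have "\<bar>moll e (G k) x\<bar> \<le> A k * (1 + q k)" using q(2)[of k] A(1)[of k] by (subst (asm) ennreal_le_iff) auto
     then show "(NBINT w. ind (ball x \<rho>) w * eabs (moll e (G k) x)) \<le> ennreal (A k * (1 + q k) * (?v * \<rho> ^ CARD('n)))"
      unfolding nn_integral_ball_const[OF \<rho>(1) abs_ge_zero] using v \<rho> by (intro ennreal_leI mult_right_mono) auto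
     show "(NBINT w. ind (ball x \<rho>) w * eabs (moll e (G k) w - moll e (G k) x)) \<le> ennreal (C k * \<rho> powr (?n + s)) * ennreal (q k)"
      by (rule C(2)[OF \<rho>(1) e(1) sub]) (use \<rho> r in simp)
    qed
    also have "\<dots> \<le> ennreal (A k * (1 + q k) * (?v * \<rho> ^ CARD('n))) + ennreal (C k * q k * \<rho> ^ CARD('n))"
    proof (rule add_left_mono)
     have "\<rho> powr (?n + s) = \<rho> ^ CARD('n) * \<rho> powr s" using \<rho> by (simp add: powr_add powr_realpow)
     also have "\<dots> \<le> \<rho> ^ CARD('n) * 1" using \<rho> r \<delta>0 s by (intro mult_left_mono powr_le1) auto
     finally have "\<rho> powr (?n + s) \<le> \<rho> ^ CARD('n)" by simp
     then have "(C k * q k) * \<rho> powr (?n + s) \<le> (C k * q k) * \<rho> ^ CARD('n)" using C(1)[of k] q(2)[of k] by (intro mult_left_mono) auto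
     then show "ennreal (C k * \<rho> powr (?n + s)) * ennreal (q k) \<le> ennreal (C k * q k * \<rho> ^ CARD('n))"
      using C(1)[of k] q(2)[of k] by (subst ennreal_mult[symmetric]) (auto intro!: ennreal_leI simp: mult_ac)
    qed
    also have "\<dots> = ennreal (B k * \<rho> ^ CARD('n))"
     using A(1)[of k] C(1)[of k] q(2)[of k] v \<rho> by (subst ennreal_plus[symmetric]) (auto simp: B_def algebra_simps)
    finally show ?thesis .
   qed
   have "(NBINT w. ind (ball x \<rho>) w * H w) = (\<Sum>k\<in>UNIV. NBINT w. ind (ball x \<rho>) w * eabs (moll e (G k) w))"
    unfolding H_def sum_distrib_left by (rule nn_integral_sum) measurable
   also have "\<dots> \<le> (\<Sum>k\<in>UNIV. ennreal (B k * \<rho> ^ CARD('n)))" by (intro sum_mono one)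
   also have "\<dots> = ennreal (\<Sum>k\<in>UNIV. B k) * ennreal (\<rho> ^ CARD('n))"
    using B0 \<rho> by (simp add: ennreal_mult sum_nonneg sum_distrib_right flip: sum_ennreal)
   finally show "(NBINT w. ind (ball x \<rho>) w * H w) \<le> ennreal (\<Sum>k\<in>UNIV. B k) * ennreal (\<rho> ^ CARD('n))" .
  qed measurable
  also have "\<dots> = ennreal (\<bar>\<omega> r\<bar> * r ^ CARD('n))"
  proof -
   have "0 \<le> \<omega> r" unfolding \<omega>_def using r B0 by (intro mult_nonneg_nonneg sum_nonneg) auto
   then show ?thesis unfolding \<omega>_def using r B0 by (subst ennreal_mult[symmetric]) (auto simp: sum_nonneg mult_ac abs_of_nonneg)
  qed
  finally show "(NBINT z. ind (ball x r) z * eabs (moll e F z - moll e F x)) \<le> ennreal (\<bar>\<omega> r\<bar> * r ^ CARD('n))" .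
 next
  have "((\<lambda>r. \<bar>(\<Sum>k\<in>UNIV. B k) * r\<bar>) \<longlongrightarrow> \<bar>(\<Sum>k\<in>UNIV. B k) * 0\<bar>) (at_right 0)" by (intro tendsto_intros)
  then show "((\<lambda>r. \<bar>\<omega> r\<bar>) \<longlongrightarrow> 0) (at_right 0)" unfolding \<omega>_def by simp
 qed (use \<delta>0 in auto)
qed

section \<open>Mollified functions along a path\<close>

lemma holder_continuous_on:
 fixes X :: "real \<Rightarrow> 'a::metric_space"
 assumes H: "H > 0" "\<alpha> > 0" and X: "\<And>t u. t \<in> A \<Longrightarrow> u \<in> A \<Longrightarrow> dist (X t) (X u) \<le> H * \<bar>t - u\<bar> powr \<alpha>"
 shows "continuous_on A X"
proof (rule continuous_onI)
 fix x :: real and e :: real assume x: "x \<in> A" and e: "e > 0"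
 define d where "d = (e / H) powr (1 / \<alpha>)"
 have d: "d > 0" unfolding d_def using e H by simp
 have "dist (X x') (X x) \<le> e" if "x' \<in> A" "dist x' x < d" for x'
 proof -
  have "dist (X x') (X x) \<le> H * \<bar>x' - x\<bar> powr \<alpha>" by (rule X[OF that(1) x])
  also have "\<dots> \<le> H * d powr \<alpha>" using that H by (intro mult_left_mono powr_mono2) (auto simp: dist_real_def)
  also have "d powr \<alpha> = e / H" unfolding d_def using H e by (simp add: powr_powr)
  finally show ?thesis using H by simp
 qed
 then show "\<exists>d>0. \<forall>x'\<in>A. dist x' x < d \<longrightarrow> dist (X x') (X x) \<le> e" using d by blast
qed

context potential_bounds begin

text \<open>Close points are compared by \<open>two_point\<close>, where the distance to the power s
  turns into |t - u| powr (\<alpha> s). Distant points are compared by size alone: a distance of at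
  least \<delta> bounds |t - u| powr (\<alpha> s) from below, so inserting this factor costs only a
  constant.\<close>

lemma time_bounds:
 fixes X :: "real \<Rightarrow> real^'n"
 assumes Uo: "open U" and XU: "\<And>t. t \<in> {0..T} \<Longrightarrow> X t \<in> U" and H: "H > 0" and \<alpha>: "\<alpha> > 0"
  and X: "\<And>t u. t \<in> {0..T} \<Longrightarrow> u \<in> {0..T} \<Longrightarrow> dist (X t) (X u) \<le> H * \<bar>t - u\<bar> powr \<alpha>"
 obtains C e0 where "C > 0" "0 < e0"
  "\<And>e t u. 0 < e \<Longrightarrow> e < e0 \<Longrightarrow> t \<in> {0..T} \<Longrightarrow> u \<in> {0..T} \<Longrightarrow>
    eabs (moll e \<phi> (X t) - moll e \<phi> (X u)) \<le> ennreal (C * \<bar>t - u\<bar> powr (\<alpha> * s)) * ((1 + pot (X t)) + (1 + pot (X u)))"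
  "\<And>e t. 0 < e \<Longrightarrow> e < e0 \<Longrightarrow> t \<in> {0..T} \<Longrightarrow> eabs (moll e \<phi> (X t)) \<le> ennreal C * (1 + pot (X t))"
proof -
 have "continuous_on {0..T} X" by (rule holder_continuous_on[OF H \<alpha> X])
 then have "compact (X ` {0..T})" by (intro compact_continuous_image) auto
 from compact_subset_open_imp_ball_epsilon_subset[OF this Uo]
 obtain \<delta>' where \<delta>': "\<delta>' > 0" "(\<Union>x\<in>X ` {0..T}. ball x \<delta>') \<subseteq> U" using XU by blast
 \<comment> \<open>For points at distance below \<delta> and e < \<delta> the radius 2 dist + e
   stays below 3 \<delta>, within the 4 \<delta> available around the path. Also e < \<delta> \<le>
   1, as \<open>moll_bound\<close> requires.\<close>
 define \<delta> where "\<delta> = min (\<delta>' / 4) (1/2)"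
 have \<delta>: "\<delta> > 0" "\<delta> \<le> 1" "4 * \<delta> \<le> \<delta>'" using \<delta>' unfolding \<delta>_def by auto
 have sub: "ball (X t) r \<subseteq> U" if "t \<in> {0..T}" "r \<le> 4 * \<delta>" for t r
 proof -
  have "ball (X t) r \<subseteq> ball (X t) \<delta>'" using that \<delta> by (intro subset_ball) auto
  also have "\<dots> \<subseteq> U" using \<delta>'(2) that by blast
  finally show ?thesis .
 qed
 obtain C1 where C1: "C1 > 0" "\<And>x y e. x \<noteq> y \<Longrightarrow> 0 < e \<Longrightarrow> ball x (2 * dist x y + e) \<subseteq> U \<Longrightarrow> ball y (2 * dist x y + e) \<subseteq> U \<Longrightarrow>
  eabs (moll e \<phi> x - moll e \<phi> y) \<le> ennreal (C1 * dist x y powr s) * (pot x + pot y)"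
  by (rule two_point) blast
 obtain A where A: "A > 0" "\<And>x e. 0 < e \<Longrightarrow> e \<le> 1 \<Longrightarrow> ball x (\<delta> + e) \<subseteq> U \<Longrightarrow> eabs (moll e \<phi> x) \<le> ennreal A * (1 + pot x)"
  by (rule moll_bound[OF \<delta>(1)]) blast
 \<comment> \<open>The summands serve close pairs, distant pairs and the size bound, in this
   order.\<close>
 define C where "C = C1 * H powr s + A * (H / \<delta>) powr s + A"
 have C: "C > 0" unfolding C_def using C1 A by (intro add_nonneg_pos add_nonneg_nonneg) auto
 have size: "eabs (moll e \<phi> (X t)) \<le> ennreal A * (1 + pot (X t))" if "0 < e" "e < \<delta>" "t \<in> {0..T}" for e t
  using that \<delta> by (intro A(2) sub) auto
 show ?thesis
 proof (rule that[of C \<delta>])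
  fix e t assume "0 < e" "e < \<delta>" "t \<in> {0..T}"
  from size[OF this] have "eabs (moll e \<phi> (X t)) \<le> ennreal A * (1 + pot (X t))" .
  also have "\<dots> \<le> ennreal C * (1 + pot (X t))" unfolding C_def using C1 A by (intro mult_right_mono ennreal_leI) auto
  finally show "eabs (moll e \<phi> (X t)) \<le> ennreal C * (1 + pot (X t))" .
 next
  fix e t u assume e: "0 < e" "e < \<delta>" and t: "t \<in> {0..T}" and u: "u \<in> {0..T}"
  let ?W = "(1 + pot (X t)) + (1 + pot (X u))"
  have Hp: "dist (X t) (X u) powr s \<le> H powr s * \<bar>t - u\<bar> powr (\<alpha> * s)"
  proof -
   have "dist (X t) (X u) powr s \<le> (H * \<bar>t - u\<bar> powr \<alpha>) powr s" using X[OF t u] s by (intro powr_mono2) auto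
   then show ?thesis using H by (simp add: powr_mult powr_powr)
  qed
  show "eabs (moll e \<phi> (X t) - moll e \<phi> (X u)) \<le> ennreal (C * \<bar>t - u\<bar> powr (\<alpha> * s)) * ?W"
  proof (cases "X t = X u")
   case False
   show ?thesis
   proof (cases "dist (X t) (X u) < \<delta>")
    case True
    have "eabs (moll e \<phi> (X t) - moll e \<phi> (X u)) \<le> ennreal (C1 * dist (X t) (X u) powr s) * (pot (X t) + pot (X u))"
     using True e by (intro C1(2) False sub t u) auto
    also have "\<dots> \<le> ennreal (C * \<bar>t - u\<bar> powr (\<alpha> * s)) * ?W"
    proof (rule mult_mono)
     have "C1 * dist (X t) (X u) powr s \<le> C1 * (H powr s * \<bar>t - u\<bar> powr (\<alpha> * s))" using C1 Hp by (intro mult_left_mono) auto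
     also have "\<dots> = (C1 * H powr s) * \<bar>t - u\<bar> powr (\<alpha> * s)" by simp
     also have "\<dots> \<le> C * \<bar>t - u\<bar> powr (\<alpha> * s)" unfolding C_def using A by (intro mult_right_mono) auto
     finally show "ennreal (C1 * dist (X t) (X u) powr s) \<le> ennreal (C * \<bar>t - u\<bar> powr (\<alpha> * s))" by (rule ennreal_leI)
     show "pot (X t) + pot (X u) \<le> ?W" by (intro add_mono) auto
    qed auto
    finally show ?thesis .
   next
    case far: False
    have "eabs (moll e \<phi> (X t) - moll e \<phi> (X u)) \<le> eabs (moll e \<phi> (X t)) + eabs (moll e \<phi> (X u))"
     by (simp add: ennreal_leI flip: ennreal_plus)
    also have "\<dots> \<le> ennreal A * (1 + pot (X t)) + ennreal A * (1 + pot (X u))"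
     using e t u by (intro add_mono size) auto
    also have "\<dots> = ennreal A * ?W" by (simp add: distrib_left)
    also have "\<dots> \<le> ennreal (C * \<bar>t - u\<bar> powr (\<alpha> * s)) * ?W"
    proof (intro mult_right_mono ennreal_leI)
     have "\<delta> powr s \<le> dist (X t) (X u) powr s" using far \<delta> s by (intro powr_mono2) auto
     also note Hp
     finally have "1 \<le> (H powr s * \<bar>t - u\<bar> powr (\<alpha> * s)) / \<delta> powr s" using \<delta> by simp
     also have "\<dots> = (H / \<delta>) powr s * \<bar>t - u\<bar> powr (\<alpha> * s)" using H \<delta> by (simp add: powr_divide)
     finally have "A * 1 \<le> A * ((H / \<delta>) powr s * \<bar>t - u\<bar> powr (\<alpha> * s))" using A by (intro mult_left_mono) auto
     also have "\<dots> = (A * (H / \<delta>) powr s) * \<bar>t - u\<bar> powr (\<alpha> * s)" by simp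
     also have "\<dots> \<le> C * \<bar>t - u\<bar> powr (\<alpha> * s)" unfolding C_def using A C1 by (intro mult_right_mono) auto
     finally show "A \<le> C * \<bar>t - u\<bar> powr (\<alpha> * s)" by simp
    qed simp
    finally show ?thesis .
   qed
  qed simp
 qed (use C \<delta> in auto)
qed

end

lemma nn_integral_power_kernel:
 fixes t T c :: real
 assumes t: "t \<in> {0<..<T}" and c: "c > -1"
 shows "(NBINT u. ennreal (ind {0<..<T} u * \<bar>t - u\<bar> powr c)) \<le> ennreal (2 * (T powr (c+1) / (c+1)))"
proof -
 have "(NBINT u. ennreal (ind {0<..<T} u * \<bar>t - u\<bar> powr c))
   \<le> (NBINT u. ennreal (ind {0<..<T} (t - u) * (t - u) powr c) + ennreal (ind {0<..<T} (-t + u) * (-t + u) powr c))"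
 proof (rule nn_integral_mono)
  fix u
  show "ennreal (ind {0<..<T} u * \<bar>t - u\<bar> powr c) \<le> ennreal (ind {0<..<T} (t - u) * (t - u) powr c) + ennreal (ind {0<..<T} (-t + u) * (-t + u) powr c)"
   using t by (cases "u < t"; cases "u = t") (auto split: split_indicator)
 qed
 also have "\<dots> = (NBINT u. ennreal (ind {0<..<T} (t - u) * (t - u) powr c)) + (NBINT u. ennreal (ind {0<..<T} (-t + u) * (-t + u) powr c))"
  by (rule nn_integral_add) measurable
 also have "(NBINT u. ennreal (ind {0<..<T} (t - u) * (t - u) powr c)) = (NBINT u. ennreal (ind {0<..<T} u * u powr c))"
  by (rule nn_integral_lborel_reflect[of "\<lambda>u. ennreal (ind {0<..<T} u * u powr c)"]) measurable
 also have "(NBINT u. ennreal (ind {0<..<T} (-t + u) * (-t + u) powr c)) = (NBINT u. ennreal (ind {0<..<T} u * u powr c))"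
  by (rule nn_integral_lborel_translate[of "\<lambda>u. ennreal (ind {0<..<T} u * u powr c)"]) measurable
 also have "(NBINT u. ennreal (ind {0<..<T} u * u powr c)) = ennreal (T powr (c+1) / (c+1))"
  using t by (intro powr_head_nn c) auto
 also have "ennreal (T powr (c+1) / (c+1)) + ennreal (T powr (c+1) / (c+1)) = ennreal (2 * (T powr (c+1) / (c+1)))"
  unfolding mult_2 using c by (intro ennreal_plus[symmetric]) auto
 finally show ?thesis .
qed

text \<open>Over the product space a single dominated convergence argument suffices.\<close>

lemma gagliardo_pair:
 assumes [measurable]: "f \<in> \<B>"
 shows "gagliardo b T f = (\<integral>\<^sup>+z. ennreal (ind {0<..<T} (fst z) * ind {0<..<T} (snd z) * (\<bar>f (fst z) - f (snd z)\<bar> / \<bar>fst z - snd z\<bar> powr (1 + b))) \<partial>(lborel \<Otimes>\<^sub>M lborel))"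
 unfolding gagliardo_def by (subst lborel.nn_integral_fst[symmetric]) auto

text \<open>In use W is 1 plus the potential along the path. The integrands are dominated by a
  multiple of |t - u| powr (\<gamma> - b - 1) times W t + W u, integrable because b < \<gamma>:
  integrating out one variable leaves the L1 norm of W. The limit inherits both bounds where W is
  finite; where W is infinite they hold trivially.\<close>

lemma gagliardo_convergence:
 fixes f :: "nat \<Rightarrow> real \<Rightarrow> real" and f0 :: "real \<Rightarrow> real" and W :: "real \<Rightarrow> ennreal"
 assumes b: "0 < b" "b < \<gamma>" and T: "T > 0" and C: "C > 0"
  and fm [measurable]: "\<And>m. f m \<in> \<B>" and f0m [measurable]: "f0 \<in> \<B>"
  and Wm [measurable]: "W \<in> \<B>"
  and inc: "\<And>m t u. t \<in> {0<..<T} \<Longrightarrow> u \<in> {0<..<T} \<Longrightarrow> eabs (f m t - f m u) \<le> ennreal (C * \<bar>t - u\<bar> powr \<gamma>) * (W t + W u)"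
  and size: "\<And>m t. t \<in> {0<..<T} \<Longrightarrow> eabs (f m t) \<le> ennreal C * W t"
  and Wfin: "(NBINT t. ind {0<..<T} t * W t) < \<infinity>"
  and conv: "\<And>t. t \<in> {0<..<T} \<Longrightarrow> W t < \<infinity> \<Longrightarrow> (\<lambda>m. f m t) \<longlonglongrightarrow> f0 t"
 shows "(NBINT t. ennreal (ind {0<..<T} t * \<bar>f0 t\<bar>)) < \<infinity>" and "gagliardo b T f0 < \<infinity>"
  and "(NBINT t. ennreal (ind {0<..<T} t * \<bar>f m t\<bar>)) < \<infinity>" and "gagliardo b T (f m) < \<infinity>"
  and "(\<lambda>m. NBINT t. ennreal (ind {0<..<T} t * \<bar>f m t - f0 t\<bar>)) \<longlonglongrightarrow> 0"
  and "(\<lambda>m. gagliardo b T (\<lambda>t. f m t - f0 t)) \<longlonglongrightarrow> 0"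
proof -
 have size0: "eabs (f0 t) \<le> ennreal C * W t" if t: "t \<in> {0<..<T}" for t
 proof (cases "W t < \<infinity>")
  case True
  show ?thesis
   by (rule LIMSEQ_le_const2[OF tendsto_ennrealI[OF tendsto_rabs[OF conv[OF t True]]]]) (use size[OF t] in blast)
 next
  case False
  then have "W t = top" by (metis infinity_ennreal_def top.not_eq_extremum)
  then show ?thesis using C by (simp add: ennreal_mult_top)
 qed
 have inc0: "eabs (f0 t - f0 u) \<le> ennreal (C * \<bar>t - u\<bar> powr \<gamma>) * (W t + W u)" if t: "t \<in> {0<..<T}" and u: "u \<in> {0<..<T}" for t u
 proof (cases "W t < \<infinity> \<and> W u < \<infinity>")
  case True
  then have "(\<lambda>m. eabs (f m t - f m u)) \<longlonglongrightarrow> eabs (f0 t - f0 u)"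
   by (intro tendsto_ennrealI tendsto_rabs tendsto_diff conv t u) auto
  then show ?thesis by (rule LIMSEQ_le_const2) (use inc[OF t u] in blast)
 next
  case False
  then have "W t = top \<or> W u = top" by (metis infinity_ennreal_def top.not_eq_extremum)
  then have "W t + W u = top" by auto
  \<comment> \<open>For t = u the left side vanishes; otherwise the right side is infinite.\<close>
  then show ?thesis using C by (cases "t = u") (auto simp: ennreal_mult_top)
 qed
 have "(NBINT t. ennreal C * (ind {0<..<T} t * W t)) = ennreal C * (NBINT t. ind {0<..<T} t * W t)"
  by (rule nn_integral_cmult) measurable
 then have Wfin': "(NBINT t. ennreal C * (ind {0<..<T} t * W t)) < \<infinity>" using Wfin by (simp add: ennreal_mult_less_top)
 have L1: "(NBINT t. ennreal (ind {0<..<T} t * \<bar>g t\<bar>)) < \<infinity>" if "\<And>t. t \<in> {0<..<T} \<Longrightarrow> eabs (g t) \<le> ennreal C * W t" for g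
 proof -
  have "(NBINT t. ennreal (ind {0<..<T} t * \<bar>g t\<bar>)) \<le> (NBINT t. ennreal C * (ind {0<..<T} t * W t))"
   using that by (intro nn_integral_mono) (auto split: split_indicator)
  then show ?thesis using Wfin' by (rule order_le_less_trans)
 qed
 show "(NBINT t. ennreal (ind {0<..<T} t * \<bar>f0 t\<bar>)) < \<infinity>" by (rule L1[OF size0])
 show "(NBINT t. ennreal (ind {0<..<T} t * \<bar>f m t\<bar>)) < \<infinity>" by (rule L1[OF size])
 have AEW: "AE t in lborel. ind {0<..<T} t * W t \<noteq> \<infinity>"
  by (rule nn_integral_PInf_AE) (use Wfin in auto)
 have "(\<lambda>m. NBINT t. ennreal (ind {0<..<T} t * \<bar>f m t - f0 t\<bar>)) \<longlonglongrightarrow> (\<integral>\<^sup>+t. 0 \<partial>(lborel :: real measure))"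
 proof (rule nn_integral_dominated_convergence[where w="\<lambda>t. 2 * (ennreal C * (ind {0<..<T} t * W t))"])
  have "(NBINT t. 2 * (ennreal C * (ind {0<..<T} t * W t))) = 2 * (NBINT t. ennreal C * (ind {0<..<T} t * W t))"
   by (rule nn_integral_cmult) measurable
  then show "(NBINT t. 2 * (ennreal C * (ind {0<..<T} t * W t))) < \<infinity>" using Wfin' by (simp add: ennreal_mult_less_top)
  show "AE t in lborel. ennreal (ind {0<..<T} t * \<bar>f m t - f0 t\<bar>) \<le> 2 * (ennreal C * (ind {0<..<T} t * W t))" for m
  proof (rule AE_I2)
   fix t
   show "ennreal (ind {0<..<T} t * \<bar>f m t - f0 t\<bar>) \<le> 2 * (ennreal C * (ind {0<..<T} t * W t))"
   proof (cases "t \<in> {0<..<T}")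
    case True
    have "eabs (f m t - f0 t) \<le> eabs (f m t) + eabs (f0 t)" by (simp add: ennreal_leI flip: ennreal_plus)
    also have "\<dots> \<le> ennreal C * W t + ennreal C * W t" by (intro add_mono size size0 True)
    finally show ?thesis using True by (simp add: mult_2)
   qed simp
  qed
  show "AE t in lborel. (\<lambda>m. ennreal (ind {0<..<T} t * \<bar>f m t - f0 t\<bar>)) \<longlonglongrightarrow> 0"
   using AEW
  proof eventually_elim
   case (elim t)
   show ?case
   proof (cases "t \<in> {0<..<T}")
    case True
    then have "W t < \<infinity>" using elim by (simp add: less_top)
    from conv[OF True this] have "(\<lambda>m. \<bar>f m t - f0 t\<bar>) \<longlonglongrightarrow> 0" by (simp add: LIM_zero tendsto_rabs_zero)
    from tendsto_ennrealI[OF this] show ?thesis using True by simp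
   qed simp
  qed
 qed measurable
 then show "(\<lambda>m. NBINT t. ennreal (ind {0<..<T} t * \<bar>f m t - f0 t\<bar>)) \<longlonglongrightarrow> 0" by simp
 define c where "c = \<gamma> - b - 1"
 have c: "c > -1" using b by (simp add: c_def)
 define a where "a t u = ennreal (ind {0<..<T} t * ind {0<..<T} u * (2 * C * \<bar>t - u\<bar> powr c))" for t u :: real
 have am [measurable]: "(\<lambda>(t, u). a t u) \<in> borel_measurable (borel \<Otimes>\<^sub>M borel)" unfolding a_def by measurable
 define J where "J = 2 * C * (2 * (T powr (c+1) / (c+1)))"
 have aJ: "(NBINT u. a t u) \<le> ennreal J * ind {0<..<T} t" for t
 proof (cases "t \<in> {0<..<T}")
  case True
  have "(NBINT u. a t u) = (NBINT u. ennreal (2 * C) * ennreal (ind {0<..<T} u * \<bar>t - u\<bar> powr c))"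
   using True C by (intro nn_integral_cong) (auto simp: a_def mult_ac simp flip: ennreal_mult)
  also have "\<dots> = ennreal (2 * C) * (NBINT u. ennreal (ind {0<..<T} u * \<bar>t - u\<bar> powr c))" by (rule nn_integral_cmult) measurable
  also have "\<dots> \<le> ennreal (2 * C) * ennreal (2 * (T powr (c+1) / (c+1)))" by (intro mult_left_mono nn_integral_power_kernel True c) simp
  also have "\<dots> = ennreal J" unfolding J_def using C c by (intro ennreal_mult[symmetric]) auto
  finally show ?thesis using True by simp
 qed (simp add: a_def)
 have asym: "a t u = a u t" for t u unfolding a_def by (simp add: abs_minus_commute mult_ac)
 define K where "K z = a (fst z) (snd z) * (W (fst z) + W (snd z))" for z
 have Km [measurable]: "K \<in> borel_measurable (lborel \<Otimes>\<^sub>M lborel)" unfolding K_def by measurable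
 have Kfin: "(\<integral>\<^sup>+z. K z \<partial>(lborel \<Otimes>\<^sub>M lborel)) < \<infinity>"
 proof -
  have half: "(NBINT t. NBINT u. a t u * W t) \<le> ennreal J * (NBINT t. ind {0<..<T} t * W t)"
  proof -
   have "(NBINT t. NBINT u. a t u * W t) = (NBINT t. (NBINT u. a t u) * W t)"
    by (intro nn_integral_cong nn_integral_multc) measurable
   also have "\<dots> \<le> (NBINT t. ennreal J * (ind {0<..<T} t * W t))"
   proof (rule nn_integral_mono)
    fix t
    show "(NBINT u. a t u) * W t \<le> ennreal J * (ind {0<..<T} t * W t)"
     using mult_right_mono[OF aJ[of t], of "W t"] by (simp add: mult.assoc)
   qed
   also have "\<dots> = ennreal J * (NBINT t. ind {0<..<T} t * W t)" by (rule nn_integral_cmult) measurable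
   finally show ?thesis .
  qed
  have "(\<integral>\<^sup>+z. K z \<partial>(lborel \<Otimes>\<^sub>M lborel)) = (NBINT t. NBINT u. a t u * W t + a t u * W u)"
   by (subst lborel.nn_integral_fst[symmetric]) (auto simp: K_def distrib_left)
  also have "\<dots> = (NBINT t. NBINT u. a t u * W t) + (NBINT t. NBINT u. a t u * W u)"
   by (simp add: nn_integral_add)
  also have "(NBINT t. NBINT u. a t u * W u) = (NBINT u. NBINT t. a t u * W u)"
   by (intro lborel_pair.Fubini') measurable
  \<comment> \<open>By symmetry of the kernel, renaming the variables turns this half into the first
    one.\<close>
  also have "\<dots> = (NBINT t. NBINT u. a t u * W t)" by (simp add: asym)
  also have "(NBINT t. NBINT u. a t u * W t) + (NBINT t. NBINT u. a t u * W t)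
   \<le> ennreal J * (NBINT t. ind {0<..<T} t * W t) + ennreal J * (NBINT t. ind {0<..<T} t * W t)"
   by (intro add_mono half)
  also have "\<dots> < \<infinity>" using Wfin by (simp add: ennreal_mult_less_top)
  finally show ?thesis .
 qed
 have ptw: "ennreal (ind {0<..<T} t * ind {0<..<T} u * (\<bar>x\<bar> / \<bar>t - u\<bar> powr (1 + b))) \<le> K (t, u)"
  if le: "t \<in> {0<..<T} \<Longrightarrow> u \<in> {0<..<T} \<Longrightarrow> eabs x \<le> ennreal (2 * C * \<bar>t - u\<bar> powr \<gamma>) * (W t + W u)" for x t u
 proof (cases "t \<in> {0<..<T} \<and> u \<in> {0<..<T} \<and> t \<noteq> u")
  case True
  then have tu: "\<bar>t - u\<bar> > 0" by auto
  have "ennreal (\<bar>x\<bar> / \<bar>t - u\<bar> powr (1 + b)) = ennreal (1 / \<bar>t - u\<bar> powr (1 + b)) * eabs x"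
   by (subst ennreal_mult[symmetric]) auto
  also have "\<dots> \<le> ennreal (1 / \<bar>t - u\<bar> powr (1 + b)) * (ennreal (2 * C * \<bar>t - u\<bar> powr \<gamma>) * (W t + W u))"
   using True by (intro mult_left_mono le) auto
  also have "\<dots> = ennreal (1 / \<bar>t - u\<bar> powr (1 + b) * (2 * C * \<bar>t - u\<bar> powr \<gamma>)) * (W t + W u)"
   using C by (intro ennreal_mult_assoc) auto
  also have "1 / \<bar>t - u\<bar> powr (1 + b) * (2 * C * \<bar>t - u\<bar> powr \<gamma>) = 2 * C * \<bar>t - u\<bar> powr c"
  proof -
   have "c = \<gamma> - (1 + b)" by (simp add: c_def)
   then show ?thesis using tu by (simp add: powr_diff)
  qed
  finally show ?thesis using True unfolding K_def a_def by simp
 qed (auto simp: K_def a_def split: split_indicator)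
 have C2: "ennreal (C * \<bar>t - u\<bar> powr \<gamma>) * (W t + W u) \<le> ennreal (2 * C * \<bar>t - u\<bar> powr \<gamma>) * (W t + W u)" for t u
  using C by (intro mult_right_mono ennreal_leI) auto
 have gag: "gagliardo b T g < \<infinity>" if [measurable]: "g \<in> \<B>"
  and g: "\<And>t u. t \<in> {0<..<T} \<Longrightarrow> u \<in> {0<..<T} \<Longrightarrow> eabs (g t - g u) \<le> ennreal (C * \<bar>t - u\<bar> powr \<gamma>) * (W t + W u)" for g
 proof -
  have "gagliardo b T g \<le> (\<integral>\<^sup>+z. K z \<partial>(lborel \<Otimes>\<^sub>M lborel))"
   unfolding gagliardo_pair[OF that(1)]
  proof (rule nn_integral_mono)
   fix z :: "real \<times> real"
   show "ennreal (ind {0<..<T} (fst z) * ind {0<..<T} (snd z) * (\<bar>g (fst z) - g (snd z)\<bar> / \<bar>fst z - snd z\<bar> powr (1 + b))) \<le> K z"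
    using ptw[OF order_trans[OF g C2], of "fst z" "snd z"] by simp
  qed
  then show ?thesis using Kfin by (rule order_le_less_trans)
 qed
 show "gagliardo b T f0 < \<infinity>" by (rule gag[OF f0m inc0])
 show "gagliardo b T (f m) < \<infinity>" by (rule gag[OF fm inc])
 have "(\<lambda>m. gagliardo b T (\<lambda>t. f m t - f0 t)) \<longlonglongrightarrow> (\<integral>\<^sup>+z. 0 \<partial>(lborel \<Otimes>\<^sub>M lborel :: (real \<times> real) measure))"
  unfolding gagliardo_pair[OF borel_measurable_diff[OF fm f0m]]
 proof (rule nn_integral_dominated_convergence[where w=K])
  show "AE z in lborel \<Otimes>\<^sub>M lborel. ennreal (ind {0<..<T} (fst z) * ind {0<..<T} (snd z) * (\<bar>(f m (fst z) - f0 (fst z)) - (f m (snd z) - f0 (snd z))\<bar> / \<bar>fst z - snd z\<bar> powr (1 + b))) \<le> K z" for m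
  proof (rule AE_I2)
   fix z :: "real \<times> real"
   have "eabs ((f m t - f0 t) - (f m u - f0 u)) \<le> ennreal (2 * C * \<bar>t - u\<bar> powr \<gamma>) * (W t + W u)" if "t \<in> {0<..<T}" "u \<in> {0<..<T}" for t u
   proof -
    have "eabs ((f m t - f0 t) - (f m u - f0 u)) \<le> eabs (f m t - f m u) + eabs (f0 t - f0 u)"
     by (simp add: ennreal_leI flip: ennreal_plus)
    also have "\<dots> \<le> ennreal (C * \<bar>t - u\<bar> powr \<gamma>) * (W t + W u) + ennreal (C * \<bar>t - u\<bar> powr \<gamma>) * (W t + W u)"
     by (intro add_mono inc inc0 that)
    also have "\<dots> = ennreal (2 * C * \<bar>t - u\<bar> powr \<gamma>) * (W t + W u)"
     using C by (simp add: distrib_right[symmetric] flip: ennreal_plus)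
    finally show ?thesis .
   qed
   from ptw[OF this, of "fst z" "snd z"]
   show "ennreal (ind {0<..<T} (fst z) * ind {0<..<T} (snd z) * (\<bar>(f m (fst z) - f0 (fst z)) - (f m (snd z) - f0 (snd z))\<bar> / \<bar>fst z - snd z\<bar> powr (1 + b))) \<le> K z" by simp
  qed
  have AE2: "AE z in lborel \<Otimes>\<^sub>M lborel. ind {0<..<T} (fst z) * W (fst z) \<noteq> \<infinity> \<and> ind {0<..<T} (snd z) * W (snd z) \<noteq> \<infinity>"
  proof (rule lborel_pair.AE_pair_measure)
   show "AE x in lborel. AE y in lborel. ind {0<..<T} (fst (x, y)) * W (fst (x, y)) \<noteq> \<infinity> \<and> ind {0<..<T} (snd (x, y)) * W (snd (x, y)) \<noteq> \<infinity>"
    using AEW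
   proof eventually_elim
    case (elim x)
    show ?case using AEW by eventually_elim (use elim in simp)
   qed
  qed measurable
  show "AE z in lborel \<Otimes>\<^sub>M lborel. (\<lambda>m. ennreal (ind {0<..<T} (fst z) * ind {0<..<T} (snd z) * (\<bar>(f m (fst z) - f0 (fst z)) - (f m (snd z) - f0 (snd z))\<bar> / \<bar>fst z - snd z\<bar> powr (1 + b)))) \<longlonglongrightarrow> 0"
   using AE2
  proof eventually_elim
   case (elim z)
   obtain t u where z: "z = (t, u)" by (cases z)
   show ?case
   proof (cases "t \<in> {0<..<T} \<and> u \<in> {0<..<T}")
    case True
    then have "W t < \<infinity>" "W u < \<infinity>" using elim by (auto simp: z less_top)
    then have "(\<lambda>m. (f m t - f0 t) - (f m u - f0 u)) \<longlonglongrightarrow> (f0 t - f0 t) - (f0 u - f0 u)"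
     using True by (intro tendsto_intros conv) auto
    then have "(\<lambda>m. \<bar>(f m t - f0 t) - (f m u - f0 u)\<bar> * (1 / \<bar>t - u\<bar> powr (1 + b))) \<longlonglongrightarrow> 0 * (1 / \<bar>t - u\<bar> powr (1 + b))"
     by (intro tendsto_mult tendsto_const tendsto_rabs_zero) simp
    from tendsto_ennrealI[OF this] show ?thesis using True by (simp add: z)
   qed (auto simp: z)
  qed
 qed (use Kfin in auto)
 then show "(\<lambda>m. gagliardo b T (\<lambda>t. f m t - f0 t)) \<longlonglongrightarrow> 0" by simp
qed

section \<open>The chain rule for smooth functions\<close>

text \<open>A Hoelder function varies by at most H e powr \<alpha> over a window of length e. The
  averaged path is that close up to a factor, while the bound on its rate grows like e powr
  (\<alpha> - 1); the product of the two decides \<open>chain_rule_limit\<close>.\<close>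

lemma double_steklov_holder:
 assumes hc: "continuous_on UNIV h" and H: "H > 0" and \<alpha>: "\<alpha> > 0" and e: "e > 0"
  and h: "\<And>t u. \<bar>h t - h u\<bar> \<le> H * \<bar>t - u\<bar> powr \<alpha>"
 shows "\<bar>steklov e (steklov e h) t - h t\<bar> \<le> 2 * (H * e powr \<alpha>)"
  and "\<bar>steklov_rate e h t\<bar> \<le> 3 * (H * e powr \<alpha>) / e"
proof -
 have hm [measurable]: "h \<in> \<B>" using hc by (rule borel_measurable_continuous_onI)
 have near: "\<bar>h (v + r) - h v\<bar> \<le> H * e powr \<alpha>" if "0 \<le> r" "r \<le> e" for v r
 proof -
  have "\<bar>h (v + r) - h v\<bar> \<le> H * \<bar>r\<bar> powr \<alpha>" using h[of "v + r" v] by simp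
  also have "\<dots> \<le> H * e powr \<alpha>" using that H \<alpha> by (intro mult_left_mono powr_mono2) auto
  finally show ?thesis .
 qed
 have one: "\<bar>steklov e h v - h v\<bar> \<le> H * e powr \<alpha>" for v
  by (rule steklov_dist_le[OF hm e]) (use near in auto)
 show "\<bar>steklov e (steklov e h) t - h t\<bar> \<le> 2 * (H * e powr \<alpha>)"
 proof (rule steklov_dist_le[OF steklov_borel[OF hm] e])
  fix r assume "r \<in> {0<..<e}"
  then show "\<bar>steklov e h (t + r) - h t\<bar> \<le> 2 * (H * e powr \<alpha>)" using one[of "t + r"] near[of r t] by auto
 qed
 have "\<bar>steklov e h (t + e) - steklov e h t\<bar> \<le> 3 * (H * e powr \<alpha>)"
  using one[of "t + e"] near[of e t] one[of t] e by auto
 then show "\<bar>steklov_rate e h t\<bar> \<le> 3 * (H * e powr \<alpha>) / e"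
  unfolding steklov_rate_def abs_divide using e by (simp add: divide_right_mono)
qed

lemma steklov_rate_continuous:
 assumes "continuous_on UNIV h" "e > 0"
 shows "continuous_on UNIV (steklov_rate e h)"
proof -
 note c = steklov_continuous[OF assms]
 have "continuous_on UNIV (\<lambda>t. steklov e h (t + e))"
  by (rule continuous_on_compose2[OF c]) (auto intro: continuous_intros)
 then show ?thesis unfolding steklov_rate_def using c assms(2) by (intro continuous_intros) auto
qed

lemma steklov_chain_rule:
 fixes \<Phi> :: "real^'n \<Rightarrow> real" and g :: "'n \<Rightarrow> real^'n \<Rightarrow> real" and x :: "'n \<Rightarrow> real \<Rightarrow> real"
 assumes D: "\<And>z. (\<Phi> has_derivative \<Phi>' z) (at z)" and g: "\<And>z k. \<Phi>' z (axis k 1) = g k z"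
  and gc: "\<And>k. continuous_on UNIV (g k)" and xc: "\<And>k. continuous_on UNIV (x k)" and e: "e > 0" and t: "0 \<le> t"
 defines "Y \<equiv> \<lambda>u. (\<chi> k. steklov e (steklov e (x k)) u)"
 shows "continuous_on UNIV Y"
  and "(LBINT u. ind {0..t} u * (\<Sum>k\<in>UNIV. g k (Y u) * steklov_rate e (x k) u)) = \<Phi> (Y t) - \<Phi> (Y 0)"
proof -
 show Yc: "continuous_on UNIV Y" unfolding Y_def
  by (intro continuous_on_vec_lambda steklov_continuous xc e)
 have Y: "Y = (\<lambda>u. \<Sum>k\<in>UNIV. steklov e (steklov e (x k)) u *\<^sub>R axis k 1)"
  unfolding Y_def using basis_expansion[of "\<chi> k. steklov e (steklov e (x k)) _"] by (simp add: scalar_mult_eq_scaleR)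
 have dY: "(Y has_vector_derivative (\<Sum>k\<in>UNIV. steklov_rate e (x k) u *\<^sub>R axis k 1)) (at u)" for u
  unfolding Y
 proof (rule has_vector_derivative_sum)
  fix k :: 'n
  show "((\<lambda>u. steklov e (steklov e (x k)) u *\<^sub>R (axis k 1 :: real^'n)) has_vector_derivative steklov_rate e (x k) u *\<^sub>R axis k 1) (at u)"
   using has_vector_derivative_scaleR[OF steklov_rate_deriv[OF xc e, of k u] has_vector_derivative_const[of "axis k 1 :: real^'n"]] by simp
 qed
 have dF: "((\<lambda>u. \<Phi> (Y u)) has_vector_derivative (\<Sum>k\<in>UNIV. g k (Y u) * steklov_rate e (x k) u)) (at u)" for u
 proof -
  have lin: "linear (\<Phi>' (Y u))" using D by (rule has_derivative_linear)
  have "\<Phi>' (Y u) (\<Sum>k\<in>UNIV. steklov_rate e (x k) u *\<^sub>R axis k 1) = (\<Sum>k\<in>UNIV. g k (Y u) * steklov_rate e (x k) u)"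
   by (simp add: linear_sum[OF lin] linear_cmul[OF lin] g mult.commute)
  with vector_derivative_diff_chain_within[OF dY, of \<Phi> "\<Phi>' (Y u)" u] has_derivative_at_withinI[OF D]
  show ?thesis by (simp add: o_def)
 qed
 have gY: "continuous_on UNIV (\<lambda>u. g k (Y u))" for k
  by (rule continuous_on_compose2[OF gc Yc]) auto
 have "(LBINT u. ind {0..t} u *\<^sub>R (\<Sum>k\<in>UNIV. g k (Y u) * steklov_rate e (x k) u)) = \<Phi> (Y t) - \<Phi> (Y 0)"
 proof (rule integral_FTC_atLeastAtMost[OF t])
  show "continuous_on {0..t} (\<lambda>u. \<Sum>k\<in>UNIV. g k (Y u) * steklov_rate e (x k) u)"
   by (intro continuous_on_sum continuous_on_mult continuous_on_subset[OF gY] continuous_on_subset[OF steklov_rate_continuous[OF xc e]]) auto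
 qed (auto intro: has_vector_derivative_at_within dF)
 then show "(LBINT u. ind {0..t} u * (\<Sum>k\<in>UNIV. g k (Y u) * steklov_rate e (x k) u)) = \<Phi> (Y t) - \<Phi> (Y 0)" by simp
qed

lemma integral_Icc_Ioo:
 fixes f :: "real \<Rightarrow> real"
 shows "(LBINT u. ind {a..b} u * f u) = (LBINT u. ind {a<..<b} u * f u)"
 by (rule integral_discrete_difference[of "{a, b}"]) (auto split: split_indicator)

lemma powr_tendsto_0_at_right:
 fixes a :: real
 assumes "a > 0"
 shows "((\<lambda>e. e powr a) \<longlongrightarrow> 0) (at_right 0)"
proof -
 have "eventually (\<lambda>e::real. 0 \<le> e) (at_right 0)" using eventually_at_right_less[of "0::real"] by eventually_elim simp
 then have "((\<lambda>e::real. e powr a) \<longlongrightarrow> 0 powr a) (at_right 0)"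
  using assms by (intro tendsto_powr' tendsto_ident_at tendsto_const disjI2 conjI)
 then show ?thesis by simp
qed

lemma continuous_integrable_Ioo:
 fixes f :: "real \<Rightarrow> real"
 assumes "continuous_on UNIV f"
 shows "integrable lborel (\<lambda>u. ind {a<..<b} u * f u)"
proof -
 have "set_integrable lborel {a..b} f" using assms by (intro borel_integrable_atLeastAtMost') (auto intro: continuous_on_subset)
 then have "set_integrable lborel {a<..<b} f" by (rule set_integrable_subset) auto
 then show ?thesis by (simp add: set_integrable_def)
qed

text \<open>Along the averaged path the chain rule is the fundamental theorem of calculus. Putting
  the original path into g k costs a Lipschitz error of order e powr \<alpha> times a rate of order
  e powr (\<alpha> - 1); the total e powr (2 \<alpha> - 1) tends to 0 because \<alpha> >
  1/2.\<close>

lemma chain_rule_limit: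
 fixes \<Phi> :: "real^'n \<Rightarrow> real" and g :: "'n \<Rightarrow> real^'n \<Rightarrow> real" and X :: "real \<Rightarrow> real^'n"
 assumes D: "\<And>z. (\<Phi> has_derivative \<Phi>' z) (at z)" and g: "\<And>z k. \<Phi>' z (axis k 1) = g k z"
  and gc: "\<And>k. continuous_on UNIV (g k)"
  and gL: "\<And>k R. \<exists>L\<ge>0. \<forall>z\<in>ball 0 R. \<forall>z'. norm (z - z') \<le> 1 \<longrightarrow> \<bar>g k z - g k z'\<bar> \<le> L * norm (z - z')"
  and H: "H > 0" and \<alpha>: "\<alpha> > 1/2" and X: "\<And>t u. dist (X t) (X u) \<le> H * \<bar>t - u\<bar> powr \<alpha>"
  and R: "\<And>t. norm (X t) < R" and t: "0 \<le> t"
 shows "((\<lambda>e. \<Sum>k\<in>UNIV. LBINT u. ind {0<..<t} u * (g k (X u) * steklov_rate e (\<lambda>u. X u $ k) u))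
  \<longlongrightarrow> \<Phi> (X t) - \<Phi> (X 0)) (at_right 0)"
proof -
 have Xc: "continuous_on UNIV X" by (rule holder_continuous_on[OF H _ X]) (use \<alpha> in auto)
 have xc: "continuous_on UNIV (\<lambda>u. X u $ k)" for k by (intro continuous_intros Xc)
 have xh: "\<bar>X a $ k - X b $ k\<bar> \<le> H * \<bar>a - b\<bar> powr \<alpha>" for a b k
  using component_le_norm_cart[of "X a - X b" k] X[of a b] by (simp add: dist_norm)
 have "\<forall>k. \<exists>L. L \<ge> 0 \<and> (\<forall>z\<in>ball 0 R. \<forall>z'. norm (z - z') \<le> 1 \<longrightarrow> \<bar>g k z - g k z'\<bar> \<le> L * norm (z - z'))"
  using gL by blast
 from choice[OF this] obtain L where L': "\<forall>k. L k \<ge> 0 \<and> (\<forall>z\<in>ball 0 R. \<forall>z'. norm (z - z') \<le> 1 \<longrightarrow> \<bar>g k z - g k z'\<bar> \<le> L k * norm (z - z'))"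
  by (elim exE) (rule that)
 note L = L'[THEN spec, THEN conjunct1] L'[THEN spec, THEN conjunct2, rule_format]
 define Y where "Y e u = (\<chi> k. steklov e (steklov e (\<lambda>u. X u $ k)) u)" for e u
 let ?n = "real CARD('n)"
 define d where "d e = ?n * (2 * (H * e powr \<alpha>))" for e
 have YX: "norm (Y e u - X u) \<le> d e" if "e > 0" for e u
 proof -
  have "norm (Y e u - X u) \<le> (\<Sum>k\<in>UNIV. \<bar>(Y e u - X u) $ k\<bar>)" by (rule norm_le_l1_cart)
  also have "\<dots> \<le> (\<Sum>k\<in>(UNIV::'n set). 2 * (H * e powr \<alpha>))"
   unfolding Y_def using \<alpha> by (intro sum_mono) (simp add: double_steklov_holder(1)[OF xc H _ that xh])
  finally show ?thesis by (simp add: d_def)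
 qed
 have d0: "(d \<longlongrightarrow> 0) (at_right 0)"
  unfolding d_def[abs_def] using \<alpha> by (intro tendsto_mult_right_zero powr_tendsto_0_at_right) simp
 have Ylim: "((\<lambda>e. \<Phi> (Y e u)) \<longlongrightarrow> \<Phi> (X u)) (at_right 0)" for u
 proof (rule isCont_tendsto_compose[OF has_derivative_continuous[OF D]])
  have "((\<lambda>e. Y e u - X u) \<longlongrightarrow> 0) (at_right 0)"
   by (rule Lim_null_comparison[OF _ d0]) (use YX in \<open>auto simp: eventually_at_filter\<close>)
  then show "((\<lambda>e. Y e u) \<longlongrightarrow> X u) (at_right 0)" by (rule LIM_zero_cancel)
 qed
 define S where "S e = (\<Sum>k\<in>UNIV. LBINT u. ind {0<..<t} u * (g k (X u) * steklov_rate e (\<lambda>u. X u $ k) u))" for e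
 \<comment> \<open>2 n H from the distance of the two paths and 3 H from the rate give 6 n H^2; t is
   the length of the interval.\<close>
 define A where "A = (\<Sum>k\<in>UNIV. L k) * (6 * ?n * H\<^sup>2) * t"
 \<comment> \<open>The Lipschitz bound of g k holds within distance 1 only, hence the condition on
   \<open>d e\<close>.\<close>
 have err: "\<bar>S e - (\<Phi> (Y e t) - \<Phi> (Y e 0))\<bar> \<le> A * e powr (2 * \<alpha> - 1)" if e: "e > 0" "d e < 1" for e
 proof (cases "t = 0")
  case False
  then have t: "t > 0" using t by simp
  have Yc: "continuous_on UNIV (Y e)" unfolding Y_def by (rule steklov_chain_rule(1)[OF D g gc xc e(1) order_refl])
  have gY: "continuous_on UNIV (\<lambda>u. g k (Y e u))" "continuous_on UNIV (\<lambda>u. g k (X u))" for k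
   by (auto intro!: continuous_on_compose2[OF gc Yc] continuous_on_compose2[OF gc Xc])
  note rc = steklov_rate_continuous[OF xc e(1)]
  have "\<Phi> (Y e t) - \<Phi> (Y e 0) = (LBINT u. ind {0..t} u * (\<Sum>k\<in>UNIV. g k (Y e u) * steklov_rate e (\<lambda>u. X u $ k) u))"
   unfolding Y_def by (rule steklov_chain_rule(2)[OF D g gc xc e(1) less_imp_le[OF t], symmetric])
  also have "\<dots> = (LBINT u. (\<Sum>k\<in>UNIV. ind {0<..<t} u * (g k (Y e u) * steklov_rate e (\<lambda>u. X u $ k) u)))"
   by (simp only: integral_Icc_Ioo sum_distrib_left[symmetric])
  also have "\<dots> = (\<Sum>k\<in>UNIV. LBINT u. ind {0<..<t} u * (g k (Y e u) * steklov_rate e (\<lambda>u. X u $ k) u))"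
   by (intro Bochner_Integration.integral_sum continuous_integrable_Ioo continuous_on_mult gY rc)
  finally have eq: "S e - (\<Phi> (Y e t) - \<Phi> (Y e 0)) = (\<Sum>k\<in>UNIV. (LBINT u. ind {0<..<t} u * (g k (X u) * steklov_rate e (\<lambda>u. X u $ k) u))
    - (LBINT u. ind {0<..<t} u * (g k (Y e u) * steklov_rate e (\<lambda>u. X u $ k) u)))"
   by (simp add: S_def sum_subtractf)
  have "\<bar>S e - (\<Phi> (Y e t) - \<Phi> (Y e 0))\<bar> \<le> (\<Sum>k\<in>UNIV. (L k * (6 * ?n * H\<^sup>2) * e powr (2 * \<alpha> - 1)) * t)"
   unfolding eq
  proof (rule order_trans[OF sum_abs sum_mono])
   fix k
   have "(LBINT u. ind {0<..<t} u * (g k (X u) * steklov_rate e (\<lambda>u. X u $ k) u))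
     - (LBINT u. ind {0<..<t} u * (g k (Y e u) * steklov_rate e (\<lambda>u. X u $ k) u))
    = (LBINT u. ind {0<..<t} u * (g k (X u) * steklov_rate e (\<lambda>u. X u $ k) u) - ind {0<..<t} u * (g k (Y e u) * steklov_rate e (\<lambda>u. X u $ k) u))"
    by (intro Bochner_Integration.integral_diff[symmetric] continuous_integrable_Ioo continuous_on_mult gY rc)
   also have "\<dots> = (LBINT u. ind {0<..<t} u * ((g k (X u) - g k (Y e u)) * steklov_rate e (\<lambda>u. X u $ k) u))"
    by (simp add: algebra_simps)
   finally have eq': "(LBINT u. ind {0<..<t} u * (g k (X u) * steklov_rate e (\<lambda>u. X u $ k) u))
     - (LBINT u. ind {0<..<t} u * (g k (Y e u) * steklov_rate e (\<lambda>u. X u $ k) u))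
     = (LBINT u. ind {0<..<t} u * ((g k (X u) - g k (Y e u)) * steklov_rate e (\<lambda>u. X u $ k) u))" .
   have "\<bar>LBINT u. ind {0<..<t} u * ((g k (X u) - g k (Y e u)) * steklov_rate e (\<lambda>u. X u $ k) u)\<bar> \<le> (L k * (6 * ?n * H\<^sup>2) * e powr (2 * \<alpha> - 1)) * t"
   proof (rule integral_interval_bound[OF t])
    fix u
    have "\<bar>g k (X u) - g k (Y e u)\<bar> \<le> L k * norm (X u - Y e u)"
     using R YX[OF e(1), of u] e(2) by (intro L(2)) (auto simp: norm_minus_commute)
    also have "\<dots> \<le> L k * d e" using YX[OF e(1), of u] by (intro mult_left_mono L(1)) (simp add: norm_minus_commute)
    finally have "\<bar>g k (X u) - g k (Y e u)\<bar> * \<bar>steklov_rate e (\<lambda>u. X u $ k) u\<bar> \<le> (L k * d e) * (3 * (H * e powr \<alpha>) / e)"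
     using L(1)[of k] H \<alpha> by (intro mult_mono double_steklov_holder(2)[OF xc H _ e(1) xh]) (auto simp: d_def)
    also have "\<dots> = L k * (6 * ?n * H\<^sup>2) * (e powr \<alpha> * e powr \<alpha> / e)" by (simp add: d_def power2_eq_square)
    also have "e powr \<alpha> * e powr \<alpha> / e = e powr (2 * \<alpha> - 1)"
     using e by (simp add: powr_diff flip: powr_add)
    finally show "\<bar>(g k (X u) - g k (Y e u)) * steklov_rate e (\<lambda>u. X u $ k) u\<bar> \<le> L k * (6 * ?n * H\<^sup>2) * e powr (2 * \<alpha> - 1)"
     by (simp add: abs_mult)
   qed (use L(1)[of k] in simp)
   then show "\<bar>(LBINT u. ind {0<..<t} u * (g k (X u) * steklov_rate e (\<lambda>u. X u $ k) u))
     - (LBINT u. ind {0<..<t} u * (g k (Y e u) * steklov_rate e (\<lambda>u. X u $ k) u))\<bar> \<le> (L k * (6 * ?n * H\<^sup>2) * e powr (2 * \<alpha> - 1)) * t" unfolding eq' .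
  qed
  also have "\<dots> = A * e powr (2 * \<alpha> - 1)" unfolding A_def sum_distrib_right by (intro sum.cong refl) (simp only: mult_ac)
  finally show ?thesis .
 qed (simp add: S_def A_def)
 have "((\<lambda>e. S e - (\<Phi> (Y e t) - \<Phi> (Y e 0))) \<longlongrightarrow> 0) (at_right 0)"
 proof (rule Lim_null_comparison)
  have "eventually (\<lambda>e. d e < 1) (at_right 0)" using d0 by (rule order_tendstoD) simp
  moreover have "eventually (\<lambda>e::real. e > 0) (at_right 0)" by (simp add: eventually_at_filter)
  ultimately show "eventually (\<lambda>e. norm (S e - (\<Phi> (Y e t) - \<Phi> (Y e 0))) \<le> A * e powr (2 * \<alpha> - 1)) (at_right 0)"
   by eventually_elim (use err in simp)
  show "((\<lambda>e. A * e powr (2 * \<alpha> - 1)) \<longlongrightarrow> 0) (at_right (0::real))"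
   using \<alpha> by (intro tendsto_mult_right_zero powr_tendsto_0_at_right) simp
 qed
 from tendsto_add[OF this tendsto_diff[OF Ylim[of t] Ylim[of 0]]]
 show ?thesis unfolding S_def by simp
qed

section \<open>Passage to the limit\<close>

lemma borel_measurable_lebesgue_on_cong:
 assumes "\<And>t. t \<in> S \<Longrightarrow> f t = f' t"
 shows "f \<in> borel_measurable (lebesgue_on S) \<longleftrightarrow> f' \<in> borel_measurable (lebesgue_on S)"
 by (rule measurable_cong) (simp add: assms)

lemma W0_1_cong:
 assumes f: "\<And>t. t \<in> {0<..<T} \<Longrightarrow> f t = f' t"
 shows "f \<in> W0_1 b T \<longleftrightarrow> f' \<in> W0_1 b T"
proof -
 have 1: "(\<integral>\<^sup>+ t\<in>{0<..<T}. ennreal (\<bar>f t\<bar> / t powr b) \<partial>lebesgue) = (\<integral>\<^sup>+ t\<in>{0<..<T}. ennreal (\<bar>f' t\<bar> / t powr b) \<partial>lebesgue)"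
  by (intro nn_integral_cong) (auto simp: f split: split_indicator)
 have 2: "(\<integral>\<^sup>+ t\<in>{0<..<T}. (\<integral>\<^sup>+ u\<in>{0<..<T}. ennreal (\<bar>f t - f u\<bar> / \<bar>t - u\<bar> powr (1 + b)) \<partial>lebesgue) \<partial>lebesgue)
  = (\<integral>\<^sup>+ t\<in>{0<..<T}. (\<integral>\<^sup>+ u\<in>{0<..<T}. ennreal (\<bar>f' t - f' u\<bar> / \<bar>t - u\<bar> powr (1 + b)) \<partial>lebesgue) \<partial>lebesgue)"
 proof (rule nn_integral_cong)
  fix t
  show "(\<integral>\<^sup>+ u\<in>{0<..<T}. ennreal (\<bar>f t - f u\<bar> / \<bar>t - u\<bar> powr (1 + b)) \<partial>lebesgue) * ind {0<..<T} t
   = (\<integral>\<^sup>+ u\<in>{0<..<T}. ennreal (\<bar>f' t - f' u\<bar> / \<bar>t - u\<bar> powr (1 + b)) \<partial>lebesgue) * ind {0<..<T} t"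
   by (cases "t \<in> {0<..<T}") (auto simp: f intro!: nn_integral_cong split: split_indicator)
 qed
 show ?thesis unfolding W0_1_def mem_Collect_eq 1 2 using borel_measurable_lebesgue_on_cong[of "{0<..<T}" f f'] f by simp
qed

lemma at_left_cong:
 fixes T :: real
 assumes "T > 0" and g: "\<And>t. t \<in> {0<..<T} \<Longrightarrow> g t = g' t"
 shows "(g \<longlongrightarrow> l) (at_left T) \<longleftrightarrow> (g' \<longlongrightarrow> l) (at_left T)"
proof (rule filterlim_cong[OF refl refl])
 show "eventually (\<lambda>t. g t = g' t) (at_left T)"
  unfolding eventually_at_left[OF assms(1)] using assms by (intro exI[of _ 0]) auto
qed

lemma WT_inf_cong:
 assumes T: "T > 0" and g: "\<And>t. t \<in> {0<..<T} \<Longrightarrow> g t = g' t"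
 shows "g \<in> WT_inf b T \<longleftrightarrow> g' \<in> WT_inf b T"
proof -
 have 1: "(SUP t\<in>{0<..<T}. ennreal (\<bar>l - g t\<bar> / (T - t) powr b)) = (SUP t\<in>{0<..<T}. ennreal (\<bar>l - g' t\<bar> / (T - t) powr b))" for l
  by (intro SUP_cong refl) (simp add: g)
 have 2: "(SUP t\<in>{0<..<T}. (\<integral>\<^sup>+ u\<in>{t<..<T}. ennreal (\<bar>g t - g u\<bar> / \<bar>t - u\<bar> powr (1 + b)) \<partial>lebesgue))
  = (SUP t\<in>{0<..<T}. (\<integral>\<^sup>+ u\<in>{t<..<T}. ennreal (\<bar>g' t - g' u\<bar> / \<bar>t - u\<bar> powr (1 + b)) \<partial>lebesgue))"
  by (intro SUP_cong refl nn_integral_cong) (auto simp: g split: split_indicator)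
 have 3: "(g \<longlongrightarrow> l) (at_left T) \<longleftrightarrow> (g' \<longlongrightarrow> l) (at_left T)" for l
  by (rule at_left_cong[OF T g])
 show ?thesis unfolding WT_inf_def mem_Collect_eq 1 2 3
  using borel_measurable_lebesgue_on_cong[of "{0<..<T}" g g'] g by simp
qed

lemma stieltjes_integral_order_cong:
 assumes T: "T > 0" and f: "\<And>t. t \<in> {0<..<T} \<Longrightarrow> f t = f' t" and g: "\<And>t. t \<in> {0<..<T} \<Longrightarrow> g t = g' t"
 shows "stieltjes_integral_order b T f g = stieltjes_integral_order b T f' g'"
proof -
 have Lim: "Lim (at_left T) g = Lim (at_left T) g'"
  unfolding Topological_Spaces.Lim_def using at_left_cong[of T g g', OF T g] by simp
 have L: "frac_deriv_left b f t = frac_deriv_left b f' t" if t: "t \<in> {0<..<T}" for t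
 proof -
  have "(LINT u:{0<..<t}|lebesgue. (f t - f u) / (t - u) powr (b + 1)) = (LINT u:{0<..<t}|lebesgue. (f' t - f' u) / (t - u) powr (b + 1))"
   by (rule set_lebesgue_integral_cong) (use t f in auto)
  then show ?thesis unfolding frac_deriv_left_def using f[OF t] by simp
 qed
 have R: "frac_deriv_right (1 - b) T (\<lambda>u. g u - c) t = frac_deriv_right (1 - b) T (\<lambda>u. g' u - c) t" if t: "t \<in> {0<..<T}" for t c
 proof -
  have "(LINT u:{t<..<T}|lebesgue. ((g t - c) - (g u - c)) / (u - t) powr (1 - b + 1)) = (LINT u:{t<..<T}|lebesgue. ((g' t - c) - (g' u - c)) / (u - t) powr (1 - b + 1))"
   by (rule set_lebesgue_integral_cong) (use t g in auto)
  then show ?thesis unfolding frac_deriv_right_def using g[OF t] by simp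
 qed
 show ?thesis unfolding stieltjes_integral_order_def Lim
  by (intro arg_cong[where f=uminus] set_lebesgue_integral_cong) (auto simp: L R)
qed

text \<open>The order chosen by \<open>SOME\<close> and the given order b compute the same limit in
  \<open>stieltjes_order_limit\<close>. Agreement with f' and g' on the open interval is enough,
  which leaves endpoint values and extensions free.\<close>

lemma stieltjes_integral_eq_order:
 assumes T: "T > 0" and b: "0 < b" "b < 1"
  and f: "\<And>t. t \<in> {0<..<T} \<Longrightarrow> f t = f' t" and g: "\<And>t. t \<in> {0<..<T} \<Longrightarrow> g t = g' t"
  and fm: "f' \<in> \<B>" and f0: "\<And>x. x \<notin> {0<..<T} \<Longrightarrow> f' x = 0" and W: "f' \<in> W0_1 b T"
  and gc: "continuous_on UNIV g'" and gT: "\<And>x. x \<ge> T \<Longrightarrow> g' x = g' T" and gB: "\<And>x. \<bar>g' x\<bar> \<le> B"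
  and gW: "g' \<in> WT_inf (1 - b) T"
 shows "stieltjes_integrable T f g" and "stieltjes_integral T f g = stieltjes_integral_order b T f' g'"
proof -
 have c1: "f \<in> W0_1 \<theta> T \<longleftrightarrow> f' \<in> W0_1 \<theta> T" for \<theta> by (rule W0_1_cong[OF f])
 have c2: "g \<in> WT_inf \<theta> T \<longleftrightarrow> g' \<in> WT_inf \<theta> T" for \<theta> by (rule WT_inf_cong[OF T g])
 have adm: "admissible_order T f g \<theta> \<longleftrightarrow> 0 < \<theta> \<and> \<theta> < 1 \<and> f' \<in> W0_1 \<theta> T \<and> g' \<in> WT_inf (1 - \<theta>) T" for \<theta>
  unfolding admissible_order_def c1 c2 ..
 then have "admissible_order T f g b" using b W gW by simp
 then show "stieltjes_integrable T f g" unfolding stieltjes_integrable_def by blast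
 define \<theta> where "\<theta> = (SOME \<theta>. admissible_order T f g \<theta>)"
 have "admissible_order T f g \<theta>" unfolding \<theta>_def using \<open>admissible_order T f g b\<close> by (rule someI)
 then have \<theta>: "0 < \<theta>" "\<theta> < 1" "f' \<in> W0_1 \<theta> T" "g' \<in> WT_inf (1 - \<theta>) T" using adm by auto
 have "stieltjes_integral T f g = stieltjes_integral_order \<theta> T f' g'"
  unfolding stieltjes_integral_def \<theta>_def[symmetric] by (rule stieltjes_integral_order_cong[OF T f g])
 also have "\<dots> = stieltjes_integral_order b T f' g'"
  by (rule tendsto_unique[OF _ stieltjes_order_limit[OF T \<theta>(1,2) fm f0 \<theta>(3) gc gT gB \<theta>(4)] stieltjes_order_limit[OF T b fm f0 W gc gT gB gW]]) simp
 finally show "stieltjes_integral T f g = stieltjes_integral_order b T f' g'" .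
qed

text \<open>The Hoelder bound leaves the exponent \<alpha> - 1 - b in the integral, which exceeds -1
  because b < \<alpha>.\<close>

lemma holder_WT_inf:
 fixes x :: "real \<Rightarrow> real"
 assumes T: "T > 0" and H: "H > 0" and b: "0 < b" "b < \<alpha>" and x: "\<And>t u. \<bar>x t - x u\<bar> \<le> H * \<bar>t - u\<bar> powr \<alpha>"
 shows "x \<in> WT_inf b T"
proof -
 have xc: "continuous_on UNIV x" by (rule holder_continuous_on[of H \<alpha>]) (use H b x in \<open>auto simp: dist_real_def\<close>)
 have xm: "x \<in> borel_measurable (lebesgue_on {0<..<T})"
  by (intro measurable_restrict_space1 measurable_completion) (simp add: borel_measurable_continuous_onI[OF xc])
 have lim: "(x \<longlongrightarrow> x T) (at_left T)"
  using continuous_on_subset[OF xc, of "{..T}"] by (auto simp: continuous_on_def intro: tendsto_within_subset)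
 have "(SUP t\<in>{0<..<T}. ennreal (\<bar>x T - x t\<bar> / (T - t) powr b)) \<le> ennreal (H * T powr (\<alpha> - b))"
 proof (intro SUP_least ennreal_leI)
  fix t assume t: "t \<in> {0<..<T}"
  have "\<bar>x T - x t\<bar> / (T - t) powr b \<le> H * (T - t) powr \<alpha> / (T - t) powr b"
   using x[of T t] t by (intro divide_right_mono) auto
  also have "\<dots> = H * (T - t) powr (\<alpha> - b)" using t by (simp add: powr_diff)
  also have "\<dots> \<le> H * T powr (\<alpha> - b)" using t H b by (intro mult_left_mono powr_mono2) auto
  finally show "\<bar>x T - x t\<bar> / (T - t) powr b \<le> H * T powr (\<alpha> - b)" .
 qed
 then have 1: "(SUP t\<in>{0<..<T}. ennreal (\<bar>x T - x t\<bar> / (T - t) powr b)) < \<infinity>" by (rule order_le_less_trans) simp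
 define c where "c = \<alpha> - (1 + b)"
 have c: "c > -1" using b by (simp add: c_def)
 have "(SUP t\<in>{0<..<T}. (\<integral>\<^sup>+ u\<in>{t<..<T}. ennreal (\<bar>x t - x u\<bar> / \<bar>t - u\<bar> powr (1 + b)) \<partial>lebesgue)) \<le> ennreal H * ennreal (2 * (T powr (c+1) / (c+1)))"
 proof (rule SUP_least)
  fix t assume t: "t \<in> {0<..<T}"
  have "(\<integral>\<^sup>+ u\<in>{t<..<T}. ennreal (\<bar>x t - x u\<bar> / \<bar>t - u\<bar> powr (1 + b)) \<partial>lebesgue)
   \<le> (NBINT u. ennreal H * ennreal (ind {0<..<T} u * \<bar>t - u\<bar> powr c))"
   unfolding nn_integral_completion
  proof (rule nn_integral_mono)
   fix u
   have "\<bar>x t - x u\<bar> / \<bar>t - u\<bar> powr (1 + b) \<le> H * \<bar>t - u\<bar> powr c" if "t < u"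
   proof -
    have "\<bar>x t - x u\<bar> / \<bar>t - u\<bar> powr (1 + b) \<le> H * \<bar>t - u\<bar> powr \<alpha> / \<bar>t - u\<bar> powr (1 + b)" by (intro divide_right_mono x) simp
    then show ?thesis unfolding c_def using that by (simp add: powr_diff)
   qed
   then show "ennreal (\<bar>x t - x u\<bar> / \<bar>t - u\<bar> powr (1 + b)) * ind {t<..<T} u \<le> ennreal H * ennreal (ind {0<..<T} u * \<bar>t - u\<bar> powr c)"
    using t H by (auto simp: ennreal_mult[symmetric] intro!: ennreal_leI split: split_indicator)
  qed
  also have "\<dots> = ennreal H * (NBINT u. ennreal (ind {0<..<T} u * \<bar>t - u\<bar> powr c))" by (rule nn_integral_cmult) measurable
  also have "\<dots> \<le> ennreal H * ennreal (2 * (T powr (c+1) / (c+1)))" by (intro mult_left_mono nn_integral_power_kernel t c) simp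
  finally show "(\<integral>\<^sup>+ u\<in>{t<..<T}. ennreal (\<bar>x t - x u\<bar> / \<bar>t - u\<bar> powr (1 + b)) \<partial>lebesgue) \<le> ennreal H * ennreal (2 * (T powr (c+1) / (c+1)))" .
 qed
 then have 2: "(SUP t\<in>{0<..<T}. (\<integral>\<^sup>+ u\<in>{t<..<T}. ennreal (\<bar>x t - x u\<bar> / \<bar>t - u\<bar> powr (1 + b)) \<partial>lebesgue)) < \<infinity>"
  by (rule order_le_less_trans) (simp add: ennreal_mult_less_top)
 show ?thesis unfolding WT_inf_def mem_Collect_eq using xm lim 1 2 by (auto intro!: exI[of _ "x T"])
qed

text \<open>Finiteness of the variation measure on U is extracted from the integral: U is bounded
  and the kernel exponent is not positive, so the kernel has a positive lower bound on U, and the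
  path spends the time T > 0 there.\<close>

lemma s1_variable_finite:
 fixes X :: "real \<Rightarrow> real^'n"
 assumes v: "s1_variable s T X \<phi>" and T: "T > 0" and s: "0 < s"
 obtains U where "open U" "bounded U" "X ` {0..T} \<subseteq> U" "emeasure (variation_measure \<phi>) U < \<infinity>"
  "(\<integral>\<^sup>+ t\<in>{0..T}. (\<integral>\<^sup>+ z\<in>U. riesz_kernel s (X t) z \<partial>variation_measure \<phi>) \<partial>lborel) < \<infinity>"
proof -
 obtain U where U: "open U" "compact (closure U)" "X ` {0..T} \<subseteq> U"
  and fin: "(\<integral>\<^sup>+ t\<in>{0..T}. (\<integral>\<^sup>+ z\<in>U. riesz_kernel s (X t) z \<partial>variation_measure \<phi>) \<partial>lborel) < \<infinity>"
  using v unfolding s1_variable_def by blast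
 have bU: "bounded U" using U(2) compact_imp_bounded bounded_subset closure_subset by blast
 then obtain B where B: "\<And>x. x \<in> U \<Longrightarrow> norm x \<le> B" by (auto simp: bounded_iff)
 let ?p = "- real CARD('n) + 1 - s"
 \<comment> \<open>2 |B| bounds the diameter of U, and the 1 keeps D positive.\<close>
 define D where "D = 2 * \<bar>B\<bar> + 1"
 define c where "c = ennreal (D powr ?p)"
 have c: "c > 0" unfolding c_def D_def by (simp add: ennreal_zero_less_top)
 have p: "?p \<le> 0" using s by (smt (verit) One_nat_def Suc_leI of_nat_1 of_nat_le_iff zero_less_card_finite)
 have ker: "c \<le> riesz_kernel s x z" if "x \<in> U" "z \<in> U" for x z
 proof (cases "x = z")
  case False
  have "norm (x - z) \<le> D" using norm_triangle_ineq4[of x z] B[OF that(1)] B[OF that(2)] unfolding D_def by linarith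
  then have "D powr ?p \<le> norm (x - z) powr ?p" using False p by (intro powr_mono2') auto
  then show ?thesis using False unfolding c_def riesz_kernel_def by (simp add: ennreal_leI)
 qed (simp add: riesz_kernel_def)
 let ?V = "variation_measure \<phi>"
 have Us: "U \<in> sets ?V" using U(1) by simp
 have "(NBINT t. (c * emeasure ?V U) * ind {0..T} t) \<le> (\<integral>\<^sup>+ t\<in>{0..T}. (\<integral>\<^sup>+ z\<in>U. riesz_kernel s (X t) z \<partial>?V) \<partial>lborel)"
 proof (rule nn_integral_mono)
  fix t
  have "c * emeasure ?V U \<le> (\<integral>\<^sup>+ z\<in>U. riesz_kernel s (X t) z \<partial>?V)" if "t \<in> {0..T}"
  proof -
   have "c * emeasure ?V U = (\<integral>\<^sup>+ z. c * ind U z \<partial>?V)" using Us by (simp add: nn_integral_cmult_indicator)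
   also have "\<dots> \<le> (\<integral>\<^sup>+ z\<in>U. riesz_kernel s (X t) z \<partial>?V)"
    using U(3) that by (intro nn_integral_mono) (auto split: split_indicator intro!: ker)
   finally show ?thesis .
  qed
  then show "(c * emeasure ?V U) * ind {0..T} t \<le> (\<integral>\<^sup>+ z\<in>U. riesz_kernel s (X t) z \<partial>?V) * ind {0..T} t"
   by (auto split: split_indicator)
 qed
 then have "(c * emeasure ?V U) * ennreal T < \<infinity>" using fin T by (simp add: nn_integral_cmult_indicator order_le_less_trans)
 then have "emeasure ?V U < \<infinity>" using c T by (auto simp: ennreal_mult_less_top)
 then show ?thesis by (rule that[OF U(1) bU U(3) _ fin])
qed

section \<open>Continuity of the cut-off integral\<close>

lemma hardy_gagliardo_cong:
 assumes "\<And>t. t \<in> {0<..<T} \<Longrightarrow> f t = f' t"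
 shows "hardy_norm b T f = hardy_norm b T f'" and "gagliardo b T f = gagliardo b T f'"
 unfolding hardy_norm_def gagliardo_def
 by (intro nn_integral_cong; auto simp: assms split: split_indicator)+

text \<open>Agrees with \<open>indicator {0..t} u * f u\<close> on the open interval but is forced
  to vanish off it, the form in which \<open>stieltjes_order_limit\<close> takes its
  integrands.\<close>

definition cutoff :: "real \<Rightarrow> real \<Rightarrow> (real \<Rightarrow> real) \<Rightarrow> real \<Rightarrow> real" where
 "cutoff T t f u = ind {0<..<T} u * (ind {0<..t} u * f u)"

lemma cutoff_borel [measurable]:
 assumes [measurable]: "f \<in> \<B>"
 shows "cutoff T t f \<in> \<B>"
 unfolding cutoff_def[abs_def] by measurable

lemma cutoff_outside: "u \<notin> {0<..<T} \<Longrightarrow> cutoff T t f u = 0"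
 by (simp add: cutoff_def)

lemma cutoff_bound:
 assumes T: "T > 0" and b: "0 < b" "b < 1" and t: "t \<in> {0..T}"
 obtains C where "C \<ge> 0" "\<And>f. f \<in> \<B> \<Longrightarrow>
   hardy_norm b T (cutoff T t f) + gagliardo b T (cutoff T t f)
   \<le> ennreal C * ((NBINT t. ennreal (ind {0<..<T} t * \<bar>f t\<bar>)) + gagliardo b T f)"
\<comment> \<open>At t = 0 there is no interval (0, t) for the Hardy inequality, but then the
  cut-off is zero.\<close>
proof (cases "t = 0")
 case True
 show ?thesis
 proof (rule that[of 0])
  fix f
  have "cutoff T t f = (\<lambda>u. 0)" using True by (auto simp: cutoff_def split: split_indicator)
  then show "hardy_norm b T (cutoff T t f) + gagliardo b T (cutoff T t f)
   \<le> ennreal 0 * ((NBINT t. ennreal (ind {0<..<T} t * \<bar>f t\<bar>)) + gagliardo b T f)"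
   by (simp add: hardy_norm_def gagliardo_def)
 qed simp
next
 case False
 then have t': "0 < t" "t \<le> T" using t by auto
 obtain C where C: "C \<ge> 0" "\<And>f. f \<in> \<B> \<Longrightarrow>
   hardy_norm b T (\<lambda>u. ind {0<..t} u * f u) + gagliardo b T (\<lambda>u. ind {0<..t} u * f u)
   \<le> ennreal C * ((NBINT t. ennreal (ind {0<..<T} t * \<bar>f t\<bar>)) + gagliardo b T f)"
  by (rule W0_1_indicator_bound[OF T b t']) blast
 have eq: "hardy_norm b T (cutoff T t f) = hardy_norm b T (\<lambda>u. ind {0<..t} u * f u)"
  "gagliardo b T (cutoff T t f) = gagliardo b T (\<lambda>u. ind {0<..t} u * f u)" for f
  by (rule hardy_gagliardo_cong; simp add: cutoff_def)+
 show ?thesis by (rule that[OF C(1)]) (simp only: eq C(2))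
qed

text \<open>The Hardy inequality bounds the cut-off of f m - f0 by its L1 norm and Gagliardo
  seminorm, and \<open>stieltjes_order_bound\<close> bounds the integral. That integral is the
  difference of the two integrals because the approximations in \<open>stieltjes_order_limit\<close>
  are linear in f: for fixed e the rate is bounded, so the products are integrable.\<close>

lemma stieltjes_order_cutoff_convergence:
 fixes f :: "nat \<Rightarrow> real \<Rightarrow> real" and f0 g :: "real \<Rightarrow> real"
 assumes T: "T > 0" and b: "0 < b" "b < 1" and t: "t \<in> {0..T}"
  and fm [measurable]: "\<And>m. f m \<in> \<B>" and f0m [measurable]: "f0 \<in> \<B>"
  and fin: "(NBINT t. ennreal (ind {0<..<T} t * \<bar>f0 t\<bar>)) < \<infinity>" "gagliardo b T f0 < \<infinity>"
   "\<And>m. (NBINT t. ennreal (ind {0<..<T} t * \<bar>f m t\<bar>)) < \<infinity>" "\<And>m. gagliardo b T (f m) < \<infinity>"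
  and lim: "(\<lambda>m. NBINT t. ennreal (ind {0<..<T} t * \<bar>f m t - f0 t\<bar>)) \<longlonglongrightarrow> 0"
   "(\<lambda>m. gagliardo b T (\<lambda>t. f m t - f0 t)) \<longlonglongrightarrow> 0"
  and g: "continuous_on UNIV g" and gT: "\<And>x. x \<ge> T \<Longrightarrow> g x = g T" and gB: "\<And>x. \<bar>g x\<bar> \<le> B"
  and gW: "g \<in> WT_inf (1 - b) T"
 shows "cutoff T t f0 \<in> W0_1 b T" and "cutoff T t (f m) \<in> W0_1 b T"
  and "(\<lambda>m. stieltjes_integral_order b T (cutoff T t (f m)) g) \<longlonglongrightarrow> stieltjes_integral_order b T (cutoff T t f0) g"
proof -
 let ?c = "cutoff T t" and ?I = "\<lambda>f. stieltjes_integral_order b T f g"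
 obtain C where C: "C \<ge> 0" "\<And>f. f \<in> \<B> \<Longrightarrow>
   hardy_norm b T (?c f) + gagliardo b T (?c f) \<le> ennreal C * ((NBINT t. ennreal (ind {0<..<T} t * \<bar>f t\<bar>)) + gagliardo b T f)"
  by (rule cutoff_bound[OF T b t]) blast
 have W: "?c h \<in> W0_1 b T" if "h \<in> \<B>" "(NBINT t. ennreal (ind {0<..<T} t * \<bar>h t\<bar>)) < \<infinity>" "gagliardo b T h < \<infinity>" for h
  unfolding W0_1_iff[OF cutoff_borel[OF that(1)]]
  by (rule order_le_less_trans[OF C(2)[OF that(1)]]) (use that in \<open>simp add: ennreal_mult_less_top\<close>)
 show W0: "?c f0 \<in> W0_1 b T" by (rule W[OF f0m fin(1,2)])
 show Wm: "?c (f m) \<in> W0_1 b T" for m by (rule W[OF fm fin(3,4)])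
 obtain K where K: "K \<ge> 0" "\<And>h. h \<in> \<B> \<Longrightarrow> ?c h \<in> W0_1 b T \<Longrightarrow>
   eabs (?I (?c h)) \<le> ennreal K * (gagliardo b T (?c h) + ennreal (1/b) * hardy_norm b T (?c h))"
 proof (rule stieltjes_order_bound[OF T b g gT gW])
  fix K :: real
  assume K: "K \<ge> 0" and k: "\<And>f. f \<in> \<B> \<Longrightarrow> (\<And>x. x \<notin> {0<..<T} \<Longrightarrow> f x = 0) \<Longrightarrow> f \<in> W0_1 b T \<Longrightarrow>
   eabs (?I f) \<le> ennreal K * (gagliardo b T f + ennreal (1/b) * hardy_norm b T f)"
  show thesis by (rule that[OF K]) (rule k[OF cutoff_borel cutoff_outside])
 qed
 define N where "N m = (NBINT t. ennreal (ind {0<..<T} t * \<bar>f m t - f0 t\<bar>)) + gagliardo b T (\<lambda>t. f m t - f0 t)" for m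
 have N0: "N \<longlonglongrightarrow> 0" unfolding N_def[abs_def] using tendsto_add[OF lim] by simp
 have bound: "eabs (?I (?c (f m)) - ?I (?c f0)) \<le> ennreal (K * (1 + 1/b) * C) * N m" if fin': "N m < \<infinity>" for m
 proof -
  let ?d = "\<lambda>t. f m t - f0 t"
  have dm: "?d \<in> \<B>" by measurable
  have Wd: "?c ?d \<in> W0_1 b T" using fin' unfolding N_def by (intro W[OF dm]) auto
  note L = stieltjes_order_limit[OF T b cutoff_borel _ _ g gT gB gW]
  have la: "((\<lambda>e. LBINT u. ?c (f m) u * steklov_rate e g u) \<longlongrightarrow> ?I (?c (f m))) (at_right 0)"
   by (rule L[OF fm _ Wm]) (simp add: cutoff_outside)
  have lb: "((\<lambda>e. LBINT u. ?c f0 u * steklov_rate e g u) \<longlongrightarrow> ?I (?c f0)) (at_right 0)"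
   by (rule L[OF f0m _ W0]) (simp add: cutoff_outside)
  have lc: "((\<lambda>e. LBINT u. ?c ?d u * steklov_rate e g u) \<longlongrightarrow> ?I (?c ?d)) (at_right 0)"
   by (rule L[OF dm _ Wd]) (simp add: cutoff_outside)
  have gm [measurable]: "g \<in> \<B>" using g by (rule borel_measurable_continuous_onI)
  have int: "integrable lborel (\<lambda>u. ?c h u * steklov_rate e g u)" if h: "h \<in> \<B>" "?c h \<in> W0_1 b T" and e: "e > 0" for h e
  proof (rule Bochner_Integration.integrable_bound[where f="\<lambda>u. (2 * B / e) * ?c h u"])
   show "integrable lborel (\<lambda>u. (2 * B / e) * ?c h u)"
    by (intro integrable_mult_right stieltjes_order_eq(1)[OF T b cutoff_borel[OF h(1)] _ h(2) g gT gW]) (simp add: cutoff_outside)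
   show "(\<lambda>u. ?c h u * steklov_rate e g u) \<in> borel_measurable lborel" using h(1) by measurable
   have "\<bar>steklov_rate e g u\<bar> \<le> 2 * B / e" for u
   proof -
    have "\<bar>steklov e g v\<bar> \<le> B" for v by (rule steklov_bound[OF gm e gB])
    from this[of u] this[of "u + e"] have "\<bar>steklov e g (u + e) - steklov e g u\<bar> \<le> 2 * B" by linarith
    then show ?thesis unfolding steklov_rate_def abs_divide using e by (simp add: divide_right_mono)
   qed
   then have "norm (?c h u * steklov_rate e g u) \<le> norm ((2 * B / e) * ?c h u)" for u
   proof -
    have "\<bar>steklov_rate e g u\<bar> \<le> \<bar>2 * B / e\<bar>" using \<open>\<And>u. \<bar>steklov_rate e g u\<bar> \<le> 2 * B / e\<close>[of u] by linarith
    then show ?thesis unfolding real_norm_def abs_mult[of "?c h u"] abs_mult[of "2 * B / e"] mult.commute[of "\<bar>2 * B / e\<bar>"] by (intro mult_left_mono) auto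
   qed
   then show "AE u in lborel. norm (?c h u * steklov_rate e g u) \<le> norm ((2 * B / e) * ?c h u)" by simp
  qed
  have "?I (?c (f m)) - ?I (?c f0) = ?I (?c ?d)"
  proof (rule tendsto_unique[OF _ tendsto_diff[OF la lb]])
   have ev: "eventually (\<lambda>e. (LBINT u. ?c ?d u * steklov_rate e g u)
     = (LBINT u. ?c (f m) u * steklov_rate e g u) - (LBINT u. ?c f0 u * steklov_rate e g u)) (at_right 0)"
    using eventually_at_right_less[of "0::real"]
   proof eventually_elim
    case (elim e)
    have "(LBINT u. ?c ?d u * steklov_rate e g u) = (LBINT u. ?c (f m) u * steklov_rate e g u - ?c f0 u * steklov_rate e g u)"
     by (intro Bochner_Integration.integral_cong refl) (simp add: cutoff_def algebra_simps)
    also have "\<dots> = (LBINT u. ?c (f m) u * steklov_rate e g u) - (LBINT u. ?c f0 u * steklov_rate e g u)"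
     by (intro Bochner_Integration.integral_diff int fm f0m Wm W0 elim)
    finally show ?case .
   qed
   show "((\<lambda>e. (LBINT u. ?c (f m) u * steklov_rate e g u) - (LBINT u. ?c f0 u * steklov_rate e g u)) \<longlongrightarrow> ?I (?c ?d)) (at_right 0)"
    by (rule tendsto_cong[THEN iffD1, OF ev lc])
  qed simp
  then have "eabs (?I (?c (f m)) - ?I (?c f0)) = eabs (?I (?c ?d))" by simp
  also have "\<dots> \<le> ennreal K * (gagliardo b T (?c ?d) + ennreal (1/b) * hardy_norm b T (?c ?d))"
   by (rule K(2)[OF dm Wd])
  also have "\<dots> \<le> ennreal K * (ennreal (1 + 1/b) * (hardy_norm b T (?c ?d) + gagliardo b T (?c ?d)))"
  proof (rule mult_left_mono)
   have "gagliardo b T (?c ?d) + ennreal (1/b) * hardy_norm b T (?c ?d)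
    \<le> ennreal (1 + 1/b) * gagliardo b T (?c ?d) + ennreal (1 + 1/b) * hardy_norm b T (?c ?d)"
   proof (rule add_mono)
    show "gagliardo b T (?c ?d) \<le> ennreal (1 + 1/b) * gagliardo b T (?c ?d)"
     using mult_right_mono[of "1::ennreal" "ennreal (1 + 1/b)" "gagliardo b T (?c ?d)"] b ennreal_leI[of 1 "1 + 1/b"] by simp
    show "ennreal (1/b) * hardy_norm b T (?c ?d) \<le> ennreal (1 + 1/b) * hardy_norm b T (?c ?d)"
     by (intro mult_right_mono ennreal_leI) auto
   qed
   then show "gagliardo b T (?c ?d) + ennreal (1/b) * hardy_norm b T (?c ?d) \<le> ennreal (1 + 1/b) * (hardy_norm b T (?c ?d) + gagliardo b T (?c ?d))"
    unfolding distrib_left by (simp only: add.commute)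
  qed simp
  also have "\<dots> \<le> ennreal K * (ennreal (1 + 1/b) * (ennreal C * N m))"
   unfolding N_def by (intro mult_left_mono C(2) dm) auto
  also have "\<dots> = ennreal (K * (1 + 1/b) * C) * N m"
   using K(1) b C(1) by (simp add: ennreal_mult_assoc mult.assoc del: ennreal_plus)
  finally show ?thesis .
 qed
 have "(\<lambda>m. eabs (?I (?c (f m)) - ?I (?c f0))) \<longlonglongrightarrow> 0"
 proof (rule tendsto_sandwich[OF _ _ tendsto_const])
  have "eventually (\<lambda>m. N m < \<infinity>) sequentially" using N0 by (rule order_tendstoD) simp
  then show "eventually (\<lambda>m. eabs (?I (?c (f m)) - ?I (?c f0)) \<le> ennreal (K * (1 + 1/b) * C) * N m) sequentially"
   by eventually_elim (rule bound)
  show "(\<lambda>m. ennreal (K * (1 + 1/b) * C) * N m) \<longlonglongrightarrow> 0"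
   using ennreal_tendsto_cmult[OF _ N0, of "ennreal (K * (1 + 1/b) * C)"] by simp
 qed simp
 then have "(\<lambda>m. \<bar>?I (?c (f m)) - ?I (?c f0)\<bar>) \<longlonglongrightarrow> 0" by (simp add: ennreal_tendsto_0_iff)
 then have "(\<lambda>m. ?I (?c (f m)) - ?I (?c f0)) \<longlonglongrightarrow> 0" by (rule tendsto_rabs_zero_cancel)
 then show "(\<lambda>m. ?I (?c (f m))) \<longlonglongrightarrow> ?I (?c f0)" by (rule LIM_zero_cancel)
qed

lemma sequence_at_right:
 fixes e :: "nat \<Rightarrow> real"
 assumes "e \<longlonglongrightarrow> 0" "\<And>m. 0 < e m"
 shows "filterlim e (at_right 0) sequentially"
 unfolding filterlim_at using assms by (auto intro!: always_eventually simp: less_imp_neq[THEN not_sym])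

text \<open>The plain L1 norm stands in for the weighted term of \<open>W0_1\<close>, which the
  Hardy inequality recovers after cutting off. Bundling lets one statement be chosen for every index
  k.\<close>

definition W0_1_converges :: "real \<Rightarrow> real \<Rightarrow> (nat \<Rightarrow> real \<Rightarrow> real) \<Rightarrow> (real \<Rightarrow> real) \<Rightarrow> bool" where
 "W0_1_converges b T f f0 \<longleftrightarrow> (\<forall>m. f m \<in> \<B>) \<and> f0 \<in> \<B> \<and>
   (NBINT t. ennreal (ind {0<..<T} t * \<bar>f0 t\<bar>)) < \<infinity> \<and> gagliardo b T f0 < \<infinity> \<and>
   (\<forall>m. (NBINT t. ennreal (ind {0<..<T} t * \<bar>f m t\<bar>)) < \<infinity>) \<and> (\<forall>m. gagliardo b T (f m) < \<infinity>) \<and>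
   ((\<lambda>m. NBINT t. ennreal (ind {0<..<T} t * \<bar>f m t - f0 t\<bar>)) \<longlonglongrightarrow> 0) \<and>
   ((\<lambda>m. gagliardo b T (\<lambda>t. f m t - f0 t)) \<longlonglongrightarrow> 0)"

text \<open>f0 is prescribed only where \<phi> has an approximate limit, which covers every time
  with finite potential, hence almost every time. The threshold e0 does not depend on the sequence,
  so one sequence can serve all partial derivatives.\<close>

lemma (in potential_bounds) mollified_path_convergence:
 fixes X :: "real \<Rightarrow> real^'n"
 assumes Uo: "open U" and XU: "\<And>t. t \<in> {0..T} \<Longrightarrow> X t \<in> U" and H: "H > 0" and \<alpha>: "\<alpha> > 0"
  and X: "\<And>t u. t \<in> {0..T} \<Longrightarrow> u \<in> {0..T} \<Longrightarrow> dist (X t) (X u) \<le> H * \<bar>t - u\<bar> powr \<alpha>"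
  and Xm [measurable]: "X \<in> \<B>" and T: "T > 0" and b: "0 < b" "b < \<alpha> * s"
  and fin: "(NBINT t. ind {0<..<T} t * pot (X t)) < \<infinity>"
  and f0m [measurable]: "f0 \<in> \<B>"
  and f0: "\<And>t l. t \<in> {0<..<T} \<Longrightarrow> has_approx_limit \<phi> (X t) l \<Longrightarrow> f0 t = l"
 shows "\<exists>e0>0. \<forall>e. (\<forall>m. 0 < e m \<and> e m < e0) \<longrightarrow> e \<longlonglongrightarrow> 0 \<longrightarrow> W0_1_converges b T (\<lambda>m t. moll (e m) \<phi> (X t)) f0"
proof -
 obtain C e0 where C: "C > 0" and e0: "0 < e0" and inc: "\<And>e t u. 0 < e \<Longrightarrow> e < e0 \<Longrightarrow> t \<in> {0..T} \<Longrightarrow> u \<in> {0..T} \<Longrightarrow>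
    eabs (moll e \<phi> (X t) - moll e \<phi> (X u)) \<le> ennreal (C * \<bar>t - u\<bar> powr (\<alpha> * s)) * ((1 + pot (X t)) + (1 + pot (X u)))"
  and size: "\<And>e t. 0 < e \<Longrightarrow> e < e0 \<Longrightarrow> t \<in> {0..T} \<Longrightarrow> eabs (moll e \<phi> (X t)) \<le> ennreal C * (1 + pot (X t))"
  by (rule time_bounds[OF Uo XU H \<alpha> X]) blast+
 have "W0_1_converges b T (\<lambda>m t. moll (e m) \<phi> (X t)) f0" if e: "\<And>m. 0 < e m \<and> e m < e0" and lim: "e \<longlonglongrightarrow> 0" for e
 proof -
  define W where "W t = 1 + pot (X t)" for t
  have Wm: "W \<in> \<B>" unfolding W_def by measurable
  have mm: "(\<lambda>t. moll (e m) \<phi> (X t)) \<in> \<B>" for m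
   by (rule measurable_compose[OF Xm moll_borel[OF \<phi>]]) (use e in simp)
  have ae: "filterlim e (at_right 0) sequentially" using lim e by (intro sequence_at_right) auto
  have i: "eabs (moll (e m) \<phi> (X t) - moll (e m) \<phi> (X u)) \<le> ennreal (C * \<bar>t - u\<bar> powr (\<alpha> * s)) * (W t + W u)"
   if "t \<in> {0<..<T}" "u \<in> {0<..<T}" for m t u
   unfolding W_def using that e by (intro inc) auto
  have sz: "eabs (moll (e m) \<phi> (X t)) \<le> ennreal C * W t" if "t \<in> {0<..<T}" for m t
   unfolding W_def using that e by (intro size) auto
  have "(NBINT t. ind {0<..<T} t * W t) = (NBINT t. ind {0<..<T} t) + (NBINT t. ind {0<..<T} t * pot (X t))"
   unfolding W_def distrib_left mult_1_right by (rule nn_integral_add) measurable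
  then have Wfin: "(NBINT t. ind {0<..<T} t * W t) < \<infinity>" using fin T by simp
  have conv: "(\<lambda>m. moll (e m) \<phi> (X t)) \<longlonglongrightarrow> f0 t" if t: "t \<in> {0<..<T}" and w: "W t < \<infinity>" for t
  proof -
   have "pot (X t) < \<infinity>" using w unfolding W_def by simp
   then obtain l where l: "has_approx_limit \<phi> (X t) l" using approx_limit_exists[OF Uo XU, of t] t by auto
   from filterlim_compose[OF moll_tendsto_approx_limit[OF \<phi> l] ae] show ?thesis using f0[OF t l] by simp
  qed
  note G = gagliardo_convergence[OF b T C mm f0m Wm i sz Wfin conv]
  show ?thesis unfolding W0_1_converges_def using mm f0m G by blast
 qed
 then show ?thesis using e0 by blast
qed

text \<open>Formulated with approximate limits of F, so that the almost everywhere claim for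
  representatives and the claim at every time for continuous F can both be read off.\<close>

lemma stieltjes_chain_rule:
 fixes F :: "real^'n \<Rightarrow> real" and dF dFrep :: "'n \<Rightarrow> real^'n \<Rightarrow> real" and X :: "real \<Rightarrow> real^'n"
 assumes T: "T > 0" and F: "locally_integrable F" and w: "\<And>k. has_weak_partial k F (dF k)" and BV: "\<And>k. BV_loc (dF k)"
  and \<alpha>: "1/2 < \<alpha>" "\<alpha> < 1" and X: "holder_on \<alpha> {0..T} X" and s: "(1 - \<alpha>) / \<alpha> < s" "s < 1"
  and v: "\<And>k. s1_variable s T X (dF k)" and rep: "\<And>k. lebesgue_representative (dF k) (dFrep k)"
 shows "\<And>t k. t \<in> {0..T} \<Longrightarrow> stieltjes_integrable_upto T t (\<lambda>u. dFrep k (X u)) (\<lambda>u. X u $ k)"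
  and "\<And>t l0 l1. t \<in> {0..T} \<Longrightarrow> has_approx_limit F (X 0) l0 \<Longrightarrow> has_approx_limit F (X t) l1 \<Longrightarrow>
   l1 = l0 + (\<Sum>k\<in>UNIV. stieltjes_integral_upto T t (\<lambda>u. dFrep k (X u)) (\<lambda>u. X u $ k))"
  and "AE t in lebesgue_on {0..T}. \<exists>l. has_approx_limit F (X t) l"
proof -
 have s0: "s > 0" using s \<alpha> by (smt (verit) divide_nonneg_pos)
 obtain H where H: "H > 0" "\<And>t u. t \<in> {0..T} \<Longrightarrow> u \<in> {0..T} \<Longrightarrow> dist (X t) (X u) \<le> H * \<bar>t - u\<bar> powr \<alpha>"
 proof -
  obtain C where C: "\<forall>t\<in>{0..T}. \<forall>u\<in>{0..T}. dist (X t) (X u) \<le> C * \<bar>t - u\<bar> powr \<alpha>" using X unfolding holder_on_def by blast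
  show thesis
  \<comment> \<open>The constant in \<open>holder_on\<close> may be zero or negative, whereas the
    estimates ask for a positive one.\<close>
  proof (rule that[of "max C 1"])
   fix t u assume "t \<in> {0..T}" "u \<in> {0..T}"
   then have "dist (X t) (X u) \<le> C * \<bar>t - u\<bar> powr \<alpha>" using C by blast
   also have "\<dots> \<le> max C 1 * \<bar>t - u\<bar> powr \<alpha>" by (intro mult_right_mono) auto
   finally show "dist (X t) (X u) \<le> max C 1 * \<bar>t - u\<bar> powr \<alpha>" .
  qed simp
 qed
 \<comment> \<open>Clamping time to [0, T] extends the path to all times with the same Hoelder bound
   and makes it constant beyond T, as \<open>stieltjes_order_limit\<close> asks of the
   integrator.\<close>
 define c where "c u = max 0 (min u T)" for u :: real
 have c: "c u \<in> {0..T}" "u \<in> {0..T} \<Longrightarrow> c u = u" "u \<ge> T \<Longrightarrow> c u = T" "\<bar>c u - c u'\<bar> \<le> \<bar>u - u'\<bar>" for u u'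
  using T unfolding c_def by auto
 define Y where "Y u = X (c u)" for u
 have YX: "Y u = X u" if "u \<in> {0..T}" for u unfolding Y_def c(2)[OF that] ..
 have Y: "dist (Y t) (Y u) \<le> H * \<bar>t - u\<bar> powr \<alpha>" for t u
 proof -
  have "dist (Y t) (Y u) \<le> H * \<bar>c t - c u\<bar> powr \<alpha>" unfolding Y_def by (intro H(2) c)
  also have "\<dots> \<le> H * \<bar>t - u\<bar> powr \<alpha>" using H(1) \<alpha> by (intro mult_left_mono powr_mono2 c) auto
  finally show ?thesis .
 qed
 have Yc: "continuous_on UNIV Y" by (rule holder_continuous_on[OF H(1) _ Y]) (use \<alpha> in auto)
 have Ym [measurable]: "Y \<in> \<B>" using Yc by (rule borel_measurable_continuous_onI)
 have "bounded (Y ` {0..T})" by (intro compact_imp_bounded compact_continuous_image continuous_on_subset[OF Yc]) auto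
 then obtain R' where R': "\<And>u. u \<in> {0..T} \<Longrightarrow> norm (Y u) \<le> R'" unfolding bounded_iff by blast
 define R where "R = R' + 1"
 have R: "norm (Y u) < R" for u
  using R'[OF c(1), of u] unfolding R_def Y_def c(2)[OF c(1)] by simp
 define x where "x k u = Y u $ k" for k u
 have xc: "continuous_on UNIV (x k)" for k unfolding x_def by (intro continuous_intros Yc)
 have xT: "x k u = x k T" if "u \<ge> T" for k u unfolding x_def Y_def using c(3)[OF that] c(3)[of T] by simp
 have xB: "\<bar>x k u\<bar> \<le> R" for k u using component_le_norm_cart[of "Y u" k] R[of u] unfolding x_def by linarith
 have xh: "\<bar>x k t - x k u\<bar> \<le> H * \<bar>t - u\<bar> powr \<alpha>" for k t u
  using component_le_norm_cart[of "Y t - Y u" k] Y[of t u] by (simp add: dist_norm x_def)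
 obtain F' where F': "loc_int F'" "AE x in lebesgue. F x = F' x" using loc_int_representative(2)[OF F] by blast
 note Fm = loc_int_representative(1)[OF F] loc_int_borel[OF F'(1)] F'(2)
 have dFl: "locally_integrable (dF k)" for k using w[of k] unfolding has_weak_partial_def by blast
 have "\<forall>k. \<exists>G'. loc_int G' \<and> (AE x in lebesgue. dF k x = G' x)" using loc_int_representative(2)[OF dFl] by blast
 from choice[OF this] obtain G' where G0: "\<forall>k. loc_int (G' k) \<and> (AE x in lebesgue. dF k x = G' k x)" by (elim exE) (rule that)
 then have G': "loc_int (G' k)" "AE x in lebesgue. dF k x = G' k x" for k by auto
 note Gm = loc_int_representative(1)[OF dFl] loc_int_borel[OF G'(1)] G'(2)
 have grad: "moll_deriv e F' z (axis k 1) = moll e (G' k) z" if "e > 0" for e z k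
  by (rule moll_deriv_weak_partial[OF Fm Gm w that])
 have "\<forall>k. \<exists>U. open U \<and> bounded U \<and> X ` {0..T} \<subseteq> U \<and> emeasure (variation_measure (dF k)) U < \<infinity> \<and>
  (\<integral>\<^sup>+ t\<in>{0..T}. (\<integral>\<^sup>+ z\<in>U. riesz_kernel s (X t) z \<partial>variation_measure (dF k)) \<partial>lborel) < \<infinity>"
 proof
  fix k
  show "\<exists>U. open U \<and> bounded U \<and> X ` {0..T} \<subseteq> U \<and> emeasure (variation_measure (dF k)) U < \<infinity> \<and>
   (\<integral>\<^sup>+ t\<in>{0..T}. (\<integral>\<^sup>+ z\<in>U. riesz_kernel s (X t) z \<partial>variation_measure (dF k)) \<partial>lborel) < \<infinity>"
   by (rule s1_variable_finite[OF v T s0]) blast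
 qed
 from choice[OF this] obtain U where U0: "\<forall>k. open (U k) \<and> bounded (U k) \<and> X ` {0..T} \<subseteq> U k \<and> emeasure (variation_measure (dF k)) (U k) < \<infinity> \<and>
  (\<integral>\<^sup>+ t\<in>{0..T}. (\<integral>\<^sup>+ z\<in>U k. riesz_kernel s (X t) z \<partial>variation_measure (dF k)) \<partial>lborel) < \<infinity>" by (elim exE) (rule that)
 then have U: "open (U k)" "bounded (U k)" "X ` {0..T} \<subseteq> U k" "emeasure (variation_measure (dF k)) (U k) < \<infinity>"
  "(\<integral>\<^sup>+ t\<in>{0..T}. (\<integral>\<^sup>+ z\<in>U k. riesz_kernel s (X t) z \<partial>variation_measure (dF k)) \<partial>lborel) < \<infinity>" for k by auto
 have YU: "Y t \<in> U k" for t k using U(3)[of k] c(1)[of t] unfolding Y_def by blast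
 define M where "M k = density (variation_measure (dF k)) (ind (U k))" for k
 have pb: "potential_bounds (G' k) (M k) (U k) s" for k
  unfolding M_def by (rule BV_potential_bounds(1)[OF BV Gm(1) G' U(1,2,4) s0 s(2)])
 have pot: "potential_bounds.pot (M k) s z = (\<integral>\<^sup>+y\<in>U k. riesz_kernel s z y \<partial>variation_measure (dF k))" for k z
  unfolding M_def by (rule BV_potential_bounds(2)[OF BV Gm(1) G' U(1,2,4) s0 s(2)])
 have potm [measurable]: "(\<lambda>t. potential_bounds.pot (M k) s (Y t)) \<in> \<B>" for k
  by (rule measurable_compose[OF Ym potential_bounds.pot_borel[OF pb]])
 have pfin: "(NBINT t. ind {0..T} t * potential_bounds.pot (M k) s (Y t)) < \<infinity>" for k
 proof -
  have "(NBINT t. ind {0..T} t * potential_bounds.pot (M k) s (Y t))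
   = (\<integral>\<^sup>+ t\<in>{0..T}. (\<integral>\<^sup>+ z\<in>U k. riesz_kernel s (X t) z \<partial>variation_measure (dF k)) \<partial>lborel)"
   by (intro nn_integral_cong) (auto simp: pot YX split: split_indicator)
  then show ?thesis using U(5)[of k] by simp
 qed
 have pfin': "(NBINT t. ind {0<..<T} t * potential_bounds.pot (M k) s (Y t)) < \<infinity>" for k
  by (rule order_le_less_trans[OF nn_integral_mono pfin]) (auto split: split_indicator)
 \<comment> \<open>The midpoint of (1 - \<alpha>, \<alpha> s), an interval that the lower bound on s
   makes nonempty.\<close>
 define \<theta> where "\<theta> = ((1 - \<alpha>) + \<alpha> * s) / 2"
 have "1 - \<alpha> < \<alpha> * s" using s(1) \<alpha> by (simp add: field_simps)
 moreover have "\<alpha> * s < 1" using mult_strict_mono[of \<alpha> 1 s 1] \<alpha> s s0 by simp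
 ultimately have \<theta>: "0 < \<theta>" "\<theta> < 1" "1 - \<alpha> < \<theta>" "\<theta> < \<alpha> * s" using \<alpha> s0 unfolding \<theta>_def by auto
 have xW: "x k \<in> WT_inf (1 - \<theta>) T" for k
  by (rule holder_WT_inf[OF T H(1) _ _ xh]) (use \<theta> in auto)
 define f where "f k u = dFrep k (Y u)" for k u
 have fm: "f k \<in> \<B>" for k
  unfolding f_def using rep[of k] unfolding lebesgue_representative_def by (auto intro: measurable_compose[OF Ym])
 \<comment> \<open>\<open>dF k\<close> and its Borel version agree almost everywhere, so they have
   the same approximate limits, and the given representative takes these values.\<close>
 have fl: "f k t = l" if "has_approx_limit (G' k) (Y t) l" for k t l
  using rep[of k] that has_approx_limit_representative[OF Gm, of k "Y t" l] unfolding lebesgue_representative_def f_def by blast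
 have "\<forall>k. \<exists>e0>0. \<forall>e. (\<forall>m. 0 < e m \<and> e m < e0) \<longrightarrow> e \<longlonglongrightarrow> 0 \<longrightarrow> W0_1_converges \<theta> T (\<lambda>m t. moll (e m) (G' k) (Y t)) (f k)"
 proof
  fix k
  show "\<exists>e0>0. \<forall>e. (\<forall>m. 0 < e m \<and> e m < e0) \<longrightarrow> e \<longlonglongrightarrow> 0 \<longrightarrow> W0_1_converges \<theta> T (\<lambda>m t. moll (e m) (G' k) (Y t)) (f k)"
   by (rule potential_bounds.mollified_path_convergence[OF pb U(1) YU H(1) _ Y Ym T \<theta>(1,4) pfin' fm fl]) (use \<alpha> in auto)
 qed
 from choice[OF this] obtain e0 where e0: "\<forall>k. 0 < e0 k \<and> (\<forall>e. (\<forall>m. 0 < e m \<and> e m < e0 k) \<longrightarrow> e \<longlonglongrightarrow> 0 \<longrightarrow> W0_1_converges \<theta> T (\<lambda>m t. moll (e m) (G' k) (Y t)) (f k))"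
  by (elim exE) (rule that)
 \<comment> \<open>One sequence for all k, below the smallest of the finitely many thresholds; the
   double successor in e keeps its first term strictly below E.\<close>
 define E where "E = Min (range e0)"
 have E: "E > 0" "E \<le> e0 k" for k unfolding E_def using e0 by auto
 define e where "e m = E * inverse (real (Suc (Suc m)))" for m
 have em: "0 < e m" "e m < E" for m using E(1) unfolding e_def by (auto simp: field_simps add_pos_nonneg)
 have elim0: "e \<longlonglongrightarrow> 0"
  unfolding e_def[abs_def] by (intro tendsto_mult_right_zero LIMSEQ_Suc[OF LIMSEQ_inverse_real_of_nat])
 have elim: "filterlim e (at_right 0) sequentially" using elim0 em(1) by (rule sequence_at_right)
 have conv: "W0_1_converges \<theta> T (\<lambda>m t. moll (e m) (G' k) (Y t)) (f k)" for k
  using e0[THEN spec[of _ k], THEN conjunct2, THEN spec[of _ e], THEN mp, THEN mp] em E(2)[of k] elim0 order_less_le_trans by blast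
 note cv = conv[unfolded W0_1_converges_def, THEN conjunct1, THEN spec]
 define I where "I t k = stieltjes_integral_order \<theta> T (cutoff T t (f k)) (x k)" for t k
 define J where "J t k m = stieltjes_integral_order \<theta> T (cutoff T t (\<lambda>u. moll (e m) (G' k) (Y u))) (x k)" for t k m
 have W0: "cutoff T t (f k) \<in> W0_1 \<theta> T" and Wm: "cutoff T t (\<lambda>u. moll (e m) (G' k) (Y u)) \<in> W0_1 \<theta> T"
  and JI: "(\<lambda>m. J t k m) \<longlonglongrightarrow> I t k" if t: "t \<in> {0..T}" for t k m
 proof -
  from conv[of k] have S: "\<And>m. (\<lambda>u. moll (e m) (G' k) (Y u)) \<in> \<B>"
   "(NBINT t. ennreal (ind {0<..<T} t * \<bar>f k t\<bar>)) < \<infinity>" "gagliardo \<theta> T (f k) < \<infinity>"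
   "\<And>m. (NBINT t. ennreal (ind {0<..<T} t * \<bar>moll (e m) (G' k) (Y t)\<bar>)) < \<infinity>" "\<And>m. gagliardo \<theta> T (\<lambda>u. moll (e m) (G' k) (Y u)) < \<infinity>"
   "(\<lambda>m. NBINT t. ennreal (ind {0<..<T} t * \<bar>moll (e m) (G' k) (Y t) - f k t\<bar>)) \<longlonglongrightarrow> 0"
   "(\<lambda>m. gagliardo \<theta> T (\<lambda>t. moll (e m) (G' k) (Y t) - f k t)) \<longlonglongrightarrow> 0" unfolding W0_1_converges_def by auto
  note A = stieltjes_order_cutoff_convergence[OF T \<theta>(1,2) t S(1) fm S(2-7) xc xT xB xW]
  show "cutoff T t (f k) \<in> W0_1 \<theta> T" by (rule A(1))
  show "cutoff T t (\<lambda>u. moll (e m) (G' k) (Y u)) \<in> W0_1 \<theta> T" by (rule A(2))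
  show "(\<lambda>m. J t k m) \<longlonglongrightarrow> I t k" unfolding I_def J_def by (rule A(3))
 qed
 \<comment> \<open>On the open interval the given integrand and integrator coincide with the cut-off
   and the extended path; endpoint values are left to the congruence lemmas.\<close>
 have eqf: "ind {0..t} u * dFrep k (X u) = cutoff T t (f k) u" and eqx: "X u $ k = x k u" if "u \<in> {0<..<T}" for t k u
  using that by (auto simp: cutoff_def f_def x_def YX split: split_indicator)
 show "stieltjes_integrable_upto T t (\<lambda>u. dFrep k (X u)) (\<lambda>u. X u $ k)" if t: "t \<in> {0..T}" for t k
  unfolding stieltjes_integrable_upto_def
  by (rule stieltjes_integral_eq_order(1)[OF T \<theta>(1,2) eqf eqx cutoff_borel[OF fm] cutoff_outside W0[OF t] xc xT xB xW])
 have II: "stieltjes_integral_upto T t (\<lambda>u. dFrep k (X u)) (\<lambda>u. X u $ k) = I t k" if t: "t \<in> {0..T}" for t k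
  unfolding stieltjes_integral_upto_def I_def
  by (rule stieltjes_integral_eq_order(2)[OF T \<theta>(1,2) eqf eqx cutoff_borel[OF fm] cutoff_outside W0[OF t] xc xT xB xW])
 \<comment> \<open>Both sides are limits of the same sums of integrals against Steklov rates:
   \<open>chain_rule_limit\<close> evaluates them by increments of the mollified F,
   \<open>stieltjes_order_limit\<close> by fractional integrals.\<close>
 have smooth: "(\<Sum>k\<in>UNIV. J t k m) = moll (e m) F' (Y t) - moll (e m) F' (Y 0)" if t: "t \<in> {0..T}" for t m
 proof -
  let ?S = "\<lambda>\<eta> k. \<integral>u. ind {0<..<t} u * (moll (e m) (G' k) (Y u) * steklov_rate \<eta> (\<lambda>u. Y u $ k) u) \<partial>lborel"
  have "((\<lambda>\<eta>. \<Sum>k\<in>UNIV. ?S \<eta> k) \<longlongrightarrow> moll (e m) F' (Y t) - moll (e m) F' (Y 0)) (at_right 0)"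
   by (rule chain_rule_limit[OF moll_has_derivative(1)[OF F'(1) em(1)] grad[OF em(1)] moll_continuous[OF G'(1) em(1)] moll_lipschitz[OF G'(1) em(1)] H(1) \<alpha>(1) Y R])
    (use t in simp)
  moreover have "((\<lambda>\<eta>. \<Sum>k\<in>UNIV. ?S \<eta> k) \<longlongrightarrow> (\<Sum>k\<in>UNIV. J t k m)) (at_right 0)"
  proof (rule tendsto_sum)
   fix k
   have "?S \<eta> k = (LBINT u. cutoff T t (\<lambda>u. moll (e m) (G' k) (Y u)) u * steklov_rate \<eta> (x k) u)" for \<eta>
    by (rule integral_discrete_difference[of "{t}"]) (use t in \<open>auto simp: cutoff_def x_def[abs_def] split: split_indicator\<close>)
   then show "((\<lambda>\<eta>. ?S \<eta> k) \<longlongrightarrow> J t k m) (at_right 0)"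
    unfolding J_def using stieltjes_order_limit[OF T \<theta>(1,2) cutoff_borel[OF cv] cutoff_outside Wm[OF t] xc xT xB xW] by simp
  qed
  ultimately show ?thesis by (intro tendsto_unique[OF trivial_limit_at_right_real])
 qed
 show "l1 = l0 + (\<Sum>k\<in>UNIV. stieltjes_integral_upto T t (\<lambda>u. dFrep k (X u)) (\<lambda>u. X u $ k))"
  if t: "t \<in> {0..T}" and l: "has_approx_limit F (X 0) l0" "has_approx_limit F (X t) l1" for t l0 l1
 proof -
  have l': "has_approx_limit F' (Y 0) l0" "has_approx_limit F' (Y t) l1"
   using l has_approx_limit_representative[OF Fm] YX[OF t] YX[of 0] T by auto
  have "(\<lambda>m. moll (e m) F' (Y t) - moll (e m) F' (Y 0)) \<longlonglongrightarrow> l1 - l0"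
   by (intro tendsto_diff filterlim_compose[OF moll_tendsto_approx_limit[OF F'(1)] elim] l')
  moreover have "(\<lambda>m. \<Sum>k\<in>UNIV. J t k m) \<longlonglongrightarrow> (\<Sum>k\<in>UNIV. I t k)" by (intro tendsto_sum JI t)
  ultimately have "l1 - l0 = (\<Sum>k\<in>UNIV. I t k)" unfolding smooth[OF t] by (rule LIMSEQ_unique)
  then show ?thesis unfolding II[OF t] by simp
 qed
 \<comment> \<open>Variability makes all potentials finite at almost every time, and at such a time
   F has an approximate limit.\<close>
 have "AE t in lborel. \<forall>k\<in>UNIV. ind {0..T} t * potential_bounds.pot (M k) s (Y t) \<noteq> \<infinity>"
 proof (rule AE_finite_allI)
  fix k
  show "AE t in lborel. ind {0..T} t * potential_bounds.pot (M k) s (Y t) \<noteq> \<infinity>"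
   by (rule nn_integral_PInf_AE) (use pfin[of k] in auto)
 qed simp
 then have "AE t in lborel. t \<in> {0..T} \<longrightarrow> (\<exists>l. has_approx_limit F (X t) l)"
 proof eventually_elim
  case (elim t)
  show ?case
  proof
   assume t: "t \<in> {0..T}"
   have "potential_bounds.pot (M k) s (Y t) < \<infinity>" for k using elim t by (auto simp: less_top)
   from approx_limit_of_gradient[OF F'(1) pb grad U(1) YU this]
   show "\<exists>l. has_approx_limit F (X t) l" using has_approx_limit_representative[OF Fm] YX[OF t] by simp
  qed
 qed
 from AE_completion[OF this] show "AE t in lebesgue_on {0..T}. \<exists>l. has_approx_limit F (X t) l"
  by (subst AE_restrict_space_iff) auto
qed

theorem theorem2p13:
  fixes T \<alpha> s :: real
    and F :: "real^'n \<Rightarrow> real"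
    and dF :: "'n \<Rightarrow> real^'n \<Rightarrow> real"
    and X :: "real \<Rightarrow> real^'n"
    and x0 :: "real^'n"
    and Frep :: "real^'n \<Rightarrow> real"
    and dFrep :: "'n \<Rightarrow> real^'n \<Rightarrow> real"
  assumes "T > 0"
    and "W11_loc F"
    and "\<And>k. has_weak_partial k F (dF k)"
    and "\<And>k. BV_loc (dF k)"
    and "1/2 < \<alpha>" and "\<alpha> < 1"
    and "holder_on \<alpha> {0..T} X"
    and "X 0 = x0"
    and "(1 - \<alpha>) / \<alpha> < s" and "s < 1"
    and "\<And>k. s1_variable s T X (dF k)"
    and "lebesgue_representative F Frep"
    and "\<And>k. lebesgue_representative (dF k) (dFrep k)"
  shows "(\<forall>t\<in>{0..T}. \<forall>k. stieltjes_integrable_upto T t (\<lambda>u. dFrep k (X u)) (\<lambda>u. X u $ k)) \<and>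
    (x0 \<notin> approx_discontinuity_set F \<longrightarrow>
      (AE t in lebesgue_on {0..T}.
         Frep (X t) = Frep x0 +
           (\<Sum>k\<in>UNIV. stieltjes_integral_upto T t (\<lambda>u. dFrep k (X u)) (\<lambda>u. X u $ k)))) \<and>
    (\<forall>Fc. continuous_on UNIV Fc \<and> (AE x in lebesgue. Fc x = F x) \<longrightarrow>
      (\<forall>t\<in>{0..T}.
         Fc (X t) = Fc x0 +
           (\<Sum>k\<in>UNIV. stieltjes_integral_upto T t (\<lambda>u. dFrep k (X u)) (\<lambda>u. X u $ k))))"
proof -
 have F: "locally_integrable F" using assms(2) unfolding W11_loc_def by blast
 note main = stieltjes_chain_rule[OF assms(1) F assms(3,4,5,6,7,9,10,11,13)]
 have Frep: "Frep x = l" if "has_approx_limit F x l" for x l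
  using assms(12) that unfolding lebesgue_representative_def by blast
 have "AE t in lebesgue_on {0..T}. Frep (X t) = Frep x0 + (\<Sum>k\<in>UNIV. stieltjes_integral_upto T t (\<lambda>u. dFrep k (X u)) (\<lambda>u. X u $ k))"
  if x0: "x0 \<notin> approx_discontinuity_set F"
 proof -
  obtain l0 where l0: "has_approx_limit F (X 0) l0" using x0 assms(8) unfolding approx_discontinuity_set_def by blast
  have "AE t in lebesgue_on {0..T}. t \<in> {0..T}" by (rule AE_I2) simp
  with main(3) show ?thesis
  proof eventually_elim
   case (elim t)
   then obtain l1 where l1: "has_approx_limit F (X t) l1" by blast
   from main(2)[OF elim(2) l0 l1] show ?case using Frep[OF l0] Frep[OF l1] assms(8) by simp
  qed
 qed
 moreover have "Fc (X t) = Fc x0 + (\<Sum>k\<in>UNIV. stieltjes_integral_upto T t (\<lambda>u. dFrep k (X u)) (\<lambda>u. X u $ k))"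
  if Fc: "continuous_on UNIV Fc" "AE x in lebesgue. Fc x = F x" and t: "t \<in> {0..T}" for Fc t
 proof -
  have Fcm: "Fc \<in> borel_measurable borel" using Fc(1) by (rule borel_measurable_continuous_onI)
  have ae: "AE x in lebesgue. F x = Fc x" using Fc(2) by eventually_elim simp
  have "loc_int Fc" unfolding loc_int_def
  proof (intro conjI allI Fcm)
   fix R
   have "set_integrable lborel (cball 0 R) Fc"
    unfolding set_integrable_def by (rule borel_integrable_compact) (auto intro: continuous_on_subset[OF Fc(1)])
   then have "set_integrable lborel (ball 0 R) Fc" by (rule set_integrable_subset) auto
   then show "integrable lborel (\<lambda>y. indicator (ball 0 R) y * Fc y)" by (simp add: set_integrable_def)
  qed
  \<comment> \<open>Fc has its own value as approximate limit at every point, and F shares it; hence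
    neither the starting point nor any time has to be excluded.\<close>
  then have "has_approx_limit F x (Fc x)" for x
   using has_approx_limit_representative[OF loc_int_representative(1)[OF F] Fcm ae] continuous_has_approx_limit[OF Fc(1)] by blast
  from main(2)[OF t this this] show ?thesis using assms(8) by simp
 qed
 ultimately show ?thesis using main(1) by blast
qed

end
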